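(* The problem of deciding, given a finite relational structure $\mathbb{H}$, whether $\mathbb{H}$ admits a conservative binary commutative polymorphism is solvable in nondeterministic logarithmic space (NL).
   Context: A relational structure has a nonempty finite universe $H$ and finitely many relations, each given as input by an explicit list of its tuples. A binary operation $f:H^2\to H$ is a polymorphism if for every relation $\theta$ of arity $r$ and all $s,t\in\theta$, $(f(s_1,t_1),\dots,f(s_r,t_r))\in\theta$. It is commutative if $f(x,y)=f(y,x)$ and conservative if $f(x,y)\in\{x,y\}$ for all $x,y$. *)

theory Defs
  imports Complex_Main "HOL-Library.Landau_Symbols"
begin

section \<open>Relational structures and polymorphisms\<close>

record 'a rel_structure =
  universe :: "'a set"
  relations :: "(nat \<times> 'a list set) list"  \<comment> \<open>each relation together with its arity\<close>

definition is_structure :: "'a rel_structure \<Rightarrow> bool" where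
  "is_structure H \<longleftrightarrow> finite (universe H) \<and> universe H \<noteq> {} \<and>
     (\<forall>(r, \<theta>) \<in> set (relations H). \<forall>t\<in>\<theta>. length t = r \<and> set t \<subseteq> universe H)"

definition binary_polymorphism :: "'a rel_structure \<Rightarrow> ('a \<Rightarrow> 'a \<Rightarrow> 'a) \<Rightarrow> bool" where
  "binary_polymorphism H f \<longleftrightarrow>
     (\<forall>x\<in>universe H. \<forall>y\<in>universe H. f x y \<in> universe H) \<and>
     (\<forall>(r, \<theta>) \<in> set (relations H). \<forall>s\<in>\<theta>. \<forall>t\<in>\<theta>. map2 f s t \<in> \<theta>)"

definition commutative_on :: "'a set \<Rightarrow> ('a \<Rightarrow> 'a \<Rightarrow> 'a) \<Rightarrow> bool" where
  "commutative_on A f \<longleftrightarrow> (\<forall>x\<in>A. \<forall>y\<in>A. f x y = f y x)"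

definition conservative_on :: "'a set \<Rightarrow> ('a \<Rightarrow> 'a \<Rightarrow> 'a) \<Rightarrow> bool" where
  "conservative_on A f \<longleftrightarrow> (\<forall>x\<in>A. \<forall>y\<in>A. f x y \<in> {x, y})"

definition admits_conservative_commutative :: "'a rel_structure \<Rightarrow> bool" where
  "admits_conservative_commutative H \<longleftrightarrow>
     (\<exists>f. binary_polymorphism H f \<and> commutative_on (universe H) f \<and> conservative_on (universe H) f)"


section \<open>Structures as input words\<close>

text \<open>
  An input structure has universe \<open>{0, \<dots>, n - 1}\<close> and relations given as lists of tuples, in any
  order and possibly with repetitions. Universe size and arities are written in unary, so that the
  input is at least as long as the universe is large; elements in tuples are written in binary.
\<close>

type_synonym presentation = "nat \<times> (nat \<times> nat list list) list"

definition structure_of :: "presentation \<Rightarrow> nat rel_structure" where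
  "structure_of = (\<lambda>(n, rs).
     \<lparr> universe = {..<n}, relations = map (\<lambda>(r, ts). (r, set ts)) rs \<rparr>)"

datatype letter = Zero | One | Stroke | RelMark | TupleMark | EltMark

instance letter :: finite
proof
  have "(UNIV :: letter set) \<subseteq> {Zero, One, Stroke, RelMark, TupleMark, EltMark}"
    using letter.exhaust by blast
  then show "finite (UNIV :: letter set)"
    by (rule finite_subset) simp
qed

text \<open>Most significant digit first, without leading zeros (and \<open>0\<close> as a single digit).\<close>

fun binary :: "nat \<Rightarrow> letter list" where
  "binary x = (if x < 2 then [] else binary (x div 2)) @ [if even x then Zero else One]"

declare binary.simps [simp del]

definition encode_tuple :: "nat list \<Rightarrow> letter list" where
  "encode_tuple t = concat (map (\<lambda>x. EltMark # binary x) t)"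

definition encode_relation :: "nat \<times> nat list list \<Rightarrow> letter list" where
  "encode_relation = (\<lambda>(r, ts).
     replicate r Stroke @ concat (map (\<lambda>t. TupleMark # encode_tuple t) ts))"

definition encode :: "presentation \<Rightarrow> letter list" where
  "encode = (\<lambda>(n, rs).
     replicate n Stroke @ concat (map (\<lambda>R. RelMark # encode_relation R) rs))"

lemma set_binary: "set (binary x) \<subseteq> {Zero, One}"
proof (induction x rule: binary.induct)
  case (1 x)
  then show ?case
    unfolding binary.simps[of x] by simp
qed

lemma binary_inject: "binary x = binary y \<Longrightarrow> x = y"
proof (induction x arbitrary: y rule: binary.induct)
  case (1 x)
  have nonempty: "binary z \<noteq> []" for z
    by (subst binary.simps) simp
  have "(if x < 2 then [] else binary (x div 2)) @ [if even x then Zero else One] =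
        (if y < 2 then [] else binary (y div 2)) @ [if even y then Zero else One]"
    using "1.prems" unfolding binary.simps[of x] binary.simps[of y] .
  then have eq: "(if x < 2 then [] else binary (x div 2)) = (if y < 2 then [] else binary (y div 2))"
    and par: "even x \<longleftrightarrow> even y"
    unfolding append1_eq_conv by (simp_all split: if_splits)
  have "x div 2 = y div 2"
  proof (cases "x < 2")
    case True
    with eq nonempty[of "y div 2"] have "y < 2" by (auto split: if_splits)
    with True show ?thesis by simp
  next
    case False
    with eq nonempty[of "x div 2"] have "\<not> y < 2" by (auto split: if_splits)
    with eq False have "binary (x div 2) = binary (y div 2)" by simp
    with False show ?thesis by (rule "1.IH")
  qed
  moreover have "x mod 2 = y mod 2"
    using par by (simp add: mod2_eq_if)
  ultimately show ?case
    using div_mult_mod_eq[of x 2] div_mult_mod_eq[of y 2] by linarith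
qed

lemma first_occurrence_unique:
  assumes "m \<notin> set u" "m \<notin> set v" "u @ m # xs = v @ m # ys"
  shows "u = v \<and> xs = ys"
  using assms
proof (induction u arbitrary: v)
  case Nil
  then show ?case by (cases v) auto
next
  case (Cons a u)
  then show ?case by (cases v) auto
qed

lemma marked_blocks_inject:
  assumes inj: "\<And>x y. g x = g y \<Longrightarrow> x = y" and fresh: "\<And>x. m \<notin> set (g x)"
    and "m \<notin> set u" "m \<notin> set v"
    and "u @ concat (map (\<lambda>x. m # g x) xs) = v @ concat (map (\<lambda>x. m # g x) ys)"
  shows "u = v \<and> xs = ys"
  using assms(3-)
proof (induction xs arbitrary: u v ys)
  case Nil
  then show ?case by (cases ys) auto
next
  case (Cons x xs)
  have "ys \<noteq> []"
  proof
    assume "ys = []"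
    then have "v = u @ m # (g x @ concat (map (\<lambda>x. m # g x) xs))"
      using Cons.prems(3) by simp
    then have "m \<in> set v" by simp
    with Cons.prems(2) show False ..
  qed
  then obtain y ys' where ys: "ys = y # ys'" by (meson neq_Nil_conv)
  have "u @ m # (g x @ concat (map (\<lambda>x. m # g x) xs)) =
        v @ m # (g y @ concat (map (\<lambda>x. m # g x) ys'))"
    using Cons.prems(3) ys by simp
  from first_occurrence_unique[OF Cons.prems(1,2) this]
  have "u = v" and "g x @ concat (map (\<lambda>x. m # g x) xs) = g y @ concat (map (\<lambda>x. m # g x) ys')"
    by auto
  with Cons.IH[OF fresh fresh] have "g x = g y \<and> xs = ys'" by blast
  with inj \<open>u = v\<close> ys show ?case by blast
qed

lemma set_encode_tuple: "set (encode_tuple t) \<subseteq> {Zero, One, EltMark}"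
proof -
  have "set (encode_tuple t) \<subseteq> insert EltMark (\<Union>x. set (binary x))"
    unfolding encode_tuple_def by auto
  with set_binary show ?thesis by blast
qed

lemma set_encode_relation: "set (encode_relation R) \<subseteq> {Zero, One, EltMark, TupleMark, Stroke}"
proof -
  obtain r ts where R: "R = (r, ts)" by fastforce
  have "set (encode_relation R) \<subseteq> insert Stroke (insert TupleMark (\<Union>t. set (encode_tuple t)))"
    unfolding R encode_relation_def by auto
  with set_encode_tuple show ?thesis by blast
qed

lemma encode_tuple_inject:
  assumes "encode_tuple t = encode_tuple t'"
  shows "t = t'"
proof -
  have "EltMark \<notin> set (binary x)" for x
    using set_binary[of x] by auto
  from marked_blocks_inject[of binary EltMark "[]" "[]", OF binary_inject this] assms
  show ?thesis unfolding encode_tuple_def by simp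
qed

lemma encode_relation_inject:
  assumes "encode_relation R = encode_relation R'"
  shows "R = R'"
proof -
  obtain r ts r' ts' where R: "R = (r, ts)" "R' = (r', ts')" by fastforce
  have "TupleMark \<notin> set (encode_tuple t)" for t
    using set_encode_tuple[of t] by auto
  from marked_blocks_inject[of encode_tuple TupleMark, OF encode_tuple_inject this,
      of "replicate r Stroke" "replicate r' Stroke" ts ts'] assms
  show ?thesis unfolding R encode_relation_def by simp
qed

lemma encode_inject:
  assumes "encode p = encode p'"
  shows "p = p'"
proof -
  obtain n rs n' rs' where p: "p = (n, rs)" "p' = (n', rs')" by fastforce
  have "RelMark \<notin> set (encode_relation R)" for R
    using set_encode_relation[of R] by auto
  from marked_blocks_inject[of encode_relation RelMark, OF encode_relation_inject this,
      of "replicate n Stroke" "replicate n' Stroke" rs rs'] assms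
  show ?thesis unfolding p encode_def by simp
qed

definition conservative_commutative_problem :: "letter list set" where
  "conservative_commutative_problem =
     {encode p | p. is_structure (structure_of p) \<and>
        admits_conservative_commutative (structure_of p)}"


section \<open>Nondeterministic space\<close>

text \<open>
  Nondeterministic machines with a two-way read-only input tape delimited by end markers and
  finitely many read-write work tapes. Work tapes are infinite to the right only, and a head told
  to leave its tape (including the end markers of the input) stays put. Since only finiteness of
  the state set and work alphabet matters, they are taken to be sets of natural numbers; the
  blank symbol is \<open>0\<close>.
\<close>

datatype 's scanned = LeftEnd | Letter 's | RightEnd

datatype move = MoveLeft | Stay | MoveRight

text \<open>
  A transition \<open>(q, a, vs, q', d, acts)\<close> applies in state \<open>q\<close> when the input head scans \<open>a\<close> and the
  work heads scan the symbols \<open>vs\<close>; \<open>q'\<close> is the new state, \<open>d\<close> the move of the input head and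
  \<open>acts\<close> contains, for each work tape, the symbol to write and the move of its head.
\<close>

record 's machine =
  states :: "nat set"
  start :: nat
  accepting :: "nat set"
  alphabet :: "nat set"
  tapes :: nat
  transitions ::
    "(nat \<times> 's scanned \<times> nat list \<times> nat \<times> move \<times> (nat \<times> move) list) set"

definition is_machine :: "'s machine \<Rightarrow> bool" where
  "is_machine M \<longleftrightarrow>
     finite (states M) \<and> start M \<in> states M \<and> accepting M \<subseteq> states M \<and>
     finite (alphabet M) \<and> 0 \<in> alphabet M \<and>
     (\<forall>(q, a, vs, q', d, acts) \<in> transitions M.
        q \<in> states M \<and> length vs = tapes M \<and> set vs \<subseteq> alphabet M \<and>
        q' \<in> states M \<and> length acts = tapes M \<and> fst ` set acts \<subseteq> alphabet M)"

text \<open>A configuration: state, input head, and for each work tape its head and contents.\<close>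

type_synonym config = "nat \<times> nat \<times> (nat \<times> (nat \<Rightarrow> nat)) list"

definition initial :: "'s machine \<Rightarrow> config" where
  "initial M = (start M, 0, replicate (tapes M) (0, \<lambda>_. 0))"

definition scan :: "'s list \<Rightarrow> nat \<Rightarrow> 's scanned" where
  "scan w i = (if i = 0 then LeftEnd else if i \<le> length w then Letter (w ! (i - 1)) else RightEnd)"

fun move_head :: "move \<Rightarrow> nat \<Rightarrow> nat" where
  "move_head MoveLeft i = i - 1"
| "move_head Stay i = i"
| "move_head MoveRight i = i + 1"

definition act :: "nat \<times> (nat \<Rightarrow> nat) \<Rightarrow> nat \<times> move \<Rightarrow> nat \<times> (nat \<Rightarrow> nat)" where
  "act = (\<lambda>(h, tape) (v, d). (move_head d h, tape(h := v)))"

inductive step :: "'s machine \<Rightarrow> 's list \<Rightarrow> config \<Rightarrow> config \<Rightarrow> bool" for M w where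
  "(q, scan w i, map (\<lambda>(h, tape). tape h) ts, q', d, acts) \<in> transitions M \<Longrightarrow>
   step M w (q, i, ts) (q', min (move_head d i) (length w + 1), map2 act ts acts)"

definition reachable :: "'s machine \<Rightarrow> 's list \<Rightarrow> config \<Rightarrow> bool" where
  "reachable M w = (step M w)\<^sup>*\<^sup>* (initial M)"

text \<open>
  Acceptance means that some computation reaches an accepting state; the remaining computations
  need not halt.
\<close>

definition accepts :: "'s machine \<Rightarrow> 's list \<Rightarrow> bool" where
  "accepts M w \<longleftrightarrow> (\<exists>q i ts. reachable M w (q, i, ts) \<and> q \<in> accepting M)"

text \<open>
  Every computation, accepting or not, visits only the first \<open>m\<close> cells of each work tape; the
  input tape is not counted.
\<close>

definition runs_in_space :: "'s machine \<Rightarrow> 's list \<Rightarrow> nat \<Rightarrow> bool" where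
  "runs_in_space M w m \<longleftrightarrow>
     (\<forall>q i ts. reachable M w (q, i, ts) \<longrightarrow> (\<forall>(h, tape) \<in> set ts. h < m))"

definition NSPACE :: "(nat \<Rightarrow> nat) \<Rightarrow> ('s :: finite) list set set" where
  "NSPACE s = {L. \<exists>M. is_machine M \<and>
     (\<forall>w. (accepts M w \<longleftrightarrow> w \<in> L) \<and> runs_in_space M w (s (length w)))}"

definition NL :: "('s :: finite) list set set" where
  "NL = (\<Union>s \<in> {s. (\<lambda>n. real (s n)) \<in> O(\<lambda>n. ln (real n))}. NSPACE s)"

end

theory Submission
  imports Defs "HOL-Library.Countable"
begin

text \<open>A conservative commutative operation is a choice of one element from every pair of
  distinct elements. Read the literal \<open>(a, b)\<close> as the assertion that \<open>a\<close>
  is chosen from the pair, so that \<open>(b, a)\<close> is its negation. For tuples s, t of a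
  relation, preservation asks that the tuple chosen coordinatewise from s and t lies in the relation
  again. Looking at two coordinates i, j only, this yields implications between literals: if no
  tuple of the relation lies coordinatewise between s and t, has the value of s at i and the value
  of t at j, then choosing s_i over t_i forces choosing s_j over t_j. These implications form the
  graph \<open>forces\<close>, which is closed under contraposition (\<open>forces_skew\<close>).

  If a literal on two distinct elements and its negation reach each other in this graph, no
  operation exists (\<open>admits_imp_no_cycle\<close>). Conversely, without such a cycle the usual
  argument for 2-satisfiability gives a choice that respects all implications
  (\<open>orientation_exists\<close>). This choice preserves every relation whatever its arity: two
  tuples between s and t, each of them correct on a set of coordinates with one exception, can be
  merged into a tuple that is correct on the whole set (\<open>no_cycle_imp_admits\<close>). So the
  question is one of reachability in a graph whose vertices are pairs of elements.

  Inputs are words. Vertices are represented by pairs of positions of element marks, and all notions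
  involved (equality of binary numerals, equal coordinates in two tuples, the edge relation,
  validity of the structure) are expressed by first-order formulas over positions together with
  transitive closure of relations on pairs of positions.
  \<open>conservative_commutative_problem_iff\<close> collects this; the outer shape of the word is
  treated separately, as a regular language (\<open>readable_encodings\<close>).

  It remains to evaluate such formulas in nondeterministic logarithmic space. A predicate is
  \<open>definable\<close> if both it and its complement can be tested by nondeterministic programs
  with finitely many registers whose values are linear in the input length. Quantifiers become
  guesses or exhaustive loops, and transitive closure becomes a guessed walk. The complement of
  transitive closure is the theorem of Immerman and Szelepcsenyi, proved by inductive counting
  (\<open>unreachable_iff\<close>, \<open>test_not_tc\<close>) and combined with the positive half
  in \<open>definable_path\<close>. Programs are regular expressions over elementary register
  instructions, and \<open>program_in_NL\<close> compiles them to machines with one work tape per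
  register, laid out with just enough digits to count the input cells
  (\<open>accepts_machine_of\<close>, \<open>runs_in_space_machine_of\<close>,
  \<open>width_bigo\<close>).\<close>

subsection \<open>Regular programs over bounded registers\<close>

datatype 's instr = Inc nat | Dec nat | AllBits bool nat | Move move | Scan "'s scanned"

datatype 's prog = Atom "'s instr" | Seq "'s prog" "'s prog" | Alt "'s prog" "'s prog" | Star "'s prog"

text \<open>Strictness makes this the number of binary digits of \<open>length w + 2\<close>, which
  the layout phase of the machine finds by counting. Registers of this width hold every input
  position \<open>0, ..., length w + 1\<close> and have at least one value to spare, a fact on which
  \<open>definable_path\<close> depends.\<close>

definition width :: "'s list \<Rightarrow> nat" where
  "width w = (LEAST l. length w + 2 < 2 ^ l)"

abbreviation capacity :: "'s list \<Rightarrow> nat" where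
  "capacity w \<equiv> 2 ^ width w"

type_synonym store = "nat \<times> (nat \<Rightarrow> nat)"

text \<open>Exceeding the capacity or going below zero blocks the branch instead of saturating. A
  machine shows this behaviour by getting stuck at the end of the tape, and the loops built later
  rely on it in order to stop.\<close>

fun exec :: "'s list \<Rightarrow> 's instr \<Rightarrow> store \<Rightarrow> store \<Rightarrow> bool" where
  "exec w (Inc j) (i, c) s \<longleftrightarrow> c j + 1 < capacity w \<and> s = (i, c(j := c j + 1))"
| "exec w (Dec j) (i, c) s \<longleftrightarrow> 0 < c j \<and> s = (i, c(j := c j - 1))"
| "exec w (AllBits b j) (i, c) s \<longleftrightarrow> (\<forall>n < width w. bit (c j) n = b) \<and> s = (i, c)"
| "exec w (Move d) (i, c) s \<longleftrightarrow> s = (min (move_head d i) (length w + 1), c)"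
| "exec w (Scan a) (i, c) s \<longleftrightarrow> scan w i = a \<and> s = (i, c)"

primrec run :: "'s list \<Rightarrow> 's prog \<Rightarrow> store \<Rightarrow> store \<Rightarrow> bool" where
  "run w (Atom a) = exec w a"
| "run w (Seq p q) = run w p OO run w q"
| "run w (Alt p q) = (\<lambda>s t. run w p s t \<or> run w q s t)"
| "run w (Star p) = (run w p)\<^sup>*\<^sup>*"

lemma width_less: "length w + 2 < capacity w"
proof -
  have "length w + 2 < 2 ^ (length w + 2)" by (rule less_exp)
  then show ?thesis unfolding width_def by (rule LeastI)
qed

lemma width_eqI:
  assumes "length w + 2 < 2 ^ l" "2 ^ (l - 1) \<le> length w + 2"
  shows "width w = l"
  unfolding width_def
proof (rule Least_equality)
  fix k assume "length w + 2 < 2 ^ k"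
  with assms(2) have "(2::nat) ^ (l - 1) < 2 ^ k" by linarith
  then have "l - 1 < k" by (rule power_less_imp_less_exp[rotated]) simp
  then show "l \<le> k" by simp
qed (fact assms(1))

text \<open>
  Control states of the compiled machine are continuations: lists of programs still to be run.
\<close>

primrec is_atom :: "'s prog \<Rightarrow> bool" where
  "is_atom (Atom a) = True"
| "is_atom (Seq p q) = False"
| "is_atom (Alt p q) = False"
| "is_atom (Star p) = False"

fun succs :: "'s prog list \<Rightarrow> 's prog list set" where
  "succs [] = {}"
| "succs (Atom a # ps) = {ps}"
| "succs (Seq p q # ps) = {p # q # ps}"
| "succs (Alt p q # ps) = {p # ps, q # ps}"
| "succs (Star p # ps) = {ps, p # Star p # ps}"

text \<open>Small-step form of \<open>run\<close> in which the pending work is explicit. The side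
  condition of the second rule matters because \<open>succs\<close> also drops a leading atom, which
  must not happen without executing it.\<close>

inductive cont_step :: "'s list \<Rightarrow> 's prog list \<times> store \<Rightarrow> 's prog list \<times> store \<Rightarrow> bool" for w where
  atom: "exec w a s s' \<Longrightarrow> cont_step w (Atom a # ps, s) (ps, s')"
| silent: "ps' \<in> succs (p # ps) \<Longrightarrow> \<not> is_atom p \<Longrightarrow> cont_step w (p # ps, s) (ps', s)"

lemma cont_step_complete:
  "run w p s s' \<Longrightarrow> (cont_step w)\<^sup>*\<^sup>* (p # ps, s) (ps, s')"
proof (induction p arbitrary: s s' ps)
  case (Atom a)
  then show ?case by (auto intro: cont_step.atom)
next
  case (Seq p q)
  then obtain t where "run w p s t" "run w q t s'" by auto
  with Seq.IH have "(cont_step w)\<^sup>*\<^sup>* (p # q # ps, s) (ps, s')"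
    by (meson rtranclp_trans)
  then show ?case
    by (rule converse_rtranclp_into_rtranclp[rotated]) (auto intro: cont_step.silent)
next
  case (Alt p q)
  have "cont_step w (Alt p q # ps, s) (p # ps, s)" "cont_step w (Alt p q # ps, s) (q # ps, s)"
    by (auto intro: cont_step.silent)
  moreover have "(cont_step w)\<^sup>*\<^sup>* (p # ps, s) (ps, s') \<or> (cont_step w)\<^sup>*\<^sup>* (q # ps, s) (ps, s')"
    using Alt.prems Alt.IH[of s s' ps] by (simp del: split_paired_All) blast
  ultimately show ?case by (meson converse_rtranclp_into_rtranclp)
next
  case (Star p)
  from Star.prems have "(run w p)\<^sup>*\<^sup>* s s'" by simp
  then show ?case
  proof (induction rule: converse_rtranclp_induct)
    case base
    have "cont_step w (Star p # ps, s') (ps, s')" by (auto intro: cont_step.silent)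
    then show ?case by blast
  next
    case (step s t)
    have "cont_step w (Star p # ps, s) (p # Star p # ps, s)" by (auto intro: cont_step.silent)
    moreover have "(cont_step w)\<^sup>*\<^sup>* (p # Star p # ps, s) (Star p # ps, t)"
      using step.hyps(1) by (rule Star.IH)
    ultimately show ?case using step.IH
      by (meson converse_rtranclp_into_rtranclp rtranclp_trans)
  qed
qed

text \<open>A continuation list denotes the composition of its programs, and a step from one list to
  the next can be absorbed in front of that composition; the induction therefore runs backwards from
  the empty list. Only \<open>Star\<close> needs thought: one round is put before an iteration
  obtained already.\<close>

lemma cont_step_sound:
  "(cont_step w)\<^sup>*\<^sup>* (ps, s) ([], s') \<Longrightarrow> foldr (\<lambda>p r. run w p OO r) ps (=) s s'"
proof (induction "(ps, s)" arbitrary: ps s rule: converse_rtranclp_induct)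
  case base
  then show ?case by simp
next
  case (step z)
  obtain ps' t where z: "z = (ps', t)" by (cases z)
  have IH: "foldr (\<lambda>p r. run w p OO r) ps' (=) t s'" using step.hyps(3) z by simp
  from step.hyps(1) z have "cont_step w (ps, s) (ps', t)" by simp
  then show ?case
  proof cases
    case (atom a)
    then show ?thesis using IH by auto
  next
    case (silent p qs)
    show ?thesis
    proof (cases p)
      case (Star q)
      let ?K = "foldr (\<lambda>p r. run w p OO r) qs (=)"
      from silent Star have t: "t = s" and "ps' = qs \<or> ps' = q # Star q # qs" by auto
      then show ?thesis
      proof (elim disjE)
        assume "ps' = qs"
        with IH silent(1) Star t show ?thesis by (auto intro!: relcomppI)
      next
        assume "ps' = q # Star q # qs"
        with IH t obtain u v where "run w q s u" "(run w q)\<^sup>*\<^sup>* u v" "?K v s'" by auto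
        then show ?thesis using silent(1) Star
          by (auto intro!: relcomppI[of _ s v] intro: converse_rtranclp_into_rtranclp)
      qed
    qed (use silent IH in \<open>auto simp: relcompp_assoc\<close>)
  qed
qed

text \<open>These lists play the part of the partial derivatives of a regular expression: they are
  finitely many and include every continuation met while \<open>p\<close> runs in front of
  \<open>ps\<close>. They supply the control states of the machine.\<close>

primrec conts :: "'s prog \<Rightarrow> 's prog list \<Rightarrow> 's prog list set" where
  "conts (Atom a) ps = {Atom a # ps, ps}"
| "conts (Seq p q) ps = insert (Seq p q # ps) (conts p (q # ps) \<union> conts q ps)"
| "conts (Alt p q) ps = insert (Alt p q # ps) (conts p ps \<union> conts q ps)"
| "conts (Star p) ps = {Star p # ps, ps} \<union> conts p (Star p # ps)"

lemma finite_conts: "finite (conts p ps)"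
  by (induction p arbitrary: ps) auto

lemma conts_ends: "ps \<in> conts p ps" "p # ps \<in> conts p ps"
  by (induction p arbitrary: ps) auto

text \<open>The exit \<open>ps\<close> is exempt because its successors belong to the surrounding
  program. For \<open>ps = []\<close> there are no successors, so the set is then closed
  outright.\<close>

lemma conts_closed: "qs \<in> conts p ps \<Longrightarrow> qs \<noteq> ps \<Longrightarrow> succs qs \<subseteq> conts p ps"
proof (induction p arbitrary: qs ps)
  case (Seq p q)
  consider "qs = Seq p q # ps" | "qs \<in> conts p (q # ps)" "qs \<noteq> q # ps"
    | "qs \<in> conts q ps" "qs \<noteq> ps"
    using Seq.prems conts_ends(2)[of q ps] by auto
  then show ?case
  proof cases
    case 3
    then have "succs qs \<subseteq> conts q ps" by (rule Seq.IH(2))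
    then show ?thesis by auto
  next
    case 2
    then have "succs qs \<subseteq> conts p (q # ps)" by (rule Seq.IH(1))
    then show ?thesis by auto
  qed (use conts_ends(2)[of p "q # ps"] in auto)
next
  case (Alt p q)
  consider "qs = Alt p q # ps" | "qs \<in> conts p ps" | "qs \<in> conts q ps"
    using Alt.prems by auto
  then show ?case
  proof cases
    case 2
    then have "succs qs \<subseteq> conts p ps" using Alt.prems(2) by (rule Alt.IH(1))
    then show ?thesis by auto
  next
    case 3
    then have "succs qs \<subseteq> conts q ps" using Alt.prems(2) by (rule Alt.IH(2))
    then show ?thesis by auto
  qed (use conts_ends(2)[of p ps] conts_ends(2)[of q ps] in auto)
next
  case (Star p)
  then show ?case using conts_ends(2)[of p "Star p # ps"] by (cases "qs = Star p # ps") auto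
qed auto

fun fits_instr :: "nat \<Rightarrow> 's instr \<Rightarrow> bool" where
  "fits_instr K (Inc j) = (j < K)"
| "fits_instr K (Dec j) = (j < K)"
| "fits_instr K (AllBits b j) = (j < K)"
| "fits_instr K _ = True"

primrec fits :: "nat \<Rightarrow> 's prog \<Rightarrow> bool" where
  "fits K (Atom a) = fits_instr K a"
| "fits K (Seq p q) = (fits K p \<and> fits K q)"
| "fits K (Alt p q) = (fits K p \<and> fits K q)"
| "fits K (Star p) = fits K p"

lemma fits_mono: "fits K p \<Longrightarrow> K \<le> K' \<Longrightarrow> fits K' p"
proof (induction p)
  case (Atom a)
  then show ?case by (cases a) auto
qed auto

lemma ex_fits: "\<exists>K>0. fits K p"
proof (induction p)
  case (Atom a)
  show ?case
  proof (cases a)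
    case (Inc j)
    then show ?thesis by (intro exI[of _ "Suc j"]) simp
  next
    case (Dec j)
    then show ?thesis by (intro exI[of _ "Suc j"]) simp
  next
    case (AllBits b j)
    then show ?thesis by (intro exI[of _ "Suc j"]) simp
  qed auto
next
  case (Seq p q)
  then obtain K K' where "0 < K" "fits K p" "fits K' q" by blast
  then show ?case by (intro exI[of _ "max K K'"]) (auto intro: fits_mono)
next
  case (Alt p q)
  then obtain K K' where "0 < K" "fits K p" "fits K' q" by blast
  then show ?case by (intro exI[of _ "max K K'"]) (auto intro: fits_mono)
qed auto

lemma fits_conts:
  assumes "fits K p" "\<forall>q\<in>set ps. fits K q" "qs \<in> conts p ps"
  shows "\<forall>q\<in>set qs. fits K q"
  using assms
proof (induction p arbitrary: ps)
  case (Seq p q)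
  from Seq.prems(3) consider "qs = Seq p q # ps" | "qs \<in> conts p (q # ps)" | "qs \<in> conts q ps"
    by auto
  then show ?case
  proof cases
    case 2
    show ?thesis by (rule Seq.IH(1)[OF _ _ 2]) (use Seq.prems in auto)
  next
    case 3
    show ?thesis by (rule Seq.IH(2)[OF _ _ 3]) (use Seq.prems in auto)
  qed (use Seq.prems in simp)
next
  case (Alt p q)
  from Alt.prems(3) consider "qs = Alt p q # ps" | "qs \<in> conts p ps" | "qs \<in> conts q ps"
    by auto
  then show ?case
  proof cases
    case 2
    show ?thesis by (rule Alt.IH(1)[OF _ _ 2]) (use Alt.prems in auto)
  next
    case 3
    show ?thesis by (rule Alt.IH(2)[OF _ _ 3]) (use Alt.prems in auto)
  qed (use Alt.prems in simp)
next
  case (Star p)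
  from Star.prems(3) consider "qs = Star p # ps" | "qs = ps" | "qs \<in> conts p (Star p # ps)"
    by auto
  then show ?case
  proof cases
    case 3
    show ?thesis by (rule Star.IH[OF _ _ 3]) (use Star.prems in auto)
  qed (use Star.prems in simp_all)
qed auto


section \<open>Binary registers on work tapes and the compiled machine\<close>

subsection \<open>Compilation to machines\<close>

datatype 's ctl = Start | Carry | Return | Fill | Home | Run "'s prog list"
  | Flip bool nat "'s prog list" | Check bool nat "'s prog list" | Back nat "'s prog list"

instance scanned :: (countable) countable by countable_datatype
instance move :: countable by countable_datatype
instance instr :: (countable) countable by countable_datatype
instance prog :: (countable) countable by countable_datatype
instance ctl :: (countable) countable by countable_datatype

definition digit :: "bool \<Rightarrow> nat" where
  "digit b = (if b then 2 else 1)"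

abbreviation marker :: nat where
  "marker \<equiv> 3"

lemma digit_simps [simp]:
  "digit b \<noteq> 0" "digit b \<noteq> marker" "marker \<noteq> digit b" "digit b = digit b' \<longleftrightarrow> b = b'" "0 \<noteq> digit b"
  "digit b < 4"
  by (auto simp: digit_def)

text \<open>
  The tapes are first laid out in lockstep: a binary counter is incremented once per input cell, and
  the number of its digits becomes the width of all registers.
\<close>

inductive lockstep :: "'s prog \<Rightarrow> 's ctl \<Rightarrow> 's scanned \<Rightarrow> nat \<Rightarrow> 's ctl \<Rightarrow> move \<Rightarrow> nat \<Rightarrow> move \<Rightarrow> bool"
  for p where
  start: "lockstep p Start a 0 Carry Stay marker MoveRight"
| carry_one: "lockstep p Carry a (digit True) Carry Stay (digit False) MoveRight"
| carry_zero: "lockstep p Carry a (digit False) Return Stay (digit True) MoveLeft"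
| carry_new: "lockstep p Carry a 0 Return Stay (digit True) MoveLeft"
| return_digit: "lockstep p Return a (digit b) Return Stay (digit b) MoveLeft"
| return_next: "a \<noteq> RightEnd \<Longrightarrow> lockstep p Return a marker Carry MoveRight marker MoveRight"
| return_end: "lockstep p Return RightEnd marker Fill Stay marker MoveRight"
| fill_digit: "lockstep p Fill a (digit b) Fill Stay (digit False) MoveRight"
| fill_end: "lockstep p Fill a 0 Home Stay marker MoveLeft"
| home_digit: "lockstep p Home a (digit b) Home Stay (digit b) MoveLeft"
| home_end: "lockstep p Home a marker (Run [p]) Stay marker Stay"

text \<open>After the layout, a step acts on one tape \<open>j\<close> only. Between instructions
  every head rests on its left marker. \<open>Flip\<close> propagates a carry (\<open>b\<close>
  true) or a borrow (\<open>b\<close> false) from the least significant digit upwards and has no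
  rule for a marker, so overflow and underflow kill the branch. Steps that concern no register are
  attached to tape 0, whence the condition \<open>0 < K\<close> later on.\<close>

inductive single :: "'s ctl \<Rightarrow> 's scanned \<Rightarrow> nat \<Rightarrow> nat \<Rightarrow> 's ctl \<Rightarrow> move \<Rightarrow> nat \<Rightarrow> move \<Rightarrow> bool" where
  silent: "ps' \<in> succs (p # ps) \<Longrightarrow> \<not> is_atom p \<Longrightarrow>
     single (Run (p # ps)) a 0 marker (Run ps') Stay marker Stay"
| scan: "single (Run (Atom (Scan a) # ps)) a 0 marker (Run ps) Stay marker Stay"
| move: "single (Run (Atom (Move d) # ps)) a 0 marker (Run ps) d marker Stay"
| inc: "single (Run (Atom (Inc j) # ps)) a j marker (Flip True j ps) Stay marker MoveRight"
| dec: "single (Run (Atom (Dec j) # ps)) a j marker (Flip False j ps) Stay marker MoveRight"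
| all_bits: "single (Run (Atom (AllBits b j) # ps)) a j marker (Check b j ps) Stay marker MoveRight"
| flip_on: "single (Flip b j ps) a j (digit b) (Flip b j ps) Stay (digit (\<not> b)) MoveRight"
| flip_off: "single (Flip b j ps) a j (digit (\<not> b)) (Back j ps) Stay (digit b) MoveLeft"
| check_digit: "single (Check b j ps) a j (digit b) (Check b j ps) Stay (digit b) MoveRight"
| check_end: "single (Check b j ps) a j marker (Back j ps) Stay marker MoveLeft"
| back_digit: "single (Back j ps) a j (digit b) (Back j ps) Stay (digit b) MoveLeft"
| back_end: "single (Back j ps) a j marker (Run ps) Stay marker Stay"

definition ctls :: "nat \<Rightarrow> 's prog \<Rightarrow> 's ctl set" where
  "ctls K p = {Start, Carry, Return, Fill, Home} \<union> Run ` conts p [] \<union>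
     (\<lambda>(j, ps). Back j ps) ` ({..<K} \<times> conts p []) \<union>
     (\<lambda>(b, j, ps). Flip b j ps) ` (UNIV \<times> {..<K} \<times> conts p []) \<union>
     (\<lambda>(b, j, ps). Check b j ps) ` (UNIV \<times> {..<K} \<times> conts p [])"

inductive transition :: "nat \<Rightarrow> 's prog \<Rightarrow>
    's ctl \<Rightarrow> 's scanned \<Rightarrow> nat list \<Rightarrow> 's ctl \<Rightarrow> move \<Rightarrow> (nat \<times> move) list \<Rightarrow> bool"
  for K p where
  lockstep: "lockstep p q a v q' d v' e \<Longrightarrow>
     transition K p q a (replicate K v) q' d (replicate K (v', e))"
| single: "single q a j v q' d v' e \<Longrightarrow> j < K \<Longrightarrow> length vs = K \<Longrightarrow> set vs \<subseteq> {..<4} \<Longrightarrow> vs ! j = v \<Longrightarrow>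
     transition K p q a vs q' d ((map (\<lambda>x. (x, Stay)) vs)[j := (v', e)])"

definition machine_of :: "nat \<Rightarrow> ('s :: countable) prog \<Rightarrow> 's machine" where
  "machine_of K p =
     \<lparr> states = to_nat ` ctls K p, start = to_nat (Start :: 's ctl),
       accepting = {to_nat (Run [] :: 's ctl)}, alphabet = {..<4}, tapes = K,
       transitions = {(to_nat q, a, vs, to_nat q', d, acts) | q a vs q' d acts.
         q \<in> ctls K p \<and> q' \<in> ctls K p \<and> transition K p q a vs q' d acts} \<rparr>"

lemma transition_wf:
  assumes "transition K p q a vs q' d acts"
  shows "length vs = K \<and> set vs \<subseteq> {..<4} \<and> length acts = K \<and> fst ` set acts \<subseteq> {..<4}"
  using assms
proof cases
  case (lockstep v v' e)
  from lockstep(3) have "v < 4 \<and> v' < 4" by cases auto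
  with lockstep show ?thesis by (auto simp: set_replicate_conv_if)
next
  case (single j v v' e)
  from single(2) have "v' < 4" by cases auto
  have "fst ` set acts \<subseteq> insert v' (set vs)"
    unfolding single(1) using set_update_subset_insert[of "map (\<lambda>x. (x, Stay)) vs" j "(v', e)"] by force
  with single \<open>v' < 4\<close> show ?thesis by auto
qed

lemma is_machine_machine_of: "is_machine (machine_of K p)"
proof -
  have "finite (ctls K p)" by (auto simp: ctls_def finite_conts)
  moreover have "Start \<in> ctls K p" "Run [] \<in> ctls K p"
    using conts_ends(1)[of "[]" p] by (auto simp: ctls_def)
  ultimately show ?thesis
    unfolding is_machine_def machine_of_def by (auto dest: transition_wf)
qed

text \<open>Steps on uncoded control states, so that invariants can be stated by cases on the
  constructor; \<open>to_nat\<close> enters only when results are transferred to the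
  machine.\<close>

definition mstep :: "nat \<Rightarrow> 's prog \<Rightarrow> 's list \<Rightarrow>
    's ctl \<times> nat \<times> (nat \<times> (nat \<Rightarrow> nat)) list \<Rightarrow> 's ctl \<times> nat \<times> (nat \<times> (nat \<Rightarrow> nat)) list \<Rightarrow> bool" where
  "mstep K p w = (\<lambda>(q, i, ts) (q', i', ts'). q \<in> ctls K p \<and> q' \<in> ctls K p \<and>
     (\<exists>d acts. transition K p q (scan w i) (map (\<lambda>(h, tape). tape h) ts) q' d acts \<and>
       i' = min (move_head d i) (length w + 1) \<and> ts' = map2 act ts acts))"

lemma step_machine_of:
  "step (machine_of K p) w (n, i, ts) (n', i', ts') \<longleftrightarrow>
     (\<exists>q q'. n = to_nat q \<and> n' = to_nat q' \<and> mstep K p w (q, i, ts) (q', i', ts'))"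
proof
  assume "step (machine_of K p) w (n, i, ts) (n', i', ts')"
  then show "\<exists>q q'. n = to_nat q \<and> n' = to_nat q' \<and> mstep K p w (q, i, ts) (q', i', ts')"
    by cases (auto simp: machine_of_def mstep_def)
next
  assume "\<exists>q q'. n = to_nat q \<and> n' = to_nat q' \<and> mstep K p w (q, i, ts) (q', i', ts')"
  then obtain q q' d acts where *: "n = to_nat q" "n' = to_nat q'" "q \<in> ctls K p" "q' \<in> ctls K p"
    "transition K p q (scan w i) (map (\<lambda>(h, tape). tape h) ts) q' d acts"
    "i' = min (move_head d i) (length w + 1)" "ts' = map2 act ts acts"
    by (auto simp: mstep_def)
  then have "(n, scan w i, map (\<lambda>(h, tape). tape h) ts, n', d, acts) \<in> transitions (machine_of K p)"
    by (auto simp: machine_of_def)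
  from step.intros[OF this] show "step (machine_of K p) w (n, i, ts) (n', i', ts')" by (simp add: *)
qed

definition mstart :: "nat \<Rightarrow> 's ctl \<times> nat \<times> (nat \<times> (nat \<Rightarrow> nat)) list" where
  "mstart K = (Start, 0, replicate K (0, \<lambda>_. 0))"

lemma reachable_machine_of:
  "reachable (machine_of K p) w (n, i, ts) \<longleftrightarrow>
     (\<exists>q. n = to_nat q \<and> (mstep K p w)\<^sup>*\<^sup>* (mstart K) (q, i, ts))"
proof
  assume "reachable (machine_of K p) w (n, i, ts)"
  then have "(step (machine_of K p) w)\<^sup>*\<^sup>* (initial (machine_of K p)) (n, i, ts)"
    by (simp add: reachable_def)
  then show "\<exists>q. n = to_nat q \<and> (mstep K p w)\<^sup>*\<^sup>* (mstart K) (q, i, ts)"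
  proof (induction "(n, i, ts)" arbitrary: n i ts rule: rtranclp_induct)
    case base
    then show ?case by (auto simp: initial_def mstart_def machine_of_def)
  next
    case (step y)
    obtain n0 i0 ts0 where y: "y = (n0, i0, ts0)" by (cases y)
    with step.hyps(2) obtain q q' where "n0 = to_nat q" "n = to_nat q'"
      "mstep K p w (q, i0, ts0) (q', i, ts)"
      by (auto simp: step_machine_of)
    with step.hyps(3)[OF y] show ?case
      by (auto intro: rtranclp.rtrancl_into_rtrancl)
  qed
next
  assume "\<exists>q. n = to_nat q \<and> (mstep K p w)\<^sup>*\<^sup>* (mstart K) (q, i, ts)"
  then obtain q where n: "n = to_nat q" and "(mstep K p w)\<^sup>*\<^sup>* (mstart K) (q, i, ts)" by blast
  from this(2) have "(step (machine_of K p) w)\<^sup>*\<^sup>* (initial (machine_of K p)) (to_nat q, i, ts)"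
  proof (induction "(q, i, ts)" arbitrary: q i ts rule: rtranclp_induct)
    case base
    then show ?case by (auto simp: initial_def mstart_def machine_of_def)
  next
    case (step y)
    obtain q0 i0 ts0 where y: "y = (q0, i0, ts0)" by (cases y)
    have "step (machine_of K p) w (to_nat q0, i0, ts0) (to_nat q, i, ts)"
      using step.hyps(2) y by (auto simp: step_machine_of)
    with step.hyps(3)[OF y] show ?case by (rule rtranclp.rtrancl_into_rtrancl)
  qed
  with n show "reachable (machine_of K p) w (n, i, ts)" by (simp add: reachable_def)
qed

lemma ctls_simps [simp]:
  "Start \<in> ctls K p" "Carry \<in> ctls K p" "Return \<in> ctls K p" "Fill \<in> ctls K p" "Home \<in> ctls K p"
  "Run ps \<in> ctls K p \<longleftrightarrow> ps \<in> conts p []"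
  "Flip b j ps \<in> ctls K p \<longleftrightarrow> j < K \<and> ps \<in> conts p []"
  "Check b j ps \<in> ctls K p \<longleftrightarrow> j < K \<and> ps \<in> conts p []"
  "Back j ps \<in> ctls K p \<longleftrightarrow> j < K \<and> ps \<in> conts p []"
  by (auto simp: ctls_def image_iff)

definition at_init :: "'s ctl \<Rightarrow> bool" where
  "at_init q \<longleftrightarrow> q \<in> {Start, Carry, Return, Fill, Home}"

lemma at_init_simps [simp]:
  "at_init Start" "at_init Carry" "at_init Return" "at_init Fill" "at_init Home"
  "\<not> at_init (Run ps)" "\<not> at_init (Flip b j ps)" "\<not> at_init (Check b j ps)" "\<not> at_init (Back j ps)"
  by (auto simp: at_init_def)

lemma map2_act_replicate:
  "map2 act (replicate K x) (replicate K y) = replicate K (act x y)"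
  by (rule nth_equalityI) auto

lemma mstep_lockstepI:
  assumes "lockstep p q (scan w i) (t h) q' d v e" "q \<in> ctls K p" "q' \<in> ctls K p"
    "i' = min (move_head d i) (length w + 1)" "h' = move_head e h" "t' = t(h := v)"
  shows "mstep K p w (q, i, replicate K (h, t)) (q', i', replicate K (h', t'))"
  using transition.lockstep[OF assms(1), of K] assms(2-)
  by (fastforce simp: mstep_def map2_act_replicate act_def)

lemma mstep_lockstepE:
  assumes "mstep K p w (q, i, replicate K (h, t)) s" "at_init q" "0 < K"
  obtains q' d v e where "lockstep p q (scan w i) (t h) q' d v e"
    "s = (q', min (move_head d i) (length w + 1), replicate K (move_head e h, t(h := v)))"
proof -
  obtain q' i' ts' where s: "s = (q', i', ts')" by (cases s)
  with assms(1) obtain d acts where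
    tr: "transition K p q (scan w i) (replicate K (t h)) q' d acts"
    and i': "i' = min (move_head d i) (length w + 1)" and ts': "ts' = map2 act (replicate K (h, t)) acts"
    by (auto simp: mstep_def)
  from tr show thesis
  proof cases
    case (lockstep v v' e)
    with assms(3) have "v = t h" by (simp add: replicate_eq_replicate)
    with lockstep i' ts' s show thesis
      by (intro that[of q' d v' e]) (simp_all add: map2_act_replicate act_def)
  next
    case (single j v v' e)
    from single(2) assms(2) show thesis by cases auto
  qed
qed

lemma map2_act_single:
  assumes "j < length ts"
  shows "map2 act ts ((map (\<lambda>x. (x, Stay)) (map (\<lambda>(h, tape). tape h) ts))[j := y]) = ts[j := act (ts ! j) y]"
proof (rule nth_equalityI)
  fix l assume "l < length (map2 act ts ((map (\<lambda>x. (x, Stay)) (map (\<lambda>(h, tape). tape h) ts))[j := y]))"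
  then show "map2 act ts ((map (\<lambda>x. (x, Stay)) (map (\<lambda>(h, tape). tape h) ts))[j := y]) ! l =
      ts[j := act (ts ! j) y] ! l"
    by (cases "ts ! l"; cases "l = j") (auto simp: act_def)
qed simp

definition symbols_ok :: "(nat \<times> (nat \<Rightarrow> nat)) list \<Rightarrow> bool" where
  "symbols_ok ts \<longleftrightarrow> (\<forall>(h, tape) \<in> set ts. tape h < 4)"

lemma mstep_singleI:
  assumes "single q (scan w i) j (t h) q' d v e" "q \<in> ctls K p" "q' \<in> ctls K p" "j < K" "length ts = K"
    "ts ! j = (h, t)" "symbols_ok ts"
    "i' = min (move_head d i) (length w + 1)" "ts' = ts[j := (move_head e h, t(h := v))]"
  shows "mstep K p w (q, i, ts) (q', i', ts')"
proof -
  let ?vs = "map (\<lambda>(h, tape). tape h) ts"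
  have "set ?vs \<subseteq> {..<4}" using assms(7) by (auto simp: symbols_ok_def)
  moreover have "?vs ! j = t h" using assms by simp
  ultimately have "transition K p q (scan w i) ?vs q' d ((map (\<lambda>x. (x, Stay)) ?vs)[j := (v, e)])"
    using assms by (intro transition.single) auto
  moreover have "ts' = map2 act ts ((map (\<lambda>x. (x, Stay)) ?vs)[j := (v, e)])"
    using assms by (subst map2_act_single) (simp_all add: act_def)
  ultimately show ?thesis using assms by (auto simp: mstep_def)
qed

lemma mstep_singleE:
  assumes "mstep K p w (q, i, ts) s" "\<not> at_init q" "length ts = K"
  obtains q' d v e j h t where "single q (scan w i) j (t h) q' d v e" "j < K" "ts ! j = (h, t)"
    "s = (q', min (move_head d i) (length w + 1), ts[j := (move_head e h, t(h := v))])"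
proof -
  obtain q' i' ts' where s: "s = (q', i', ts')" by (cases s)
  with assms(1) obtain d acts where
    tr: "transition K p q (scan w i) (map (\<lambda>(h, tape). tape h) ts) q' d acts"
    and i': "i' = min (move_head d i) (length w + 1)" and ts': "ts' = map2 act ts acts"
    by (auto simp: mstep_def)
  from tr show thesis
  proof cases
    case (lockstep v v' e)
    from lockstep(3) assms(2) show thesis by cases auto
  next
    case (single j v v' e)
    obtain h t where "ts ! j = (h, t)" by (cases "ts ! j")
    moreover have "ts' = ts[j := act (ts ! j) (v', e)]"
      unfolding ts' single(1) using single(3) assms(3) by (intro map2_act_single) simp
    ultimately show thesis using single assms(3) i' s
      by (intro that[of j t h q' d v' e]) (simp_all add: act_def)
  qed
qed

text \<open>Tape picture of \<open>l\<close> digits, least significant first, between markers. The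
  flag \<open>e\<close> records whether the right marker has been written: as long as the layout
  counter may still grow, the cell after the last digit is blank.\<close>

definition cells :: "(nat \<Rightarrow> bool) \<Rightarrow> nat \<Rightarrow> bool \<Rightarrow> nat \<Rightarrow> nat" where
  "cells f l e = (\<lambda>x. if x = 0 then marker else if x \<le> l then digit (f (x - 1))
     else if x = l + 1 \<and> e then marker else 0)"

lemma cells_0 [simp]: "cells f l e 0 = marker"
  by (simp add: cells_def)

lemma cells_Suc [simp]: "h < l \<Longrightarrow> cells f l e (Suc h) = digit (f h)"
  by (simp add: cells_def)

lemma cells_end [simp]: "cells f l True (Suc l) = marker" "cells f l False (Suc l) = 0"
  by (simp_all add: cells_def)

lemma cells_less [simp]: "cells f l e x < 4"
  by (simp add: cells_def)

lemma cells_update: "h < l \<Longrightarrow> (cells f l e)(Suc h := digit b) = cells (f(h := b)) l e"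
  by (auto simp: cells_def fun_eq_iff)

lemma cells_extend: "(cells f l False)(Suc l := digit b) = cells (f(l := b)) (Suc l) False"
  by (auto simp: cells_def fun_eq_iff)

lemma cells_close: "(cells f l False)(Suc l := marker) = cells f l True"
  by (auto simp: cells_def fun_eq_iff)

lemma cells_cong: "(\<And>n. n < l \<Longrightarrow> f n = g n) \<Longrightarrow> cells f l e = cells g l e"
  by (auto simp: cells_def fun_eq_iff)

lemma bit_clear:
  fixes v :: nat
  assumes "bit v n"
  shows "(bit v)(n := False) = bit (v - 2 ^ n)" "2 ^ n \<le> v"
proof -
  have "v = set_bit n (unset_bit n v)" using assms
    by (intro bit_eqI) (auto simp: bit_set_bit_iff bit_unset_bit_iff)
  also have "\<dots> = unset_bit n v + 2 ^ n"
    by (simp add: set_bit_eq bit_unset_bit_iff)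
  finally have v: "v = unset_bit n v + 2 ^ n" .
  then show "2 ^ n \<le> v" by linarith
  from v have "v - 2 ^ n = unset_bit n v" by linarith
  then show "(bit v)(n := False) = bit (v - 2 ^ n)"
    by (auto simp: fun_eq_iff bit_unset_bit_iff)
qed

lemma bit_insert:
  fixes v :: nat
  assumes "\<not> bit v n"
  shows "(bit v)(n := True) = bit (v + 2 ^ n)" "v < 2 ^ l \<Longrightarrow> n < l \<Longrightarrow> v + 2 ^ n < 2 ^ l"
proof -
  have s: "set_bit n v = v + 2 ^ n" using assms by (simp add: set_bit_eq)
  then show "(bit v)(n := True) = bit (v + 2 ^ n)"
    by (auto simp: fun_eq_iff bit_set_bit_iff simp flip: s)
  assume "v < 2 ^ l" "n < l"
  then have "take_bit l v = v" by (simp add: take_bit_nat_eq_self)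
  with \<open>n < l\<close> have "take_bit l (set_bit n v) = set_bit n v" by (simp add: take_bit_set_bit_eq)
  then show "v + 2 ^ n < 2 ^ l" by (simp add: s take_bit_nat_eq_self_iff)
qed

section \<open>Soundness of the compiled machine through an invariant\<close>

abbreviation cont_reach :: "'s list \<Rightarrow> 's prog \<Rightarrow> 's prog list \<Rightarrow> nat \<Rightarrow> (nat \<Rightarrow> nat) \<Rightarrow> bool" where
  "cont_reach w p ps i c \<equiv> (cont_step w)\<^sup>*\<^sup>* ([p], (length w + 1, \<lambda>_. 0)) (ps, (i, c))"

lemma cont_reach_bounded: "cont_reach w p ps i c \<Longrightarrow> c j < capacity w"
proof (induction "(ps, (i, c))" arbitrary: ps i c j rule: rtranclp_induct)
  case base
  then show ?case by simp
next
  case (step y)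
  obtain qs i0 c0 where y: "y = (qs, (i0, c0))" by (cases y) auto
  have c0: "c0 l < capacity w" for l using step.hyps(3)[OF y] .
  from step.hyps(2)[unfolded y] show ?case
  proof cases
    case (atom a)
    then show ?thesis using c0[of j] less_imp_diff_less[OF c0] by (cases a) auto
  next
    case (silent p)
    then show ?thesis using c0 by simp
  qed
qed

lemma cont_reach_step: "cont_reach w p ps i c \<Longrightarrow> cont_step w (ps, (i, c)) (ps', (i', c')) \<Longrightarrow> cont_reach w p ps' i' c'"
  by (rule rtranclp.rtrancl_into_rtrancl)

lemma cont_reach_head:
  "cont_reach w p ps i c \<Longrightarrow> i \<le> length w + 1"
proof (induction "(ps, (i, c))" arbitrary: ps i c rule: rtranclp_induct)
  case (step y)
  then show ?case by (cases y) (auto elim!: cont_step.cases exec.elims)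
qed simp

definition regs :: "'s list \<Rightarrow> nat \<Rightarrow> (nat \<Rightarrow> nat) \<Rightarrow> (nat \<times> (nat \<Rightarrow> nat)) list" where
  "regs w K c = map (\<lambda>j. (0, cells (bit (c j)) (width w) True)) [0..<K]"

lemma length_regs [simp]: "length (regs w K c) = K"
  by (simp add: regs_def)

lemma nth_regs [simp]: "j < K \<Longrightarrow> regs w K c ! j = (0, cells (bit (c j)) (width w) True)"
  by (simp add: regs_def)

lemma regs_update:
  "(regs w K c)[j := (0, cells (bit v) (width w) True)] = regs w K (c(j := v))"
  by (rule nth_equalityI) (auto simp: nth_list_update regs_def)

lemma regs_unchanged [simp]:
  "(regs w K c)[j := (0, cells (bit (c j)) (width w) True)] = regs w K c"
  by (simp add: regs_update)

lemma symbols_ok_regs: "symbols_ok ((regs w K c)[j := (h', cells f l e)])"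
  using set_update_subset_insert[of "regs w K c" j "(h', cells f l e)"]
  by (fastforce simp: regs_def symbols_ok_def)

lemma mstep_regsI:
  assumes "single q (scan w i) j (cells f (width w) True h) q' d v e" "q \<in> ctls K p" "q' \<in> ctls K p" "j < K"
    "i' = min (move_head d i) (length w + 1)" "h' = move_head e h" "t' = (cells f (width w) True)(h := v)"
  shows "mstep K p w (q, i, (regs w K c)[j := (h, cells f (width w) True)]) (q', i', (regs w K c)[j := (h', t')])"
  using assms(1) by (rule mstep_singleI) (use assms symbols_ok_regs in simp_all)

text \<open>The exact number of binary digits of \<open>x\<close>, where 0 has none.\<close>

definition tight :: "nat \<Rightarrow> nat \<Rightarrow> bool" where
  "tight l x \<longleftrightarrow> x < 2 ^ l \<and> (l = 0 \<or> 2 ^ (l - 1) \<le> x)"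

lemma tight_width: "tight l (length w + 2) \<Longrightarrow> l = width w"
  using width_eqI[of w l] by (cases l) (auto simp: tight_def)

lemma tight_le_width: "tight l x \<Longrightarrow> x \<le> length w + 2 \<Longrightarrow> l \<le> width w"
proof (cases l)
  case (Suc k)
  assume "tight l x" "x \<le> length w + 2"
  then have "(2::nat) ^ k \<le> length w + 2" using Suc by (auto simp: tight_def)
  also note width_less
  finally have "k < width w" by (rule power_less_imp_less_exp[rotated]) simp
  then show ?thesis using Suc by simp
qed simp

text \<open>In \<open>Carry\<close> the digits show \<open>v\<close> while a carry of weight
  \<open>2 ^ h\<close> is pending, and the sum is the next counter value \<open>i + 1\<close>.
  \<open>Flip\<close> is analogous: for a decrement the target \<open>c j - 1\<close> equals
  \<open>v - 2 ^ h\<close>, and the equation is written without subtraction. During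
  \<open>Flip\<close> and \<open>Check\<close> the instruction still stands in front of the
  continuation and \<open>c\<close> holds the old values; it counts as executed only once it can no
  longer fail.\<close>

fun invar :: "nat \<Rightarrow> 's prog \<Rightarrow> 's list \<Rightarrow> 's ctl \<Rightarrow> nat \<Rightarrow> (nat \<times> (nat \<Rightarrow> nat)) list \<Rightarrow> bool" where
  "invar K p w Start i ts \<longleftrightarrow> i = 0 \<and> ts = replicate K (0, \<lambda>_. 0)"
| "invar K p w Carry i ts \<longleftrightarrow> (\<exists>l h v. ts = replicate K (Suc h, cells (bit v) l False) \<and>
     h \<le> l \<and> v < 2 ^ l \<and> v + 2 ^ h = i + 1 \<and> i \<le> length w + 1 \<and> tight l i)"
| "invar K p w Return i ts \<longleftrightarrow> (\<exists>l h. ts = replicate K (h, cells (bit (i + 1)) l False) \<and>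
     h \<le> l \<and> i \<le> length w + 1 \<and> tight l (i + 1))"
| "invar K p w Fill i ts \<longleftrightarrow> (\<exists>h f. ts = replicate K (Suc h, cells f (width w) False) \<and>
     h \<le> width w \<and> (\<forall>n<h. \<not> f n) \<and> i = length w + 1)"
| "invar K p w Home i ts \<longleftrightarrow> (\<exists>h. ts = replicate K (h, cells (\<lambda>_. False) (width w) True) \<and>
     h \<le> width w \<and> i = length w + 1)"
| "invar K p w (Run ps) i ts \<longleftrightarrow> (\<exists>c. cont_reach w p ps i c \<and> ts = regs w K c)"
| "invar K p w (Flip b j ps) i ts \<longleftrightarrow> (\<exists>c h v.
     cont_reach w p (Atom (if b then Inc j else Dec j) # ps) i c \<and> j < K \<and>
     ts = (regs w K c)[j := (Suc h, cells (bit v) (width w) True)] \<and>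
     h \<le> width w \<and> v < capacity w \<and> (if b then v + 2 ^ h = c j + 1 else v + 1 = c j + 2 ^ h))"
| "invar K p w (Check b j ps) i ts \<longleftrightarrow> (\<exists>c h. cont_reach w p (Atom (AllBits b j) # ps) i c \<and> j < K \<and>
     ts = (regs w K c)[j := (Suc h, cells (bit (c j)) (width w) True)] \<and>
     h \<le> width w \<and> (\<forall>n<h. bit (c j) n = b))"
| "invar K p w (Back j ps) i ts \<longleftrightarrow> (\<exists>c h. cont_reach w p ps i c \<and> j < K \<and>
     ts = (regs w K c)[j := (h, cells (bit (c j)) (width w) True)] \<and> h \<le> width w)"

lemma invar_intros:
  "ts = replicate K (Suc h, cells (bit v) l False) \<Longrightarrow> h \<le> l \<Longrightarrow> v < 2 ^ l \<Longrightarrow> v + 2 ^ h = i + 1 \<Longrightarrow>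
     i \<le> length w + 1 \<Longrightarrow> tight l i \<Longrightarrow> invar K p w Carry i ts"
  "ts = replicate K (h, cells (bit (i + 1)) l False) \<Longrightarrow> h \<le> l \<Longrightarrow> i \<le> length w + 1 \<Longrightarrow>
     tight l (i + 1) \<Longrightarrow> invar K p w Return i ts"
  "ts = replicate K (Suc h, cells f (width w) False) \<Longrightarrow> h \<le> width w \<Longrightarrow> \<forall>n<h. \<not> f n \<Longrightarrow>
     i = length w + 1 \<Longrightarrow> invar K p w Fill i ts"
  "cont_reach w p (Atom (if b then Inc j else Dec j) # ps) i c \<Longrightarrow> j < K \<Longrightarrow>
     ts = (regs w K c)[j := (Suc h, cells (bit v) (width w) True)] \<Longrightarrow> h \<le> width w \<Longrightarrow>
     v < capacity w \<Longrightarrow> (if b then v + 2 ^ h = c j + 1 else v + 1 = c j + 2 ^ h) \<Longrightarrow>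
     invar K p w (Flip b j ps) i ts"
  "cont_reach w p (Atom (AllBits b j) # ps) i c \<Longrightarrow> j < K \<Longrightarrow>
     ts = (regs w K c)[j := (Suc h, cells (bit (c j)) (width w) True)] \<Longrightarrow> h \<le> width w \<Longrightarrow>
     \<forall>n<h. bit (c j) n = b \<Longrightarrow> invar K p w (Check b j ps) i ts"
  "cont_reach w p ps i c \<Longrightarrow> j < K \<Longrightarrow>
     ts = (regs w K c)[j := (h, cells (bit (c j)) (width w) True)] \<Longrightarrow> h \<le> width w \<Longrightarrow>
     invar K p w (Back j ps) i ts"
  unfolding invar.simps by blast+

lemmas invar_CarryI = invar_intros(1) and invar_ReturnI = invar_intros(2) and invar_FillI = invar_intros(3)
  and invar_FlipI = invar_intros(4) and invar_CheckI = invar_intros(5) and invar_BackI = invar_intros(6)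

declare invar.simps(2,3,4,7,8,9) [simp del]

lemma cells_upd_0 [simp]: "(cells f l e)(0 := marker) = cells f l e"
  by (rule fun_upd_idem) simp

lemma cells_digit_iff: "h \<le> Suc l \<Longrightarrow> cells f l e h = digit b \<longleftrightarrow> (\<exists>n<l. h = Suc n \<and> f n = b)"
  by (cases h) (auto simp: cells_def)

lemma cells_marker_iff: "cells f l e h = marker \<longleftrightarrow> h = 0 \<or> e \<and> h = Suc l"
  by (auto simp: cells_def)

lemma cells_blank_iff: "h \<le> Suc l \<Longrightarrow> cells f l e h = 0 \<longleftrightarrow> \<not> e \<and> h = Suc l"
  by (auto simp: cells_def)

lemmas cells_iffs = cells_digit_iff cells_marker_iff cells_blank_iff

lemma scan_eq_RightEnd_iff: "scan w i = RightEnd \<longleftrightarrow> length w < i"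
  by (auto simp: scan_def)

lemma invar_step_lockstep:
  assumes "invar K p w q i ts" "mstep K p w (q, i, ts) (q', i', ts')" "at_init q" "0 < K"
  shows "invar K p w q' i' ts'"
proof (cases q)
  case Start
  with assms(1) have ts: "ts = replicate K (0, \<lambda>_. 0)" "i = 0" by auto
  have eq: "(\<lambda>_. 0)(0 := marker) = cells (bit (0::nat)) 0 False" by (auto simp: cells_def fun_eq_iff)
  from assms(2)[unfolded ts Start] obtain q'' d v e where
    "lockstep p Start (scan w 0) 0 q'' d v e"
    "(q', i', ts') = (q'', min (move_head d 0) (length w + 1), replicate K (move_head e 0, (\<lambda>_. 0)(0 := v)))"
    using assms(4) by (elim mstep_lockstepE) auto
  then show ?thesis
    by cases (auto simp: eq tight_def intro!: invar_CarryI[where h = 0 and l = 0 and v = 0])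
next
  case Carry
  with assms(1) obtain l h v where ts: "ts = replicate K (Suc h, cells (bit v) l False)" and
    inv: "h \<le> l" "v < 2 ^ l" "v + 2 ^ h = i + 1" "i \<le> length w + 1" "tight l i" by (auto simp: invar.simps)
  from assms(2)[unfolded ts Carry] obtain q'' d x e where
    ls: "lockstep p Carry (scan w i) (cells (bit v) l False (Suc h)) q'' d x e" and
    eq: "(q', i', ts') = (q'', min (move_head d i) (length w + 1),
      replicate K (move_head e (Suc h), (cells (bit v) l False)(Suc h := x)))"
    using assms(4) by (elim mstep_lockstepE) auto
  from ls show ?thesis
  proof cases
    case carry_one
    with inv have "h < l" "bit v h" by (auto simp: cells_iffs)
    moreover have "(cells (bit v) l False)(Suc h := digit False) = cells (bit (v - 2 ^ h)) l False"
      using calculation by (simp add: cells_update bit_clear)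
    ultimately show ?thesis using eq carry_one inv bit_clear(2)[of v h]
      by (auto intro!: invar_CarryI[where l = l and h = "Suc h" and v = "v - 2 ^ h"])
  next
    case carry_zero
    with inv have "h < l" "\<not> bit v h" by (auto simp: cells_iffs)
    moreover have "(cells (bit v) l False)(Suc h := digit True) = cells (bit (Suc i)) l False"
      using calculation inv by (simp add: cells_update bit_insert)
    moreover have "Suc i < 2 ^ l" using bit_insert(2)[of v h l] calculation inv by simp
    ultimately show ?thesis using eq carry_zero inv
      by (auto simp: tight_def intro!: invar_ReturnI[where l = l and h = h])
  next
    case carry_new
    with inv have h: "h = l" by (auto simp: cells_iffs)
    \<comment> \<open>The carry has run through all digits: \<open>i < 2 ^ l\<close> and
      \<open>v + 2 ^ l = i + 1\<close> leave only \<open>v = 0\<close>, and the number gets a new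
      leading digit.\<close>
    with inv have v: "v = 0" "Suc i = 2 ^ l" by (auto simp: tight_def)
    have "(cells (bit v) l False)(Suc h := digit True) = cells (bit (Suc i)) (Suc l) False"
      using v bit_insert(1)[of 0 l] by (simp add: h cells_extend)
    then show ?thesis using eq carry_new inv v
      by (auto simp: tight_def h intro!: invar_ReturnI[where l = "Suc l" and h = h])
  qed
next
  case Return
  with assms(1) obtain l h where ts: "ts = replicate K (h, cells (bit (i + 1)) l False)" and
    inv: "h \<le> l" "i \<le> length w + 1" "tight l (i + 1)" by (auto simp: invar.simps)
  from assms(2)[unfolded ts Return] obtain q'' d x e where
    ls: "lockstep p Return (scan w i) (cells (bit (i + 1)) l False h) q'' d x e" and
    eq: "(q', i', ts') = (q'', min (move_head d i) (length w + 1),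
      replicate K (move_head e h, (cells (bit (i + 1)) l False)(h := x)))"
    using assms(4) by (elim mstep_lockstepE) auto
  from ls show ?thesis
  proof cases
    case (return_digit b)
    then have "cells (bit (i + 1)) l False h = x" by (simp only:)
    then have "(cells (bit (i + 1)) l False)(h := x) = cells (bit (i + 1)) l False"
      by (rule fun_upd_idem)
    then show ?thesis using eq return_digit inv by (auto intro!: invar_ReturnI[where l = l and h = "h - 1"])
  next
    case return_next
    then have "h = 0" "i \<le> length w" by (auto simp: cells_iffs scan_eq_RightEnd_iff)
    then show ?thesis using eq return_next inv
      by (auto simp: tight_def intro!: invar_CarryI[where l = l and h = 0 and v = "Suc i"])
  next
    case return_end
    then have "h = 0" "i = length w + 1" using inv by (auto simp: cells_iffs scan_eq_RightEnd_iff)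
    \<comment> \<open>At the right end marker the counter shows \<open>length w + 2\<close>, so its
      number of digits is the width.\<close>
    then show ?thesis using eq return_end inv tight_width[of l w] by (auto intro!: invar_FillI[where h = 0])
  qed
next
  case Fill
  with assms(1) obtain h f where ts: "ts = replicate K (Suc h, cells f (width w) False)" and
    inv: "h \<le> width w" "\<forall>n<h. \<not> f n" "i = length w + 1" by (auto simp: invar.simps)
  from assms(2)[unfolded ts Fill] obtain q'' d x e where
    ls: "lockstep p Fill (scan w i) (cells f (width w) False (Suc h)) q'' d x e" and
    eq: "(q', i', ts') = (q'', min (move_head d i) (length w + 1),
      replicate K (move_head e (Suc h), (cells f (width w) False)(Suc h := x)))"
    using assms(4) by (elim mstep_lockstepE) auto
  from ls show ?thesis
  proof cases
    case (fill_digit b)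
    then have "h < width w" using inv by (auto simp: cells_iffs)
    then have "(cells f (width w) False)(Suc h := digit False) = cells (f(h := False)) (width w) False"
      by (rule cells_update)
    then show ?thesis using eq fill_digit inv \<open>h < width w\<close>
      by (auto simp: less_Suc_eq intro!: invar_FillI[where h = "Suc h" and f = "f(h := False)"])
  next
    case fill_end
    then have h: "h = width w" using inv by (auto simp: cells_iffs)
    have "cells f (width w) True = cells (\<lambda>_. False) (width w) True"
      using inv h by (intro cells_cong) auto
    then show ?thesis using eq fill_end inv by (auto simp: cells_close h)
  qed
next
  case Home
  with assms(1) obtain h where ts: "ts = replicate K (h, cells (\<lambda>_. False) (width w) True)" and
    inv: "h \<le> width w" "i = length w + 1" by (auto simp: invar.simps)
  from assms(2)[unfolded ts Home] obtain q'' d x e where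
    ls: "lockstep p Home (scan w i) (cells (\<lambda>_. False) (width w) True h) q'' d x e" and
    eq: "(q', i', ts') = (q'', min (move_head d i) (length w + 1),
      replicate K (move_head e h, (cells (\<lambda>_. False) (width w) True)(h := x)))"
    using assms(4) by (elim mstep_lockstepE) auto
  from ls show ?thesis
  proof cases
    case (home_digit b)
    then have "cells (\<lambda>_. False) (width w) True h = x" by (simp only:)
    then have "(cells (\<lambda>_. False) (width w) True)(h := x) = cells (\<lambda>_. False) (width w) True"
      by (rule fun_upd_idem)
    then show ?thesis using eq home_digit inv by auto
  next
    case home_end
    then have "h = 0" using inv by (auto simp: cells_iffs)
    moreover have "replicate K (0, cells (\<lambda>_. False) (width w) True) = regs w K (\<lambda>_. 0)"
      by (rule nth_equalityI) (auto simp: cells_def fun_eq_iff)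
    ultimately show ?thesis using eq home_end inv by auto
  qed
qed (use assms(3) in auto)

lemma invar_step_single:
  assumes "invar K p w q i ts" "mstep K p w (q, i, ts) (q', i', ts')" "\<not> at_init q" "0 < K"
  shows "invar K p w q' i' ts'"
proof -
  have "length ts = K" using assms(1,3) by (cases q) (auto simp: invar.simps)
  with assms(2,3) obtain d v e j h t where
    tr: "single q (scan w i) j (t h) q' d v e" and j: "j < K" "ts ! j = (h, t)" and
    i': "i' = min (move_head d i) (length w + 1)" and ts': "ts' = ts[j := (move_head e h, t(h := v))]"
    by (elim mstep_singleE) auto
  show ?thesis
  proof (cases q)
    case (Run qs)
    with assms(1) obtain c where c: "cont_reach w p qs i c" and ts: "ts = regs w K c" by auto
    with j have ht: "h = 0" "t = cells (bit (c j)) (width w) True" by auto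
    note cs = cont_reach_step[OF c]
    have i: "i' = i" if "d = Stay"
      using that i' cont_reach_head[OF c] by simp
    from tr[unfolded Run] show ?thesis
    proof cases
      case (silent ps' r ps)
      have "cont_reach w p ps' i c" using silent by (intro cs) (auto intro: cont_step.silent)
      then show ?thesis using silent i ts ts' ht by auto
    next
      case (scan ps)
      have "cont_reach w p ps i c" using scan by (intro cs) (auto intro: cont_step.atom)
      then show ?thesis using scan i ts ts' ht by auto
    next
      case (move ps)
      have "cont_reach w p ps i' c" using move i' by (intro cs) (auto intro: cont_step.atom)
      then show ?thesis using move ts ts' ht by auto
    next
      case (inc ps)
      have "ts' = (regs w K c)[j := (Suc 0, cells (bit (c j)) (width w) True)]"
        using inc ts ts' ht by simp
      with inc show ?thesis using c j i cont_reach_bounded[OF c, of j]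
        by (auto intro!: invar_FlipI[where c = c and h = 0 and v = "c j"])
    next
      case (dec ps)
      have "ts' = (regs w K c)[j := (Suc 0, cells (bit (c j)) (width w) True)]"
        using dec ts ts' ht by simp
      with dec show ?thesis using c j i cont_reach_bounded[OF c, of j]
        by (auto intro!: invar_FlipI[where c = c and h = 0 and v = "c j"])
    next
      case (all_bits b ps)
      have "ts' = (regs w K c)[j := (Suc 0, cells (bit (c j)) (width w) True)]"
        using all_bits ts ts' ht by simp
      with all_bits show ?thesis using c j i
        by (auto intro!: invar_CheckI[where c = c and h = 0])
    qed
  next
    case (Flip b j0 ps)
    with assms(1) obtain c h0 v0 where c: "cont_reach w p (Atom (if b then Inc j0 else Dec j0) # ps) i c"
      and j0: "j0 < K" and ts: "ts = (regs w K c)[j0 := (Suc h0, cells (bit v0) (width w) True)]"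
      and inv: "h0 \<le> width w" "v0 < capacity w"
        "if b then v0 + 2 ^ h0 = c j0 + 1 else v0 + 1 = c j0 + 2 ^ h0" by (auto simp: invar.simps)
    have jj: "j = j0" using tr[unfolded Flip] by cases auto
    with j ts have ht: "h = Suc h0" "t = cells (bit v0) (width w) True" by auto
    have i: "i' = i" if "d = Stay"
      using that i' cont_reach_head[OF c] by simp
    have "invar K p w q' i ts'"
      using tr[unfolded Flip]
    proof cases
      case flip_on
      then have h0: "h0 < width w" "bit v0 h0 = b" using inv ht by (auto simp: cells_iffs)
      let ?v = "if b then v0 - 2 ^ h0 else v0 + 2 ^ h0"
      have "t(h := v) = cells (bit ?v) (width w) True"
        using flip_on ht h0 by (auto simp: cells_update bit_clear bit_insert)
      then have "ts' = (regs w K c)[j := (Suc (Suc h0), cells (bit ?v) (width w) True)]"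
        using flip_on ts ts' ht jj by simp
      moreover have "?v < capacity w" using inv h0 bit_insert(2)[of v0 h0 "width w"] by auto
      moreover have "if b then ?v + 2 ^ Suc h0 = c j + 1 else ?v + 1 = c j + 2 ^ Suc h0"
        using inv h0 jj bit_clear(2)[of v0 h0] by auto
      ultimately show ?thesis using flip_on c j jj h0
        by (auto intro!: invar_FlipI[where c = c and h = "Suc h0" and v = ?v])
    next
      case flip_off
      then have h0: "h0 < width w" "bit v0 h0 = (\<not> b)" using inv ht by (auto simp: cells_iffs)
      let ?v = "if b then c j + 1 else c j - 1"
      have v: "?v = (if b then v0 + 2 ^ h0 else v0 - 2 ^ h0)" "b \<or> 0 < c j"
        using inv jj h0 bit_clear(2)[of v0 h0] by auto
      have "t(h := v) = cells (bit ?v) (width w) True"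
        unfolding v using flip_off ht h0 by (auto simp: cells_update bit_clear bit_insert)
      then have "ts' = (regs w K (c(j := ?v)))[j := (h0, cells (bit ?v) (width w) True)]"
        using flip_off ts ts' ht jj by (simp flip: regs_update)
      moreover have "?v < capacity w" unfolding v using inv h0 bit_insert(2)[of v0 h0 "width w"] by auto
      then have "exec w (if b then Inc j else Dec j) (i, c) (i, c(j := ?v))" using v(2) by auto
      \<comment> \<open>Here the \<open>Inc\<close> or \<open>Dec\<close> that the invariant kept at
        the front of the continuation is finally executed.\<close>
      then have "cont_reach w p ps i (c(j := ?v))" using jj
        by (intro cont_reach_step[OF c]) (auto intro: cont_step.atom)
      ultimately show ?thesis using flip_off j h0
        by (auto intro!: invar_BackI[where c = "c(j := ?v)" and h = h0])
    qed
    moreover have "d = Stay" using tr[unfolded Flip] by cases auto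
    ultimately show ?thesis using i by simp
  next
    case (Check b j0 ps)
    with assms(1) obtain c h0 where c: "cont_reach w p (Atom (AllBits b j0) # ps) i c" and j0: "j0 < K"
      and ts: "ts = (regs w K c)[j0 := (Suc h0, cells (bit (c j0)) (width w) True)]"
      and inv: "h0 \<le> width w" "\<forall>n<h0. bit (c j0) n = b" by (auto simp: invar.simps)
    have jj: "j = j0" using tr[unfolded Check] by cases auto
    with j ts have ht: "h = Suc h0" "t = cells (bit (c j)) (width w) True" by auto
    have upd: "t(h := v) = t" using tr[unfolded Check] by cases (metis fun_upd_triv)+
    have i: "i' = i" if "d = Stay"
      using that i' cont_reach_head[OF c] by simp
    from tr[unfolded Check] show ?thesis
    proof cases
      case check_digit
      then have "h0 < width w" "bit (c j0) h0 = b" using inv ht jj by (auto simp: cells_iffs)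
      moreover have "ts' = (regs w K c)[j := (Suc (Suc h0), cells (bit (c j)) (width w) True)]"
        using check_digit upd ts ts' ht jj by simp
      ultimately show ?thesis using check_digit c j jj i inv
        by (auto simp: less_Suc_eq intro!: invar_CheckI[where c = c and h = "Suc h0"])
    next
      case check_end
      then have h0: "h0 = width w" using inv ht jj by (auto simp: cells_iffs)
      have "cont_reach w p ps i c" using inv
        by (intro cont_reach_step[OF c]) (auto intro!: cont_step.atom simp: h0)
      moreover have "ts' = (regs w K c)[j := (h0, cells (bit (c j)) (width w) True)]"
        using check_end upd ts ts' ht jj by simp
      ultimately show ?thesis using check_end j i inv
        by (auto intro!: invar_BackI[where c = c and h = h0])
    qed
  next
    case (Back j0 ps)
    with assms(1) obtain c h0 where c: "cont_reach w p ps i c" and j0: "j0 < K"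
      and ts: "ts = (regs w K c)[j0 := (h0, cells (bit (c j0)) (width w) True)]"
      and inv: "h0 \<le> width w" by (auto simp: invar.simps)
    have jj: "j = j0" using tr[unfolded Back] by cases auto
    with j ts have ht: "h = h0" "t = cells (bit (c j)) (width w) True" by auto
    have upd: "t(h := v) = t" using tr[unfolded Back] by cases (metis fun_upd_triv)+
    have i: "i' = i" if "d = Stay"
      using that i' cont_reach_head[OF c] by simp
    from tr[unfolded Back] show ?thesis
    proof cases
      case (back_digit b)
      moreover have "ts' = (regs w K c)[j := (h0 - 1, cells (bit (c j)) (width w) True)]"
        using back_digit upd ts ts' ht jj by simp
      ultimately show ?thesis using c j i inv
        by (auto intro!: invar_BackI[where c = c and h = "h0 - 1"])
    next
      case back_end
      then have "h0 = 0" using inv ht jj by (auto simp: cells_iffs)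
      then have "ts' = regs w K c"
        using back_end upd ts ts' ht jj by simp
      then show ?thesis using back_end c i by auto
    qed
  qed (use assms(3) in auto)
qed

lemma invar_reachable:
  assumes "(mstep K p w)\<^sup>*\<^sup>* (mstart K) (q, i, ts)" "0 < K"
  shows "invar K p w q i ts"
  using assms(1)
proof (induction "(q, i, ts)" arbitrary: q i ts rule: rtranclp_induct)
  case base
  then show ?case by (auto simp: mstart_def)
next
  case (step y)
  obtain q0 i0 ts0 where y: "y = (q0, i0, ts0)" by (cases y)
  with step.hyps(2) have "mstep K p w (q0, i0, ts0) (q, i, ts)" by simp
  with step.hyps(3)[OF y] assms(2) show ?case
    using invar_step_lockstep invar_step_single by (cases "at_init q0") blast+
qed

text \<open>During the layout the counter never exceeds \<open>length w + 2\<close>, so by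
  \<open>tight_le_width\<close> it has at most \<open>width w\<close> digits. Afterwards the heads
  move only between the two markers, which occupy the cells \<open>0\<close> and
  \<open>width w + 1\<close>.\<close>

lemma invar_space:
  assumes "invar K p w q i ts" "(h, tape) \<in> set ts"
  shows "h < width w + 2"
proof -
  have upd: "h \<in> {0, h'}" if "(h, tape) \<in> set ((regs w K c)[j := (h', x)])" for c j h' x
    using subsetD[OF set_update_subset_insert that] by (auto simp: regs_def)
  show ?thesis
  proof (cases q)
    case Carry
    with assms show ?thesis by (auto simp: invar.simps dest!: tight_le_width[of _ i w])
  next
    case Return
    with assms show ?thesis by (auto simp: invar.simps dest!: tight_le_width[of _ "Suc i" w])
  next
    case (Flip b j ps)
    with assms show ?thesis by (fastforce simp: invar.simps dest: upd)
  next
    case (Check b j ps)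
    with assms show ?thesis by (fastforce simp: invar.simps dest: upd)
  next
    case (Back j ps)
    with assms show ?thesis by (fastforce simp: invar.simps dest: upd)
  qed (use assms in \<open>auto simp: regs_def invar.simps\<close>)
qed

section \<open>Completeness: the machine imitates every program run\<close>

lemma back_run:
  assumes "h \<le> width w" "i \<le> length w + 1" "j < K" "ps \<in> conts p []"
  shows "(mstep K p w)\<^sup>*\<^sup>* (Back j ps, i, (regs w K c)[j := (h, cells (bit v) (width w) True)])
    (Run ps, i, regs w K (c(j := v)))"
  using assms(1)
proof (induction h)
  case 0
  let ?t = "cells (bit v) (width w) True"
  have "mstep K p w (Back j ps, i, (regs w K c)[j := (0, ?t)]) (Run ps, i, regs w K (c(j := v)))"
    unfolding regs_update[symmetric]
    by (rule mstep_regsI[where e = Stay and d = Stay and v = marker]) (use assms in \<open>auto intro: single.back_end\<close>)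
  then show ?case by blast
next
  case (Suc h)
  let ?t = "cells (bit v) (width w) True"
  have "single (Back j ps) (scan w i) j (?t (Suc h)) (Back j ps) Stay (?t (Suc h)) MoveLeft"
    using Suc.prems by (auto intro: single.back_digit)
  then have "mstep K p w (Back j ps, i, (regs w K c)[j := (Suc h, ?t)]) (Back j ps, i, (regs w K c)[j := (h, ?t)])"
    by (rule mstep_regsI) (use assms in \<open>auto simp: fun_upd_idem\<close>)
  then show ?case using Suc by (meson Suc_leD converse_rtranclp_into_rtranclp)
qed

lemma flip_run:
  assumes "h \<le> width w" "v < capacity w" "if b then v + 2 ^ h = u \<and> u < capacity w else v = u + 2 ^ h"
    "i \<le> length w + 1" "j < K" "ps \<in> conts p []"
  shows "(mstep K p w)\<^sup>*\<^sup>* (Flip b j ps, i, (regs w K c)[j := (Suc h, cells (bit v) (width w) True)])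
    (Run ps, i, regs w K (c(j := u)))"
  using assms(1-3)
proof (induction "width w - h" arbitrary: h v)
  case 0
  \<comment> \<open>With no digit left, the pending weight is the capacity itself, contradicting the
    bound on \<open>u\<close> for a carry and the bound on \<open>v\<close> for a borrow.\<close>
  then show ?case by (auto split: if_splits)
next
  case (Suc k)
  then have h: "h < width w" by simp
  let ?t = "cells (bit v) (width w) True"
  show ?case
  proof (cases "bit v h = b")
    case True
    let ?v = "if b then v - 2 ^ h else v + 2 ^ h"
    have "single (Flip b j ps) (scan w i) j (?t (Suc h)) (Flip b j ps) Stay (digit (\<not> b)) MoveRight"
      using h True by (auto intro: single.flip_on)
    then have "mstep K p w (Flip b j ps, i, (regs w K c)[j := (Suc h, ?t)])
        (Flip b j ps, i, (regs w K c)[j := (Suc (Suc h), cells (bit ?v) (width w) True)])"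
      by (rule mstep_regsI)
        (use assms h True in \<open>auto simp: cells_update bit_clear bit_insert\<close>)
    moreover have "(mstep K p w)\<^sup>*\<^sup>*
        (Flip b j ps, i, (regs w K c)[j := (Suc (Suc h), cells (bit ?v) (width w) True)])
        (Run ps, i, regs w K (c(j := u)))"
      using Suc.hyps(2) Suc.prems h True bit_clear(2)[of v h] bit_insert(2)[of v h "width w"]
      by (intro Suc.hyps(1)) auto
    ultimately show ?thesis by (rule converse_rtranclp_into_rtranclp)
  next
    case False
    have "single (Flip b j ps) (scan w i) j (?t (Suc h)) (Back j ps) Stay (digit b) MoveLeft"
      using h False by (auto intro: single.flip_off[where b = b, simplified] single.flip_off)
    moreover have "?t(Suc h := digit b) = cells (bit u) (width w) True"
    proof (cases b)
      case True
      with Suc.prems(3) have "u = v + 2 ^ h" by simp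
      then show ?thesis using True False h by (simp add: cells_update bit_insert)
    next
      case b: False
      with Suc.prems(3) have "u = v - 2 ^ h" by simp
      then show ?thesis using b False h by (simp add: cells_update bit_clear)
    qed
    ultimately have "mstep K p w (Flip b j ps, i, (regs w K c)[j := (Suc h, ?t)])
        (Back j ps, i, (regs w K c)[j := (h, cells (bit u) (width w) True)])"
      by (rule_tac mstep_regsI) (use assms h in auto)
    moreover note back_run[of h w i j K ps p c u]
    ultimately show ?thesis using assms h by (auto intro: converse_rtranclp_into_rtranclp)
  qed
qed

lemma check_run:
  assumes "h \<le> width w" "\<forall>n<width w. bit (c j) n = b"
    "i \<le> length w + 1" "j < K" "ps \<in> conts p []"
  shows "(mstep K p w)\<^sup>*\<^sup>* (Check b j ps, i, (regs w K c)[j := (Suc h, cells (bit (c j)) (width w) True)])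
    (Run ps, i, regs w K c)"
  using assms(1)
proof (induction "width w - h" arbitrary: h)
  case 0
  then have h: "h = width w" by simp
  let ?t = "cells (bit (c j)) (width w) True"
  have "single (Check b j ps) (scan w i) j (?t (Suc h)) (Back j ps) Stay marker MoveLeft"
    using h by (auto intro: single.check_end)
  then have "mstep K p w (Check b j ps, i, (regs w K c)[j := (Suc h, ?t)])
      (Back j ps, i, (regs w K c)[j := (h, ?t)])"
    by (rule mstep_regsI) (use assms h in \<open>auto simp: fun_upd_idem\<close>)
  with back_run[of h w i j K ps p c "c j"] show ?case using assms h
    by (auto intro: converse_rtranclp_into_rtranclp)
next
  case (Suc k)
  then have h: "h < width w" by simp
  let ?t = "cells (bit (c j)) (width w) True"
  have "single (Check b j ps) (scan w i) j (?t (Suc h)) (Check b j ps) Stay (?t (Suc h)) MoveRight"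
    using h assms(2) by (auto intro: single.check_digit)
  then have "mstep K p w (Check b j ps, i, (regs w K c)[j := (Suc h, ?t)])
      (Check b j ps, i, (regs w K c)[j := (Suc (Suc h), ?t)])"
    by (rule mstep_regsI) (use assms h in \<open>auto simp: fun_upd_idem\<close>)
  then show ?case using Suc(1)[of "Suc h"] Suc(2) h
    by (auto intro: converse_rtranclp_into_rtranclp)
qed

lemma simulate_cont_step:
  assumes "cont_step w (ps, (i, c)) (ps', (i', c'))" "i \<le> length w + 1" "\<forall>j. c j < capacity w"
    "ps \<in> conts p []" "fits K p" "0 < K"
  shows "(mstep K p w)\<^sup>*\<^sup>* (Run ps, i, regs w K c) (Run ps', i', regs w K c')"
proof -
  have ps': "ps' \<in> conts p []"
    using assms(1)
  proof cases
    case (atom a)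
    then show ?thesis using conts_closed[OF assms(4)] by auto
  next
    case (silent q qs)
    then show ?thesis using conts_closed[OF assms(4)] by auto
  qed
  have go: "mstep K p w (Run ps, i, regs w K c) (q, min (move_head d i) (length w + 1), (regs w K c)[j := (move_head e 0, cells (bit (c j)) (width w) True)])"
    if "single (Run ps) (scan w i) j marker q d marker e" "q \<in> ctls K p" "j < K" for q d e j
  proof -
    have "mstep K p w (Run ps, i, (regs w K c)[j := (0, cells (bit (c j)) (width w) True)])
        (q, min (move_head d i) (length w + 1), (regs w K c)[j := (move_head e 0, cells (bit (c j)) (width w) True)])"
      by (rule mstep_regsI[where d = d and e = e and v = marker]) (use that assms(4) in auto)
    then show ?thesis by simp
  qed
  from assms(1) show ?thesis
  proof cases
    case (silent q qs)
    have "mstep K p w (Run ps, i, regs w K c) (Run ps', i', regs w K c')"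
      using go[of 0 "Run ps'" Stay Stay] silent ps' assms by (auto intro: single.silent)
    then show ?thesis by blast
  next
    case (atom a)
    have fits: "fits_instr K a"
      using fits_conts[OF assms(5) _ assms(4)] atom(1) by auto
    show ?thesis
    proof (cases a)
      case (Scan x)
      have "mstep K p w (Run ps, i, regs w K c) (Run ps', i', regs w K c')"
        using go[of 0 "Run ps'" Stay Stay] atom Scan ps' assms by (auto intro: single.scan)
      then show ?thesis by blast
    next
      case (Move d)
      have "mstep K p w (Run ps, i, regs w K c) (Run ps', i', regs w K c')"
        using go[of 0 "Run ps'" d Stay] atom Move ps' assms by (auto intro: single.move)
      then show ?thesis by blast
    next
      case (Inc j)
      have "mstep K p w (Run ps, i, regs w K c)
          (Flip True j ps', i, (regs w K c)[j := (Suc 0, cells (bit (c j)) (width w) True)])"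
        using go[of j "Flip True j ps'" Stay MoveRight] atom Inc ps' fits assms by (auto intro: single.inc)
      moreover have "(mstep K p w)\<^sup>*\<^sup>*
          (Flip True j ps', i, (regs w K c)[j := (Suc 0, cells (bit (c j)) (width w) True)])
          (Run ps', i, regs w K (c(j := c j + 1)))"
        using atom Inc ps' fits assms by (intro flip_run) auto
      ultimately show ?thesis using atom Inc by (auto intro: converse_rtranclp_into_rtranclp)
    next
      case (Dec j)
      have "mstep K p w (Run ps, i, regs w K c)
          (Flip False j ps', i, (regs w K c)[j := (Suc 0, cells (bit (c j)) (width w) True)])"
        using go[of j "Flip False j ps'" Stay MoveRight] atom Dec ps' fits assms by (auto intro: single.dec)
      moreover have "(mstep K p w)\<^sup>*\<^sup>*
          (Flip False j ps', i, (regs w K c)[j := (Suc 0, cells (bit (c j)) (width w) True)])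
          (Run ps', i, regs w K (c(j := c j - 1)))"
        using atom Dec ps' fits assms by (intro flip_run) auto
      ultimately show ?thesis using atom Dec by (auto intro: converse_rtranclp_into_rtranclp)
    next
      case (AllBits b j)
      have "mstep K p w (Run ps, i, regs w K c)
          (Check b j ps', i, (regs w K c)[j := (Suc 0, cells (bit (c j)) (width w) True)])"
        using go[of j "Check b j ps'" Stay MoveRight] atom AllBits ps' fits assms
        by (auto intro: single.all_bits)
      moreover have "(mstep K p w)\<^sup>*\<^sup>*
          (Check b j ps', i, (regs w K c)[j := (Suc 0, cells (bit (c j)) (width w) True)])
          (Run ps', i, regs w K c)"
        using atom AllBits ps' fits assms by (intro check_run) auto
      ultimately show ?thesis using atom AllBits by (auto intro: converse_rtranclp_into_rtranclp)
    qed
  qed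
qed

lemma simulate_cont_reach:
  assumes "cont_reach w p ps i c" "fits K p" "0 < K"
  shows "ps \<in> conts p [] \<and>
    (mstep K p w)\<^sup>*\<^sup>* (Run [p], length w + 1, regs w K (\<lambda>_. 0)) (Run ps, i, regs w K c)"
  using assms(1)
proof (induction "(ps, (i, c))" arbitrary: ps i c rule: rtranclp_induct)
  case base
  then show ?case using conts_ends(2) by auto
next
  case (step y)
  obtain qs i0 c0 where y: "y = (qs, (i0, c0))" by (cases y) auto
  have r: "cont_reach w p qs i0 c0" and st: "cont_step w (qs, (i0, c0)) (ps, (i, c))"
    using step.hyps y by auto
  have qs: "qs \<in> conts p []" using step.hyps(3)[OF y] by blast
  have "ps \<in> conts p []" using st
    by cases (use conts_closed[OF qs] in auto)
  moreover have "(mstep K p w)\<^sup>*\<^sup>* (Run qs, i0, regs w K c0) (Run ps, i, regs w K c)"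
    using cont_reach_head[OF r] cont_reach_bounded[OF r] qs assms(2,3) by (intro simulate_cont_step[OF st]) auto
  ultimately show ?case using step.hyps(3)[OF y] by auto
qed

lemma return_run:
  assumes "h \<le> l" "i \<le> length w + 1"
  shows "(mstep K p w)\<^sup>*\<^sup>* (Return, i, replicate K (h, cells f l False)) (Return, i, replicate K (0, cells f l False))"
  using assms(1)
proof (induction h)
  case (Suc h)
  have "lockstep p Return (scan w i) (cells f l False (Suc h)) Return Stay (digit (f h)) MoveLeft"
    using Suc.prems by (auto intro: lockstep.return_digit)
  then have "mstep K p w (Return, i, replicate K (Suc h, cells f l False)) (Return, i, replicate K (h, cells f l False))"
    by (rule mstep_lockstepI) (use Suc.prems assms in \<open>auto intro!: fun_upd_idem[symmetric]\<close>)
  then show ?case using Suc by (auto intro: converse_rtranclp_into_rtranclp)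
qed simp

lemma home_run:
  assumes "h \<le> width w" "i \<le> length w + 1"
  shows "(mstep K p w)\<^sup>*\<^sup>* (Home, i, replicate K (h, cells f (width w) True))
    (Run [p], i, replicate K (0, cells f (width w) True))"
  using assms(1)
proof (induction h)
  case 0
  have "mstep K p w (Home, i, replicate K (0, cells f (width w) True)) (Run [p], i, replicate K (0, cells f (width w) True))"
    by (rule mstep_lockstepI[where d = Stay and e = Stay and v = marker])
      (use assms conts_ends(2) in \<open>auto intro: lockstep.home_end\<close>)
  then show ?case by blast
next
  case (Suc h)
  have "lockstep p Home (scan w i) (cells f (width w) True (Suc h)) Home Stay (digit (f h)) MoveLeft"
    using Suc.prems by (auto intro: lockstep.home_digit)
  then have "mstep K p w (Home, i, replicate K (Suc h, cells f (width w) True)) (Home, i, replicate K (h, cells f (width w) True))"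
    by (rule mstep_lockstepI) (use Suc.prems assms in \<open>auto intro!: fun_upd_idem[symmetric]\<close>)
  then show ?case using Suc by (auto intro: converse_rtranclp_into_rtranclp)
qed

lemma fill_run:
  assumes "h \<le> l" "l = width w" "i \<le> length w + 1"
    "\<forall>n<h. \<not> g n"
  shows "\<exists>f. (\<forall>n<l. \<not> f n) \<and> (mstep K p w)\<^sup>*\<^sup>* (Fill, i, replicate K (Suc h, cells g l False)) (Home, i, replicate K (l, cells f l True))"
  using assms(1,4)
proof (induction "l - h" arbitrary: h g)
  case 0
  then have "h = l" by simp
  have "mstep K p w (Fill, i, replicate K (Suc h, cells g l False)) (Home, i, replicate K (l, cells g l True))"
    by (rule mstep_lockstepI[where d = Stay and e = MoveLeft and v = marker])
      (use assms \<open>h = l\<close> in \<open>auto intro: lockstep.fill_end simp: cells_close\<close>)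
  then show ?case using 0 \<open>h = l\<close> by blast
next
  case (Suc k)
  then have h: "h < l" by simp
  have "lockstep p Fill (scan w i) (cells g l False (Suc h)) Fill Stay (digit False) MoveRight"
    using h by (auto intro: lockstep.fill_digit)
  then have st: "mstep K p w (Fill, i, replicate K (Suc h, cells g l False)) (Fill, i, replicate K (Suc (Suc h), cells (g(h := False)) l False))"
    by (rule mstep_lockstepI) (use h assms in \<open>auto simp: cells_update\<close>)
  have "\<forall>n<Suc h. \<not> (g(h := False)) n" using Suc.prems(2) by (simp add: less_Suc_eq)
  moreover have "k = l - Suc h" "Suc h \<le> l" using Suc(2) h by auto
  ultimately obtain f where f: "\<forall>n<l. \<not> f n"
    "(mstep K p w)\<^sup>*\<^sup>* (Fill, i, replicate K (Suc (Suc h), cells (g(h := False)) l False))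
      (Home, i, replicate K (l, cells f l True))"
    using Suc(1)[of "Suc h" "g(h := False)"] by blast
  with converse_rtranclp_into_rtranclp[of "mstep K p w", OF st f(2)] show ?case by blast
qed

lemma carry_run:
  assumes "h \<le> l" "v < 2 ^ l" "v + 2 ^ h = i + 1" "i \<le> length w + 1" "tight l i"
  shows "\<exists>l' h'. h' \<le> l' \<and> tight l' (i + 1) \<and>
    (mstep K p w)\<^sup>*\<^sup>* (Carry, i, replicate K (Suc h, cells (bit v) l False))
      (Return, i, replicate K (h', cells (bit (i + 1)) l' False))"
  using assms(1-3)
proof (induction "l - h" arbitrary: h v)
  case 0
  then have h: "h = l" by simp
  then have v: "v = 0" "i + 1 = 2 ^ l" using 0 assms(5) by (auto simp: tight_def)
  have "(cells (bit v) l False)(Suc h := digit True) = cells (bit (i + 1)) (Suc l) False"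
    using v bit_insert(1)[of 0 l] by (simp add: h cells_extend)
  then have "mstep K p w (Carry, i, replicate K (Suc h, cells (bit v) l False))
      (Return, i, replicate K (h, cells (bit (i + 1)) (Suc l) False))"
    by (intro mstep_lockstepI[where d = Stay and e = MoveLeft and v = "digit True"])
      (use assms h in \<open>auto intro: lockstep.carry_new\<close>)
  moreover have "tight (Suc l) (i + 1)" using v by (auto simp: tight_def)
  ultimately show ?case using h by (intro exI[of _ "Suc l"] exI[of _ h]) auto
next
  case (Suc k)
  then have h: "h < l" by simp
  show ?case
  proof (cases "bit v h")
    case True
    have "lockstep p Carry (scan w i) (cells (bit v) l False (Suc h)) Carry Stay (digit False) MoveRight"
      using h True by (auto intro: lockstep.carry_one)
    then have st: "mstep K p w (Carry, i, replicate K (Suc h, cells (bit v) l False))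
        (Carry, i, replicate K (Suc (Suc h), cells (bit (v - 2 ^ h)) l False))"
      by (rule mstep_lockstepI) (use h True assms in \<open>auto simp: cells_update bit_clear\<close>)
    have "k = l - Suc h" "Suc h \<le> l" "v - 2 ^ h < 2 ^ l" "v - 2 ^ h + 2 ^ Suc h = i + 1"
      using Suc(2-) h bit_clear(2)[OF True] by auto
    from Suc(1)[OF this] obtain l' h' where l': "h' \<le> l'" "tight l' (i + 1)"
      "(mstep K p w)\<^sup>*\<^sup>* (Carry, i, replicate K (Suc (Suc h), cells (bit (v - 2 ^ h)) l False))
        (Return, i, replicate K (h', cells (bit (i + 1)) l' False))" by blast
    with converse_rtranclp_into_rtranclp[of "mstep K p w", OF st l'(3)] show ?thesis by blast
  next
    case False
    have "lockstep p Carry (scan w i) (cells (bit v) l False (Suc h)) Return Stay (digit True) MoveLeft"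
      using h False by (auto intro: lockstep.carry_zero)
    moreover have "(cells (bit v) l False)(Suc h := digit True) = cells (bit (i + 1)) l False"
      using h False Suc.prems(3) by (simp add: cells_update bit_insert)
    ultimately have "mstep K p w (Carry, i, replicate K (Suc h, cells (bit v) l False))
        (Return, i, replicate K (h, cells (bit (i + 1)) l False))"
      by (rule_tac mstep_lockstepI) (use assms in auto)
    moreover have "tight l (i + 1)"
      using bit_insert(2)[OF False Suc.prems(2) h] assms(5) Suc.prems(3) h by (auto simp: tight_def)
    ultimately show ?thesis using h by (intro exI[of _ l] exI[of _ h]) auto
  qed
qed

text \<open>One increment is made for each cell passed by the input head, the left end marker
  included; hence the counter shows \<open>i + 1\<close> when the head is at
  \<open>i\<close>.\<close>

lemma count_run:
  assumes "i \<le> length w + 1"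
  shows "\<exists>l. tight l (i + 1) \<and>
    (mstep K p w)\<^sup>*\<^sup>* (mstart K) (Return, i, replicate K (0, cells (bit (i + 1)) l False))"
proof -
  have "\<exists>l'. tight l' (i + 1) \<and> (mstep K p w)\<^sup>*\<^sup>* (Carry, i, replicate K (Suc 0, cells (bit i) l False))
      (Return, i, replicate K (0, cells (bit (i + 1)) l' False))"
    if "i \<le> length w + 1" "tight l i" for i l
  proof -
    have "i < 2 ^ l" "i + 2 ^ 0 = i + 1" using that(2) by (auto simp: tight_def)
    from carry_run[OF le0 this that] obtain l' h' where l': "h' \<le> l'" "tight l' (i + 1)"
      "(mstep K p w)\<^sup>*\<^sup>* (Carry, i, replicate K (Suc 0, cells (bit i) l False))
        (Return, i, replicate K (h', cells (bit (i + 1)) l' False))"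
      by blast
    from rtranclp_trans[OF this(3) return_run[OF l'(1) that(1)]] l'(2) show ?thesis by blast
  qed
  note carry = this
  show ?thesis
    using assms
  proof (induction i)
    case 0
    have st: "mstep K p w (mstart K) (Carry, 0, replicate K (Suc 0, cells (bit (0::nat)) 0 False))"
      unfolding mstart_def
      by (rule mstep_lockstepI[where d = Stay and e = MoveRight and v = marker])
        (auto intro: lockstep.start simp: cells_def fun_eq_iff)
    obtain l where l: "tight l (0 + 1)"
      "(mstep K p w)\<^sup>*\<^sup>* (Carry, 0, replicate K (Suc 0, cells (bit (0::nat)) 0 False))
        (Return, 0, replicate K (0, cells (bit (0 + 1 :: nat)) l False))"
    proof -
      have "tight 0 0" by (simp add: tight_def)
      from carry[OF le0 this] show thesis by (elim exE conjE) (rule that)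
    qed
    show ?case
      by (intro exI[of _ l] conjI l(1) converse_rtranclp_into_rtranclp[of "mstep K p w", OF st l(2)])
  next
    case (Suc i)
    from Suc.IH[OF Suc_leD[OF Suc.prems]] obtain l where l: "tight l (i + 1)"
      "(mstep K p w)\<^sup>*\<^sup>* (mstart K) (Return, i, replicate K (0, cells (bit (i + 1)) l False))" by (elim exE conjE) (rule that)
    have "scan w i \<noteq> RightEnd" using Suc.prems by (simp add: scan_eq_RightEnd_iff)
    then have st: "mstep K p w (Return, i, replicate K (0, cells (bit (i + 1)) l False))
        (Carry, Suc i, replicate K (Suc 0, cells (bit (Suc i)) l False))"
      by (intro mstep_lockstepI[where d = MoveRight and e = MoveRight and v = marker])
        (use Suc.prems in \<open>auto intro: lockstep.return_next\<close>)
    have "tight l (Suc i)" using l(1) by simp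
    from carry[OF Suc.prems this] obtain l' where l': "tight l' (Suc i + 1)"
      "(mstep K p w)\<^sup>*\<^sup>* (Carry, Suc i, replicate K (Suc 0, cells (bit (Suc i)) l False))
        (Return, Suc i, replicate K (0, cells (bit (Suc i + 1)) l' False))"
      by (elim exE conjE) (rule that)
    show ?case
      by (intro exI[of _ l'] conjI l'(1)
          rtranclp_trans[OF l(2) converse_rtranclp_into_rtranclp[of "mstep K p w", OF st l'(2)]])
  qed
qed

lemma layout_run:
  "(mstep K p w)\<^sup>*\<^sup>* (mstart K) (Run [p], length w + 1, regs w K (\<lambda>_. 0))" if "0 < K"
proof -
  obtain l where "tight l (length w + 2)" and
    1: "(mstep K p w)\<^sup>*\<^sup>* (mstart K) (Return, length w + 1, replicate K (0, cells (bit (length w + 2)) l False))"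
    using count_run[of "length w + 1" w K p] by auto
  then have l: "l = width w" by (intro tight_width)
  have 2: "mstep K p w (Return, length w + 1, replicate K (0, cells (bit (length w + 2)) l False))
      (Fill, length w + 1, replicate K (Suc 0, cells (bit (length w + 2)) l False))"
    by (rule mstep_lockstepI[where d = Stay and e = MoveRight and v = marker])
      (auto simp: scan_def intro: lockstep.return_end)
  obtain f where f: "\<forall>n<l. \<not> f n" and
    3: "(mstep K p w)\<^sup>*\<^sup>* (Fill, length w + 1, replicate K (Suc 0, cells (bit (length w + 2)) l False))
      (Home, length w + 1, replicate K (l, cells f l True))"
    using fill_run[of 0 l w "length w + 1" "bit (length w + 2)" K p] l by auto
  have 4: "(mstep K p w)\<^sup>*\<^sup>* (Home, length w + 1, replicate K (l, cells f l True))
      (Run [p], length w + 1, replicate K (0, cells f l True))"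
    using home_run[of l w "length w + 1"] l by auto
  have run: "(mstep K p w)\<^sup>*\<^sup>* (mstart K) (Run [p], length w + 1, replicate K (0, cells f l True))"
    by (rule rtranclp_trans[OF rtranclp.rtrancl_into_rtrancl[of "mstep K p w", OF 1 2] rtranclp_trans[OF 3 4]])
  have "cells f l True = cells (bit 0) l True" using f by (intro cells_cong) simp
  then have "replicate K (0, cells f l True) = regs w K (\<lambda>_. 0)"
    by (intro nth_equalityI) (auto simp: l)
  with run show ?thesis by simp
qed

text \<open>The invariant at \<open>Run []\<close> turns an accepting computation into a program
  run, and conversely a program run is imitated after the layout phase. The layout leaves the input
  head at the right end, which fixes the initial store.\<close>

theorem accepts_machine_of:
  assumes "fits K p" "0 < K"
  shows "accepts (machine_of K p) w \<longleftrightarrow> (\<exists>s. run w p (length w + 1, \<lambda>_. 0) s)"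
proof
  assume "accepts (machine_of K p) w"
  then obtain n i ts where "reachable (machine_of K p) w (n, i, ts)" "n \<in> accepting (machine_of K p)"
    by (auto simp: accepts_def)
  moreover have "accepting (machine_of K p) = {to_nat (Run [] :: 'a ctl)}" by (simp add: machine_of_def)
  ultimately have "(mstep K p w)\<^sup>*\<^sup>* (mstart K) (Run [], i, ts)"
    by (auto simp: reachable_machine_of)
  then obtain c where "cont_reach w p [] i c" using invar_reachable assms(2) by fastforce
  then have "run w p (length w + 1, \<lambda>_. 0) (i, c)" by (auto dest: cont_step_sound)
  then show "\<exists>s. run w p (length w + 1, \<lambda>_. 0) s" ..
next
  assume "\<exists>s. run w p (length w + 1, \<lambda>_. 0) s"
  then obtain i c where "run w p (length w + 1, \<lambda>_. 0) (i, c)" by auto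
  then have "cont_reach w p [] i c" by (rule cont_step_complete)
  with simulate_cont_reach[OF this assms] layout_run[OF assms(2), of p w]
  have "(mstep K p w)\<^sup>*\<^sup>* (mstart K) (Run [], i, regs w K c)" by auto
  then have "reachable (machine_of K p) w (to_nat (Run [] :: 'a ctl), i, regs w K c)"
    by (auto simp: reachable_machine_of)
  then show "accepts (machine_of K p) w" by (auto simp: accepts_def machine_of_def)
qed

section \<open>The logarithmic space bound\<close>

lemma runs_in_space_machine_of: "0 < K \<Longrightarrow> runs_in_space (machine_of K p) w (width w + 2)"
  unfolding runs_in_space_def reachable_machine_of
  using invar_space invar_reachable by fastforce

text \<open>Minimality of \<open>l\<close> gives \<open>2 ^ (l - 1) \<le> n + 2\<close>, which is at
  most \<open>n * n\<close> for \<open>n \<ge> 3\<close>. With \<open>ln 2 \<ge> 1 / 2\<close> this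
  yields \<open>l - 1 \<le> 4 * ln n\<close>, and since \<open>ln n \<ge> 1\<close> the additive
  constants are absorbed generously by the factor 12.\<close>

lemma width_bigo: "(\<lambda>n. real ((LEAST l. n + 2 < 2 ^ l) + 2)) \<in> O(\<lambda>n. ln (real n))"
proof (rule bigoI[where c = 12], rule eventually_sequentiallyI[where c = 3])
  fix n :: nat assume n: "3 \<le> n"
  define l where "l = (LEAST l. n + 2 < 2 ^ l)"
  have "1 \<le> ln (real n)"
  proof -
    have "exp 1 \<le> (3::real)" using exp_le by simp
    also have "\<dots> \<le> real n" using n by simp
    finally show ?thesis using n by (simp add: ln_ge_iff)
  qed
  have "0 < l"
  proof (rule ccontr)
    have "n + 2 < 2 ^ l" unfolding l_def by (rule LeastI[of _ "n + 2"]) (rule less_exp)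
    moreover assume "\<not> 0 < l"
    ultimately show False by simp
  qed
  then have "\<not> n + 2 < 2 ^ (l - 1)" unfolding l_def by (intro not_less_Least) simp
  then have "2 ^ (l - 1) \<le> n + 2" by simp
  also have "\<dots> \<le> 3 * n" using n by simp
  also have "\<dots> \<le> n * n" using n by (rule mult_le_mono1)
  finally have "real (2 ^ (l - 1)) \<le> real (n * n)" by (simp only: of_nat_le_iff)
  then have "(2::real) ^ (l - 1) \<le> real n * real n" by simp
  then have "ln ((2::real) ^ (l - 1)) \<le> ln (real n * real n)" using n by simp
  then have "real (l - 1) * ln 2 \<le> 2 * ln (real n)"
    using n by (simp add: ln_realpow ln_mult)
  moreover have "1 / 2 \<le> ln (2::real)" using ln_le_minus_one[of "1 / 2 :: real"] by (simp add: ln_div)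
  then have "real (l - 1) * (1 / 2) \<le> real (l - 1) * ln 2" by (intro mult_left_mono) auto
  ultimately have "real (l - 1) \<le> 4 * ln (real n)" by linarith
  with \<open>1 \<le> ln (real n)\<close> \<open>0 < l\<close> have "real (l + 2) \<le> 12 * ln (real n)" by (simp add: of_nat_diff)
  then show "norm (real ((LEAST l. n + 2 < 2 ^ l) + 2)) \<le> 12 * norm (ln (real n))"
    using \<open>1 \<le> ln (real n)\<close> by (simp add: l_def)
qed

theorem program_in_NL:
  fixes p :: "('s :: finite) prog"
  assumes "\<And>w. w \<in> L \<longleftrightarrow> (\<exists>s. run w p (length w + 1, \<lambda>_. 0) s)"
  shows "L \<in> NL"
proof -
  obtain K where K: "0 < K" "fits K p" using ex_fits by blast
  let ?s = "\<lambda>n. (LEAST l. n + 2 < 2 ^ l) + 2"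
  have "accepts (machine_of K p) w \<longleftrightarrow> w \<in> L" for w
    using accepts_machine_of[OF K(2,1), of w] assms[of w] by simp
  moreover have "runs_in_space (machine_of K p) w (?s (length w))" for w
    using runs_in_space_machine_of[OF K(1), of p w] by (simp add: width_def)
  ultimately have "L \<in> NSPACE ?s" unfolding NSPACE_def
    using is_machine_machine_of[of K p] by blast
  then show ?thesis unfolding NL_def by (intro UN_I[of ?s] CollectI width_bigo)
qed

section \<open>Actions and tests: closure properties of register programs\<close>

subsection \<open>Decidable predicates on register contents\<close>

type_synonym env = "nat \<Rightarrow> nat"

definition ok :: "'s list \<Rightarrow> nat \<Rightarrow> env \<Rightarrow> bool" where
  "ok w k c \<longleftrightarrow> (\<forall>j. c j < capacity w) \<and> (\<forall>j\<ge>k. c j = 0)"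

text \<open>
  The registers from \<open>k\<close> on are scratch space: they are zero before and after.
\<close>

definition implements :: "nat \<Rightarrow> 's prog \<Rightarrow> ('s list \<Rightarrow> env \<Rightarrow> env \<Rightarrow> bool) \<Rightarrow> bool" where
  "implements k p S \<longleftrightarrow> (\<forall>w c s. ok w k c \<longrightarrow>
     (run w p (0, c) s \<longleftrightarrow> (\<exists>c'. s = (0, c') \<and> ok w k c' \<and> S w c c')))"

definition action :: "nat \<Rightarrow> ('s list \<Rightarrow> env \<Rightarrow> env \<Rightarrow> bool) \<Rightarrow> bool" where
  "action k S \<longleftrightarrow> (\<exists>p. implements k p S)"

text \<open>A test has a surviving branch exactly when \<open>R\<close> holds, and no branch ever
  reports failure. Conjunction, disjunction and existential quantification are therefore immediate,
  whereas complements have to be established separately.\<close>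

definition test :: "nat \<Rightarrow> ('s list \<Rightarrow> env \<Rightarrow> bool) \<Rightarrow> bool" where
  "test k R \<longleftrightarrow> action k (\<lambda>w c c'. c' = c \<and> R w c)"

lemma implementsD:
  "implements k p S \<Longrightarrow> ok w k c \<Longrightarrow>
     run w p (0, c) s \<longleftrightarrow> (\<exists>c'. s = (0, c') \<and> ok w k c' \<and> S w c c')"
  unfolding implements_def by blast

lemma actionI:
  "(\<And>w c s. ok w k c \<Longrightarrow> run w p (0, c) s \<longleftrightarrow> (\<exists>c'. s = (0, c') \<and> ok w k c' \<and> S w c c')) \<Longrightarrow>
     action k S"
  unfolding action_def implements_def by (intro exI[of _ p] allI impI)

lemma action_cong:
  assumes "action k S" "\<And>w c c'. ok w k c \<Longrightarrow> ok w k c' \<Longrightarrow> S w c c' \<longleftrightarrow> T w c c'"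
  shows "action k T"
proof -
  from assms(1) obtain p where p: "implements k p S" by (auto simp: action_def)
  show ?thesis
  proof (rule actionI)
    fix w :: "'a list" and c s assume c: "ok w k c"
    show "run w p (0, c) s \<longleftrightarrow> (\<exists>c'. s = (0, c') \<and> ok w k c' \<and> T w c c')"
      unfolding implementsD[OF p c] using assms(2)[OF c] by blast
  qed
qed

lemma test_cong:
  assumes "test k R" "\<And>w c. ok w k c \<Longrightarrow> R w c \<longleftrightarrow> Q w c"
  shows "test k Q"
  using assms(1) unfolding test_def by (rule action_cong) (use assms(2) in auto)

lemma action_seq:
  assumes "action k S" "action k T"
  shows "action k (\<lambda>w c c'. \<exists>d. ok w k d \<and> S w c d \<and> T w d c')"
proof -
  from assms obtain p q where p: "implements k p S" and q: "implements k q T"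
    by (auto simp: action_def)
  show ?thesis
  proof (rule actionI)
    fix w :: "'a list" and c s assume c: "ok w k c"
    have "run w (Seq p q) (0, c) s \<longleftrightarrow> (\<exists>t. run w p (0, c) t \<and> run w q t s)" by auto
    also have "\<dots> \<longleftrightarrow> (\<exists>d. ok w k d \<and> S w c d \<and> run w q (0, d) s)"
      by (simp only: implementsD[OF p c]) blast
    also have "\<dots> \<longleftrightarrow> (\<exists>d. ok w k d \<and> S w c d \<and> (\<exists>c'. s = (0, c') \<and> ok w k c' \<and> T w d c'))"
      using implementsD[OF q] by blast
    finally show "run w (Seq p q) (0, c) s \<longleftrightarrow>
      (\<exists>c'. s = (0, c') \<and> ok w k c' \<and> (\<exists>d. ok w k d \<and> S w c d \<and> T w d c'))" by blast
  qed
qed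

lemma action_alt:
  assumes "action k S" "action k T"
  shows "action k (\<lambda>w c c'. S w c c' \<or> T w c c')"
proof -
  from assms obtain p q where p: "implements k p S" and q: "implements k q T"
    by (auto simp: action_def)
  show ?thesis
  proof (rule actionI)
    fix w :: "'a list" and c s assume c: "ok w k c"
    show "run w (Alt p q) (0, c) s \<longleftrightarrow>
      (\<exists>c'. s = (0, c') \<and> ok w k c' \<and> (S w c c' \<or> T w c c'))"
      unfolding run.simps implementsD[OF p c] implementsD[OF q c] by blast
  qed
qed

text \<open>Every step stays inside \<open>P\<close>, but the empty walk is allowed at every point,
  inside \<open>P\<close> or not.\<close>

definition star_on :: "('a \<Rightarrow> bool) \<Rightarrow> ('a \<Rightarrow> 'a \<Rightarrow> bool) \<Rightarrow> 'a \<Rightarrow> 'a \<Rightarrow> bool" where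
  "star_on P S = (\<lambda>c d. P c \<and> P d \<and> S c d)\<^sup>*\<^sup>*"

lemma action_star:
  assumes "action k S"
  shows "action k (\<lambda>w. star_on (ok w k) (S w))"
proof -
  from assms obtain p where p: "implements k p S" by (auto simp: action_def)
  show ?thesis
  proof (rule actionI)
    fix w :: "'a list" and c s assume c: "ok w k c"
    show "run w (Star p) (0, c) s \<longleftrightarrow> (\<exists>c'. s = (0, c') \<and> ok w k c' \<and> star_on (ok w k) (S w) c c')"
    proof
      assume "run w (Star p) (0, c) s"
      then have "(run w p)\<^sup>*\<^sup>* (0, c) s" by simp
      then show "\<exists>c'. s = (0, c') \<and> ok w k c' \<and> star_on (ok w k) (S w) c c'"
      proof induction
        case base
        then show ?case using c by (auto simp: star_on_def)
      next
        case (step s t)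
        then obtain d where d: "s = (0, d)" "ok w k d" "star_on (ok w k) (S w) c d" by auto
        with step implementsD[OF p d(2)] obtain e where e: "t = (0, e)" "ok w k e" "S w d e" by blast
        from d(3) have "star_on (ok w k) (S w) c e" unfolding star_on_def
          by (rule rtranclp.rtrancl_into_rtrancl) (use d e in simp)
        with e show ?case by blast
      qed
    next
      assume "\<exists>c'. s = (0, c') \<and> ok w k c' \<and> star_on (ok w k) (S w) c c'"
      then obtain d where d: "s = (0, d)" "(\<lambda>c d. ok w k c \<and> ok w k d \<and> S w c d)\<^sup>*\<^sup>* c d"
        by (auto simp: star_on_def)
      from d(2) have "(run w p)\<^sup>*\<^sup>* (0, c) (0, d)"
      proof induction
        case (step d e)
        then have "run w p (0, d) (0, e)" using implementsD[OF p, of w d] by blast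
        with step.IH show ?case by (rule rtranclp.rtrancl_into_rtrancl)
      qed simp
      with d show "run w (Star p) (0, c) s" by simp
    qed
  qed
qed

text \<open>Leaving the scope of a register requires that it has been reset.\<close>

lemma ok_Suc: "ok w k c \<Longrightarrow> ok w (Suc k) c"
  by (simp add: ok_def)

lemma ok_Suc_iff: "ok w k c \<longleftrightarrow> ok w (Suc k) c \<and> c k = 0"
proof -
  have "k \<le> j \<longleftrightarrow> j = k \<or> Suc k \<le> j" for j by auto
  then show ?thesis by (auto simp: ok_def)
qed

lemma ok_upd: "ok w (Suc k) c \<Longrightarrow> j \<le> k \<Longrightarrow> x < capacity w \<Longrightarrow> ok w (Suc k) (c(j := x))"
  by (simp add: ok_def)

lemma ok_upd': "ok w k c \<Longrightarrow> j < k \<Longrightarrow> x < capacity w \<Longrightarrow> ok w k (c(j := x))"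
  by (simp add: ok_def)

lemma ok_less: "ok w k c \<Longrightarrow> c j < capacity w"
  by (simp add: ok_def)

lemma ok_zero: "ok w k c \<Longrightarrow> k \<le> j \<Longrightarrow> c j = 0"
  by (simp add: ok_def)

lemma action_inc: "j < k \<Longrightarrow> action k (\<lambda>w c c'. c' = c(j := Suc (c j)))"
  by (rule actionI[of _ "Atom (Inc j)"]) (auto simp: ok_def)

lemma action_dec: "j < k \<Longrightarrow> action k (\<lambda>w c c'. 0 < c j \<and> c' = c(j := c j - 1))"
  by (rule actionI[of _ "Atom (Dec j)"]) (auto simp: ok_def less_imp_diff_less)

lemma test_all_bits: "test k (\<lambda>w c. \<forall>n < width w. bit (c j) n = b)"
  unfolding test_def by (rule actionI[of _ "Atom (AllBits b j)"]) auto

lemma all_bits_False: "v < 2 ^ l \<Longrightarrow> (\<forall>n<l. \<not> bit v n) \<longleftrightarrow> v = (0::nat)"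
proof
  assume "v < 2 ^ l" "\<forall>n<l. \<not> bit v n"
  then have "take_bit l v = 0" by (intro bit_eqI) (auto simp: bit_take_bit_iff)
  with \<open>v < 2 ^ l\<close> show "v = 0" by (simp add: take_bit_nat_eq_self)
qed simp

lemma all_bits_True: "v < 2 ^ l \<Longrightarrow> (\<forall>n<l. bit v n) \<longleftrightarrow> v = (2::nat) ^ l - 1"
proof -
  assume v: "v < 2 ^ l"
  have "(\<forall>n<l. bit v n) \<longleftrightarrow> take_bit l v = mask l"
    by (auto simp: bit_eq_iff bit_take_bit_iff bit_mask_iff)
  then show ?thesis using v by (simp add: take_bit_nat_eq_self mask_eq_exp_minus_1)
qed

lemma test_zero: "test k (\<lambda>w c. c j = 0)"
  using test_all_bits[of k j False] by (rule test_cong) (simp add: all_bits_False[OF ok_less])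

lemma test_max: "test k (\<lambda>w c. c j = capacity w - 1)"
  using test_all_bits[of k j True] by (rule test_cong) (simp add: all_bits_True[OF ok_less])

text \<open>Register \<open>k\<close> may be used as scratch space: the appended zero test kills
  each branch on which it has not been reset.\<close>

lemma action_local:
  assumes "action (Suc k) S"
  shows "action k S"
proof -
  have "action (Suc k) (\<lambda>w c c'. \<exists>d. ok w (Suc k) d \<and> S w c d \<and> (c' = d \<and> d k = 0))"
    using action_seq[OF assms] test_zero[of "Suc k" k] unfolding test_def by blast
  then obtain p where p: "implements (Suc k) p (\<lambda>w c c'. \<exists>d. ok w (Suc k) d \<and> S w c d \<and> (c' = d \<and> d k = 0))"
    by (auto simp: action_def)
  show ?thesis
    by (rule actionI[of _ p]) (simp only: implementsD[OF p ok_Suc] ok_Suc_iff[of _ k], blast)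
qed

text \<open>The counting loops of programs have this form: from each point of the chain there is one
  possible step, and none from the last point, so the only freedom is when to stop.\<close>

lemma star_chain:
  assumes "\<And>m d. m \<le> M \<Longrightarrow> T (g m) d \<longleftrightarrow> m < M \<and> d = g (Suc m)"
  shows "T\<^sup>*\<^sup>* (g 0) d \<longleftrightarrow> (\<exists>m\<le>M. d = g m)"
proof
  assume "T\<^sup>*\<^sup>* (g 0) d"
  then show "\<exists>m\<le>M. d = g m"
  proof induction
    case (step d e)
    then obtain m where "m \<le> M" "d = g m" by blast
    with step.hyps(2) assms[of m e] show ?case by (intro exI[of _ "Suc m"]) auto
  qed auto
next
  assume "\<exists>m\<le>M. d = g m"
  then obtain m where "m \<le> M" and d: "d = g m" by blast
  from \<open>m \<le> M\<close> have "T\<^sup>*\<^sup>* (g 0) (g m)"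
  proof (induction m)
    case (Suc m)
    then have "T (g m) (g (Suc m))" by (simp add: assms)
    with Suc show ?case by (simp add: rtranclp.rtrancl_into_rtrancl)
  qed simp
  with d show "T\<^sup>*\<^sup>* (g 0) d" by simp
qed

lemma action_inc_star: "j < k \<Longrightarrow> action k (\<lambda>w c c'. \<exists>x\<ge>c j. c' = c(j := x))"
proof (rule action_cong[OF action_star[OF action_inc]])
  fix w :: "'a list" and c c'
  assume j: "j < k" and c: "ok w k c" and c': "ok w k c'"
  have upd: "ok w k (c(j := x)) \<longleftrightarrow> x < capacity w" for x using j c by (auto simp: ok_def)
  let ?g = "\<lambda>m. c(j := c j + m)"
  have "star_on (ok w k) (\<lambda>c c'. c' = c(j := Suc (c j))) (?g 0) c' \<longleftrightarrow> (\<exists>m\<le>capacity w - 1 - c j. c' = ?g m)"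
    unfolding star_on_def
  proof (rule star_chain)
    fix m d assume "m \<le> capacity w - 1 - c j"
    then have "ok w k (?g m)" "ok w k (?g (Suc m)) \<longleftrightarrow> m < capacity w - 1 - c j"
      unfolding upd using ok_less[OF c, of j] by linarith+
    moreover have "(?g m)(j := Suc ((?g m) j)) = ?g (Suc m)" by simp
    ultimately show "ok w k (?g m) \<and> ok w k d \<and> d = (?g m)(j := Suc ((?g m) j)) \<longleftrightarrow>
        m < capacity w - 1 - c j \<and> d = ?g (Suc m)"
      by metis
  qed
  also have "\<dots> \<longleftrightarrow> (\<exists>x\<ge>c j. c' = c(j := x))"
  proof
    assume "\<exists>x\<ge>c j. c' = c(j := x)"
    then obtain x where x: "c j \<le> x" "c' = c(j := x)" by blast
    then have "x < capacity w" using ok_less[OF c', of j] by simp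
    with x show "\<exists>m\<le>capacity w - 1 - c j. c' = c(j := c j + m)" by (intro exI[of _ "x - c j"]) auto
  next
    assume "\<exists>m\<le>capacity w - 1 - c j. c' = ?g m"
    then show "\<exists>x\<ge>c j. c' = c(j := x)" using le_add1 by blast
  qed
  finally show "star_on (ok w k) (\<lambda>c c'. c' = c(j := Suc (c j))) c c' \<longleftrightarrow> (\<exists>x\<ge>c j. c' = c(j := x))" by simp
qed

lemma action_dec_star: "j < k \<Longrightarrow> action k (\<lambda>w c c'. \<exists>x\<le>c j. c' = c(j := x))"
proof (rule action_cong[OF action_star[OF action_dec]])
  fix w :: "'a list" and c c'
  assume j: "j < k" and c: "ok w k c" and c': "ok w k c'"
  have upd: "ok w k (c(j := x)) \<longleftrightarrow> x < capacity w" for x using j c by (auto simp: ok_def)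
  let ?g = "\<lambda>m. c(j := c j - m)"
  have "star_on (ok w k) (\<lambda>c c'. 0 < c j \<and> c' = c(j := c j - 1)) (?g 0) c' \<longleftrightarrow> (\<exists>m\<le>c j. c' = ?g m)"
    unfolding star_on_def
  proof (rule star_chain)
    fix m d assume "m \<le> c j"
    have "ok w k (?g m)" "ok w k (?g (Suc m))"
      unfolding upd using ok_less[OF c, of j] by linarith+
    moreover have "(?g m)(j := (?g m) j - 1) = ?g (Suc m)" "0 < (?g m) j \<longleftrightarrow> m < c j" by simp_all
    ultimately show "ok w k (?g m) \<and> ok w k d \<and> 0 < (?g m) j \<and> d = (?g m)(j := (?g m) j - 1) \<longleftrightarrow>
        m < c j \<and> d = ?g (Suc m)"
      by metis
  qed
  also have "\<dots> \<longleftrightarrow> (\<exists>x\<le>c j. c' = c(j := x))"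
    by (metis diff_diff_cancel diff_le_self)
  finally show "star_on (ok w k) (\<lambda>c c'. 0 < c j \<and> c' = c(j := c j - 1)) c c' \<longleftrightarrow> (\<exists>x\<le>c j. c' = c(j := x))"
    by simp
qed

text \<open>Repeated increments guess an arbitrary content for register \<open>k\<close>, and
  repeated decrements afterwards clear whatever \<open>S\<close> has left there; branches that stop
  clearing too early are cut off by \<open>action_local\<close>.\<close>

lemma action_block:
  assumes "action (Suc k) S"
  shows "action k (\<lambda>w c c'. \<exists>x<capacity w. \<exists>y<capacity w. S w (c(k := x)) (c'(k := y)))"
proof (rule action_cong[OF action_local[OF action_seq[OF action_inc_star[of k] action_seq[OF assms action_dec_star[of k]]]]])
  fix w :: "'a list" and c c'
  assume c: "ok w k c" and c': "ok w k c'"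
  show "(\<exists>d. ok w (Suc k) d \<and> (\<exists>x\<ge>c k. d = c(k := x)) \<and>
        (\<exists>e. ok w (Suc k) e \<and> S w d e \<and> (\<exists>x\<le>e k. c' = e(k := x)))) \<longleftrightarrow>
      (\<exists>x<capacity w. \<exists>y<capacity w. S w (c(k := x)) (c'(k := y)))" (is "?L \<longleftrightarrow> ?R")
  proof
    assume ?L
    then obtain x e y where *: "ok w (Suc k) (c(k := x))" "ok w (Suc k) e" "S w (c(k := x)) e" "c' = e(k := y)" by blast
    then have "e = c'(k := e k)" by (simp add: fun_eq_iff)
    moreover have "x < capacity w" using ok_less[OF *(1), of k] by simp
    moreover have "e k < capacity w" using *(2) by (rule ok_less)
    ultimately show ?R using * by metis
  next
    assume ?R
    then obtain x y where *: "x < capacity w" "y < capacity w" "S w (c(k := x)) (c'(k := y))" by blast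
    have "ok w (Suc k) (c(k := x))" "ok w (Suc k) (c'(k := y))"
      using c c' * by (auto intro: ok_upd ok_Suc)
    moreover have "c k = 0" "c' = (c'(k := y))(k := 0)" using ok_zero[OF c, of k] ok_zero[OF c', of k] by auto
    ultimately show ?L using *(3)
      by (intro exI[of _ "c(k := x)"] exI[of _ "c'(k := y)"] conjI exI[of _ x] exI[of _ 0]) auto
  qed
qed auto

lemma test_conj: "test k R \<Longrightarrow> test k Q \<Longrightarrow> test k (\<lambda>w c. R w c \<and> Q w c)"
  unfolding test_def by (drule (1) action_seq, erule action_cong) auto

lemma test_disj: "test k R \<Longrightarrow> test k Q \<Longrightarrow> test k (\<lambda>w c. R w c \<or> Q w c)"
  unfolding test_def by (drule (1) action_alt, erule action_cong) auto

lemma test_True: "test k (\<lambda>w c. True)"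
  unfolding test_def by (rule actionI[of _ "Atom (Scan LeftEnd)"]) (auto simp: scan_def)

lemma test_False: "test k (\<lambda>w c. False)"
  unfolding test_def by (rule actionI[of _ "Atom (Scan RightEnd)"]) (auto simp: scan_def)

lemma test_const: "test k (\<lambda>w c. P)"
  by (cases P) (simp_all add: test_True test_False)

lemma test_finite_disj: "finite B \<Longrightarrow> (\<And>b. b \<in> B \<Longrightarrow> test k (R b)) \<Longrightarrow> test k (\<lambda>w c. \<exists>b\<in>B. R b w c)"
proof (induction B rule: finite_induct)
  case (insert b B)
  then have "test k (\<lambda>w c. R b w c \<or> (\<exists>b\<in>B. R b w c))" by (intro test_disj) auto
  then show ?case by simp
qed (simp add: test_False)

definition trunc :: "nat \<Rightarrow> env \<Rightarrow> env" where
  "trunc k c = (\<lambda>j. if j < k then c j else 0)"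

lemma trunc_less [simp]: "j < k \<Longrightarrow> trunc k c j = c j"
  by (simp add: trunc_def)

lemma trunc_trunc [simp]: "k \<le> l \<Longrightarrow> trunc k (trunc l c) = trunc k c"
  by (auto simp: trunc_def)

lemma trunc_upd [simp]: "k \<le> j \<Longrightarrow> trunc k (c(j := x)) = trunc k c"
  by (auto simp: trunc_def)

lemma trunc_ok: "ok w k c \<Longrightarrow> trunc k c = c"
  by (auto simp: trunc_def ok_def)

text \<open>A guess in the sense of \<open>action_block\<close>. Since the test changes nothing,
  guessing and clearing return to the original store.\<close>

lemma test_ex:
  assumes "test (Suc k) (\<lambda>w c. R w (trunc k c) (c k))"
  shows "test k (\<lambda>w c. \<exists>x<capacity w. R w c x)"
  unfolding test_def
proof (rule action_cong[OF action_block[OF assms[unfolded test_def]]])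
  fix w :: "'a list" and c c'
  assume c: "ok w k c" and c': "ok w k c'"
  have "c' = c" if "c'(k := y) = c(k := x)" for x y
  proof
    fix j
    show "c' j = c j"
      using fun_cong[OF that, of j] ok_zero[OF c, of k] ok_zero[OF c', of k] by (cases "j = k") auto
  qed
  then show "(\<exists>x<capacity w. \<exists>y<capacity w. c'(k := y) = c(k := x) \<and>
      R w (trunc k (c(k := x))) ((c(k := x)) k)) \<longleftrightarrow> c' = c \<and> (\<exists>x<capacity w. R w c x)"
    by (auto simp: trunc_ok[OF c])
qed

text \<open>Guessing is of no help here. A counter runs through all values and the test is repeated
  at each of them. The largest value cannot be left by an increment, so it is recognised by
  \<open>test_max\<close> and tested once more after the loop.\<close>

lemma test_all:
  assumes "test (Suc k) (\<lambda>w c. R w (trunc k c) (c k))"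
  shows "test k (\<lambda>w c. \<forall>x<capacity w. R w c x)"
proof -
  define stp where "stp = (\<lambda>w c c'. \<exists>d. ok w (Suc k) d \<and> (d = c \<and> R w (trunc k c) (c k)) \<and> c' = d(k := Suc (d k)))"
  have star: "star_on (ok w (Suc k)) (stp w) c c' \<longleftrightarrow>
      (\<exists>m<capacity w. (\<forall>x<m. R w c x) \<and> c' = c(k := m))"
    if c: "ok w k c" for w c c'
  proof -
    define T where "T = (\<lambda>c d. ok w (Suc k) c \<and> ok w (Suc k) d \<and> stp w c d)"
    have okm: "ok w (Suc k) (c(k := m)) \<longleftrightarrow> m < capacity w" for m
      using c by (auto simp: ok_def)
    have fwd: "T\<^sup>*\<^sup>* (c(k := 0)) (c(k := m))" if "m < capacity w" "\<forall>x<m. R w c x" for m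
      using that
    proof (induction m)
      case (Suc m)
      then have st: "T (c(k := m)) (c(k := Suc m))" using okm by (auto simp: T_def stp_def trunc_ok[OF c])
      have "T\<^sup>*\<^sup>* (c(k := 0)) (c(k := m))" by (rule Suc.IH) (use Suc.prems in auto)
      then show ?case using st by (rule rtranclp.rtrancl_into_rtrancl[of T])
    qed simp
    have bwd: "\<exists>m<capacity w. (\<forall>x<m. R w c x) \<and> d = c(k := m)" if "T\<^sup>*\<^sup>* (c(k := 0)) d" for d
      using that
    proof induction
      case base
      then show ?case by (intro exI[of _ 0]) auto
    next
      case (step d e)
      then obtain m where m: "m < capacity w" "\<forall>x<m. R w c x" "d = c(k := m)" by blast
      with step.hyps(2) have "R w c m" "e = c(k := Suc m)" by (auto simp: T_def stp_def trunc_ok[OF c])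
      moreover have "Suc m < capacity w" using step.hyps(2) okm calculation(2) by (auto simp: T_def stp_def)
      ultimately show ?case using m by (intro exI[of _ "Suc m"]) (auto simp: less_Suc_eq)
    qed
    have "c(k := 0) = c" using ok_zero[OF c, of k] by auto
    then show ?thesis unfolding star_on_def T_def[symmetric] using fwd bwd by metis
  qed
  have "action (Suc k) (\<lambda>w. star_on (ok w (Suc k)) (stp w))"
    using assms unfolding test_def stp_def by (intro action_star action_seq action_inc) auto
  note A = action_local[OF action_seq[OF this action_seq[OF test_conj[OF assms test_max[of _ k], unfolded test_def]
        action_dec_star[of k]]]]
  show ?thesis unfolding test_def
  proof (rule action_cong[OF A])
    fix w :: "'a list" and c c'
    assume c: "ok w k c" and c': "ok w k c'"
    have c0: "c k = 0" "c' k = 0" using ok_zero[OF c, of k] ok_zero[OF c', of k] by auto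
    have okm: "ok w (Suc k) (c(k := m)) \<longleftrightarrow> m < capacity w" for m
      using c by (auto simp: ok_def)
    have all: "(\<forall>x<capacity w - 1. R w c x) \<and> R w c (capacity w - 1) \<longleftrightarrow> (\<forall>x<capacity w. R w c x)"
    proof -
      have "x < capacity w \<longleftrightarrow> x < capacity w - 1 \<or> x = capacity w - 1" for x
        using width_less[of w] by linarith
      then show ?thesis by blast
    qed
    show "(\<exists>d. ok w (Suc k) d \<and> star_on (ok w (Suc k)) (stp w) c d \<and>
          (\<exists>e. ok w (Suc k) e \<and> (e = d \<and> R w (trunc k d) (d k) \<and> d k = capacity w - 1) \<and>
            (\<exists>x\<le>e k. c' = e(k := x)))) \<longleftrightarrow> c' = c \<and> (\<forall>x<capacity w. R w c x)" (is "?L \<longleftrightarrow> ?R")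
    proof
      assume ?L
      then obtain d x where d: "star_on (ok w (Suc k)) (stp w) c d" "R w (trunc k d) (d k)"
        "d k = capacity w - 1" "c' = d(k := x)" by blast
      from star[OF c] d(1) obtain m where m: "\<forall>x<m. R w c x" "d = c(k := m)" by blast
      have "R w c m" "m = capacity w - 1" "c' = c(k := x)" using d m by (auto simp: trunc_ok[OF c])
      moreover from this(3) c0 have "x = 0" by (metis fun_upd_same)
      with c0(1) have "c(k := x) = c" by (intro fun_upd_idem) simp
      ultimately show ?R using m(1) all by simp
    next
      assume R: ?R
      let ?d = "c(k := capacity w - 1)"
      have "ok w (Suc k) ?d" unfolding okm by simp
      moreover have "star_on (ok w (Suc k)) (stp w) c ?d"
        unfolding star[OF c] using R by (intro exI[of _ "capacity w - 1"]) auto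
      moreover have "R w (trunc k ?d) (?d k)" using R by (simp add: trunc_ok[OF c])
      moreover have "c' = ?d(k := 0)" using R c0 by (auto intro!: fun_upd_idem[symmetric])
      then have "\<exists>x\<le>?d k. c' = ?d(k := x)" by blast
      moreover have "?d k = capacity w - 1" by simp
      ultimately show ?L by blast
    qed
  qed auto
qed

section \<open>Comparing registers and reading the input at a stored position\<close>

lemma action_chain:
  assumes "action k S" "\<And>w c. ok w k c \<Longrightarrow> g w c 0 = c"
    and "\<And>w c m. ok w k c \<Longrightarrow> m \<le> M w c \<Longrightarrow> ok w k (g w c m)"
    and "\<And>w c m d. ok w k c \<Longrightarrow> m \<le> M w c \<Longrightarrow> ok w k d \<Longrightarrow>
      S w (g w c m) d \<longleftrightarrow> m < M w c \<and> d = g w c (Suc m)"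
  shows "action k (\<lambda>w c c'. \<exists>m\<le>M w c. c' = g w c m)"
proof (rule action_cong[OF action_star[OF assms(1)]])
  fix w :: "'a list" and c c'
  assume c: "ok w k c"
  have "star_on (ok w k) (S w) (g w c 0) c' \<longleftrightarrow> (\<exists>m\<le>M w c. c' = g w c m)"
    unfolding star_on_def
  proof (rule star_chain)
    fix m d assume m: "m \<le> M w c"
    have "m < M w c \<Longrightarrow> ok w k (g w c (Suc m))" by (rule assms(3)[OF c]) simp
    then show "ok w k (g w c m) \<and> ok w k d \<and> S w (g w c m) d \<longleftrightarrow> m < M w c \<and> d = g w c (Suc m)"
      using assms(3)[OF c m] assms(4)[OF c m, of d] by blast
  qed
  then show "star_on (ok w k) (S w) c c' \<longleftrightarrow> (\<exists>m\<le>M w c. c' = g w c m)" by (simp only: assms(2)[OF c])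
qed

lemma ok_upd_iff: "ok w k c \<Longrightarrow> j < k \<Longrightarrow> ok w k (c(j := a)) \<longleftrightarrow> a < capacity w"
  by (auto simp: ok_def)

lemma ok_upd2_iff: "ok w k c \<Longrightarrow> i < k \<Longrightarrow> j < k \<Longrightarrow> i \<noteq> j \<Longrightarrow>
    ok w k (c(i := a, j := b)) \<longleftrightarrow> a < capacity w \<and> b < capacity w"
  by (auto simp: ok_def)

lemma ok_upd3_iff: "ok w k c \<Longrightarrow> i < k \<Longrightarrow> j < k \<Longrightarrow> l < k \<Longrightarrow> i \<noteq> j \<Longrightarrow> i \<noteq> l \<Longrightarrow> j \<noteq> l \<Longrightarrow>
    ok w k (c(i := a, j := b, l := d)) \<longleftrightarrow> a < capacity w \<and> b < capacity w \<and> d < capacity w"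
  by (auto simp: ok_def)

lemma action_subtract:
  assumes "x < k" "y < k" "t < k" "x \<noteq> y" "x \<noteq> t" "y \<noteq> t"
  shows "action k (\<lambda>w c c'. \<exists>m \<le> min (min (c x) (c y)) (capacity w - 1 - c t).
    c' = c(x := c x - m, y := c y - m, t := c t + m))"
proof -
  have "action k (\<lambda>(w :: 'a list) c c'. 0 < c x \<and> 0 < c y \<and> c' = c(x := c x - 1, y := c y - 1, t := Suc (c t)))"
  proof (rule action_cong[OF action_seq[OF action_dec[OF assms(1)] action_seq[OF action_dec[OF assms(2)] action_inc[OF assms(3)]]]])
    fix w :: "'a list" and c c'
    assume c: "ok w k c"
    show "(\<exists>d. ok w k d \<and> (0 < c x \<and> d = c(x := c x - 1)) \<and>
        (\<exists>e. ok w k e \<and> (0 < d y \<and> e = d(y := d y - 1)) \<and> c' = e(t := Suc (e t)))) \<longleftrightarrow>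
      0 < c x \<and> 0 < c y \<and> c' = c(x := c x - 1, y := c y - 1, t := Suc (c t))"
      using assms ok_less[OF c, of x] ok_less[OF c, of y]
      by (simp add: ok_upd_iff[OF c] ok_upd2_iff[OF c] less_imp_diff_less)
  qed
  then show ?thesis
  proof (rule action_chain)
    fix w :: "'a list" and c m
    assume c: "ok w k c" and m: "m \<le> min (min (c x) (c y)) (capacity w - 1 - c t)"
    note lt = ok_less[OF c, of x] ok_less[OF c, of y] ok_less[OF c, of t]
    show okm: "ok w k (c(x := c x - m, y := c y - m, t := c t + m))"
      unfolding ok_upd3_iff[OF c assms] using lt m by linarith
    fix d assume d: "ok w k d"
    have eq: "(c(x := c x - m, y := c y - m, t := c t + m))
        (x := c x - m - 1, y := c y - m - 1, t := Suc (c t + m)) =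
        c(x := c x - Suc m, y := c y - Suc m, t := c t + Suc m)"
      using assms by (auto simp: fun_eq_iff)
    have "ok w k (c(x := c x - Suc m, y := c y - Suc m, t := c t + Suc m)) \<longleftrightarrow> m < capacity w - 1 - c t"
      unfolding ok_upd3_iff[OF c assms] using lt by linarith
    moreover have "(0 < (c(x := c x - m, y := c y - m, t := c t + m)) x \<and>
          0 < (c(x := c x - m, y := c y - m, t := c t + m)) y \<and>
          d = (c(x := c x - m, y := c y - m, t := c t + m))
            (x := (c(x := c x - m, y := c y - m, t := c t + m)) x - 1,
             y := (c(x := c x - m, y := c y - m, t := c t + m)) y - 1,
             t := Suc ((c(x := c x - m, y := c y - m, t := c t + m)) t))) \<longleftrightarrow>
        m < c x \<and> m < c y \<and> d = c(x := c x - Suc m, y := c y - Suc m, t := c t + Suc m)"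
      using assms by (simp add: eq)
    ultimately show "(0 < (c(x := c x - m, y := c y - m, t := c t + m)) x \<and>
          0 < (c(x := c x - m, y := c y - m, t := c t + m)) y \<and>
          d = (c(x := c x - m, y := c y - m, t := c t + m))
            (x := (c(x := c x - m, y := c y - m, t := c t + m)) x - 1,
             y := (c(x := c x - m, y := c y - m, t := c t + m)) y - 1,
             t := Suc ((c(x := c x - m, y := c y - m, t := c t + m)) t))) \<longleftrightarrow>
        m < min (min (c x) (c y)) (capacity w - 1 - c t) \<and>
        d = c(x := c x - Suc m, y := c y - Suc m, t := c t + Suc m)"
      unfolding min_less_iff_conj using d by (metis (no_types, lifting))
  qed simp
qed

lemma action_add:
  assumes "x < k" "y < k" "t < k" "x \<noteq> y" "x \<noteq> t" "y \<noteq> t"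
  shows "action k (\<lambda>w c c'. \<exists>m \<le> min (min (capacity w - 1 - c x) (capacity w - 1 - c y)) (c t).
    c' = c(x := c x + m, y := c y + m, t := c t - m))"
proof -
  have "action k (\<lambda>(w :: 'a list) c c'. 0 < c t \<and> c' = c(t := c t - 1, x := Suc (c x), y := Suc (c y)))"
  proof (rule action_cong[OF action_seq[OF action_dec[OF assms(3)] action_seq[OF action_inc[OF assms(1)] action_inc[OF assms(2)]]]])
    fix w :: "'a list" and c c'
    assume c: "ok w k c" and c': "ok w k c'"
    have "ok w k (c(t := c t - 1, x := Suc (c x)))" if "c' = c(t := c t - 1, x := Suc (c x), y := Suc (c y))"
      using assms ok_less[OF c, of t] ok_less[OF c', of x] that
      by (simp add: ok_upd2_iff[OF c])
    then show "(\<exists>d. ok w k d \<and> (0 < c t \<and> d = c(t := c t - 1)) \<and>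
        (\<exists>e. ok w k e \<and> e = d(x := Suc (d x)) \<and> c' = e(y := Suc (e y)))) \<longleftrightarrow>
      0 < c t \<and> c' = c(t := c t - 1, x := Suc (c x), y := Suc (c y))"
      using assms ok_less[OF c, of t]
      by (auto simp: ok_upd_iff[OF c])
  qed
  then show ?thesis
  proof (rule action_chain)
    fix w :: "'a list" and c m
    assume c: "ok w k c" and m: "m \<le> min (min (capacity w - 1 - c x) (capacity w - 1 - c y)) (c t)"
    note lt = ok_less[OF c, of x] ok_less[OF c, of y] ok_less[OF c, of t]
    show okm: "ok w k (c(x := c x + m, y := c y + m, t := c t - m))"
      unfolding ok_upd3_iff[OF c assms] using lt m by linarith
    fix d assume d: "ok w k d"
    have eq: "c(t := c t - Suc m, x := Suc (c x + m), y := Suc (c y + m)) =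
        c(x := Suc (c x + m), y := Suc (c y + m), t := c t - Suc m)"
      using assms by (auto simp: fun_eq_iff)
    have "ok w k (c(x := c x + Suc m, y := c y + Suc m, t := c t - Suc m)) \<longleftrightarrow>
        m < capacity w - 1 - c x \<and> m < capacity w - 1 - c y"
      unfolding ok_upd3_iff[OF c assms] using lt by linarith
    moreover have "(0 < (c(x := c x + m, y := c y + m, t := c t - m)) t \<and>
          d = (c(x := c x + m, y := c y + m, t := c t - m))
            (t := (c(x := c x + m, y := c y + m, t := c t - m)) t - 1,
             x := Suc ((c(x := c x + m, y := c y + m, t := c t - m)) x),
             y := Suc ((c(x := c x + m, y := c y + m, t := c t - m)) y))) \<longleftrightarrow>
        m < c t \<and> d = c(x := c x + Suc m, y := c y + Suc m, t := c t - Suc m)"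
      using assms by (simp add: eq)
    ultimately show "(0 < (c(x := c x + m, y := c y + m, t := c t - m)) t \<and>
          d = (c(x := c x + m, y := c y + m, t := c t - m))
            (t := (c(x := c x + m, y := c y + m, t := c t - m)) t - 1,
             x := Suc ((c(x := c x + m, y := c y + m, t := c t - m)) x),
             y := Suc ((c(x := c x + m, y := c y + m, t := c t - m)) y))) \<longleftrightarrow>
        m < min (min (capacity w - 1 - c x) (capacity w - 1 - c y)) (c t) \<and>
        d = c(x := c x + Suc m, y := c y + Suc m, t := c t - Suc m)"
      unfolding min_less_iff_conj using d by (metis (no_types, lifting))
  qed simp
qed

text \<open>Registers are compared without being copied: a guessed amount is taken off both and
  remembered in the scratch register, the test is applied to what is left, and the amount is given
  back. With suitable zero tests this decides equality, order and successor.\<close>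

lemma test_difference:
  assumes "x < k" "y < k" "x \<noteq> y" and R: "test (Suc k) R"
  shows "test k (\<lambda>w c. \<exists>m \<le> min (c x) (c y). R w (c(x := c x - m, y := c y - m, k := m)))"
proof -
  have xy: "x < Suc k" "y < Suc k" "k < Suc k" "x \<noteq> y" "x \<noteq> k" "y \<noteq> k" using assms by auto
  show ?thesis
    unfolding test_def
  proof (rule action_cong[OF action_local[OF action_seq[OF action_subtract[OF xy]
          action_seq[OF R[unfolded test_def] action_add[OF xy]]]]])
    fix w :: "'a list" and c c'
    assume c: "ok w k c" and c': "ok w k c'"
    have ck: "c k = 0" "c' k = 0" using ok_zero[OF c, of k] ok_zero[OF c', of k] by auto
    note lt = ok_less[OF c, of x] ok_less[OF c, of y] ok_less[OF c, of k]
    let ?g = "\<lambda>m. c(x := c x - m, y := c y - m, k := m)"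
    have okg: "ok w (Suc k) (?g m)" if "m \<le> min (c x) (c y)" for m
      unfolding ok_upd3_iff[OF ok_Suc[OF c] xy] using lt that by linarith
    have restore: "(?g m)(x := (?g m) x + m, y := (?g m) y + m, k := (?g m) k - m) = c" if "m \<le> min (c x) (c y)" for m
      using that xy ck by (auto simp: fun_eq_iff)
    show "(\<exists>d. ok w (Suc k) d \<and>
          (\<exists>m \<le> min (min (c x) (c y)) (capacity w - 1 - c k). d = c(x := c x - m, y := c y - m, k := c k + m)) \<and>
          (\<exists>e. ok w (Suc k) e \<and> (e = d \<and> R w d) \<and>
            (\<exists>m \<le> min (min (capacity w - 1 - e x) (capacity w - 1 - e y)) (e k).
              c' = e(x := e x + m, y := e y + m, k := e k - m)))) \<longleftrightarrow>
        c' = c \<and> (\<exists>m \<le> min (c x) (c y). R w (?g m))" (is "?L \<longleftrightarrow> ?R")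
    proof
      assume ?L
      then obtain m n where m: "m \<le> min (c x) (c y)" "R w (?g m)" and
        n: "n \<le> (?g m) k" "c' = (?g m)(x := (?g m) x + n, y := (?g m) y + n, k := (?g m) k - n)"
        unfolding ck by auto
      \<comment> \<open>Giving back less than was taken would leave the scratch register nonzero,
        which \<open>ok\<close> forbids at the end.\<close>
      from n ck(2) have "n = m" by (simp split: if_splits)
      with n restore[OF m(1)] m show ?R by blast
    next
      assume ?R
      then obtain m where m: "m \<le> min (c x) (c y)" "R w (?g m)" and "c' = c" by blast
      moreover have "m \<le> capacity w - 1 - c k" using m(1) lt ck by auto
      moreover have "m \<le> min (min (capacity w - 1 - (?g m) x) (capacity w - 1 - (?g m) y)) ((?g m) k)"
        using m(1) lt xy by simp linarith
      ultimately show ?L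
        by (intro exI[of _ "?g m"] conjI okg exI[of _ m] refl) (simp_all only: restore ck, simp_all)
    qed
  qed
qed

lemma test_nonzero: "j < k \<Longrightarrow> test k (\<lambda>w c. c j \<noteq> 0)"
  unfolding test_def
proof (rule action_cong[OF action_seq[OF action_dec action_inc]])
  fix w :: "'a list" and c c'
  assume "j < k" and c: "ok w k c"
  then have "ok w k (c(j := c j - 1))" using ok_less[OF c, of j] by (simp add: ok_upd_iff less_imp_diff_less)
  then show "(\<exists>d. ok w k d \<and> (0 < c j \<and> d = c(j := c j - 1)) \<and> c' = d(j := Suc (d j))) \<longleftrightarrow>
      c' = c \<and> c j \<noteq> 0"
    by auto
qed

lemma test_one: "j < k \<Longrightarrow> test k (\<lambda>w c. c j = 1)"
  unfolding test_def
proof (rule action_cong[OF action_seq[OF action_dec action_seq[OF test_zero[unfolded test_def] action_inc]]])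
  fix w :: "'a list" and c c'
  assume "j < k" and c: "ok w k c"
  then have "ok w k (c(j := c j - 1))" using ok_less[OF c, of j] by (simp add: ok_upd_iff less_imp_diff_less)
  moreover have "c(j := Suc 0) = c" if "c j = 1" using that by (simp add: fun_upd_idem)
  moreover have "c j = 1 \<longleftrightarrow> 0 < c j \<and> c j - 1 = 0" by auto
  ultimately show "(\<exists>d. ok w k d \<and> (0 < c j \<and> d = c(j := c j - 1)) \<and>
      (\<exists>e. ok w k e \<and> (e = d \<and> d j = 0) \<and> c' = e(j := Suc (e j)))) \<longleftrightarrow> c' = c \<and> c j = 1"
    by auto
qed

lemma test_eq: "x < k \<Longrightarrow> y < k \<Longrightarrow> test k (\<lambda>w c. c x = c y)"
proof (cases "x = y")
  case True
  then show ?thesis by (simp add: test_True)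
next
  case False
  assume "x < k" "y < k"
  with False test_difference[OF _ _ False test_conj[OF test_zero[of _ x] test_zero[of _ y]], of k]
  have "test k (\<lambda>(w :: 'a list) c. \<exists>m \<le> min (c x) (c y). (c(x := c x - m, y := c y - m, k := m)) x = 0 \<and>
      (c(x := c x - m, y := c y - m, k := m)) y = 0)" by blast
  then show ?thesis
    by (rule test_cong) (use False \<open>x < k\<close> \<open>y < k\<close> in auto)
qed

lemma test_less: "x < k \<Longrightarrow> y < k \<Longrightarrow> test k (\<lambda>w c. c x < c y)"
proof (cases "x = y")
  case True
  then show ?thesis by (simp add: test_False)
next
  case False
  assume xy: "x < k" "y < k"
  with test_difference[OF _ _ False test_conj[OF test_zero[of _ x] test_nonzero[of y]], of k]
  have "test k (\<lambda>(w :: 'a list) c. \<exists>m \<le> min (c x) (c y). (c(x := c x - m, y := c y - m, k := m)) x = 0 \<and>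
      (c(x := c x - m, y := c y - m, k := m)) y \<noteq> 0)" by simp
  then show ?thesis
  proof (rule test_cong)
    fix w :: "'a list" and c :: env
    show "(\<exists>m \<le> min (c x) (c y). (c(x := c x - m, y := c y - m, k := m)) x = 0 \<and>
      (c(x := c x - m, y := c y - m, k := m)) y \<noteq> 0) \<longleftrightarrow> c x < c y"
    proof
      assume "c x < c y"
      then show "\<exists>m \<le> min (c x) (c y). (c(x := c x - m, y := c y - m, k := m)) x = 0 \<and>
          (c(x := c x - m, y := c y - m, k := m)) y \<noteq> 0"
        using False xy by (intro exI[of _ "c x"]) auto
    qed (use False xy in auto)
  qed
qed

lemma test_succ: "x < k \<Longrightarrow> y < k \<Longrightarrow> test k (\<lambda>w c. c y = Suc (c x))"
proof (cases "x = y")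
  case True
  then show ?thesis by (simp add: test_False)
next
  case False
  assume xy: "x < k" "y < k"
  with test_difference[OF _ _ False test_conj[OF test_zero[of _ x] test_one[of y]], of k]
  have "test k (\<lambda>(w :: 'a list) c. \<exists>m \<le> min (c x) (c y). (c(x := c x - m, y := c y - m, k := m)) x = 0 \<and>
      (c(x := c x - m, y := c y - m, k := m)) y = 1)" by simp
  then show ?thesis
  proof (rule test_cong)
    fix w :: "'a list" and c
    show "(\<exists>m \<le> min (c x) (c y). (c(x := c x - m, y := c y - m, k := m)) x = 0 \<and>
      (c(x := c x - m, y := c y - m, k := m)) y = 1) \<longleftrightarrow> c y = Suc (c x)"
    proof
      assume "c y = Suc (c x)"
      then show "\<exists>m \<le> min (c x) (c y). (c(x := c x - m, y := c y - m, k := m)) x = 0 \<and>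
          (c(x := c x - m, y := c y - m, k := m)) y = 1"
        using False xy by (intro exI[of _ "c x"]) auto
    qed (use False xy in auto)
  qed
qed

lemma action_transfer:
  assumes "x < k" "y < k" "x \<noteq> y"
  shows "action k (\<lambda>w c c'. c' = c(x := c y, y := 0))"
proof -
  have "action k (\<lambda>(w :: 'a list) c c'. 0 < c y \<and> c' = c(y := c y - 1, x := Suc (c x)))"
  proof (rule action_cong[OF action_seq[OF action_dec[OF assms(2)] action_inc[OF assms(1)]]])
    fix w :: "'a list" and c c'
    assume c: "ok w k c"
    show "(\<exists>d. ok w k d \<and> (0 < c y \<and> d = c(y := c y - 1)) \<and> c' = d(x := Suc (d x))) \<longleftrightarrow>
      0 < c y \<and> c' = c(y := c y - 1, x := Suc (c x))"
      using assms ok_less[OF c, of y] by (auto simp: ok_upd_iff[OF c])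
  qed
  then have "action k (\<lambda>(w :: 'a list) c c'. \<exists>m \<le> min (capacity w - 1 - c x) (c y). c' = c(x := c x + m, y := c y - m))"
  proof (rule action_chain)
    fix w :: "'a list" and c m
    assume c: "ok w k c" and m: "m \<le> min (capacity w - 1 - c x) (c y)"
    note lt = ok_less[OF c, of x] ok_less[OF c, of y]
    show okm: "ok w k (c(x := c x + m, y := c y - m))"
      unfolding ok_upd2_iff[OF c assms] using lt m by linarith
    fix d assume d: "ok w k d"
    have eq: "c(y := c y - Suc m, x := Suc (c x + m)) = c(x := Suc (c x + m), y := c y - Suc m)"
      using assms by (auto simp: fun_eq_iff)
    have "ok w k (c(x := c x + Suc m, y := c y - Suc m)) \<longleftrightarrow> m < capacity w - 1 - c x"
      unfolding ok_upd2_iff[OF c assms] using lt by linarith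
    moreover have "(0 < (c(x := c x + m, y := c y - m)) y \<and>
          d = (c(x := c x + m, y := c y - m))
            (y := (c(x := c x + m, y := c y - m)) y - 1,
             x := Suc ((c(x := c x + m, y := c y - m)) x))) \<longleftrightarrow>
        m < c y \<and> d = c(x := c x + Suc m, y := c y - Suc m)"
      using assms by (simp add: eq)
    ultimately show "(0 < (c(x := c x + m, y := c y - m)) y \<and>
          d = (c(x := c x + m, y := c y - m))
            (y := (c(x := c x + m, y := c y - m)) y - 1,
             x := Suc ((c(x := c x + m, y := c y - m)) x))) \<longleftrightarrow>
        m < min (capacity w - 1 - c x) (c y) \<and>
        d = c(x := c x + Suc m, y := c y - Suc m)"
      unfolding min_less_iff_conj using d by (metis (no_types, lifting))
  qed simp
  note A = action_seq[OF action_dec_star[OF assms(1)] action_seq[OF test_zero[of k x, unfolded test_def]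
      action_seq[OF this test_zero[of k y, unfolded test_def]]]]
  show ?thesis
  proof (rule action_cong[OF A])
    fix w :: "'a list" and c c'
    assume c: "ok w k c" and c': "ok w k c'"
    note lt = ok_less[OF c, of x] ok_less[OF c, of y]
    show "(\<exists>d. ok w k d \<and> (\<exists>xa\<le>c x. d = c(x := xa)) \<and>
        (\<exists>da. ok w k da \<and> (da = d \<and> d x = 0) \<and>
          (\<exists>d. ok w k d \<and> (\<exists>m\<le>min (capacity w - 1 - da x) (da y). d = da(x := da x + m, y := da y - m)) \<and>
            c' = d \<and> d y = 0))) \<longleftrightarrow> c' = c(x := c y, y := 0)" (is "?L \<longleftrightarrow> ?R")
    proof
      assume ?L
      then obtain z m where "c' = (c(x := z))(x := z + m, y := c y - m)" "z = 0" "m \<le> c y" "c y - m = 0"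
        using assms by auto
      then show ?R by simp
    next
      assume ?R
      define e where "e = c(x := 0)"
      have "c' = e(x := e x + c y, y := e y - c y)" using \<open>?R\<close> assms by (simp add: e_def)
      moreover have "c y \<le> min (capacity w - 1 - e x) (e y)" using lt assms by (auto simp: e_def)
      moreover have "ok w k e" unfolding e_def using assms by (simp add: ok_upd_iff[OF c])
      moreover have "\<exists>z\<le>c x. e = c(x := z)" "e x = 0" by (auto simp: e_def)
      moreover have "c' y = 0" using \<open>?R\<close> by simp
      ultimately show ?L using c' by blast
    qed
  qed
qed

text \<open>The head walks to the right while the count is transferred from \<open>x\<close> to the
  scratch register, and the way back restores both. A value beyond the input makes the head wait at
  the right end and later at the left end; this is harmless because \<open>scan\<close> gives
  \<open>RightEnd\<close> for all such values.\<close>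

lemma test_scan:
  assumes "x < k"
  shows "test k (\<lambda>w c. scan w (c x) = a)"
  unfolding test_def
proof (rule actionI)
  let ?there = "Seq (Atom (Dec x)) (Seq (Atom (Inc k)) (Atom (Move MoveRight)))"
  let ?back = "Seq (Atom (Dec k)) (Seq (Atom (Inc x)) (Atom (Move MoveLeft)))"
  let ?p = "Seq (Star ?there) (Seq (Atom (AllBits False x)) (Seq (Atom (Scan a))
    (Seq (Star ?back) (Atom (AllBits False k)))))"
  fix w :: "'a list" and c s
  assume c: "ok w k c"
  let ?n = "length w + 1"
  note lt = ok_less[OF c, of x]
  have ck: "c k = 0" using ok_zero[OF c, of k] by simp
  have xk: "x \<noteq> k" using assms by simp
  have there: "(run w ?there)\<^sup>*\<^sup>* (0, c) t \<longleftrightarrow> (\<exists>m\<le>c x. t = (min m ?n, c(x := c x - m, k := m)))" for t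
  proof -
    let ?g = "\<lambda>m. (min m ?n, c(x := c x - m, k := m))"
    have "(run w ?there)\<^sup>*\<^sup>* (?g 0) t \<longleftrightarrow> (\<exists>m\<le>c x. t = ?g m)"
    proof (rule star_chain)
      fix m t assume "m \<le> c x"
      have 1: "(c(x := c x - m, k := m))(x := c x - m - 1, k := m + 1) = c(x := c x - Suc m, k := Suc m)"
        using xk by (auto simp: fun_eq_iff)
      have 2: "min (min m ?n + 1) ?n = min (Suc m) ?n" by simp
      have "run w ?there (?g m) t \<longleftrightarrow> 0 < c x - m \<and> m + 1 < capacity w \<and>
          t = (min (min m ?n + 1) ?n, (c(x := c x - m, k := m))(x := c x - m - 1, k := m + 1))"
        using xk by (auto simp: relcompp.simps)
      then show "run w ?there (?g m) t \<longleftrightarrow> m < c x \<and> t = ?g (Suc m)"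
        unfolding 1 2 using lt by (cases "t = ?g (Suc m)") (simp_all only: simp_thms, linarith)
    qed
    moreover have "?g 0 = (0, c)" using ck by (simp add: fun_upd_idem)
    ultimately show ?thesis by simp
  qed
  have restore: "(run w ?back)\<^sup>*\<^sup>* (min (c x) ?n, c(x := 0, k := c x)) t \<longleftrightarrow>
      (\<exists>m\<le>c x. t = (min (c x) ?n - m, c(x := m, k := c x - m)))" for t
  proof -
    let ?g = "\<lambda>m. (min (c x) ?n - m, c(x := m, k := c x - m))"
    have "(run w ?back)\<^sup>*\<^sup>* (?g 0) t \<longleftrightarrow> (\<exists>m\<le>c x. t = ?g m)"
    proof (rule star_chain)
      fix m t assume "m \<le> c x"
      have 1: "(c(x := m, k := c x - m))(k := c x - m - 1, x := m + 1) = c(x := Suc m, k := c x - Suc m)"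
        using xk by (auto simp: fun_eq_iff)
      have 2: "min (min (c x) ?n - m - 1) ?n = min (c x) ?n - Suc m" by simp
      have "run w ?back (?g m) t \<longleftrightarrow> 0 < c x - m \<and> m + 1 < capacity w \<and>
          t = (min (min (c x) ?n - m - 1) ?n, (c(x := m, k := c x - m))(k := c x - m - 1, x := m + 1))"
        using xk by (auto simp: relcompp.simps)
      then show "run w ?back (?g m) t \<longleftrightarrow> m < c x \<and> t = ?g (Suc m)"
        unfolding 1 2 using lt by (cases "t = ?g (Suc m)") (simp_all only: simp_thms, linarith)
    qed
    then show ?thesis by simp
  qed
  have zero: "(\<forall>n<width w. bit v n = False) \<longleftrightarrow> v = 0" if "v < capacity w" for v
    using all_bits_False[OF that] by simp
  have sc: "scan w (min (c x) ?n) = scan w (c x)" by (auto simp: scan_def)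
  have fin: "c(x := c x, k := 0) = c" using ck by (simp add: fun_upd_idem)
  have bits: "(\<exists>v. exec w (AllBits b j) u v \<and> Q v) \<longleftrightarrow> (\<forall>n<width w. bit (snd u j) n = b) \<and> Q u"
    and scans: "(\<exists>v. exec w (Scan a) u v \<and> Q v) \<longleftrightarrow> scan w (fst u) = a \<and> Q u" for b j u Q
    by (cases u; auto)+
  have "run w ?p (0, c) s \<longleftrightarrow> (\<exists>u. (run w ?there)\<^sup>*\<^sup>* (0, c) u \<and>
      (\<exists>v. exec w (AllBits False x) u v \<and> (\<exists>v'. exec w (Scan a) v v' \<and>
        (\<exists>u'. (run w ?back)\<^sup>*\<^sup>* v' u' \<and> exec w (AllBits False k) u' s))))"
    unfolding run.simps(1,4) run.simps(2)[of w "Star ?there"] run.simps(2)[of w "Atom (AllBits False x)"]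
      run.simps(2)[of w "Atom (Scan a)"] run.simps(2)[of w "Star ?back"] by blast
  also have "\<dots> \<longleftrightarrow> (\<exists>m\<le>c x. (\<forall>n<width w. bit (snd (min m ?n, c(x := c x - m, k := m)) x) n = False) \<and>
      scan w (fst (min m ?n, c(x := c x - m, k := m))) = a \<and>
      (\<exists>u'. (run w ?back)\<^sup>*\<^sup>* (min m ?n, c(x := c x - m, k := m)) u' \<and> exec w (AllBits False k) u' s))"
    unfolding bits scans there by blast
  also have "\<dots> \<longleftrightarrow> (\<exists>m\<le>c x. c x - m = 0 \<and> scan w (min m ?n) = a \<and>
      (\<exists>u. (run w ?back)\<^sup>*\<^sup>* (min m ?n, c(x := c x - m, k := m)) u \<and> exec w (AllBits False k) u s))"
  proof -
    have "(\<forall>n<width w. bit (snd (min m ?n, c(x := c x - m, k := m)) x) n = False) \<longleftrightarrow> c x - m = 0" for m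
      using zero[of "c x - m"] lt xk by simp
    then show ?thesis by (simp only: fst_conv)
  qed
  also have "\<dots> \<longleftrightarrow> scan w (c x) = a \<and>
      (\<exists>u. (run w ?back)\<^sup>*\<^sup>* (min (c x) ?n, c(x := 0, k := c x)) u \<and> exec w (AllBits False k) u s)"
  proof -
    have "m \<le> c x \<and> c x - m = 0 \<longleftrightarrow> m = c x" for m by auto
    then show ?thesis unfolding sc[symmetric] by (metis (no_types, lifting) diff_self_eq_0)
  qed
  also have "\<dots> \<longleftrightarrow> scan w (c x) = a \<and> s = (0, c)"
  proof -
    have ex: "exec w (AllBits False k) u s \<longleftrightarrow> (\<forall>n<width w. bit (snd u k) n = False) \<and> s = u" for u
      by (cases u) auto
    have z: "(\<forall>n<width w. bit (snd (min (c x) ?n - m, c(x := m, k := c x - m)) k) n = False) \<longleftrightarrow> c x - m = 0" for m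
      using zero[of "c x - m"] lt by simp
    have "(\<exists>u. (run w ?back)\<^sup>*\<^sup>* (min (c x) ?n, c(x := 0, k := c x)) u \<and> exec w (AllBits False k) u s)
      \<longleftrightarrow> (\<exists>m\<le>c x. (\<forall>n<width w. bit (snd (min (c x) ?n - m, c(x := m, k := c x - m)) k) n = False) \<and>
        s = (min (c x) ?n - m, c(x := m, k := c x - m)))"
      unfolding restore ex by blast
    also have "\<dots> \<longleftrightarrow> (\<exists>m\<le>c x. c x - m = 0 \<and> s = (min (c x) ?n - m, c(x := m, k := c x - m)))"
      unfolding z ..
    also have "\<dots> \<longleftrightarrow> s = (min (c x) ?n - c x, c(x := c x, k := 0))"
    proof -
      have "m \<le> c x \<and> c x - m = 0 \<longleftrightarrow> m = c x" for m by auto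
      then show ?thesis by (metis (no_types, lifting) diff_self_eq_0)
    qed
    also have "\<dots> \<longleftrightarrow> s = (0, c)" unfolding fin by simp
    finally show ?thesis by (rule arg_cong)
  qed
  finally show "run w ?p (0, c) s \<longleftrightarrow> (\<exists>c'. s = (0, c') \<and> ok w k c' \<and> c' = c \<and> scan w (c x) = a)"
    using c by auto
qed

section \<open>Reachability between nodes stored in registers\<close>

definition put :: "nat \<Rightarrow> env \<Rightarrow> nat \<times> nat \<times> nat \<times> nat \<Rightarrow> env" where
  "put k c = (\<lambda>(x0, x1, x2, x3). c(k := x0, k + 1 := x1, k + 2 := x2, k + 3 := x3))"

definition node :: "nat \<Rightarrow> env \<Rightarrow> nat \<times> nat \<times> nat \<times> nat" where
  "node k c = (c k, c (k + 1), c (k + 2), c (k + 3))"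

definition box :: "'s list \<Rightarrow> (nat \<times> nat \<times> nat \<times> nat) set" where
  "box w = {..<capacity w} \<times> {..<capacity w} \<times> {..<capacity w} \<times> {..<capacity w}"

lemma bex_box: "(\<exists>x\<in>box w. P x) \<longleftrightarrow> (\<exists>a<capacity w. \<exists>b<capacity w. \<exists>c<capacity w. \<exists>d<capacity w. P (a, b, c, d))"
  by (simp add: box_def Bex_def)

lemma node_put [simp]: "node k (put k c x) = x"
  by (cases x) (simp add: node_def put_def)

lemma node_put_above [simp]: "node k (put (k + 4) c x) = node k c"
  by (cases x) (simp add: node_def put_def)

definition entry :: "nat \<times> nat \<times> nat \<times> nat \<Rightarrow> nat \<Rightarrow> nat" where
  "entry x = put 0 (\<lambda>_. 0) x"

lemma put_apply: "put k c x j = (if k \<le> j \<and> j < k + 4 then entry x (j - k) else c j)"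
proof -
  have "j < k \<or> k + 4 \<le> j \<or> j = k \<or> j = k + 1 \<or> j = k + 2 \<or> j = k + 3" by linarith
  then show ?thesis by (cases x) (auto simp: put_def entry_def)
qed

lemma trunc_put [simp]: "k \<le> l \<Longrightarrow> trunc k (put l c x) = trunc k c"
  by (auto simp: trunc_def put_apply fun_eq_iff)

lemma ok_put_iff:
  assumes "\<forall>j. c j < capacity w" "\<forall>j\<ge>k + 4. c j = 0"
  shows "ok w (k + 4) (put k c x) \<longleftrightarrow> x \<in> box w"
proof
  assume "ok w (k + 4) (put k c x)"
  then have "put k c x j < capacity w" for j by (simp add: ok_def)
  from this[of k] this[of "k + 1"] this[of "k + 2"] this[of "k + 3"] show "x \<in> box w"
    by (cases x) (simp add: put_def box_def)
next
  assume "x \<in> box w"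
  then show "ok w (k + 4) (put k c x)" using assms
    by (cases x) (simp add: ok_def put_def box_def)
qed

lemma put_eq_iff:
  assumes "ok w k c" "ok w k c'"
  shows "put k c' y = put k c x \<longleftrightarrow> c' = c \<and> y = x"
proof
  assume eq: "put k c' y = put k c x"
  have "c' j = c j" for j
    using fun_cong[OF eq, of j] ok_zero[OF assms(1), of j] ok_zero[OF assms(2), of j]
    by (cases "j < k") (simp_all add: put_apply)
  moreover have "y = x" using arg_cong[OF eq, of "node k"] by simp
  ultimately show "c' = c \<and> y = x" by blast
qed simp

lemma action_block4:
  assumes "action (k + 4) S"
  shows "action k (\<lambda>w c c'. \<exists>x\<in>box w. \<exists>y\<in>box w. S w (put k c x) (put k c' y))"
proof -
  have e: "Suc (k + 3) = k + 4" "Suc (k + 2) = k + 3" "Suc (k + 1) = k + 2" "Suc k = k + 1" by simp_all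
  have 3: "action (k + 3) (\<lambda>w c c'. \<exists>x<capacity w. \<exists>y<capacity w. S w (c(k + 3 := x)) (c'(k + 3 := y)))"
    by (rule action_block) (use assms in \<open>simp only: e\<close>)
  have 2: "action (k + 2) (\<lambda>w c c'. \<exists>x<capacity w. \<exists>y<capacity w.
      \<exists>x'<capacity w. \<exists>y'<capacity w. S w (c(k + 2 := x, k + 3 := x')) (c'(k + 2 := y, k + 3 := y')))"
    by (rule action_block) (use 3 in \<open>simp only: e\<close>)
  have 1: "action (k + 1) (\<lambda>w c c'. \<exists>x<capacity w. \<exists>y<capacity w.
      \<exists>x'<capacity w. \<exists>y'<capacity w. \<exists>x''<capacity w. \<exists>y''<capacity w.
      S w (c(k + 1 := x, k + 2 := x', k + 3 := x'')) (c'(k + 1 := y, k + 2 := y', k + 3 := y'')))"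
    by (rule action_block) (use 2 in \<open>simp only: e\<close>)
  have 0: "action k (\<lambda>w c c'. \<exists>x<capacity w. \<exists>y<capacity w.
      \<exists>x'<capacity w. \<exists>y'<capacity w. \<exists>x''<capacity w. \<exists>y''<capacity w. \<exists>x'''<capacity w. \<exists>y'''<capacity w.
      S w (c(k := x, k + 1 := x', k + 2 := x'', k + 3 := x''')) (c'(k := y, k + 1 := y', k + 2 := y'', k + 3 := y''')))"
    by (rule action_block) (use 1 in \<open>simp only: e\<close>)
  show ?thesis
    by (rule action_cong[OF 0], unfold bex_box put_def prod.case, rule iffI)
      (elim exE conjE, intro exI conjI[rotated], assumption+)+
qed

lemma action_compose:
  assumes "action k (\<lambda>w c c'. c' = f w c)" "\<And>w c. ok w k c \<Longrightarrow> ok w k (f w c)" "action k T"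
  shows "action k (\<lambda>w c c'. T w (f w c) c')"
  by (rule action_cong[OF action_seq[OF assms(1,3)]]) (use assms(2) in auto)

lemma action_move4: "action (k + 8) (\<lambda>w c c'. c' = put (k + 4) (put k c (node (k + 4) c)) (0, 0, 0, 0))"
proof -
  have t: "action (k + 8) (\<lambda>(w :: 'a list) c c'. c' = c(x := c y, y := 0))"
    if "x < k + 8" "y < k + 8" "x \<noteq> y" for x y
    using that by (rule action_transfer)
  have o: "ok w (k + 8) (c(x := c y, y := 0))"
    if "ok w (k + 8) c" "x < k + 8" "y < k + 8" "x \<noteq> y" for w :: "'a list" and c x y
    using that ok_less[OF that(1)] by (simp add: ok_upd2_iff)
  have 3: "action (k + 8) (\<lambda>(w :: 'a list) c c'. c' = c(k + 2 := c (k + 6), k + 6 := 0, k + 3 := c (k + 7), k + 7 := 0))"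
    using action_compose[OF t[of "k + 2" "k + 6"] o t[of "k + 3" "k + 7"]] by simp
  have 2: "action (k + 8) (\<lambda>(w :: 'a list) c c'. c' = c(k + 1 := c (k + 5), k + 5 := 0,
      k + 2 := c (k + 6), k + 6 := 0, k + 3 := c (k + 7), k + 7 := 0))"
    using action_compose[OF t[of "k + 1" "k + 5"] o 3] by simp
  have 1: "action (k + 8) (\<lambda>(w :: 'a list) c c'. c' = c(k := c (k + 4), k + 4 := 0, k + 1 := c (k + 5), k + 5 := 0,
      k + 2 := c (k + 6), k + 6 := 0, k + 3 := c (k + 7), k + 7 := 0))"
    using action_compose[OF t[of "k" "k + 4"] o 2] by simp
  have "c(k := c (k + 4), k + 4 := 0, k + 1 := c (k + 5), k + 5 := 0,
      k + 2 := c (k + 6), k + 6 := 0, k + 3 := c (k + 7), k + 7 := 0) =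
    put (k + 4) (put k c (node (k + 4) c)) (0, 0, 0, 0)" for c
    by (rule ext) (simp add: put_def node_def add.commute)
  with 1 show ?thesis by simp
qed

text \<open>From an encoded point every step leads to an encoded point again, so walks for
  \<open>B\<close> are the images of walks for \<open>R\<close> inside \<open>A\<close>. This
  identifies a loop on register contents with a walk on nodes, and later a walk on quadruples with
  one on pairs of numbers.\<close>

lemma star_on_map:
  assumes step: "\<And>x d. x \<in> A \<Longrightarrow> B (f x) d \<longleftrightarrow> (\<exists>y\<in>A. R x y \<and> d = f y)" and "x \<in> A"
  shows "B\<^sup>*\<^sup>* (f x) d \<longleftrightarrow> (\<exists>y\<in>A. d = f y \<and> star_on (\<lambda>x. x \<in> A) R x y)"
proof
  assume "B\<^sup>*\<^sup>* (f x) d"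
  then show "\<exists>y\<in>A. d = f y \<and> star_on (\<lambda>x. x \<in> A) R x y"
  proof induction
    case base
    then show ?case using assms(2) by (auto simp: star_on_def)
  next
    case (step d e)
    then obtain y where y: "y \<in> A" "d = f y" "star_on (\<lambda>x. x \<in> A) R x y" by blast
    with step.hyps(2) assms(1) obtain z where z: "z \<in> A" "R y z" "e = f z" by blast
    have "star_on (\<lambda>x. x \<in> A) R x z"
      using y(3) unfolding star_on_def by (rule rtranclp.rtrancl_into_rtrancl) (use y z in simp)
    with z show ?case by blast
  qed
next
  assume "\<exists>y\<in>A. d = f y \<and> star_on (\<lambda>x. x \<in> A) R x y"
  then obtain y where d: "d = f y" and "(\<lambda>x y. x \<in> A \<and> y \<in> A \<and> R x y)\<^sup>*\<^sup>* x y"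
    by (auto simp: star_on_def)
  from this(2) have "B\<^sup>*\<^sup>* (f x) (f y)"
  proof induction
    case (step y z)
    then have "B (f y) (f z)" using assms(1) by blast
    with step.IH show ?case by (rule rtranclp.rtrancl_into_rtrancl[of B])
  qed simp
  with d show "B\<^sup>*\<^sup>* (f x) d" by simp
qed

text \<open>Only two nodes are stored at any time: the current one, and a guessed successor that
  replaces it once the edge has been tested. Guessing when to stop the loop yields the transitive
  closure.\<close>

lemma test_tc4:
  assumes I: "test (k + 4) (\<lambda>w c. I w (trunc k c) (node k c))"
    and R: "test (k + 8) (\<lambda>w c. R w (trunc k c) (node k c) (node (k + 4) c))"
    and F: "test (k + 4) (\<lambda>w c. F w (trunc k c) (node k c))"
  shows "test k (\<lambda>w c. \<exists>x\<in>box w. \<exists>y\<in>box w. I w c x \<and> star_on (\<lambda>x. x \<in> box w) (R w c) x y \<and> F w c y)"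
proof -
  have zero: "(0, 0, 0, 0) \<in> box w" for w :: "'a list" by (simp add: box_def)
  have body: "action (k + 4) (\<lambda>w c c'. \<exists>y\<in>box w. R w (trunc k c) (node k c) y \<and> c' = put k c y)"
  proof -
    define B where "B = (\<lambda>w c c'. R w (trunc k c) (node k c) (node (k + 4) c) \<and>
        c' = put (k + 4) (put k c (node (k + 4) c)) (0, 0, 0, 0))"
    have "action (k + 8) B" unfolding B_def
      by (rule action_cong[OF action_seq[OF R[unfolded test_def] action_move4]]) blast
    moreover have "k + 8 = k + 4 + 4" by simp
    ultimately have "action (k + 4 + 4) B" by (rule back_subst[where P = "\<lambda>l. action l B"])
    from action_block4[OF this] show ?thesis
    proof (rule action_cong)
    fix w :: "'a list" and c c'
    assume c: "ok w (k + 4) c" and c': "ok w (k + 4) c'"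
    have "put (k + 4) (put k (put (k + 4) c x) x) (0, 0, 0, 0) = put (k + 4) (put k c x) (0, 0, 0, 0)" for x
      by (auto simp: put_apply fun_eq_iff)
    moreover have "put (k + 4) c' z = put (k + 4) (put k c x) (0, 0, 0, 0) \<longleftrightarrow> c' = put k c x \<and> z = (0, 0, 0, 0)"
      if "x \<in> box w" for x z
      by (intro put_eq_iff[OF _ c'] ok_put_iff[THEN iffD2]) (use c that in \<open>auto simp: ok_def\<close>)
    ultimately show "(\<exists>x\<in>box w. \<exists>y\<in>box w. B w (put (k + 4) c x) (put (k + 4) c' y)) \<longleftrightarrow>
      (\<exists>y\<in>box w. R w (trunc k c) (node k c) y \<and> c' = put k c y)"
      unfolding B_def using zero[of w] by (simp cong: bex_cong)
    qed
  qed
  define S where "S = (\<lambda>(w :: 'a list) c c'. \<exists>d. ok w (k + 4) d \<and> (d = c \<and> I w (trunc k c) (node k c)) \<and>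
    (\<exists>e. ok w (k + 4) e \<and> star_on (ok w (k + 4)) (\<lambda>c c'. \<exists>y\<in>box w. R w (trunc k c) (node k c) y \<and> c' = put k c y) d e \<and>
      (c' = e \<and> F w (trunc k e) (node k e))))"
  have "action (k + 4) S"
    unfolding S_def using I F body unfolding test_def by (intro action_seq action_star)
  from action_block4[OF this] show ?thesis
    unfolding test_def
  proof (rule action_cong)
    fix w :: "'a list" and c c'
    assume c: "ok w k c" and c': "ok w k c'"
    have okp: "ok w (k + 4) (put k c x) \<longleftrightarrow> x \<in> box w" for x
      using c by (intro ok_put_iff) (auto simp: ok_def)
    have "put k (put k c x) y = put k c y" for x y by (auto simp: put_apply fun_eq_iff)
    note simps = this node_put trunc_put[OF order_refl] trunc_ok[OF c]
    have star: "star_on (ok w (k + 4)) (\<lambda>c c'. \<exists>y\<in>box w. R w (trunc k c) (node k c) y \<and> c' = put k c y) (put k c x) e \<longleftrightarrow>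
        (\<exists>y\<in>box w. e = put k c y \<and> star_on (\<lambda>x. x \<in> box w) (R w c) x y)" if "x \<in> box w" for x e
      unfolding star_on_def[of "ok w (k + 4)"]
    proof (rule star_on_map[OF _ that])
      fix x d assume "x \<in> box w"
      then show "ok w (k + 4) (put k c x) \<and> ok w (k + 4) d \<and>
          (\<exists>y\<in>box w. R w (trunc k (put k c x)) (node k (put k c x)) y \<and> d = put k (put k c x) y) \<longleftrightarrow>
        (\<exists>y\<in>box w. R w c x y \<and> d = put k c y)"
        unfolding simps using okp by blast
    qed
    have S: "S w (put k c x) (put k c' y) \<longleftrightarrow>
        I w c x \<and> c' = c \<and> star_on (\<lambda>x. x \<in> box w) (R w c) x y \<and> F w c y"
      if "x \<in> box w" "y \<in> box w" for x y
    proof -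
      have drop: "(\<exists>e. ok w (k + 4) e \<and> (\<exists>z\<in>box w. e = put k c z \<and> St z) \<and> P e) \<longleftrightarrow>
          (\<exists>z\<in>box w. St z \<and> P (put k c z))" for St P
        using okp by blast
      have "S w (put k c x) (put k c' y) \<longleftrightarrow> ok w (k + 4) (put k c x) \<and>
          I w (trunc k (put k c x)) (node k (put k c x)) \<and>
          (\<exists>e. ok w (k + 4) e \<and> star_on (ok w (k + 4))
              (\<lambda>c c'. \<exists>y\<in>box w. R w (trunc k c) (node k c) y \<and> c' = put k c y) (put k c x) e \<and>
            (put k c' y = e \<and> F w (trunc k e) (node k e)))"
        unfolding S_def by blast
      also have "\<dots> \<longleftrightarrow> I w c x \<and> (\<exists>z\<in>box w. star_on (\<lambda>x. x \<in> box w) (R w c) x z \<and>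
          (put k c' y = put k c z \<and> F w c z))"
        unfolding star[OF that(1)] drop simps okp using that(1) by simp
      finally have "S w (put k c x) (put k c' y) \<longleftrightarrow> I w c x \<and>
          (\<exists>z\<in>box w. star_on (\<lambda>x. x \<in> box w) (R w c) x z \<and> (put k c' y = put k c z \<and> F w c z))" .
      then show ?thesis unfolding put_eq_iff[OF c c'] using that by blast
    qed
    show "(\<exists>x\<in>box w. \<exists>y\<in>box w. S w (put k c x) (put k c' y)) \<longleftrightarrow> c' = c \<and>
        (\<exists>x\<in>box w. \<exists>y\<in>box w. I w c x \<and> star_on (\<lambda>x. x \<in> box w) (R w c) x y \<and> F w c y)"
      using S by blast
  qed
qed


text \<open>
  Two consecutive registers hold a number below the square of the capacity. Such numbers serve as
  graph nodes, and at the same time they are large enough to count the nodes.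
\<close>

definition num :: "'s list \<Rightarrow> env \<Rightarrow> nat \<Rightarrow> nat" where
  "num w c r = c r * capacity w + c (r + 1)"

abbreviation bound :: "'s list \<Rightarrow> nat" where
  "bound w \<equiv> capacity w * capacity w"

lemma digits_less:
  assumes "a < n" "b < (n :: nat)"
  shows "a * n + b < n * n"
proof -
  have "a * n + b < Suc a * n" using assms by simp
  also have "\<dots> \<le> n * n" using assms by (intro mult_le_mono1) simp
  finally show ?thesis .
qed

lemma digits_eq_iff:
  assumes "b < n" "b' < (n :: nat)"
  shows "a * n + b = a' * n + b' \<longleftrightarrow> a = a' \<and> b = b'"
proof
  assume eq: "a * n + b = a' * n + b'"
  then have "(a * n + b) mod n = (a' * n + b') mod n" by simp
  then have "b = b'" using assms by simp
  with eq assms show "a = a' \<and> b = b'" by auto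
qed simp

lemma num_less: "ok w k c \<Longrightarrow> num w c r < bound w"
  unfolding num_def by (intro digits_less ok_less)

lemma bex_bound: "(\<exists>z<n * n. P z) \<longleftrightarrow> (\<exists>x<n. \<exists>y<n. P (x * n + y))" for n :: nat
proof
  assume "\<exists>z<n * n. P z"
  then obtain z where z: "z < n * n" "P z" by blast
  then have "0 < n" by (cases n) auto
  then have "z div n < n" "z mod n < n" using z by (simp_all add: less_mult_imp_div_less)
  moreover have "P (z div n * n + z mod n)" using z by simp
  ultimately show "\<exists>x<n. \<exists>y<n. P (x * n + y)" by blast
qed (use digits_less in blast)

lemma test_ex_num:
  assumes "test (k + 2) (\<lambda>w c. R w (trunc k c) (num w c k))"
  shows "test k (\<lambda>w c. \<exists>z<bound w. R w c z)"
  unfolding bex_bound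
proof (rule test_ex, rule test_ex)
  show "test (Suc (Suc k)) (\<lambda>w c. R w (trunc k (trunc (Suc k) c)) (trunc (Suc k) c k * capacity w + c (Suc k)))"
    using assms by (simp add: num_def)
qed

lemma test_neq: "x < k \<Longrightarrow> y < k \<Longrightarrow> test k (\<lambda>w c. c x \<noteq> c y)"
  using test_disj[OF test_less[of x k y] test_less[of y k x]] by (simp add: nat_neq_iff)

lemma test_num_eq:
  assumes "r + 1 < k" "s + 1 < k"
  shows "test k (\<lambda>w c. num w c r = num w c s)"
  using test_conj[OF test_eq[of r k s] test_eq[of "r + 1" k "s + 1"]]
proof (rule test_cong)
  show "c r = c s \<and> c (r + 1) = c (s + 1) \<longleftrightarrow> num w c r = num w c s" if "ok w k c" for w :: "'a list" and c
    unfolding num_def by (rule digits_eq_iff[symmetric]) (rule ok_less[OF that])+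
qed (use assms in auto)

lemma test_num_neq:
  assumes "r + 1 < k" "s + 1 < k"
  shows "test k (\<lambda>w c. num w c r \<noteq> num w c s)"
  using test_disj[OF test_neq[of r k s] test_neq[of "r + 1" k "s + 1"]]
proof (rule test_cong)
  show "c r \<noteq> c s \<or> c (r + 1) \<noteq> c (s + 1) \<longleftrightarrow> num w c r \<noteq> num w c s" if "ok w k c" for w :: "'a list" and c
    unfolding num_def by (subst digits_eq_iff) (auto intro: ok_less[OF that])
qed (use assms in auto)

lemma test_num_zero: "test k (\<lambda>w c. num w c r = 0)"
  using test_conj[OF test_zero[of k r] test_zero[of k "r + 1"]]
  by (rule test_cong) (simp add: num_def)

lemma test_num_one:
  assumes "r + 1 < k"
  shows "test k (\<lambda>w c. num w c r = 1)"
  using test_conj[OF test_zero[of k r] test_one[OF assms]]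
proof (rule test_cong)
  fix w :: "'a list" and c
  assume c: "ok w k c"
  have "1 < capacity w" using width_less[of w] by linarith
  then show "c r = 0 \<and> c (r + 1) = 1 \<longleftrightarrow> num w c r = 1"
    unfolding num_def using digits_eq_iff[OF ok_less[OF c, of "r + 1"], of 1 "c r" 0] by simp
qed

lemma capacity_gt: "2 < capacity w"
  using width_less[of w] by linarith

lemma max_digits: "(capacity w - 1) * capacity w + (capacity w - 1) = bound w - 1"
proof -
  have "(n - 1) * n + (n - 1) = n * n - 1" if "0 < n" for n :: nat
    using that by (cases n) auto
  then show ?thesis using capacity_gt[of w] by simp
qed

lemma num_max_iff: "ok w k c \<Longrightarrow> num w c r = bound w - 1 \<longleftrightarrow> c r = capacity w - 1 \<and> c (r + 1) = capacity w - 1"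
  unfolding num_def max_digits[symmetric] by (rule digits_eq_iff) (simp_all add: ok_less)

lemma test_num_max: "test k (\<lambda>w c. num w c r = bound w - 1)"
  using test_conj[OF test_max[of k r] test_max[of k "r + 1"]]
  by (rule test_cong) (simp only: num_max_iff)

lemma test_not_max:
  assumes "r < k"
  shows "test k (\<lambda>w c. c r \<noteq> capacity w - 1)"
proof -
  have "test k (\<lambda>(w :: 'a list) c. \<exists>x<capacity w. c r < x)"
    using assms by (intro test_ex) (simp add: test_less)
  then show ?thesis
  proof (rule test_cong)
    fix w :: "'a list" and c
    assume "ok w k c"
    then have "c r < capacity w" by (rule ok_less)
    then show "(\<exists>x<capacity w. c r < x) \<longleftrightarrow> c r \<noteq> capacity w - 1"
      by (auto intro: exI[of _ "capacity w - 1"])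
  qed
qed

lemma test_num_not_max:
  assumes "r + 1 < k"
  shows "test k (\<lambda>w c. num w c r \<noteq> bound w - 1)"
  using test_disj[OF test_not_max[of r k] test_not_max[OF assms]]
  by (rule test_cong) (use assms num_max_iff in auto)

text \<open>The two disjuncts are the cases without and with a carry into the leading digit.\<close>

lemma test_num_succ:
  assumes "r + 1 < k" "s + 1 < k"
  shows "test k (\<lambda>w c. num w c s = Suc (num w c r))"
proof -
  have "test k (\<lambda>(w :: 'a list) c. (c s = c r \<and> c (s + 1) = Suc (c (r + 1))) \<or>
      (c s = Suc (c r) \<and> c (r + 1) = capacity w - 1 \<and> c (s + 1) = 0))"
    using assms by (intro test_disj test_conj test_eq test_succ test_max test_zero) auto
  then show ?thesis
  proof (rule test_cong)
    fix w :: "'a list" and c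
    assume c: "ok w k c"
    show "(c s = c r \<and> c (s + 1) = Suc (c (r + 1))) \<or>
        (c s = Suc (c r) \<and> c (r + 1) = capacity w - 1 \<and> c (s + 1) = 0) \<longleftrightarrow>
      num w c s = Suc (num w c r)"
    proof (cases "c (r + 1) = capacity w - 1")
      case True
      then have "Suc (num w c r) = Suc (c r) * capacity w + 0"
        using capacity_gt[of w] by (simp add: num_def)
      then have "num w c s = Suc (num w c r) \<longleftrightarrow> c s = Suc (c r) \<and> c (s + 1) = 0"
        unfolding num_def[of w c s] using digits_eq_iff[OF ok_less[OF c, of "s + 1"], of 0 "c s" "Suc (c r)"] by simp
      then show ?thesis using True ok_less[OF c, of "s + 1"] by auto
    next
      case False
      then have "Suc (c (r + 1)) < capacity w" using ok_less[OF c, of "r + 1"] by simp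
      then show ?thesis
        using False digits_eq_iff[OF ok_less[OF c, of "s + 1"], of "Suc (c (r + 1))" "c s" "c r"]
        by (simp add: num_def)
    qed
  qed
qed

definition square :: "'s list \<Rightarrow> (nat \<times> nat) set" where
  "square w = {..<bound w} \<times> {..<bound w}"

text \<open>Quadruples below the capacity correspond to pairs of numbers below its square, so this
  is \<open>test_tc4\<close> after a change of coordinates.\<close>

lemma test_tc_num:
  assumes I: "test (k + 4) (\<lambda>w c. I w (trunc k c) (num w c k, num w c (k + 2)))"
    and R: "test (k + 8) (\<lambda>w c. R w (trunc k c) (num w c k, num w c (k + 2)) (num w c (k + 4), num w c (k + 6)))"
    and F: "test (k + 4) (\<lambda>w c. F w (trunc k c) (num w c k, num w c (k + 2)))"
  shows "test k (\<lambda>w c. \<exists>x\<in>square w. \<exists>y\<in>square w. I w c x \<and> star_on (\<lambda>x. x \<in> square w) (R w c) x y \<and> F w c y)"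
proof -
  define f where "f = (\<lambda>(w :: 'a list) (x0, x1, x2, x3). (x0 * capacity w + x1, x2 * capacity w + x3))"
  have f: "f w (node k c) = (num w c k, num w c (k + 2))" for w :: "'a list" and k c
    by (simp add: f_def node_def num_def numeral_3_eq_3)
  have f4: "f w (node (k + 4) c) = (num w c (k + 4), num w c (k + 6))" for w :: "'a list" and k c
    by (simp add: f_def node_def num_def add.commute)
  have surj: "(\<exists>x\<in>square w. P x) \<longleftrightarrow> (\<exists>x\<in>box w. P (f w x))" for w P
    unfolding bex_box by (simp add: square_def f_def Bex_def bex_bound)
  have into: "f w x \<in> square w" if "x \<in> box w" for w x
    using that by (cases x) (simp add: f_def square_def box_def digits_less)
  have star: "(\<exists>y\<in>square w. star_on (\<lambda>x. x \<in> square w) R (f w x) y \<and> Q y) \<longleftrightarrow>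
      (\<exists>y\<in>box w. star_on (\<lambda>x. x \<in> box w) (\<lambda>x y. R (f w x) (f w y)) x y \<and> Q (f w y))"
    if x: "x \<in> box w" for w R Q x
  proof -
    have "star_on (\<lambda>x. x \<in> square w) R (f w x) y \<longleftrightarrow>
        (\<exists>z\<in>box w. y = f w z \<and> star_on (\<lambda>x. x \<in> box w) (\<lambda>x y. R (f w x) (f w y)) x z)" for y
      unfolding star_on_def[of "\<lambda>x. x \<in> square w"]
    proof (rule star_on_map[OF _ x])
      fix x d assume "x \<in> box w"
      then show "f w x \<in> square w \<and> d \<in> square w \<and> R (f w x) d \<longleftrightarrow>
          (\<exists>y\<in>box w. R (f w x) (f w y) \<and> d = f w y)"
        using into surj[of w "\<lambda>e. e = d"] by auto
    qed
    then show ?thesis using into by auto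
  qed
  have "test k (\<lambda>w c. \<exists>x\<in>box w. \<exists>y\<in>box w. I w c (f w x) \<and>
      star_on (\<lambda>x. x \<in> box w) (\<lambda>x y. R w c (f w x) (f w y)) x y \<and> F w c (f w y))"
  proof (rule test_tc4[where R = "\<lambda>w c x y. R w c (f w x) (f w y)"])
    show "test (k + 8) (\<lambda>w c. R w (trunc k c) (f w (node k c)) (f w (node (k + 4) c)))"
      using R by (simp only: f4) (simp only: f)
  qed (use I F in \<open>simp_all add: f\<close>)
  then show ?thesis
  proof (rule test_cong)
    fix w :: "'a list" and c
    have "(\<exists>y\<in>square w. I w c (f w x) \<and> star_on (\<lambda>x. x \<in> square w) (R w c) (f w x) y \<and> F w c y) \<longleftrightarrow>
        (\<exists>y\<in>box w. I w c (f w x) \<and> star_on (\<lambda>x. x \<in> box w) (\<lambda>x y. R w c (f w x) (f w y)) x y \<and> F w c (f w y))"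
      if "x \<in> box w" for x
      using star[OF that, of "R w c" "F w c"] by blast
    then show "(\<exists>x\<in>box w. \<exists>y\<in>box w. I w c (f w x) \<and>
        star_on (\<lambda>x. x \<in> box w) (\<lambda>x y. R w c (f w x) (f w y)) x y \<and> F w c (f w y)) \<longleftrightarrow>
      (\<exists>x\<in>square w. \<exists>y\<in>square w. I w c x \<and> star_on (\<lambda>x. x \<in> square w) (R w c) x y \<and> F w c y)"
      unfolding surj[where P = "\<lambda>x. \<exists>y\<in>square w. I w c x \<and> star_on (\<lambda>x. x \<in> square w) (R w c) x y \<and> F w c y"]
      by blast
  qed
qed

section \<open>Complementing reachability by inductive counting\<close>

subsection \<open>Inductive counting\<close>

definition grid :: "nat \<Rightarrow> (nat \<times> nat) set" where
  "grid M = {..<M} \<times> {..<M}"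

lemma star_on_induct [consumes 1, case_names base step]:
  assumes "star_on P R x y" "Q x" "\<And>y z. star_on P R x y \<Longrightarrow> P y \<Longrightarrow> P z \<Longrightarrow> R y z \<Longrightarrow> Q y \<Longrightarrow> Q z"
  shows "Q y"
proof -
  have "(\<lambda>c d. P c \<and> P d \<and> R c d)\<^sup>*\<^sup>* x y" using assms(1) by (simp add: star_on_def)
  then show ?thesis
    by (induction rule: rtranclp_induct) (use assms(2,3) in \<open>auto simp: star_on_def\<close>)
qed

lemma star_on_refl: "star_on P R x x"
  by (simp add: star_on_def)

lemma star_on_step: "star_on P R x y \<Longrightarrow> P y \<Longrightarrow> P z \<Longrightarrow> R y z \<Longrightarrow> star_on P R x z"
  unfolding star_on_def by (rule rtranclp.rtrancl_into_rtrancl) auto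

text \<open>Allowing a step to stand still makes the i-th power mean reachability in at most i
  steps.\<close>

definition lazy :: "('a \<Rightarrow> 'a \<Rightarrow> bool) \<Rightarrow> 'a \<Rightarrow> 'a \<Rightarrow> bool" where
  "lazy e u v \<longleftrightarrow> u = v \<or> e u v"

lemma lazyI: "u = v \<or> e u v \<Longrightarrow> lazy e u v"
  by (simp add: lazy_def)

lemma lazyD: "lazy e u v \<Longrightarrow> u = v \<or> e u v"
  by (simp add: lazy_def)

lemma rtranclp_lazy: "(lazy e)\<^sup>*\<^sup>* = e\<^sup>*\<^sup>*"
proof -
  have "lazy e = e\<^sup>=\<^sup>=" by (auto simp: lazy_def fun_eq_iff)
  then show ?thesis by simp
qed

text \<open>The second component is a clock, so reachability within a given number of steps becomes
  plain reachability in a product graph and no path has to be stored.\<close>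

lemma star_on_relpowp:
  assumes dom: "\<And>u v. e u v \<Longrightarrow> v < M" and "a < M"
  shows "star_on (\<lambda>x. x \<in> grid M) (\<lambda>x y. (fst y = fst x \<or> e (fst x) (fst y)) \<and> snd y = Suc (snd x)) (a, 0) (v, i) \<longleftrightarrow>
    i < M \<and> (lazy e ^^ i) a v"
    (is "?S (v, i) \<longleftrightarrow> _")
proof
  have "?S x \<Longrightarrow> snd x < M \<and> (lazy e ^^ snd x) a (fst x)" for x
  proof (induction rule: star_on_induct)
    case base
    then show ?case using assms(2) by simp
  next
    case (step y z)
    have "fst y = fst z \<or> e (fst y) (fst z)" using step(4) by auto
    then have yz: "(lazy e ^^ snd y) a (fst y)" "lazy e (fst y) (fst z)" "snd z = Suc (snd y)"
      using step(4,5) lazyI[of "fst y" "fst z" e] by blast+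
    from yz(1,2) have "(lazy e ^^ Suc (snd y)) a (fst z)" by (rule relpowp_Suc_I)
    moreover have "snd z < M" using step(3) by (auto simp: grid_def)
    ultimately show ?case unfolding yz(3)[symmetric] by blast
  qed
  then show "?S (v, i) \<Longrightarrow> i < M \<and> (lazy e ^^ i) a v" by fastforce
next
  have "i < M \<Longrightarrow> (lazy e ^^ i) a v \<Longrightarrow> v < M \<and> ?S (v, i)" for v
  proof (induction i arbitrary: v)
    case 0
    then show ?case using assms(2) by (simp add: star_on_refl)
  next
    case (Suc i)
    from Suc.prems(2) obtain u where u: "(lazy e ^^ i) a u" "lazy e u v" by (rule relpowp_Suc_E)
    with Suc have IH: "u < M" "?S (u, i)" by auto
    moreover have "v < M" using lazyD[OF u(2)] IH(1) dom by auto
    moreover have "v = u \<or> e u v" using lazyD[OF u(2)] by auto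
    ultimately show ?case using Suc.prems(1) star_on_step[OF IH(2), of "(v, Suc i)"] by (simp add: grid_def)
  qed
  then show "i < M \<and> (lazy e ^^ i) a v \<Longrightarrow> ?S (v, i)" by blast
qed

lemma card_less_Suc:
  "card {u. u < Suc v \<and> P u} = (if P v then Suc (card {u. u < v \<and> P u}) else card {u. u < v \<and> P u})"
proof -
  have "{u. u < Suc v \<and> P u} = (if P v then insert v {u. u < v \<and> P u} else {u. u < v \<and> P u})"
    by (auto simp: less_Suc_eq)
  then show ?thesis by simp
qed

lemma card_less_le: "card {u. u < v \<and> P u} \<le> v"
  using card_mono[of "{..<v}" "{u. u < v \<and> P u}"] by auto

text \<open>The first component passes through all candidates; at a member of \<open>P\<close> the
  second may be increased, but need not be. The values that can be reached are thus all lower bounds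
  of the count, and lower bounds are what nondeterminism can certify.\<close>

lemma star_on_census:
  assumes "0 < M"
  shows "star_on (\<lambda>x. x \<in> grid M)
      (\<lambda>x y. fst y = Suc (fst x) \<and> (snd y = snd x \<or> snd y = Suc (snd x) \<and> P (fst x))) (0, 0) (v, d) \<longleftrightarrow>
    v < M \<and> d \<le> card {u. u < v \<and> P u}"
    (is "?S (v, d) \<longleftrightarrow> _")
proof
  have "?S x \<Longrightarrow> fst x < M \<and> snd x \<le> card {u. u < fst x \<and> P u}" for x
  proof (induction rule: star_on_induct)
    case base
    then show ?case using assms by simp
  next
    case (step y z)
    then show ?case by (auto simp: grid_def card_less_Suc)
  qed
  then show "?S (v, d) \<Longrightarrow> v < M \<and> d \<le> card {u. u < v \<and> P u}" by fastforce
next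
  have "v < M \<Longrightarrow> d \<le> card {u. u < v \<and> P u} \<Longrightarrow> ?S (v, d)" for d
  proof (induction v arbitrary: d)
    case 0
    then show ?case by (simp add: star_on_refl)
  next
    case (Suc v)
    have lt: "d < M" using Suc.prems card_less_le[of "Suc v" P] by linarith
    show ?case
    proof (cases "d \<le> card {u. u < v \<and> P u}")
      case True
      then have "?S (v, d)" using Suc by auto
      then show ?thesis by (rule star_on_step) (use Suc.prems lt in \<open>auto simp: grid_def\<close>)
    next
      case False
      with Suc.prems(2) have P: "P v" and d: "d = Suc (card {u. u < v \<and> P u})"
        by (auto simp: card_less_Suc split: if_splits)
      then have "?S (v, card {u. u < v \<and> P u})" using Suc by auto
      then show ?thesis by (rule star_on_step) (use Suc.prems lt P d in \<open>auto simp: grid_def\<close>)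
    qed
  qed
  then show "v < M \<and> d \<le> card {u. u < v \<and> P u} \<Longrightarrow> ?S (v, d)" by blast
qed

lemma star_on_deterministic:
  assumes "0 < M" "\<And>i. i < M \<Longrightarrow> f i < M"
    and R: "\<And>i y. Suc i < M \<Longrightarrow> R (i, f i) y \<longleftrightarrow> y = (Suc i, f (Suc i))"
    and R': "\<And>x y. R x y \<Longrightarrow> fst y = Suc (fst x)"
  shows "star_on (\<lambda>x. x \<in> grid M) R (0, f 0) (v, d) \<longleftrightarrow> v < M \<and> d = f v"
    (is "?S (v, d) \<longleftrightarrow> _")
proof
  have "?S x \<Longrightarrow> fst x < M \<and> snd x = f (fst x)" for x
  proof (induction rule: star_on_induct)
    case base
    then show ?case using assms(1) by simp
  next
    case (step y z)
    then have y: "y = (fst y, f (fst y))" by (metis prod.collapse)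
    have "Suc (fst y) < M" using R'[OF step(4)] step(3) by (auto simp: grid_def)
    then have "z = (Suc (fst y), f (Suc (fst y)))" using R[of "fst y" z] step(4) y by simp
    then show ?case using \<open>Suc (fst y) < M\<close> by simp
  qed
  then show "?S (v, d) \<Longrightarrow> v < M \<and> d = f v" by fastforce
next
  have "v < M \<Longrightarrow> ?S (v, f v)"
  proof (induction v)
    case 0
    then show ?case by (simp add: star_on_refl)
  next
    case (Suc v)
    then have "?S (v, f v)" by simp
    then show ?case by (rule star_on_step) (use Suc.prems assms(2) R in \<open>auto simp: grid_def\<close>)
  qed
  then show "v < M \<and> d = f v \<Longrightarrow> ?S (v, d)" by blast
qed

text \<open>A certified lower bound for the part of layer \<open>i\<close> inside \<open>S\<close>.
  If \<open>n\<close> is the exact size of the layer, the bound forces the whole layer into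
  \<open>S\<close>, so a universal statement has been put into positive form.\<close>

definition census :: "(nat \<Rightarrow> nat \<Rightarrow> bool) \<Rightarrow> nat \<Rightarrow> nat \<Rightarrow> nat \<Rightarrow> (nat \<Rightarrow> bool) \<Rightarrow> nat \<Rightarrow> bool" where
  "census e M a i S n \<longleftrightarrow> n \<le> card {u. u < M - 1 \<and> (lazy e ^^ i) a u \<and> S u}"

text \<open>The walk passes through all vertices v and counts those in the next layer. Membership is
  certified by reachability. Absence is certified by a census: if \<open>n\<close> is the true size
  of layer \<open>i\<close>, then all vertices of that layer differ from v and have no edge to
  v.\<close>

definition stage :: "(nat \<Rightarrow> nat \<Rightarrow> bool) \<Rightarrow> nat \<Rightarrow> nat \<Rightarrow> nat \<Rightarrow> nat \<Rightarrow> nat \<Rightarrow> bool" where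
  "stage e M a i n n' \<longleftrightarrow> star_on (\<lambda>x. x \<in> grid M)
     (\<lambda>x y. fst y = Suc (fst x) \<and>
       (snd y = Suc (snd x) \<and> (lazy e ^^ Suc i) a (fst x) \<or>
        snd y = snd x \<and> census e M a i (\<lambda>u. u \<noteq> fst x \<and> \<not> e u (fst x)) n))
     (0, 0) (M - 1, n')"

text \<open>The size of layer 0 is 1, and \<open>M - 1\<close> stages carry it to the last layer; a
  final census then certifies that this layer avoids \<open>t\<close>.\<close>

definition unreachable :: "(nat \<Rightarrow> nat \<Rightarrow> bool) \<Rightarrow> nat \<Rightarrow> nat \<Rightarrow> nat \<Rightarrow> bool" where
  "unreachable e M a t \<longleftrightarrow> (\<exists>n<M. star_on (\<lambda>x. x \<in> grid M)
     (\<lambda>x y. fst y = Suc (fst x) \<and> stage e M a (fst x) (snd x) (snd y)) (0, 1) (M - 1, n) \<and>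
     census e M a (M - 1) (\<lambda>u. u \<noteq> t) n)"

text \<open>Vertices are kept below \<open>M - 1\<close> in order that layer sizes, and the pointer
  that ends each scan at \<open>M - 1\<close>, remain below \<open>M\<close>.\<close>

context
  fixes e :: "nat \<Rightarrow> nat \<Rightarrow> bool" and M a :: nat
  assumes dom: "\<And>u v. e u v \<Longrightarrow> v < M - 1" and a: "a < M - 1"
begin

private abbreviation layer :: "nat \<Rightarrow> nat \<Rightarrow> bool" where
  "layer i \<equiv> (lazy e ^^ i) a"

private definition cnt :: "nat \<Rightarrow> nat" where
  "cnt i = card {u. u < M - 1 \<and> layer i u}"

lemma layer_less: "layer i u \<Longrightarrow> u < M - 1"
proof (induction i arbitrary: u)
  case 0
  then show ?case using a by simp
next
  case (Suc i)
  from Suc.prems obtain v where "layer i v" "lazy e v u" by (rule relpowp_Suc_E)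
  with Suc.IH[of v] dom[of v u] lazyD[of e v u] show ?case by blast
qed

lemma layer_Suc_iff: "layer (Suc i) v \<longleftrightarrow> (\<exists>u. layer i u \<and> (u = v \<or> e u v))"
  by (blast elim: relpowp_Suc_E intro: relpowp_Suc_I lazyI dest: lazyD)

text \<open>A subset of a finite set with at least as many elements is the whole set.\<close>

lemma census_cnt: "census e M a i S (cnt i) \<longleftrightarrow> (\<forall>u. layer i u \<longrightarrow> S u)"
proof
  assume "census e M a i S (cnt i)"
  then have "{u. u < M - 1 \<and> layer i u \<and> S u} = {u. u < M - 1 \<and> layer i u}"
    unfolding census_def cnt_def by (intro card_seteq) auto
  then show "\<forall>u. layer i u \<longrightarrow> S u" using layer_less by blast
next
  assume "\<forall>u. layer i u \<longrightarrow> S u"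
  then have "{u. u < M - 1 \<and> layer i u \<and> S u} = {u. u < M - 1 \<and> layer i u}" by auto
  then show "census e M a i S (cnt i)" by (simp add: census_def cnt_def)
qed

text \<open>Once the previous count is exact, \<open>census_cnt\<close> makes the two alternatives
  in \<open>stage\<close> complementary. The walk becomes deterministic and has to arrive at the
  exact new count.\<close>

lemma stage_cnt: "stage e M a i (cnt i) n \<longleftrightarrow> n = cnt (Suc i)"
proof -
  let ?f = "\<lambda>v. card {u. u < v \<and> layer (Suc i) u}"
  have c: "census e M a i (\<lambda>u. u \<noteq> v \<and> \<not> e u v) (cnt i) \<longleftrightarrow> \<not> layer (Suc i) v" for v
    unfolding census_cnt layer_Suc_iff by auto
  have "stage e M a i (cnt i) n \<longleftrightarrow> star_on (\<lambda>x. x \<in> grid M)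
     (\<lambda>x y. fst y = Suc (fst x) \<and>
       (snd y = Suc (snd x) \<and> layer (Suc i) (fst x) \<or> snd y = snd x \<and> \<not> layer (Suc i) (fst x)))
     (0, ?f 0) (M - 1, n)"
    by (simp add: stage_def c del: relpowp.simps)
  also have "\<dots> \<longleftrightarrow> M - 1 < M \<and> n = ?f (M - 1)"
  proof (rule star_on_deterministic)
    show "?f i < M" if "i < M" for i
      using card_less_le[of i] that by (rule le_less_trans)
  qed (use a in \<open>auto simp: card_less_Suc simp del: relpowp.simps\<close>)
  finally show ?thesis using a by (simp add: cnt_def)
qed

lemma layer_mono: "i \<le> j \<Longrightarrow> layer i u \<Longrightarrow> layer j u"
  by (induction rule: dec_induct) (auto simp: layer_Suc_iff simp del: relpowp.simps)

lemma layer_stable: "i \<le> j \<Longrightarrow> layer (Suc i) = layer i \<Longrightarrow> layer j = layer i"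
proof (induction rule: dec_induct)
  case (step j)
  then have "layer (Suc j) v \<longleftrightarrow> layer (Suc i) v" for v by (simp add: layer_Suc_iff del: relpowp.simps)
  with step show ?case by (auto simp del: relpowp.simps)
qed simp

text \<open>Layers increase, and two equal consecutive layers make all later ones equal. As long as
  they grow strictly, layer \<open>j\<close> has more than \<open>j\<close> elements, which is
  impossible up to \<open>M - 1\<close> because only \<open>M - 1\<close> vertices exist.\<close>

lemma layer_all: "layer (M - 1) t \<longleftrightarrow> e\<^sup>*\<^sup>* a t"
proof
  assume "layer (M - 1) t"
  then have "(lazy e)\<^sup>*\<^sup>* a t" by (rule relpowp_imp_rtranclp)
  then show "e\<^sup>*\<^sup>* a t" by (simp only: rtranclp_lazy)
next
  have fin: "finite {u. layer i u}" for i
    by (rule finite_subset[of _ "{..<M - 1}"]) (use layer_less in auto)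
  have card: "(\<forall>i<j. layer (Suc i) \<noteq> layer i) \<Longrightarrow> j < card {u. layer j u}" for j
  proof (induction j)
    case 0
    then show ?case using fin[of 0] by (auto simp: card_gt_0_iff)
  next
    case (Suc j)
    have "{u. layer j u} \<subset> {u. layer (Suc j) u}"
      using Suc.prems layer_mono[of j "Suc j"] by (auto simp del: relpowp.simps)
    then have "card {u. layer j u} < card {u. layer (Suc j) u}"
      by (rule psubset_card_mono[OF fin])
    with Suc show ?case by auto
  qed
  have "card {u. layer (M - 1) u} \<le> card {..<M - 1}"
    by (rule card_mono) (use layer_less in auto)
  then have "\<not> M - 1 < card {u. layer (M - 1) u}" by simp
  then obtain i where i: "i < M - 1" "layer (Suc i) = layer i" using card by blast
  assume "e\<^sup>*\<^sup>* a t"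
  then have "(lazy e)\<^sup>*\<^sup>* a t" by (simp only: rtranclp_lazy)
  then obtain j where "layer j t" by (auto dest: rtranclp_imp_relpowp)
  then have "layer (max i j) t" by (rule layer_mono[rotated]) simp
  then have "layer i t" using layer_stable[of i "max i j", OF _ i(2)] by simp
  then show "layer (M - 1) t" using layer_mono[of i "M - 1"] i by simp
qed

lemma unreachable_iff: "unreachable e M a t \<longleftrightarrow> \<not> e\<^sup>*\<^sup>* a t"
proof -
  have 0: "cnt 0 = 1"
  proof -
    have "{u. u < M - 1 \<and> layer 0 u} = {a}" using a by auto
    then show ?thesis by (simp add: cnt_def del: relpowp.simps)
  qed
  have lt: "cnt i < M" for i
    using card_less_le[of "M - 1" "layer i"] a by (simp add: cnt_def)
  have "star_on (\<lambda>x. x \<in> grid M) (\<lambda>x y. fst y = Suc (fst x) \<and> stage e M a (fst x) (snd x) (snd y)) (0, cnt 0) (i, n) \<longleftrightarrow>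
      i < M \<and> n = cnt i" for i n
    using a lt by (intro star_on_deterministic) (auto simp: stage_cnt)
  then have "unreachable e M a t \<longleftrightarrow> census e M a (M - 1) (\<lambda>u. u \<noteq> t) (cnt (M - 1))"
    using a lt by (auto simp: unreachable_def 0)
  also have "\<dots> \<longleftrightarrow> \<not> layer (M - 1) t" unfolding census_cnt by blast
  finally show ?thesis by (simp only: layer_all)
qed

end

section \<open>Inductive counting carried out by register programs\<close>

lemma num_trunc [simp]: "r + 1 < l \<Longrightarrow> num w (trunc l c) r = num w c r"
  by (simp add: num_def)

lemma square_grid: "square w = grid (bound w)"
  by (simp add: square_def grid_def)

text \<open>Non-edges must be testable too, because the census in \<open>stage\<close> asks for
  them. The edge relation may depend on the registers below \<open>k\<close> as parameters; stating
  the tests for all \<open>l\<close> from \<open>k\<close> on allows them to be nested below further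
  scratch registers.\<close>

locale graph_test =
  fixes k :: nat and e :: "'s list \<Rightarrow> env \<Rightarrow> nat \<Rightarrow> nat \<Rightarrow> bool"
  assumes pos: "\<And>l r s. k \<le> l \<Longrightarrow> r + 1 < l \<Longrightarrow> s + 1 < l \<Longrightarrow>
      test l (\<lambda>w c. e w (trunc k c) (num w c r) (num w c s))"
    and neg: "\<And>l r s. k \<le> l \<Longrightarrow> r + 1 < l \<Longrightarrow> s + 1 < l \<Longrightarrow>
      test l (\<lambda>w c. \<not> e w (trunc k c) (num w c r) (num w c s))"
    and dom: "\<And>w c u v. e w c u v \<Longrightarrow> v < bound w - 1"
begin

text \<open>\<open>test_tc_num\<close> works on pairs; here the second component is idle and held at
  0.\<close>

lemma test_tc:
  assumes l: "k \<le> l" "a + 1 < l" "t + 1 < l"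
  shows "test l (\<lambda>w c. (e w (trunc k c))\<^sup>*\<^sup>* (num w c a) (num w c t))"
proof -
  have "test l (\<lambda>w c. \<exists>x\<in>square w. \<exists>y\<in>square w. (fst x = num w c a \<and> snd x = 0) \<and>
      star_on (\<lambda>x. x \<in> square w) (\<lambda>x y. e w (trunc k c) (fst x) (fst y) \<and> snd y = 0) x y \<and>
      (fst y = num w c t \<and> snd y = 0))"
    by (rule test_tc_num; use l in \<open>simp del: One_nat_def relpowp.simps; (intro test_conj test_num_eq test_num_zero pos; simp)?\<close>)
  then show ?thesis
  proof (rule test_cong)
    fix w :: "'s list" and c
    assume c: "ok w l c"
    let ?e = "e w (trunc k c)"
    let ?R = "\<lambda>x y. ?e (fst x) (fst y) \<and> snd y = (0 :: nat)"
    have lt: "num w c a < bound w" using c by (rule num_less)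
    have pos: "0 < bound w" by simp
    have "star_on (\<lambda>x. x \<in> square w) ?R (num w c a, 0) x \<Longrightarrow> ?e\<^sup>*\<^sup>* (num w c a) (fst x)" for x
      by (induction rule: star_on_induct) auto
    moreover have "?e\<^sup>*\<^sup>* (num w c a) v \<Longrightarrow> v < bound w \<and> star_on (\<lambda>x. x \<in> square w) ?R (num w c a, 0) (v, 0)" for v
    proof (induction rule: rtranclp_induct)
      case base
      then show ?case using lt by (simp add: star_on_refl)
    next
      case (step u v)
      have "v < bound w" using dom[OF step(2)] by simp
      moreover have "star_on (\<lambda>x. x \<in> square w) ?R (num w c a, 0) (v, 0)"
        using step.IH[THEN conjunct2] by (rule star_on_step) (use step \<open>v < bound w\<close> in \<open>auto simp: square_def\<close>)
      ultimately show ?case by blast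
    qed
    ultimately show "(\<exists>x\<in>square w. \<exists>y\<in>square w. (fst x = num w c a \<and> snd x = 0) \<and>
        star_on (\<lambda>x. x \<in> square w) ?R x y \<and> (fst y = num w c t \<and> snd y = 0)) \<longleftrightarrow>
      ?e\<^sup>*\<^sup>* (num w c a) (num w c t)"
      using lt pos by (fastforce simp: square_def)
  qed
qed

lemma test_layer:
  assumes l: "k \<le> l" "a + 1 < l" "i + 1 < l" "v + 1 < l"
  shows "test l (\<lambda>w c. (lazy (e w (trunc k c)) ^^ num w c i) (num w c a) (num w c v))"
proof -
  have "test l (\<lambda>w c. \<exists>x\<in>square w. \<exists>y\<in>square w. (fst x = num w c a \<and> snd x = 0) \<and>
      star_on (\<lambda>x. x \<in> square w) (\<lambda>x y. (fst y = fst x \<or> e w (trunc k c) (fst x) (fst y)) \<and> snd y = Suc (snd x)) x y \<and>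
      (fst y = num w c v \<and> snd y = num w c i))"
    by (rule test_tc_num; use l in \<open>simp del: One_nat_def relpowp.simps; (intro test_conj test_disj test_num_eq test_num_zero test_num_succ pos; simp)?\<close>)
  then show ?thesis
  proof (rule test_cong)
    fix w :: "'s list" and c
    assume c: "ok w l c"
    let ?e = "e w (trunc k c)"
    let ?R = "\<lambda>x y. (fst y = fst x \<or> ?e (fst x) (fst y)) \<and> snd y = Suc (snd x)"
    have lt: "num w c r < bound w" for r using c by (rule num_less)
    have e: "v < bound w" if "?e u v" for u v using dom[OF that] by simp
    have "(\<exists>x\<in>square w. \<exists>y\<in>square w. (fst x = num w c a \<and> snd x = 0) \<and>
        star_on (\<lambda>x. x \<in> square w) ?R x y \<and> (fst y = num w c v \<and> snd y = num w c i)) \<longleftrightarrow>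
      star_on (\<lambda>x. x \<in> square w) ?R (num w c a, 0) (num w c v, num w c i)"
      using lt[of a] lt[of v] lt[of i] by (auto simp: square_def)
    also have "\<dots> \<longleftrightarrow> num w c i < bound w \<and> (lazy ?e ^^ num w c i) (num w c a) (num w c v)"
      unfolding square_grid by (rule star_on_relpowp) (use e lt in auto)
    finally show "(\<exists>x\<in>square w. \<exists>y\<in>square w. (fst x = num w c a \<and> snd x = 0) \<and>
        star_on (\<lambda>x. x \<in> square w) ?R x y \<and> (fst y = num w c v \<and> snd y = num w c i)) \<longleftrightarrow>
      (lazy ?e ^^ num w c i) (num w c a) (num w c v)" using lt[of i] by simp
  qed
qed

text \<open>The exponent is not the content of a register, so the last step is split off and its
  source is guessed.\<close>

lemma test_layer_Suc:
  assumes l: "k \<le> l" "a + 1 < l" "i + 1 < l" "v + 1 < l"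
  shows "test l (\<lambda>w c. (lazy (e w (trunc k c)) ^^ Suc (num w c i)) (num w c a) (num w c v))"
proof -
  have "test l (\<lambda>w c. \<exists>u<bound w. (lazy (e w (trunc k c)) ^^ num w c i) (num w c a) u \<and>
      (u = num w c v \<or> e w (trunc k c) u (num w c v)))"
    using l by (intro test_ex_num) (simp, intro test_conj test_disj test_num_eq pos test_layer; simp)
  then show ?thesis
  proof (rule test_cong)
    fix w :: "'s list" and c
    assume c: "ok w l c"
    let ?e = "e w (trunc k c)"
    have "u < bound w" if "(lazy ?e ^^ i) (num w c a) u" for u i
      using that
    proof (induction i arbitrary: u)
      case 0
      then show ?case using num_less[OF c, of a] by simp
    next
      case (Suc i)
      from Suc.prems obtain v where "(lazy ?e ^^ i) (num w c a) v" "lazy ?e v u" by (rule relpowp_Suc_E)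
      with Suc.IH[of v] dom[of w "trunc k c" v u] lazyD[of ?e v u] show ?case by auto
    qed
    then show "(\<exists>u<bound w. (lazy ?e ^^ num w c i) (num w c a) u \<and> (u = num w c v \<or> ?e u (num w c v))) \<longleftrightarrow>
        (lazy ?e ^^ Suc (num w c i)) (num w c a) (num w c v)"
      by (blast elim: relpowp_Suc_E intro: relpowp_Suc_I lazyI dest: lazyD)
  qed
qed

lemma test_census:
  assumes l: "k \<le> l" "a + 1 < l" "i + 1 < l" "n + 1 < l"
    and S: "test (l + 8) (\<lambda>w c. S w (trunc l c) (num w c l))"
  shows "test l (\<lambda>w c. census (e w (trunc k c)) (bound w) (num w c a) (num w c i) (S w c) (num w c n))"
proof -
  have "test l (\<lambda>w c. \<exists>x\<in>square w. \<exists>y\<in>square w. (fst x = 0 \<and> snd x = 0) \<and>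
      star_on (\<lambda>x. x \<in> square w) (\<lambda>x y. fst y = Suc (fst x) \<and> (snd y = snd x \<or> snd y = Suc (snd x) \<and>
        ((lazy (e w (trunc k c)) ^^ num w c i) (num w c a) (fst x) \<and> S w c (fst x)))) x y \<and>
      (fst y = bound w - 1 \<and> snd y = num w c n))"
    by (rule test_tc_num; use l in \<open>simp del: One_nat_def relpowp.simps; (intro test_conj test_disj test_num_eq test_num_zero test_num_succ test_num_max test_layer S; simp)?\<close>)
  then show ?thesis
  proof (rule test_cong)
    fix w :: "'s list" and c
    assume c: "ok w l c"
    let ?P = "\<lambda>u. (lazy (e w (trunc k c)) ^^ num w c i) (num w c a) u \<and> S w c u"
    let ?R = "\<lambda>x y. fst y = Suc (fst x) \<and> (snd y = snd x \<or> snd y = Suc (snd x) \<and> ?P (fst x))"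
    have pos: "0 < bound w" by simp
    have "(\<exists>x\<in>square w. \<exists>y\<in>square w. (fst x = 0 \<and> snd x = 0) \<and>
        star_on (\<lambda>x. x \<in> square w) ?R x y \<and> (fst y = bound w - 1 \<and> snd y = num w c n)) \<longleftrightarrow>
      star_on (\<lambda>x. x \<in> square w) ?R (0, 0) (bound w - 1, num w c n)"
      using num_less[OF c, of n] pos by (auto simp: square_def)
    also have "\<dots> \<longleftrightarrow> bound w - 1 < bound w \<and> num w c n \<le> card {u. u < bound w - 1 \<and> ?P u}"
      unfolding square_grid by (rule star_on_census[OF pos])
    finally show "(\<exists>x\<in>square w. \<exists>y\<in>square w. (fst x = 0 \<and> snd x = 0) \<and>
        star_on (\<lambda>x. x \<in> square w) ?R x y \<and> (fst y = bound w - 1 \<and> snd y = num w c n)) \<longleftrightarrow>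
      census (e w (trunc k c)) (bound w) (num w c a) (num w c i) (S w c) (num w c n)"
      using pos by (simp add: census_def)
  qed
qed

lemma test_stage:
  assumes l: "k \<le> l" "a + 1 < l" "i + 1 < l" "n + 1 < l" "n' + 1 < l"
  shows "test l (\<lambda>w c. stage (e w (trunc k c)) (bound w) (num w c a) (num w c i) (num w c n) (num w c n'))"
proof -
  have "test l (\<lambda>w c. \<exists>x\<in>square w. \<exists>y\<in>square w. (fst x = 0 \<and> snd x = 0) \<and>
      star_on (\<lambda>x. x \<in> square w) (\<lambda>x y. fst y = Suc (fst x) \<and>
       (snd y = Suc (snd x) \<and> (lazy (e w (trunc k c)) ^^ Suc (num w c i)) (num w c a) (fst x) \<or>
        snd y = snd x \<and> census (e w (trunc k c)) (bound w) (num w c a) (num w c i)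
          (\<lambda>u. u \<noteq> fst x \<and> \<not> e w (trunc k c) u (fst x)) (num w c n))) x y \<and>
      (fst y = bound w - 1 \<and> snd y = num w c n'))"
  proof (rule test_tc_num)
    have S: "test (l + 8 + 8) (\<lambda>w c. num w c (l + 8) \<noteq> num w (trunc (l + 8) c) l \<and>
        \<not> e w (trunc k (trunc (l + 8) c)) (num w c (l + 8)) (num w (trunc (l + 8) c) l))"
      using l by simp (intro test_conj test_num_neq neg; simp)
    have C: "test (l + 8) (\<lambda>w c. census (e w (trunc k c)) (bound w) (num w c a) (num w c i)
        (\<lambda>u. u \<noteq> num w c l \<and> \<not> e w (trunc k c) u (num w c l)) (num w c n))"
      by (rule test_census[OF _ _ _ _ S]) (use l in simp_all)
    show "test (l + 8) (\<lambda>w c. fst (num w c (l + 4), num w c (l + 6)) = Suc (fst (num w c l, num w c (l + 2))) \<and>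
       (snd (num w c (l + 4), num w c (l + 6)) = Suc (snd (num w c l, num w c (l + 2))) \<and>
        (lazy (e w (trunc k (trunc l c))) ^^ Suc (num w (trunc l c) i)) (num w (trunc l c) a) (fst (num w c l, num w c (l + 2))) \<or>
        snd (num w c (l + 4), num w c (l + 6)) = snd (num w c l, num w c (l + 2)) \<and>
        census (e w (trunc k (trunc l c))) (bound w) (num w (trunc l c) a) (num w (trunc l c) i)
          (\<lambda>u. u \<noteq> fst (num w c l, num w c (l + 2)) \<and> \<not> e w (trunc k (trunc l c)) u (fst (num w c l, num w c (l + 2))))
          (num w (trunc l c) n)))"
      using l by (simp del: relpowp.simps)
        (intro test_conj test_disj test_num_eq test_num_succ test_layer_Suc C; simp)
  next
    show "test (l + 4) (\<lambda>w c. fst (num w c l, num w c (l + 2)) = 0 \<and> snd (num w c l, num w c (l + 2)) = 0)"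
      by (simp del: One_nat_def) (intro test_conj test_num_zero)
  next
    show "test (l + 4) (\<lambda>w c. fst (num w c l, num w c (l + 2)) = bound w - 1 \<and>
        snd (num w c l, num w c (l + 2)) = num w (trunc l c) n')"
      using l by (simp del: One_nat_def) (intro test_conj test_num_max test_num_eq; simp)
  qed
  then show ?thesis
  proof (rule test_cong)
    fix w :: "'s list" and c
    assume c: "ok w l c"
    let ?R = "\<lambda>x y. fst y = Suc (fst x) \<and>
       (snd y = Suc (snd x) \<and> (lazy (e w (trunc k c)) ^^ Suc (num w c i)) (num w c a) (fst x) \<or>
        snd y = snd x \<and> census (e w (trunc k c)) (bound w) (num w c a) (num w c i)
          (\<lambda>u. u \<noteq> fst x \<and> \<not> e w (trunc k c) u (fst x)) (num w c n))"
    have pos: "0 < bound w" by simp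
    have "(\<exists>x\<in>square w. \<exists>y\<in>square w. (fst x = 0 \<and> snd x = 0) \<and>
        star_on (\<lambda>x. x \<in> square w) ?R x y \<and> (fst y = bound w - 1 \<and> snd y = num w c n')) \<longleftrightarrow>
      star_on (\<lambda>x. x \<in> square w) ?R (0, 0) (bound w - 1, num w c n')"
      using num_less[OF c, of n'] pos by (auto simp: square_def simp del: relpowp.simps)
    then show "(\<exists>x\<in>square w. \<exists>y\<in>square w. (fst x = 0 \<and> snd x = 0) \<and>
        star_on (\<lambda>x. x \<in> square w) ?R x y \<and> (fst y = bound w - 1 \<and> snd y = num w c n')) \<longleftrightarrow>
      stage (e w (trunc k c)) (bound w) (num w c a) (num w c i) (num w c n) (num w c n')"
      unfolding stage_def square_grid .
  qed
qed

text \<open>The start vertex has to lie below \<open>bound w - 1\<close> for the counting argument,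
  and the test itself checks this; for all further vertices it follows from
  \<open>dom\<close>.\<close>

theorem test_not_tc:
  assumes l: "k \<le> l" "a + 1 < l" "t + 1 < l"
  shows "test l (\<lambda>w c. num w c a \<noteq> bound w - 1 \<and> \<not> (e w (trunc k c))\<^sup>*\<^sup>* (num w c a) (num w c t))"
proof -
  have "test l (\<lambda>w c. \<exists>x\<in>square w. \<exists>y\<in>square w. (fst x = 0 \<and> snd x = 1) \<and>
      star_on (\<lambda>x. x \<in> square w) (\<lambda>x y. fst y = Suc (fst x) \<and>
        stage (e w (trunc k c)) (bound w) (num w c a) (fst x) (snd x) (snd y)) x y \<and>
      (fst y = bound w - 1 \<and>
       census (e w (trunc k c)) (bound w) (num w c a) (fst y) (\<lambda>u. u \<noteq> num w c t) (snd y)))"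
  proof (rule test_tc_num)
    have S: "test (l + 4 + 8) (\<lambda>w c. num w c (l + 4) \<noteq> num w (trunc (l + 4) c) t)"
      using l by simp (intro test_num_neq; simp)
    have "test (l + 4) (\<lambda>w c. census (e w (trunc k c)) (bound w) (num w c a) (num w c l)
        (\<lambda>u. u \<noteq> num w c t) (num w c (l + 2)))"
      by (rule test_census[OF _ _ _ _ S]) (use l in simp_all)
    then show "test (l + 4) (\<lambda>w c. fst (num w c l, num w c (l + 2)) = bound w - 1 \<and>
        census (e w (trunc k (trunc l c))) (bound w) (num w (trunc l c) a) (fst (num w c l, num w c (l + 2)))
          (\<lambda>u. u \<noteq> num w (trunc l c) t) (snd (num w c l, num w c (l + 2))))"
      using l by (simp del: One_nat_def add_2_eq_Suc') (intro test_conj test_num_max)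
  next
    show "test (l + 4) (\<lambda>w c. fst (num w c l, num w c (l + 2)) = 0 \<and> snd (num w c l, num w c (l + 2)) = 1)"
      by (simp del: One_nat_def) (intro test_conj test_num_zero test_num_one; simp)
  next
    show "test (l + 8) (\<lambda>w c. fst (num w c (l + 4), num w c (l + 6)) = Suc (fst (num w c l, num w c (l + 2))) \<and>
        stage (e w (trunc k (trunc l c))) (bound w) (num w (trunc l c) a) (fst (num w c l, num w c (l + 2)))
          (snd (num w c l, num w c (l + 2))) (snd (num w c (l + 4), num w c (l + 6))))"
      using l by (simp del: One_nat_def) (intro test_conj test_num_succ test_stage; simp)
  qed
  with test_num_not_max[OF l(2)] have "test l (\<lambda>w c. num w c a \<noteq> bound w - 1 \<and>
      (\<exists>x\<in>square w. \<exists>y\<in>square w. (fst x = 0 \<and> snd x = 1) \<and>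
      star_on (\<lambda>x. x \<in> square w) (\<lambda>x y. fst y = Suc (fst x) \<and>
        stage (e w (trunc k c)) (bound w) (num w c a) (fst x) (snd x) (snd y)) x y \<and>
      (fst y = bound w - 1 \<and>
       census (e w (trunc k c)) (bound w) (num w c a) (fst y) (\<lambda>u. u \<noteq> num w c t) (snd y))))"
    by (rule test_conj)
  then show ?thesis
  proof (rule test_cong)
    fix w :: "'s list" and c
    assume c: "ok w l c"
    let ?e = "e w (trunc k c)"
    let ?R = "\<lambda>x y. fst y = Suc (fst x) \<and> stage ?e (bound w) (num w c a) (fst x) (snd x) (snd y)"
    have one: "1 < bound w" using capacity_gt[of w] less_1_mult[of "capacity w" "capacity w"] by linarith
    have "(\<exists>x\<in>square w. \<exists>y\<in>square w. (fst x = 0 \<and> snd x = 1) \<and> star_on (\<lambda>x. x \<in> square w) ?R x y \<and>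
        (fst y = bound w - 1 \<and> census ?e (bound w) (num w c a) (fst y) (\<lambda>u. u \<noteq> num w c t) (snd y))) \<longleftrightarrow>
      unreachable ?e (bound w) (num w c a) (num w c t)"
      using one unfolding unreachable_def square_grid by (auto simp: grid_def)
    moreover have "unreachable ?e (bound w) (num w c a) (num w c t) \<longleftrightarrow> \<not> ?e\<^sup>*\<^sup>* (num w c a) (num w c t)"
      if "num w c a \<noteq> bound w - 1"
      by (rule unreachable_iff) (use dom that num_less[OF c, of a] in auto)
    ultimately show "num w c a \<noteq> bound w - 1 \<and>
        (\<exists>x\<in>square w. \<exists>y\<in>square w. (fst x = 0 \<and> snd x = 1) \<and> star_on (\<lambda>x. x \<in> square w) ?R x y \<and>
        (fst y = bound w - 1 \<and> census ?e (bound w) (num w c a) (fst y) (\<lambda>u. u \<noteq> num w c t) (snd y))) \<longleftrightarrow>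
      num w c a \<noteq> bound w - 1 \<and> \<not> ?e\<^sup>*\<^sup>* (num w c a) (num w c t)"
      by blast
  qed
qed

end

section \<open>Predicates testable together with their complements\<close>

subsection \<open>First-order definitions with transitive closure\<close>

text \<open>Two-sided testability makes negation free. The price is paid once, in the closure under
  transitive closure (\<open>definable_path\<close>).\<close>

definition definable :: "nat \<Rightarrow> ('s list \<Rightarrow> env \<Rightarrow> bool) \<Rightarrow> bool" where
  "definable k R \<longleftrightarrow> test k R \<and> test k (\<lambda>w c. \<not> R w c)"

lemma definable_cong:
  assumes "definable k R" "\<And>w c. ok w k c \<Longrightarrow> R w c \<longleftrightarrow> Q w c"
  shows "definable k Q"
  using assms(1) test_cong[of k R Q] test_cong[of k "\<lambda>w c. \<not> R w c" "\<lambda>w c. \<not> Q w c"] assms(2)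
  by (simp add: definable_def)

lemma definable_conj: "definable k R \<Longrightarrow> definable k Q \<Longrightarrow> definable k (\<lambda>w c. R w c \<and> Q w c)"
  unfolding definable_def de_Morgan_conj by (intro conjI test_conj test_disj) auto

lemma definable_disj: "definable k R \<Longrightarrow> definable k Q \<Longrightarrow> definable k (\<lambda>w c. R w c \<or> Q w c)"
  unfolding definable_def de_Morgan_disj by (intro conjI test_conj test_disj) auto

lemma definable_not: "definable k R \<Longrightarrow> definable k (\<lambda>w c. \<not> R w c)"
  unfolding definable_def by simp

lemma definable_imp: "definable k R \<Longrightarrow> definable k Q \<Longrightarrow> definable k (\<lambda>w c. R w c \<longrightarrow> Q w c)"
  unfolding imp_conv_disj by (intro definable_disj definable_not)

lemma definable_eq: "x < k \<Longrightarrow> y < k \<Longrightarrow> definable k (\<lambda>w c. c x = c y)"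
  unfolding definable_def by (intro conjI test_eq test_neq)

lemma definable_less: "x < k \<Longrightarrow> y < k \<Longrightarrow> definable k (\<lambda>w c. c x < c y)"
  using test_less[of x k y] test_disj[OF test_less[of y k x] test_eq[of y k x]]
  by (simp add: definable_def not_less le_less)

lemma definable_ex_less_capacity:
  assumes "definable (Suc k) (\<lambda>w c. R w (trunc k c) (c k))"
  shows "definable k (\<lambda>w c. \<exists>x<capacity w. R w c x)"
proof -
  have "test k (\<lambda>w c. \<forall>x<capacity w. \<not> R w c x)"
    using assms by (intro test_all) (simp add: definable_def)
  then show ?thesis using assms by (auto simp: definable_def intro: test_ex)
qed

text \<open>Over a finite alphabet, the complement is a finite disjunction of tests for the other
  symbols.\<close>

lemma definable_scan:
  fixes a :: "('s :: finite) scanned"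
  assumes "x < k"
  shows "definable k (\<lambda>w c. scan w (c x) = a)"
proof -
  have "b \<in> {LeftEnd, RightEnd} \<union> range Letter" for b :: "'s scanned"
    by (cases b) auto
  then have "(UNIV :: 's scanned set) = {LeftEnd, RightEnd} \<union> range Letter" by auto
  moreover have "finite ({LeftEnd, RightEnd} \<union> range (Letter :: 's \<Rightarrow> _))" by simp
  ultimately have "finite (UNIV :: 's scanned set)" by (simp only:)
  then have fin: "finite (UNIV - {a})" by (rule finite_Diff)
  have "test k (\<lambda>w c. \<exists>b\<in>UNIV - {a}. scan w (c x) = b)"
    by (rule test_finite_disj[OF fin]) (rule test_scan[OF assms])
  then have "test k (\<lambda>w c. scan w (c x) \<noteq> a)" by (rule test_cong) blast
  with test_scan[OF assms] show ?thesis unfolding definable_def by blast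
qed

lemma definable_succ:
  assumes "x < k" "y < k"
  shows "definable k (\<lambda>w c. c y = Suc (c x))"
proof -
  have "definable (Suc k) (\<lambda>(w :: 'a list) c. trunc k c x < c k \<and> c k < trunc k c y)"
    using assms by simp (intro definable_conj definable_less; simp)
  then have "definable k (\<lambda>(w :: 'a list) c. c x < c y \<and> \<not> (\<exists>z<capacity w. c x < z \<and> z < c y))"
    by (intro definable_conj definable_not definable_less assms) (rule definable_ex_less_capacity)
  then show ?thesis
  proof (rule definable_cong)
    fix w :: "'a list" and c
    assume "ok w k c"
    then have "c y < capacity w" by (rule ok_less)
    then have "Suc (c x) < capacity w" if "Suc (c x) < c y" using that by simp
    then show "c x < c y \<and> \<not> (\<exists>z<capacity w. c x < z \<and> z < c y) \<longleftrightarrow> c y = Suc (c x)"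
      by (metis Suc_lessI lessI not_less_eq)
  qed
qed

lemma definable_zero: "x < k \<Longrightarrow> definable k (\<lambda>w c. c x = 0)"
  unfolding definable_def by (intro conjI test_zero test_nonzero)

lemma definable_const: "definable k (\<lambda>w c. P)"
  unfolding definable_def by (intro conjI test_const)

lemma scan_RightEnd_iff: "scan w x = RightEnd \<longleftrightarrow> length w < x"
  by (auto simp: scan_def)

text \<open>A positive number is a position exactly when its predecessor does not scan as the right
  end.\<close>

lemma definable_position:
  assumes "x < k"
  shows "definable k (\<lambda>(w :: 's :: finite list) c. c x \<le> Suc (length w))"
proof -
  have "definable k (\<lambda>(w :: 's list) c. c x = 0 \<or> (\<exists>y<capacity w. c x = Suc y \<and> \<not> scan w y = RightEnd))"
    by (intro definable_disj definable_zero definable_ex_less_capacity assms)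
      (use assms in \<open>simp, intro definable_conj definable_not definable_scan definable_succ; simp\<close>)
  then show ?thesis
  proof (rule definable_cong)
    fix w :: "'s list" and c
    assume "ok w k c"
    then have "c x < capacity w" by (rule ok_less)
    then show "(c x = 0 \<or> (\<exists>y<capacity w. c x = Suc y \<and> \<not> scan w y = RightEnd)) \<longleftrightarrow> c x \<le> Suc (length w)"
      unfolding scan_RightEnd_iff by (cases "c x") auto
  qed
qed

abbreviation positions :: "'s list \<Rightarrow> nat set" where
  "positions w \<equiv> {..Suc (length w)}"

lemma definable_ex:
  assumes "definable (Suc k) (\<lambda>(w :: 's :: finite list) c. R w (trunc k c) (c k))"
  shows "definable k (\<lambda>w c. \<exists>x\<in>positions w. R w c x)"
proof -
  have "definable k (\<lambda>w c. \<exists>x<capacity w. x \<le> Suc (length w) \<and> R w c x)"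
    by (intro definable_ex_less_capacity definable_conj definable_position assms) simp
  then show ?thesis
  proof (rule definable_cong)
    fix w :: "'s list" and c
    have "x < capacity w" if "x \<le> Suc (length w)" for x
      using that width_less[of w] by linarith
    then show "(\<exists>x<capacity w. x \<le> Suc (length w) \<and> R w c x) \<longleftrightarrow> (\<exists>x\<in>positions w. R w c x)"
      by auto
  qed
qed

lemma definable_all:
  assumes "definable (Suc k) (\<lambda>(w :: 's :: finite list) c. R w (trunc k c) (c k))"
  shows "definable k (\<lambda>w c. \<forall>x\<in>positions w. R w c x)"
  using definable_not[OF definable_ex[OF definable_not[OF assms]]] by simp

text \<open>Two-headed walks along the input, in step or independent, are all expressed through this
  closure.\<close>

definition path :: "'s list \<Rightarrow> (nat \<Rightarrow> nat \<Rightarrow> nat \<Rightarrow> nat \<Rightarrow> bool) \<Rightarrow> nat \<times> nat \<Rightarrow> nat \<times> nat \<Rightarrow> bool" where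
  "path w R = star_on (\<lambda>x. x \<in> positions w \<times> positions w) (\<lambda>(x, y) (x', y'). R x y x' y')"

text \<open>Pairs of positions are coded as two-digit numbers to the base \<open>capacity w\<close>,
  which turns \<open>path\<close> into reachability between numbers. The coded graph is cut down to
  codes of positions; its edges then end below \<open>bound w - 1\<close>, and both reachability and
  its complement can be tested in \<open>graph_test\<close>.\<close>

lemma definable_path:
  fixes E :: "('s :: finite) list \<Rightarrow> env \<Rightarrow> nat \<Rightarrow> nat \<Rightarrow> nat \<Rightarrow> nat \<Rightarrow> bool"
  assumes E: "\<And>l x y x' y'. k \<le> l \<Longrightarrow> x < l \<Longrightarrow> y < l \<Longrightarrow> x' < l \<Longrightarrow> y' < l \<Longrightarrow>
      definable l (\<lambda>w c. E w (trunc k c) (c x) (c y) (c x') (c y'))"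
    and regs: "a < k" "b < k" "a' < k" "b' < k"
  shows "definable k (\<lambda>w c. path w (E w c) (c a, c b) (c a', c b'))"
proof -
  define e where "e = (\<lambda>(w :: 's list) c u v. let N = capacity w; n = Suc (length w) in
    u div N \<le> n \<and> u mod N \<le> n \<and> v div N \<le> n \<and> v mod N \<le> n \<and> E w c (u div N) (u mod N) (v div N) (v mod N))"
  have e_num: "e w d (num w c r) (num w c s) \<longleftrightarrow>
      c r \<le> Suc (length w) \<and> c (r + 1) \<le> Suc (length w) \<and> c s \<le> Suc (length w) \<and> c (s + 1) \<le> Suc (length w) \<and>
      E w d (c r) (c (r + 1)) (c s) (c (s + 1))"
    if "ok w l c" for w c d l r s
    using ok_less[OF that, of "r + 1"] ok_less[OF that, of "s + 1"] by (simp add: e_def Let_def num_def)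
  have e: "definable l (\<lambda>w c. e w (trunc k c) (num w c r) (num w c s))"
    if "k \<le> l" "r + 1 < l" "s + 1 < l" for l r s
  proof -
    have "definable l (\<lambda>w c. c r \<le> Suc (length w) \<and> c (r + 1) \<le> Suc (length w) \<and>
      c s \<le> Suc (length w) \<and> c (s + 1) \<le> Suc (length w) \<and> E w (trunc k c) (c r) (c (r + 1)) (c s) (c (s + 1)))"
      using that by (intro definable_conj definable_position E) auto
    then show ?thesis by (rule definable_cong) (simp only: e_num)
  qed
  have less: "v < bound w - 1" if "e w c u v" for w c u v
  proof -
    let ?N = "capacity w"
    have "v div ?N \<le> Suc (length w)" "0 < ?N" using that by (auto simp: e_def Let_def)
    \<comment> \<open>This is where the spare register value pays off: the leading digit is a
      position and hence smaller than the largest digit.\<close>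
    then have "v div ?N + 1 < ?N" using width_less[of w] by linarith
    moreover have "v < (v div ?N + 1) * ?N" using \<open>0 < ?N\<close> by (metis dividend_less_div_times add.commute mult.commute mult_Suc Suc_eq_plus1)
    moreover have "(v div ?N + 1) * ?N \<le> (?N - 1) * ?N" using calculation(1) by (intro mult_le_mono1) linarith
    ultimately have "v < (?N - 1) * ?N" by linarith
    then show ?thesis using max_digits[of w] capacity_gt[of w] by linarith
  qed
  interpret graph_test k e
    by unfold_locales (use e less in \<open>auto simp: definable_def\<close>)
  have path_iff: "path w (E w c) (x, y) (x', y') \<longleftrightarrow> (e w c)\<^sup>*\<^sup>* (x * capacity w + y) (x' * capacity w + y')"
    if "x < capacity w" "y < capacity w" "x' < capacity w" "y' < capacity w" for w c x y x' y'
  proof -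
    let ?N = "capacity w"
    define P where "P = positions w \<times> positions w"
    define dec where "dec = (\<lambda>u. (u div ?N, u mod ?N))"
    define T where "T = (\<lambda>u v. u \<in> P \<and> v \<in> P \<and> (case u of (x, y) \<Rightarrow> case v of (x', y') \<Rightarrow> E w c x y x' y'))"
    have T: "e w c u v \<longleftrightarrow> T (dec u) (dec v)" for u v
      by (simp add: e_def T_def P_def dec_def Let_def)
    have path: "path w (E w c) = T\<^sup>*\<^sup>*"
      by (simp add: path_def star_on_def T_def P_def case_prod_beta)
    have dec: "dec (x * ?N + y) = (x, y)" if "y < ?N" for x y using that by (simp add: dec_def)
    show ?thesis
    proof
      assume "(e w c)\<^sup>*\<^sup>* (x * ?N + y) (x' * ?N + y')"
      then have "T\<^sup>*\<^sup>* (dec (x * ?N + y)) (dec (x' * ?N + y'))"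
        by (induction rule: rtranclp_induct) (auto simp: T intro: rtranclp.rtrancl_into_rtrancl)
      then show "path w (E w c) (x, y) (x', y')" using that by (simp add: path dec)
    next
      assume "path w (E w c) (x, y) (x', y')"
      then have "T\<^sup>*\<^sup>* (x, y) (x', y')" by (simp add: path)
      then have "(e w c)\<^sup>*\<^sup>* (x * ?N + y) (x' * ?N + y')"
      proof (induction rule: rtranclp_induct2)
        case (step x' y' x'' y'')
        have "Suc (length w) < ?N" using width_less[of w] by linarith
        then have "y' < ?N" "y'' < ?N" using step.hyps(2) by (auto simp: T_def P_def)
        then have "e w c (x' * ?N + y') (x'' * ?N + y'')" using step.hyps(2) by (simp add: T dec)
        with step.IH show ?case by (rule rtranclp.rtrancl_into_rtrancl)
      qed simp
      then show "(e w c)\<^sup>*\<^sup>* (x * ?N + y) (x' * ?N + y')" .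
    qed
  qed
  have reg: "trunc k c r = c r" if "r < k" for c r using that by simp
  have code: "test (k + 2 + 2) (\<lambda>(w :: 's list) c. num w c r = c x * capacity w + c y)"
    if "x < k" "y < k" "r + 1 < k + 2 + 2" for x y r
    using test_conj[OF test_eq[of r "k + 2 + 2" x] test_eq[of "r + 1" "k + 2 + 2" y]]
  proof (rule test_cong)
    fix w :: "'s list" and c
    assume c: "ok w (k + 2 + 2) c"
    show "c r = c x \<and> c (r + 1) = c y \<longleftrightarrow> num w c r = c x * capacity w + c y"
      unfolding num_def by (rule digits_eq_iff[symmetric]) (rule ok_less[OF c])+
  qed (use that in auto)
  have exact: "(\<exists>z<bound w. \<exists>t<bound w. (z = c a * capacity w + c b \<and> t = c a' * capacity w + c b') \<and> Q z t) \<longleftrightarrow>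
      Q (c a * capacity w + c b) (c a' * capacity w + c b')" if "ok w k c" for w :: "'s list" and c Q
    using digits_less[OF ok_less[OF that, of a] ok_less[OF that, of b]]
      digits_less[OF ok_less[OF that, of a'] ok_less[OF that, of b']] by auto
  have "test k (\<lambda>w c. \<exists>z<bound w. \<exists>t<bound w. (z = c a * capacity w + c b \<and> t = c a' * capacity w + c b') \<and>
      (e w c)\<^sup>*\<^sup>* z t)"
  proof (rule test_ex_num, rule test_ex_num)
    have "test (k + 2 + 2) (\<lambda>w c. (num w c k = c a * capacity w + c b \<and> num w c (k + 2) = c a' * capacity w + c b') \<and>
        (e w (trunc k c))\<^sup>*\<^sup>* (num w c k) (num w c (k + 2)))"
      using regs by (intro test_conj code test_tc) auto
    then show "test (k + 2 + 2) (\<lambda>w c. (num w (trunc (k + 2) c) k = trunc k (trunc (k + 2) c) a * capacity w + trunc k (trunc (k + 2) c) b \<and>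
        num w c (k + 2) = trunc k (trunc (k + 2) c) a' * capacity w + trunc k (trunc (k + 2) c) b') \<and>
        (e w (trunc k (trunc (k + 2) c)))\<^sup>*\<^sup>* (num w (trunc (k + 2) c) k) (num w c (k + 2)))"
      using regs by simp
  qed
  then have pos: "test k (\<lambda>w c. path w (E w c) (c a, c b) (c a', c b'))"
    by (rule test_cong) (simp only: exact path_iff[OF ok_less ok_less ok_less ok_less])
  \<comment> \<open>The code \<open>bound w - 1\<close> as a source is excluded by
    \<open>test_not_tc\<close> and gets its own disjunct. Its leading digit is not a position, so no
    edge leaves it and it reaches itself only.\<close>
  have "test k (\<lambda>w c. \<exists>z<bound w. \<exists>t<bound w. (z = c a * capacity w + c b \<and> t = c a' * capacity w + c b') \<and>
      ((z \<noteq> bound w - 1 \<and> \<not> (e w c)\<^sup>*\<^sup>* z t) \<or> (z = bound w - 1 \<and> t \<noteq> bound w - 1)))"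
  proof (rule test_ex_num, rule test_ex_num)
    have "test (k + 2 + 2) (\<lambda>w c. (num w c k = c a * capacity w + c b \<and> num w c (k + 2) = c a' * capacity w + c b') \<and>
        ((num w c k \<noteq> bound w - 1 \<and> \<not> (e w (trunc k c))\<^sup>*\<^sup>* (num w c k) (num w c (k + 2))) \<or>
         (num w c k = bound w - 1 \<and> num w c (k + 2) \<noteq> bound w - 1)))"
      by (rule test_conj[OF test_conj[OF code code] test_disj[OF test_not_tc test_conj[OF test_num_max test_num_not_max]]])
        (use regs in auto)
    then show "test (k + 2 + 2) (\<lambda>w c. (num w (trunc (k + 2) c) k = trunc k (trunc (k + 2) c) a * capacity w + trunc k (trunc (k + 2) c) b \<and>
        num w c (k + 2) = trunc k (trunc (k + 2) c) a' * capacity w + trunc k (trunc (k + 2) c) b') \<and>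
        ((num w (trunc (k + 2) c) k \<noteq> bound w - 1 \<and>
          \<not> (e w (trunc k (trunc (k + 2) c)))\<^sup>*\<^sup>* (num w (trunc (k + 2) c) k) (num w c (k + 2))) \<or>
         (num w (trunc (k + 2) c) k = bound w - 1 \<and> num w c (k + 2) \<noteq> bound w - 1)))"
      using regs by simp
  qed
  moreover have "(z \<noteq> bound w - 1 \<and> \<not> (e w c)\<^sup>*\<^sup>* z t) \<or> (z = bound w - 1 \<and> t \<noteq> bound w - 1) \<longleftrightarrow>
      \<not> (e w c)\<^sup>*\<^sup>* z t" for w c z t
  proof -
    have "\<not> e w c (bound w - 1) v" for v
    proof
      assume ev: "e w c (bound w - 1) v"
      have "(bound w - 1) div capacity w = capacity w - 1"
      proof -
        have gen: "(m * n + r) div n = m" if "r < n" for m n r :: nat using that by simp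
        have "capacity w - 1 < capacity w" using capacity_gt[of w] by linarith
        from gen[OF this, of "capacity w - 1"] show ?thesis unfolding max_digits .
      qed
      with ev have "capacity w - 1 \<le> Suc (length w)" by (auto simp: e_def Let_def)
      then show False using width_less[of w] by linarith
    qed
    then have "(e w c)\<^sup>*\<^sup>* (bound w - 1) t \<longleftrightarrow> t = bound w - 1"
      by (metis converse_rtranclpE rtranclp.rtrancl_refl)
    then show ?thesis by blast
  qed
  ultimately have *: "test k (\<lambda>w c. \<exists>z<bound w. \<exists>t<bound w.
      (z = c a * capacity w + c b \<and> t = c a' * capacity w + c b') \<and> \<not> (e w c)\<^sup>*\<^sup>* z t)"
    by (simp only:)
  have "test k (\<lambda>w c. \<not> path w (E w c) (c a, c b) (c a', c b'))"
    using *
  proof (rule test_cong)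
    fix w :: "'s list" and c
    assume c: "ok w k c"
    show "(\<exists>z<bound w. \<exists>t<bound w. (z = c a * capacity w + c b \<and> t = c a' * capacity w + c b') \<and>
        \<not> (e w c)\<^sup>*\<^sup>* z t) \<longleftrightarrow> \<not> path w (E w c) (c a, c b) (c a', c b')"
      unfolding exact[OF c, of "\<lambda>z t. \<not> (e w c)\<^sup>*\<^sup>* z t"]
        path_iff[OF ok_less[OF c] ok_less[OF c] ok_less[OF c] ok_less[OF c]] ..
  qed
  with pos show ?thesis by (simp add: definable_def)
qed

section \<open>The implication graph of choices and its satisfiability\<close>

subsection \<open>Orientations of pairs\<close>

text \<open>
  A conservative commutative operation is a choice of one element from every pair of distinct
  elements, so the literal \<open>(a, b)\<close> says that \<open>a\<close> is chosen from \<open>{a, b}\<close>. The set of suitable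
  choices is closed under majority, because \<open>f (g x y) (h x y)\<close> is the majority of \<open>f\<close>, \<open>g\<close>, \<open>h\<close>
  at \<open>(x, y)\<close>. It is therefore defined by binary clauses.
\<close>

lemma orientation_exists:
  fixes E :: "'a \<times> 'a \<Rightarrow> 'a \<times> 'a \<Rightarrow> bool"
  assumes skew: "\<And>a b c d. E (a, b) (c, d) \<Longrightarrow> E (d, c) (b, a)"
    and no_cycle: "\<And>a b. a \<noteq> b \<Longrightarrow> \<not> (E\<^sup>*\<^sup>* (a, b) (b, a) \<and> E\<^sup>*\<^sup>* (b, a) (a, b))"
    and "finite V"
  shows "\<exists>T. (\<forall>x y. x \<in> T \<longrightarrow> E x y \<longrightarrow> y \<in> T) \<and> (\<forall>a b. a \<noteq> b \<longrightarrow> \<not> ((a, b) \<in> T \<and> (b, a) \<in> T)) \<and>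
    (\<forall>(a, b) \<in> V. a \<noteq> b \<longrightarrow> (a, b) \<in> T \<or> (b, a) \<in> T)"
  using assms(3)
proof (induction V rule: finite_induct)
  case empty
  show ?case by (rule exI[of _ "{}"]) simp
next
  case (insert v V)
  have skew': "E\<^sup>*\<^sup>* (d, c) (b, a)" if "E\<^sup>*\<^sup>* (a, b) (c, d)" for a b c d
    using that
  proof (induction rule: rtranclp_induct2)
    case (step c d c' d')
    from skew[OF step.hyps(2)] step.IH show ?case by (rule converse_rtranclp_into_rtranclp)
  qed simp
  from insert.IH obtain T where closed: "\<And>x y. x \<in> T \<Longrightarrow> E x y \<Longrightarrow> y \<in> T"
    and consistent: "\<And>a b. a \<noteq> b \<Longrightarrow> \<not> ((a, b) \<in> T \<and> (b, a) \<in> T)"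
    and total: "\<forall>(a, b) \<in> V. a \<noteq> b \<longrightarrow> (a, b) \<in> T \<or> (b, a) \<in> T" by blast
  have closed': "y \<in> T" if "E\<^sup>*\<^sup>* x y" "x \<in> T" for x y
    using that by (induction rule: rtranclp_induct) (auto intro: closed)
  obtain a b where v: "v = (a, b)" by (cases v)
  show ?case
  proof (cases "a = b \<or> (a, b) \<in> T \<or> (b, a) \<in> T")
    case True
    with closed consistent total v show ?thesis by (intro exI[of _ T]) auto
  next
    case False
    with no_cycle[of a b] obtain p q where pq: "(p, q) = (a, b) \<or> (p, q) = (b, a)" "\<not> E\<^sup>*\<^sup>* (p, q) (q, p)"
      by blast
    \<comment> \<open>Of the two literals on an undecided pair, one does not imply its own negation;
      it is made true together with all its consequences.\<close>
    let ?T = "T \<union> {z. E\<^sup>*\<^sup>* (p, q) z}"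
    have unassigned: "(p, q) \<notin> T" "(q, p) \<notin> T" using False pq(1) by auto
    \<comment> \<open>By contraposition, a consequence \<open>(d, c)\<close> of
      \<open>(p, q)\<close> that contradicts \<open>(c, d)\<close> in \<open>T\<close> gives a path
      from \<open>(c, d)\<close> to \<open>(q, p)\<close>, which would then already be in
      \<open>T\<close>.\<close>
    have mixed: False if "(c, d) \<in> T" "E\<^sup>*\<^sup>* (p, q) (d, c)" for c d
      using closed'[OF skew'[OF that(2)] that(1)] unassigned by blast
    have new: False if "E\<^sup>*\<^sup>* (p, q) (c, d)" "E\<^sup>*\<^sup>* (p, q) (d, c)" for c d
      using rtranclp_trans[OF that(1) skew'[OF that(2)]] pq(2) by blast
    have "\<forall>x y. x \<in> ?T \<longrightarrow> E x y \<longrightarrow> y \<in> ?T"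
      using closed by (auto intro: rtranclp.rtrancl_into_rtrancl)
    moreover have "\<forall>c d. c \<noteq> d \<longrightarrow> \<not> ((c, d) \<in> ?T \<and> (d, c) \<in> ?T)"
      using consistent mixed new by blast
    moreover have "\<forall>(c, d) \<in> insert v V. c \<noteq> d \<longrightarrow> (c, d) \<in> ?T \<or> (d, c) \<in> ?T"
      using total pq(1) v by auto
    ultimately show ?thesis by blast
  qed
qed

text \<open>The binary clauses as implications from \<open>x\<close> to \<open>y\<close>.
  Conservativity restricts attention to tuples \<open>u\<close> between \<open>s\<close> and
  \<open>t\<close>. Equal entries never give an edge: if \<open>s\<close> and \<open>t\<close> agree
  at \<open>i\<close> then \<open>u = t\<close> is a witness, and if they agree at \<open>j\<close>
  then \<open>u = s\<close> is one. A pair of distinct entries forces itself, by taking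
  \<open>i = j\<close>.\<close>

definition forces :: "(nat \<times> nat list list) list \<Rightarrow> nat \<times> nat \<Rightarrow> nat \<times> nat \<Rightarrow> bool" where
  "forces rs x y \<longleftrightarrow> (\<exists>(r, ts) \<in> set rs. \<exists>s\<in>set ts. \<exists>t\<in>set ts. \<exists>i<r. \<exists>j<r.
     x = (s ! i, t ! i) \<and> y = (s ! j, t ! j) \<and>
     \<not> (\<exists>u\<in>set ts. (\<forall>k<r. u ! k = s ! k \<or> u ! k = t ! k) \<and> u ! i = s ! i \<and> u ! j = t ! j))"

text \<open>Exchanging \<open>s\<close> with \<open>t\<close> and \<open>i\<close> with
  \<open>j\<close> leaves the condition on \<open>u\<close> unchanged; this is
  contraposition.\<close>

lemma forces_skew: "forces rs (a, b) (c, d) \<Longrightarrow> forces rs (d, c) (b, a)"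
proof -
  assume "forces rs (a, b) (c, d)"
  then obtain r ts s t i j where *: "(r, ts) \<in> set rs" "s \<in> set ts" "t \<in> set ts" "i < r" "j < r"
    "a = s ! i" "b = t ! i" "c = s ! j" "d = t ! j"
    "\<not> (\<exists>u\<in>set ts. (\<forall>k<r. u ! k = s ! k \<or> u ! k = t ! k) \<and> u ! i = s ! i \<and> u ! j = t ! j)"
    unfolding forces_def by auto
  then have "\<not> (\<exists>u\<in>set ts. (\<forall>k<r. u ! k = t ! k \<or> u ! k = s ! k) \<and> u ! j = t ! j \<and> u ! i = s ! i)"
    by blast
  with * show ?thesis unfolding forces_def by blast
qed

lemma structure_of_facts:
  assumes "is_structure (structure_of (n, rs))" "(r, ts) \<in> set rs" "t \<in> set ts"
  shows "length t = r" "i < r \<Longrightarrow> t ! i < n"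
proof -
  from assms have "length t = r \<and> set t \<subseteq> {..<n}"
    by (fastforce simp: is_structure_def structure_of_def)
  then show "length t = r" "i < r \<Longrightarrow> t ! i < n" by (auto simp: subset_iff)
qed

lemma polymorphism_structure_of:
  "binary_polymorphism (structure_of (n, rs)) f \<longleftrightarrow> (\<forall>x<n. \<forall>y<n. f x y < n) \<and>
     (\<forall>(r, ts) \<in> set rs. \<forall>s\<in>set ts. \<forall>t\<in>set ts. map2 f s t \<in> set ts)"
  by (auto simp: binary_polymorphism_def structure_of_def)

lemma universe_structure_of: "universe (structure_of (n, rs)) = {..<n}"
  by (simp add: structure_of_def)

text \<open>If \<open>f\<close> chooses the source of an edge, then \<open>map2 f s t\<close> takes
  the value of \<open>s\<close> at \<open>i\<close>; being in the relation, it cannot take the value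
  of \<open>t\<close> at \<open>j\<close>. So choices propagate along paths, and whichever of the
  two elements \<open>f\<close> chooses, the cycle makes it choose the other one as well.\<close>

lemma admits_imp_no_cycle:
  assumes H: "is_structure (structure_of (n, rs))" and "admits_conservative_commutative (structure_of (n, rs))"
    and "a \<noteq> b"
  shows "\<not> ((forces rs)\<^sup>*\<^sup>* (a, b) (b, a) \<and> (forces rs)\<^sup>*\<^sup>* (b, a) (a, b))"
proof
  assume cycle: "(forces rs)\<^sup>*\<^sup>* (a, b) (b, a) \<and> (forces rs)\<^sup>*\<^sup>* (b, a) (a, b)"
  from assms(2) obtain f where poly: "\<And>r ts s t. (r, ts) \<in> set rs \<Longrightarrow> s \<in> set ts \<Longrightarrow> t \<in> set ts \<Longrightarrow> map2 f s t \<in> set ts"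
    and comm: "\<And>x y. x < n \<Longrightarrow> y < n \<Longrightarrow> f x y = f y x" and cons: "\<And>x y. x < n \<Longrightarrow> y < n \<Longrightarrow> f x y = x \<or> f x y = y"
    unfolding admits_conservative_commutative_def polymorphism_structure_of commutative_on_def
      conservative_on_def universe_structure_of by fastforce
  have step: "f (fst y) (snd y) = fst y" if "forces rs x y" "f (fst x) (snd x) = fst x" for x y
  proof -
    from that(1) obtain r ts s t i j where *: "(r, ts) \<in> set rs" "s \<in> set ts" "t \<in> set ts" "i < r" "j < r"
      "x = (s ! i, t ! i)" "y = (s ! j, t ! j)" and
      none: "\<not> (\<exists>u\<in>set ts. (\<forall>k<r. u ! k = s ! k \<or> u ! k = t ! k) \<and> u ! i = s ! i \<and> u ! j = t ! j)"
      unfolding forces_def by auto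
    note st = structure_of_facts[OF H *(1,2)] structure_of_facts[OF H *(1,3)]
    have "map2 f s t \<in> set ts" using poly[OF *(1-3)] .
    moreover have "map2 f s t ! k = f (s ! k) (t ! k)" if "k < r" for k using that st by simp
    ultimately have "f (s ! j) (t ! j) \<noteq> t ! j"
      using none *(4-6) that(2) cons st by (metis fst_conv snd_conv)
    then show ?thesis using cons[of "s ! j" "t ! j"] st *(5,7) by auto
  qed
  have steps: "f (fst y) (snd y) = fst y" if "(forces rs)\<^sup>*\<^sup>* x y" "f (fst x) (snd x) = fst x" for x y
    using that by (induction rule: rtranclp_induct) (auto intro: step)
  \<comment> \<open>A path between different literals starts with an edge. Therefore
    \<open>a\<close> and \<open>b\<close> occur in tuples and lie in the universe, the only place
    where the properties of \<open>f\<close> are known.\<close>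
  from cycle \<open>a \<noteq> b\<close> obtain z where "forces rs (a, b) z" by (metis converse_rtranclpE prod.inject)
  then have "a < n" "b < n" unfolding forces_def using structure_of_facts(2)[OF H] by auto
  with cons comm consider "f a b = a" "f b a = a" | "f a b = b" "f b a = b" by metis
  then show False
  proof cases
    case 1
    with steps[of "(a, b)" "(b, a)"] cycle \<open>a \<noteq> b\<close> show False by simp
  next
    case 2
    with steps[of "(b, a)" "(a, b)"] cycle \<open>a \<noteq> b\<close> show False by simp
  qed
qed

text \<open>An orientation closed under \<open>forces\<close> satisfies the constraints on any two
  coordinates. That this suffices for all arities is the 2-decomposability familiar from majority
  operations: partially correct tuples are merged two at a time until the tuple selected by
  \<open>g\<close> itself is reached.\<close>

lemma no_cycle_imp_admits:
  assumes H: "is_structure (structure_of (n, rs))"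
    and no_cycle: "\<And>a b. a \<noteq> b \<Longrightarrow> \<not> ((forces rs)\<^sup>*\<^sup>* (a, b) (b, a) \<and> (forces rs)\<^sup>*\<^sup>* (b, a) (a, b))"
  shows "admits_conservative_commutative (structure_of (n, rs))"
proof -
  have "\<exists>T. (\<forall>x y. x \<in> T \<longrightarrow> forces rs x y \<longrightarrow> y \<in> T) \<and> (\<forall>a b. a \<noteq> b \<longrightarrow> \<not> ((a, b) \<in> T \<and> (b, a) \<in> T)) \<and>
    (\<forall>(a, b) \<in> {..<n} \<times> {..<n}. a \<noteq> b \<longrightarrow> (a, b) \<in> T \<or> (b, a) \<in> T)"
    by (rule orientation_exists) (erule forces_skew no_cycle | simp)+
  then obtain T where
    T: "\<forall>x y. x \<in> T \<longrightarrow> forces rs x y \<longrightarrow> y \<in> T" "\<forall>a b. a \<noteq> b \<longrightarrow> \<not> ((a, b) \<in> T \<and> (b, a) \<in> T)"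
    "\<forall>(a, b) \<in> {..<n} \<times> {..<n}. a \<noteq> b \<longrightarrow> (a, b) \<in> T \<or> (b, a) \<in> T"
    by (elim exE conjE) (rule that)
  have closed: "y \<in> T" if "x \<in> T" "forces rs x y" for x y using T(1) that by blast
  have consistent: "\<not> ((a, b) \<in> T \<and> (b, a) \<in> T)" if "a \<noteq> b" for a b using T(2) that by blast
  have total: "(a, b) \<in> T \<or> (b, a) \<in> T" if "a < n" "b < n" "a \<noteq> b" for a b using T(3) that by blast
  \<comment> \<open>On the universe \<open>T\<close> contains exactly one of \<open>(x, y)\<close>
    and \<open>(y, x)\<close> for distinct arguments, which makes \<open>g\<close> commutative
    there; for equal arguments both branches agree.\<close>
  define g where "g x y = (if (x, y) \<in> T then x else y)" for x y
  have comm: "g x y = g y x" if "x < n" "y < n" for x y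
    using that consistent[of x y] total[of x y] by (cases "x = y") (auto simp: g_def)
  have cons: "g x y = x \<or> g x y = y" for x y by (simp add: g_def)
  have two: "\<exists>w\<in>set ts. (\<forall>k<r. w ! k = u ! k \<or> w ! k = v ! k) \<and> w ! i = g (u ! i) (v ! i) \<and> w ! j = g (u ! j) (v ! j)"
    if R: "(r, ts) \<in> set rs" and u: "u \<in> set ts" and v: "v \<in> set ts" and i: "i < r" and j: "j < r" for r ts u v i j
  proof -
    \<comment> \<open>\<open>T\<close> is closed, so no edge leads from a literal in
      \<open>T\<close> to one outside, and a missing edge is precisely the existence of a suitable
      tuple.\<close>
    have key: "\<exists>w\<in>set ts. (\<forall>k<r. w ! k = s ! k \<or> w ! k = t ! k) \<and> w ! i = s ! i \<and> w ! j = t ! j"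
      if "s \<in> set ts" "t \<in> set ts" "(s ! i, t ! i) \<in> T" "(s ! j, t ! j) \<notin> T" for s t
      using closed[OF that(3), of "(s ! j, t ! j)"] that R i j unfolding forces_def by blast
    have lt: "u ! i < n" "v ! i < n" "u ! j < n" "v ! j < n"
      using structure_of_facts(2)[OF H R] u v i j by auto
    consider "g (u ! i) (v ! i) = u ! i" "g (u ! j) (v ! j) = u ! j"
      | "g (u ! i) (v ! i) = v ! i" "g (u ! j) (v ! j) = v ! j"
      | "(u ! i, v ! i) \<in> T" "(u ! j, v ! j) \<notin> T"
      | "(u ! i, v ! i) \<notin> T" "u ! i \<noteq> v ! i" "(u ! j, v ! j) \<in> T" "u ! j \<noteq> v ! j"
      unfolding g_def
      by (cases "(u ! i, v ! i) \<in> T"; cases "(u ! j, v ! j) \<in> T"; cases "u ! i = v ! i"; cases "u ! j = v ! j") simp_all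
    then show ?thesis
    proof cases
      case 3
      with key[OF u v] show ?thesis by (simp add: g_def)
    next
      case 4
      then have "(v ! i, u ! i) \<in> T" "(v ! j, u ! j) \<notin> T"
        using total[OF lt(1,2)] lt consistent[of "u ! j" "v ! j"] by auto
      with key[OF v u] 4 show ?thesis by (auto simp: g_def)
    qed (use u v in auto)
  qed
  \<comment> \<open>Induction on the size of \<open>I\<close>. With distinct \<open>i\<close> and
    \<open>j\<close> in \<open>I\<close>, tuples \<open>u\<close> and \<open>v\<close> that are
    correct on \<open>I\<close> without \<open>j\<close> and on \<open>I\<close> without
    \<open>i\<close> are merged by \<open>two\<close> at these coordinates; elsewhere on
    \<open>I\<close> both are correct, so the choice between them is immaterial.\<close>
  have all: "\<exists>u\<in>set ts. (\<forall>k<r. u ! k = s ! k \<or> u ! k = t ! k) \<and> (\<forall>k\<in>I. u ! k = g (s ! k) (t ! k))"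
    if R: "(r, ts) \<in> set rs" and s: "s \<in> set ts" and t: "t \<in> set ts" and "finite I" "I \<subseteq> {..<r}" for r ts s t I
    using that(4,5)
  proof (induction "card I" arbitrary: I rule: less_induct)
    case less
    consider "I = {}" | i where "I = {i}" | i j where "i \<in> I" "j \<in> I" "i \<noteq> j" by blast
    then show ?case
    proof cases
      case 1
      with s show ?thesis by auto
    next
      case (2 i)
      with s t cons[of "s ! i" "t ! i"] show ?thesis by auto
    next
      case (3 i j)
      have IH: "\<exists>u\<in>set ts. (\<forall>k<r. u ! k = s ! k \<or> u ! k = t ! k) \<and> (\<forall>k\<in>I - {l}. u ! k = g (s ! k) (t ! k))"
        if "l \<in> I" for l
        using less.prems card_Diff1_less[OF less.prems(1) that] by (intro less.hyps) blast+
      obtain u where u: "u \<in> set ts" "\<forall>k<r. u ! k = s ! k \<or> u ! k = t ! k" "\<forall>k\<in>I - {j}. u ! k = g (s ! k) (t ! k)"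
        using IH[OF 3(2)] by blast
      obtain v where v: "v \<in> set ts" "\<forall>k<r. v ! k = s ! k \<or> v ! k = t ! k" "\<forall>k\<in>I - {i}. v ! k = g (s ! k) (t ! k)"
        using IH[OF 3(1)] by blast
      have ij: "i < r" "j < r" using 3 less.prems by auto
      obtain w where w: "w \<in> set ts" "\<forall>k<r. w ! k = u ! k \<or> w ! k = v ! k" "w ! i = g (u ! i) (v ! i)" "w ! j = g (u ! j) (v ! j)"
        using two[OF R u(1) v(1) ij] by blast
      have lt: "s ! k < n" "t ! k < n" if "k < r" for k
        using structure_of_facts(2)[OF H R] s t that by auto
      \<comment> \<open>At \<open>i\<close> the entry of \<open>u\<close> is already the value
        chosen by \<open>g\<close>, and \<open>v\<close> has one of the two candidates;
        \<open>g\<close> prefers its own choice. At \<open>j\<close> the roles are reversed.\<close>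
      have absorb: "g (g (s ! k) (t ! k)) y = g (s ! k) (t ! k)" "g y (g (s ! k) (t ! k)) = g (s ! k) (t ! k)"
        if "k < r" "y = s ! k \<or> y = t ! k" for k y
        using that comm[OF lt[OF that(1)]] cons by (auto simp: g_def split: if_splits)
      have "w ! k = g (s ! k) (t ! k)" if "k \<in> I" for k
      proof -
        have k: "k < r" using that less.prems by auto
        consider "k = i" | "k = j" | "k \<noteq> i" "k \<noteq> j" by blast
        then show ?thesis
        proof cases
          case 1
          then have "u ! k = g (s ! k) (t ! k)" using u(3) 3 by simp
          with w(3) absorb(1)[OF k, of "v ! k"] v(2) k 1 show ?thesis by simp
        next
          case 2
          then have "v ! k = g (s ! k) (t ! k)" using v(3) 3 by simp
          with w(4) absorb(2)[OF k, of "u ! k"] u(2) k 2 show ?thesis by simp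
        next
          case 3
          then show ?thesis using w(2) u(3) v(3) that k by auto
        qed
      qed
      moreover have "\<forall>k<r. w ! k = s ! k \<or> w ! k = t ! k" using w(2) u(2) v(2) by metis
      ultimately show ?thesis using w(1) by blast
    qed
  qed
  have "map2 g s t \<in> set ts" if R: "(r, ts) \<in> set rs" and s: "s \<in> set ts" and t: "t \<in> set ts" for r ts s t
  proof -
    obtain u where u: "u \<in> set ts" "\<forall>k<r. u ! k = g (s ! k) (t ! k)"
      using all[OF R s t, of "{..<r}"] by auto
    have "length s = r" "length t = r" "length u = r"
      using structure_of_facts(1)[OF H R] s t u(1) by auto
    with u(2) have "map2 g s t = u" by (intro nth_equalityI) auto
    with u(1) show ?thesis by simp
  qed
  moreover have "g x y < n" if "x < n" "y < n" for x y using that by (simp add: g_def)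
  ultimately have "binary_polymorphism (structure_of (n, rs)) g"
    unfolding polymorphism_structure_of by blast
  with comm cons show ?thesis
    unfolding admits_conservative_commutative_def commutative_on_def conservative_on_def universe_structure_of
    by (intro exI[of _ g]) auto
qed

section \<open>The set of encodings as a regular language\<close>

subsection \<open>Reading the input from left to right\<close>

definition conc :: "'s list set \<Rightarrow> 's list set \<Rightarrow> 's list set" where
  "conc X Y = {u @ v | u v. u \<in> X \<and> v \<in> Y}"

definition stars :: "'s list set \<Rightarrow> 's list set" where
  "stars X = {concat us | us. set us \<subseteq> X}"

text \<open>Head position \<open>i\<close> means that \<open>i\<close> letters have been consumed,
  so \<open>drop i w\<close> remains. Every factor in \<open>X\<close> at that place must be
  available as a branch, which makes the notion compositional for concatenation and
  iteration.\<close>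

definition readable :: "'s list set \<Rightarrow> bool" where
  "readable X \<longleftrightarrow> (\<exists>p. \<forall>w i c s. i \<le> length w \<longrightarrow>
     (run w p (i, c) s \<longleftrightarrow> (\<exists>u v. u \<in> X \<and> drop i w = u @ v \<and> s = (i + length u, c))))"

lemma drop_eq_appendD: "drop i w = u @ v \<Longrightarrow> i \<le> length w \<Longrightarrow> i + length u \<le> length w \<and> drop (i + length u) w = v"
proof -
  assume d: "drop i w = u @ v" and "i \<le> length w"
  have "length w - i = length u + length v" using arg_cong[OF d, of length] by simp
  moreover have "drop (length u) (drop i w) = v" using d by simp
  ultimately show ?thesis using \<open>i \<le> length w\<close> by (simp add: add.commute)
qed

lemma readable_letter: "readable {[a]}"
proof -
  have "run w (Seq (Atom (Move MoveRight)) (Atom (Scan (Letter a)))) (i, c) s \<longleftrightarrow>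
      (\<exists>u v. u \<in> {[a]} \<and> drop i w = u @ v \<and> s = (i + length u, c))" if "i \<le> length w" for w i c s
  proof -
    have "run w (Seq (Atom (Move MoveRight)) (Atom (Scan (Letter a)))) (i, c) s \<longleftrightarrow>
        scan w (Suc i) = Letter a \<and> s = (Suc i, c)"
      using that by auto
    moreover have "scan w (Suc i) = Letter a \<longleftrightarrow> (\<exists>v. drop i w = a # v)"
    proof (cases "i < length w")
      case True
      then show ?thesis by (simp add: scan_def Cons_nth_drop_Suc[symmetric])
    next
      case False
      then show ?thesis using that by (simp add: scan_def)
    qed
    ultimately show ?thesis by auto
  qed
  then show ?thesis unfolding readable_def by blast
qed

lemma readable_conc:
  assumes "readable X" "readable Y"
  shows "readable (conc X Y)"
proof -
  from assms(1) obtain p where p: "\<And>w i c s. i \<le> length w \<Longrightarrow>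
     (run w p (i, c) s \<longleftrightarrow> (\<exists>u v. u \<in> X \<and> drop i w = u @ v \<and> s = (i + length u, c)))"
    unfolding readable_def by blast
  from assms(2) obtain q where q: "\<And>w i c s. i \<le> length w \<Longrightarrow>
     (run w q (i, c) s \<longleftrightarrow> (\<exists>u v. u \<in> Y \<and> drop i w = u @ v \<and> s = (i + length u, c)))"
    unfolding readable_def by blast
  have "run w (Seq p q) (i, c) s \<longleftrightarrow> (\<exists>u v. u \<in> conc X Y \<and> drop i w = u @ v \<and> s = (i + length u, c))"
    if i: "i \<le> length w" for w i c s
  proof
    assume "run w (Seq p q) (i, c) s"
    then obtain t where t: "run w p (i, c) t" "run w q t s" by auto
    then obtain u v where u: "u \<in> X" "drop i w = u @ v" "t = (i + length u, c)" using p[OF i] by blast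
    note d = drop_eq_appendD[OF u(2) i]
    from t(2) u(3) q[of "i + length u"] d obtain u' v' where
      "u' \<in> Y" "drop (i + length u) w = u' @ v'" "s = (i + length u + length u', c)" by blast
    with u d have "u @ u' \<in> conc X Y \<and> drop i w = (u @ u') @ v' \<and> s = (i + length (u @ u'), c)"
      by (auto simp: conc_def)
    then show "\<exists>u v. u \<in> conc X Y \<and> drop i w = u @ v \<and> s = (i + length u, c)" by blast
  next
    assume "\<exists>u v. u \<in> conc X Y \<and> drop i w = u @ v \<and> s = (i + length u, c)"
    then obtain u u' v where *: "u \<in> X" "u' \<in> Y" "drop i w = u @ (u' @ v)" "s = (i + length u + length u', c)"
      by (auto simp: conc_def)
    note d = drop_eq_appendD[OF *(3) i]
    have "run w p (i, c) (i + length u, c)" using p[OF i] * by blast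
    moreover have "run w q (i + length u, c) s" using q[of "i + length u" w] d * by blast
    ultimately show "run w (Seq p q) (i, c) s" by auto
  qed
  then show ?thesis unfolding readable_def by blast
qed

lemma readable_Un:
  assumes "readable X" "readable Y"
  shows "readable (X \<union> Y)"
proof -
  from assms(1) obtain p where p: "\<And>w i c s. i \<le> length w \<Longrightarrow>
     (run w p (i, c) s \<longleftrightarrow> (\<exists>u v. u \<in> X \<and> drop i w = u @ v \<and> s = (i + length u, c)))"
    unfolding readable_def by blast
  from assms(2) obtain q where q: "\<And>w i c s. i \<le> length w \<Longrightarrow>
     (run w q (i, c) s \<longleftrightarrow> (\<exists>u v. u \<in> Y \<and> drop i w = u @ v \<and> s = (i + length u, c)))"
    unfolding readable_def by blast
  have "run w (Alt p q) (i, c) s \<longleftrightarrow> (\<exists>u v. u \<in> X \<union> Y \<and> drop i w = u @ v \<and> s = (i + length u, c))"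
    if "i \<le> length w" for w i c s
    unfolding run.simps p[OF that] q[OF that] by blast
  then show ?thesis unfolding readable_def by blast
qed

lemma readable_stars:
  assumes "readable X"
  shows "readable (stars X)"
proof -
  from assms(1) obtain p where p: "\<And>w i c s. i \<le> length w \<Longrightarrow>
     (run w p (i, c) s \<longleftrightarrow> (\<exists>u v. u \<in> X \<and> drop i w = u @ v \<and> s = (i + length u, c)))"
    unfolding readable_def by blast
  have "run w (Star p) (i, c) s \<longleftrightarrow> (\<exists>u v. u \<in> stars X \<and> drop i w = u @ v \<and> s = (i + length u, c))"
    if i: "i \<le> length w" for w i c s
  proof
    assume "run w (Star p) (i, c) s"
    then have "(run w p)\<^sup>*\<^sup>* (i, c) s" by simp
    then show "\<exists>u v. u \<in> stars X \<and> drop i w = u @ v \<and> s = (i + length u, c)"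
    proof induction
      case base
      have "[] \<in> stars X" by (auto simp: stars_def intro: exI[of _ "[]"])
      then show ?case by (intro exI[of _ "[]"] exI[of _ "drop i w"]) simp
    next
      case (step s t)
      then obtain us v where u: "set us \<subseteq> X" "drop i w = concat us @ v" "s = (i + length (concat us), c)"
        by (auto simp: stars_def)
      note d = drop_eq_appendD[OF u(2) i]
      from step.hyps(2) u(3) p[of "i + length (concat us)"] d obtain u' v' where
        u': "u' \<in> X" "drop (i + length (concat us)) w = u' @ v'" "t = (i + length (concat us) + length u', c)" by blast
      have "concat (us @ [u']) \<in> stars X" unfolding stars_def using u(1) u'(1) by (intro CollectI exI[of _ "us @ [u']"]) simp
      moreover have "drop i w = concat (us @ [u']) @ v'" "t = (i + length (concat (us @ [u'])), c)"
        using u u' d by simp_all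
      ultimately show ?case by blast
    qed
  next
    assume "\<exists>u v. u \<in> stars X \<and> drop i w = u @ v \<and> s = (i + length u, c)"
    then obtain us v where us: "set us \<subseteq> X" "drop i w = concat us @ v" "s = (i + length (concat us), c)"
      by (auto simp: stars_def)
    from us(1,2) have "(run w p)\<^sup>*\<^sup>* (i, c) (i + length (concat us), c)"
    proof (induction us arbitrary: v rule: rev_induct)
      case (snoc u us)
      then have "drop i w = concat us @ (u @ v)" by simp
      note d = drop_eq_appendD[OF this i]
      have "(run w p)\<^sup>*\<^sup>* (i, c) (i + length (concat us), c)"
        by (rule snoc.IH[of "u @ v"]) (use snoc.prems in auto)
      moreover have "run w p (i + length (concat us), c) (i + length (concat us) + length u, c)"
        using p[of "i + length (concat us)" w] d snoc.prems(1) by auto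
      ultimately show ?case by (simp add: add.assoc)
    qed simp
    with us(3) show "run w (Star p) (i, c) s" by simp
  qed
  then show ?thesis unfolding readable_def by blast
qed

lemma rewind:
  assumes "n \<le> length w + 1"
  shows "(run w (Atom (Move MoveLeft)))\<^sup>*\<^sup>* (n, c) s \<longleftrightarrow> (\<exists>m\<le>n. s = (n - m, c))"
proof
  assume "(run w (Atom (Move MoveLeft)))\<^sup>*\<^sup>* (n, c) s"
  then show "\<exists>m\<le>n. s = (n - m, c)"
  proof induction
    case (step s t)
    then obtain m where m: "m \<le> n" "s = (n - m, c)" by blast
    with step.hyps(2) assms have "t = (n - m - 1, c)" by auto
    then show ?case using m by (cases "m < n") (auto intro: exI[of _ "Suc m"] exI[of _ n])
  qed auto
next
  have "(run w (Atom (Move MoveLeft)))\<^sup>*\<^sup>* (n, c) (n - m, c)" if "m \<le> n" for m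
    using that
  proof (induction m)
    case (Suc m)
    have "run w (Atom (Move MoveLeft)) (n - m, c) (n - Suc m, c)"
      using assms by auto
    with Suc show ?case by (meson Suc_leD rtranclp.rtrancl_into_rtrancl)
  qed simp
  then show "\<exists>m\<le>n. s = (n - m, c) \<Longrightarrow> (run w (Atom (Move MoveLeft)))\<^sup>*\<^sup>* (n, c) s" by blast
qed

text \<open>Demanding the right end marker next forces the factor just read to be the whole input.
  The head returns by guessing a number of left moves and checking for the left end marker.\<close>

lemma test_readable:
  assumes "readable X"
  shows "test k (\<lambda>w c. w \<in> X)"
proof -
  from assms(1) obtain p where p: "\<And>w i c s. i \<le> length w \<Longrightarrow>
     (run w p (i, c) s \<longleftrightarrow> (\<exists>u v. u \<in> X \<and> drop i w = u @ v \<and> s = (i + length u, c)))"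
    unfolding readable_def by blast
  let ?p = "Seq p (Seq (Atom (Move MoveRight)) (Seq (Atom (Scan RightEnd))
    (Seq (Star (Atom (Move MoveLeft))) (Atom (Scan LeftEnd)))))"
  show ?thesis unfolding test_def
  proof (rule actionI[of _ ?p])
    fix w :: "'a list" and c s
    assume c: "ok w k c"
    have "run w ?p (0, c) s \<longleftrightarrow> (\<exists>u v. u \<in> X \<and> w = u @ v \<and> scan w (Suc (length u)) = RightEnd \<and>
        (\<exists>t. (run w (Atom (Move MoveLeft)))\<^sup>*\<^sup>* (Suc (length u), c) t \<and> exec w (Scan LeftEnd) t s))"
    proof -
      let ?q = "Seq (Atom (Move MoveRight)) (Seq (Atom (Scan RightEnd))
        (Seq (Star (Atom (Move MoveLeft))) (Atom (Scan LeftEnd))))"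
      have first: "run w (Seq p q) (0, c) s \<longleftrightarrow> (\<exists>u v. u \<in> X \<and> w = u @ v \<and> run w q (length u, c) s)" for q
        unfolding run.simps(2) relcompp_apply using p[of 0 w c] by auto
      have rest: "run w ?q (m, c) s \<longleftrightarrow> scan w (Suc m) = RightEnd \<and>
          (\<exists>t. (run w (Atom (Move MoveLeft)))\<^sup>*\<^sup>* (Suc m, c) t \<and> exec w (Scan LeftEnd) t s)" if "m \<le> length w" for m
        using that by (simp add: relcompp_apply del: split_paired_Ex)
      have "length u \<le> length w" if "w = u @ v" for u v using that by simp
      then show ?thesis unfolding first using rest by blast
    qed
    also have "\<dots> \<longleftrightarrow> w \<in> X \<and> (\<exists>t. (run w (Atom (Move MoveLeft)))\<^sup>*\<^sup>* (length w + 1, c) t \<and> exec w (Scan LeftEnd) t s)"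
    proof -
      have whole: "w = u @ v \<and> scan w (Suc (length u)) = RightEnd \<longleftrightarrow> w = u \<and> v = []" for u v
        unfolding scan_RightEnd_iff by auto
      have "(\<exists>u v. u \<in> X \<and> w = u @ v \<and> scan w (Suc (length u)) = RightEnd \<and> Q (length u)) \<longleftrightarrow>
          w \<in> X \<and> Q (length w)" for Q
      proof
        assume "\<exists>u v. u \<in> X \<and> w = u @ v \<and> scan w (Suc (length u)) = RightEnd \<and> Q (length u)"
        then obtain u v where *: "u \<in> X" "Q (length u)" and "w = u @ v \<and> scan w (Suc (length u)) = RightEnd"
          by (elim exE conjE) (rule that, assumption+, rule conjI)
        from this(3)[unfolded whole] * show "w \<in> X \<and> Q (length w)" by simp
      next
        assume "w \<in> X \<and> Q (length w)"
        then show "\<exists>u v. u \<in> X \<and> w = u @ v \<and> scan w (Suc (length u)) = RightEnd \<and> Q (length u)"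
          using whole[of w "[]"] by (intro exI[of _ w] exI[of _ "[]"]) simp
      qed
      from this[of "\<lambda>m. \<exists>t. (run w (Atom (Move MoveLeft)))\<^sup>*\<^sup>* (Suc m, c) t \<and> exec w (Scan LeftEnd) t s"]
      show ?thesis by (simp only: Suc_eq_plus1)
    qed
    also have "\<dots> \<longleftrightarrow> w \<in> X \<and> s = (0, c)"
      unfolding rewind[OF order_refl] by (auto simp: scan_def split: if_splits)
    finally show "run w ?p (0, c) s \<longleftrightarrow> (\<exists>c'. s = (0, c') \<and> ok w k c' \<and> c' = c \<and> w \<in> X)"
      using c by auto
  qed
qed

lemma range_concat_map: "range (\<lambda>xs. concat (map g xs)) = stars (range g)"
proof
  show "range (\<lambda>xs. concat (map g xs)) \<subseteq> stars (range g)"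
    by (auto simp: stars_def) (metis image_set set_map subset_UNIV image_mono)
  show "stars (range g) \<subseteq> range (\<lambda>xs. concat (map g xs))"
  proof
    fix u assume "u \<in> stars (range g)"
    then obtain us where us: "u = concat us" "set us \<subseteq> range g" by (auto simp: stars_def)
    from us(2) obtain xs where "us = map g xs" by (metis ex_map_conv subset_iff rangeE)
    with us(1) show "u \<in> range (\<lambda>xs. concat (map g xs))" by blast
  qed
qed

lemma range_replicate: "range (\<lambda>n. replicate n a) = stars {[a]}"
proof -
  have "range (\<lambda>n. replicate n a) = range (\<lambda>us :: unit list. concat (map (\<lambda>_. [a]) us))"
  proof
    show "range (\<lambda>n. replicate n a) \<subseteq> range (\<lambda>us :: unit list. concat (map (\<lambda>_. [a]) us))"
    proof
      fix u assume "u \<in> range (\<lambda>n. replicate n a)"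
      then obtain n where "u = replicate n a" by blast
      then have "u = concat (map (\<lambda>_. [a]) (replicate n ()))" by (induction n arbitrary: u) auto
      then show "u \<in> range (\<lambda>us :: unit list. concat (map (\<lambda>_. [a]) us))" by blast
    qed
    have "concat (map (\<lambda>_. [a]) us) = replicate (length us) a" for us :: "unit list"
      by (induction us) auto
    then show "range (\<lambda>us :: unit list. concat (map (\<lambda>_. [a]) us)) \<subseteq> range (\<lambda>n. replicate n a)" by auto
  qed
  also have "\<dots> = stars (range (\<lambda>_ :: unit. [a]))" by (rule range_concat_map)
  also have "range (\<lambda>_ :: unit. [a]) = {[a]}" by auto
  finally show ?thesis .
qed

lemma binary_double: "0 < x \<Longrightarrow> binary (2 * x) = binary x @ [Zero]" "0 < x \<Longrightarrow> binary (2 * x + 1) = binary x @ [One]"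
  by (subst binary.simps, simp)+

lemma binary_01: "binary 0 = [Zero]" "binary 1 = [One]"
  by (subst binary.simps, simp)+

text \<open>Appending a digit to the numeral of a positive x produces that of 2x or 2x + 1, so apart
  from the numeral of 0 these are exactly the digit words beginning with \<open>One\<close>.\<close>

lemma range_binary: "range binary = {[Zero]} \<union> conc {[One]} (stars ({[Zero]} \<union> {[One]}))"
proof
  have "binary x = [Zero] \<or> (\<exists>us. binary x = One # concat us \<and> set us \<subseteq> {[Zero], [One]})" for x
  proof (induction x rule: less_induct)
    case (less x)
    show ?case
    proof (cases "x < 2")
      case True
      then have "x = 0 \<or> x = 1" by auto
      then show ?thesis using binary_01 by (auto intro: exI[of _ "[]"])
    next
      case False
      then have "0 < x div 2" "x div 2 < x" by auto
      moreover have "binary (x div 2) \<noteq> [Zero]" using binary_inject[of "x div 2" 0] binary_01 calculation by auto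
      ultimately obtain us where us: "binary (x div 2) = One # concat us" "set us \<subseteq> {[Zero], [One]}"
        using less[of "x div 2"] by blast
      have "binary x = One # concat (us @ [[if even x then Zero else One]])"
        by (subst binary.simps) (use us False in simp)
      moreover have "set (us @ [[if even x then Zero else One]]) \<subseteq> {[Zero], [One]}" using us by auto
      ultimately show ?thesis by blast
    qed
  qed
  then show "range binary \<subseteq> {[Zero]} \<union> conc {[One]} (stars ({[Zero]} \<union> {[One]}))"
    by (fastforce simp: conc_def stars_def)
  have "\<exists>x>0. binary x = One # concat us" if "set us \<subseteq> {[Zero], [One]}" for us
    using that
  proof (induction us rule: rev_induct)
    case Nil
    then show ?case using binary_01 by (intro exI[of _ 1]) simp
  next
    case (snoc u us)
    then obtain x where x: "0 < x" "binary x = One # concat us" by auto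
    from snoc.prems have "u = [Zero] \<or> u = [One]" by auto
    with x binary_double[OF x(1)] have "binary (if u = [Zero] then 2 * x else 2 * x + 1) = One # concat (us @ [u])" by auto
    moreover have "0 < (if u = [Zero] then 2 * x else 2 * x + 1)" using x(1) by simp
    ultimately show ?case by blast
  qed
  note ones = this
  show "{[Zero]} \<union> conc {[One]} (stars ({[Zero]} \<union> {[One]})) \<subseteq> range binary"
  proof
    fix u assume "u \<in> {[Zero]} \<union> conc {[One]} (stars ({[Zero]} \<union> {[One]}))"
    then consider "u = [Zero]" | us where "set us \<subseteq> {[Zero], [One]}" "u = One # concat us"
      by (auto simp: conc_def stars_def)
    then show "u \<in> range binary"
    proof cases
      case 1
      then show ?thesis using binary_01(1) by (metis rangeI)
    next
      case (2 us)
      from ones[OF 2(1)] obtain x where "binary x = u" unfolding 2(2) by blast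
      then show ?thesis by blast
    qed
  qed
qed

lemma conc_single: "range (\<lambda>x. a # f x) = conc {[a]} (range f)"
  by (auto simp: conc_def)

lemma range_conc: "range (\<lambda>(x, y). f x @ g y) = conc (range f) (range g)"
  by (auto simp: conc_def)

text \<open>Being the encoding of some presentation is a regular condition, because arities and the
  range of elements are left unconstrained by it; those are checked separately by counting.\<close>

lemma readable_encodings: "readable (range encode)"
proof -
  have "readable (range (\<lambda>x. EltMark # binary x))"
    unfolding conc_single range_binary
    by (intro readable_conc readable_Un readable_stars readable_letter)
  then have "readable (range (\<lambda>t. TupleMark # encode_tuple t))"
    unfolding conc_single[of TupleMark] encode_tuple_def range_concat_map
    by (intro readable_conc readable_stars readable_letter)
  then have "readable (range (\<lambda>R. RelMark # encode_relation R))"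
    unfolding conc_single[of RelMark] encode_relation_def range_conc range_concat_map range_replicate
    by (intro readable_conc readable_stars readable_letter)
  then show ?thesis
    unfolding encode_def range_conc range_concat_map range_replicate
    by (intro readable_conc readable_stars readable_letter)
qed

section \<open>Locating relations, tuples and elements in the input word\<close>

subsection \<open>Positions in encoded structures\<close>

definition bits :: "letter set" where
  "bits = {Zero, One}"

definition bit_at :: "letter list \<Rightarrow> nat \<Rightarrow> bool" where
  "bit_at w x \<longleftrightarrow> scan w x = Letter Zero \<or> scan w x = Letter One"

text \<open>Only digits may lie in between, so the step never crosses a tuple or relation mark and
  hence stays within one tuple.\<close>

definition next_elt :: "letter list \<Rightarrow> nat \<Rightarrow> nat \<Rightarrow> bool" where
  "next_elt w x y \<longleftrightarrow> x < y \<and> scan w y = Letter EltMark \<and> (\<forall>z\<in>positions w. x < z \<and> z < y \<longrightarrow> bit_at w z)"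

lemma scan_Suc: "scan w (Suc i) = Letter a \<longleftrightarrow> i < length w \<and> w ! i = a"
  by (auto simp: scan_def)

lemma scan_Letter_iff: "scan w x = Letter a \<longleftrightarrow> 0 < x \<and> x \<le> length w \<and> w ! (x - 1) = a"
  by (cases x) (auto simp: scan_def)

lemma scan_drop: "scan w (Suc x + i) = Letter a \<longleftrightarrow> i < length (drop x w) \<and> drop x w ! i = a"
  unfolding add_Suc scan_Suc by (cases "x + i < length w") auto

lemma scan_append:
  assumes "drop x w = u @ a # v" "x \<le> length w"
  shows "scan w (x + length u + 1) = Letter a"
  using scan_drop[of w x "length u" a] assms by (simp add: nth_append)

lemma bit_at_drop: "bit_at w (Suc x + i) \<longleftrightarrow> i < length (drop x w) \<and> drop x w ! i \<in> bits"
  unfolding bit_at_def scan_drop bits_def by auto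

lemma split_at_unique:
  assumes "ds @ v = ds' @ v'" "set ds \<subseteq> bits" "set ds' \<subseteq> bits"
    "v = [] \<or> hd v \<notin> bits" "v' = [] \<or> hd v' \<notin> bits"
  shows "ds = ds' \<and> v = v'"
  using assms
proof (induction ds arbitrary: ds')
  case Nil
  then show ?case by (cases ds') auto
next
  case (Cons d ds)
  then show ?case by (cases ds') auto
qed

lemma next_elt_iff:
  assumes "drop x w = ds @ v" "set ds \<subseteq> bits" "v = [] \<or> hd v \<notin> bits" "x \<le> length w"
  shows "next_elt w x y \<longleftrightarrow> y = x + length ds + 1 \<and> v \<noteq> [] \<and> hd v = EltMark"
proof
  assume n: "next_elt w x y"
  then obtain i where y: "y = Suc x + i" by (auto simp: next_elt_def less_iff_Suc_add)
  have i: "i < length (drop x w)" "drop x w ! i = EltMark"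
    using n scan_drop[of w x i EltMark] y by (auto simp: next_elt_def)
  have b: "drop x w ! j \<in> bits" if "j < i" for j
  proof -
    have "Suc x + j \<in> positions w" using i(1) that assms(4) by simp
    with n that y have "bit_at w (Suc x + j)" unfolding next_elt_def by auto
    then show ?thesis by (simp only: bit_at_drop)
  qed
  have "take i (drop x w) @ drop i (drop x w) = ds @ v"
    unfolding append_take_drop_id by (fact assms(1))
  moreover have "set (take i (drop x w)) \<subseteq> bits" using b i(1) by (auto simp: in_set_conv_nth)
  moreover have "hd (drop i (drop x w)) = EltMark" "drop i (drop x w) \<noteq> []" using i by (simp_all add: hd_drop_conv_nth add.commute)
  moreover have "EltMark \<notin> bits" by (simp add: bits_def)
  ultimately have eq: "take i (drop x w) = ds" "drop i (drop x w) = v"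
    using split_at_unique[of "take i (drop x w)" "drop i (drop x w)" ds v] assms(2,3) by auto
  have "length ds = i" using eq(1) i(1) by auto
  with eq(2) i y show "y = x + length ds + 1 \<and> v \<noteq> [] \<and> hd v = EltMark"
    using \<open>hd (drop i (drop x w)) = EltMark\<close> by auto
next
  assume R: "y = x + length ds + 1 \<and> v \<noteq> [] \<and> hd v = EltMark"
  then obtain v' where "v = EltMark # v'" by (cases v) auto
  with assms R have "scan w y = Letter EltMark" using scan_append[of x w ds EltMark v'] by simp
  moreover have "bit_at w z" if "x < z" "z < y" for z
  proof -
    have "Suc x \<le> z" using that(1) by simp
    then obtain j where z: "z = Suc x + j" using le_Suc_ex by blast
    then have "j < length ds" using that(2) R by simp
    then show ?thesis unfolding z bit_at_drop using assms(1,2) by (auto simp: nth_append)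
  qed
  ultimately show "next_elt w x y" using R by (simp add: next_elt_def)
qed

text \<open>
  The position of the \<open>k\<close>-th element marker of a tuple whose marker is at \<open>S\<close>; the tuple marker
  itself counts as number \<open>0\<close>.
\<close>

definition elt_pos :: "nat \<Rightarrow> nat list \<Rightarrow> nat \<Rightarrow> nat" where
  "elt_pos S t k = (if k = 0 then S else S + length (encode_tuple (take (k - 1) t)) + 1)"

text \<open>The condition on the rest of the word makes the tuple maximal, so it is determined by
  its position.\<close>

definition tuple_at :: "letter list \<Rightarrow> nat \<Rightarrow> nat list \<Rightarrow> bool" where
  "tuple_at w S t \<longleftrightarrow> S \<le> length w \<and>
     (\<exists>v. drop S w = encode_tuple t @ v \<and> (v = [] \<or> hd v = TupleMark \<or> hd v = RelMark))"

lemma set_binary_bits: "set (binary x) \<subseteq> bits"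
  using set_binary by (simp add: bits_def)

lemma encode_tuple_Cons: "encode_tuple (a # t) = EltMark # binary a @ encode_tuple t"
  by (simp add: encode_tuple_def)

lemma encode_tuple_append: "encode_tuple (s @ t) = encode_tuple s @ encode_tuple t"
  by (simp add: encode_tuple_def)

lemma drop_elt_pos:
  assumes "drop S w = encode_tuple t @ v" "S \<le> length w" "k < length t"
  shows "drop (elt_pos S t (Suc k)) w = binary (t ! k) @ encode_tuple (drop (Suc k) t) @ v"
    "elt_pos S t (Suc k) \<le> length w"
proof -
  let ?u = "encode_tuple (take k t)"
  have "t = take k t @ t ! k # drop (Suc k) t" using assms(3) by (rule id_take_nth_drop)
  then have t: "encode_tuple t = ?u @ EltMark # binary (t ! k) @ encode_tuple (drop (Suc k) t)"
    by (metis encode_tuple_append encode_tuple_Cons)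
  then have d: "drop S w = ?u @ EltMark # (binary (t ! k) @ encode_tuple (drop (Suc k) t) @ v)"
    using assms(1) by simp
  have "length w - S = length ?u + 1 + length (binary (t ! k) @ encode_tuple (drop (Suc k) t) @ v)"
    using arg_cong[OF d, of length] by simp
  then show "elt_pos S t (Suc k) \<le> length w" using assms(2) by (simp add: elt_pos_def)
  have "drop (elt_pos S t (Suc k)) w = drop (length ?u + 1) (drop S w)"
    by (simp add: elt_pos_def add.commute add.left_commute)
  also have "\<dots> = binary (t ! k) @ encode_tuple (drop (Suc k) t) @ v" unfolding d by simp
  finally show "drop (elt_pos S t (Suc k)) w = binary (t ! k) @ encode_tuple (drop (Suc k) t) @ v" .
qed

lemma tail_not_bit:
  assumes "v = [] \<or> hd v = TupleMark \<or> hd v = RelMark"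
  shows "encode_tuple t @ v = [] \<or> hd (encode_tuple t @ v) \<notin> bits"
    "encode_tuple t @ v \<noteq> [] \<and> hd (encode_tuple t @ v) = EltMark \<longleftrightarrow> t \<noteq> []"
proof -
  have nil: "encode_tuple [] = []" by (simp add: encode_tuple_def)
  show "encode_tuple t @ v = [] \<or> hd (encode_tuple t @ v) \<notin> bits"
    using assms by (cases t) (auto simp: encode_tuple_Cons nil bits_def)
  show "encode_tuple t @ v \<noteq> [] \<and> hd (encode_tuple t @ v) = EltMark \<longleftrightarrow> t \<noteq> []"
    using assms by (cases t) (auto simp: encode_tuple_Cons nil)
qed

lemma next_elt_pos:
  assumes "tuple_at w S t" "k \<le> length t"
  shows "next_elt w (elt_pos S t k) y \<longleftrightarrow> k < length t \<and> y = elt_pos S t (Suc k)" "elt_pos S t k \<le> length w"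
proof -
  from assms(1) obtain v where S: "S \<le> length w" and d: "drop S w = encode_tuple t @ v"
    and v: "v = [] \<or> hd v = TupleMark \<or> hd v = RelMark" by (auto simp: tuple_at_def)
  show "next_elt w (elt_pos S t k) y \<longleftrightarrow> k < length t \<and> y = elt_pos S t (Suc k)"
  proof (cases k)
    case 0
    have "next_elt w S y \<longleftrightarrow> y = S + length ([] :: letter list) + 1 \<and> encode_tuple t @ v \<noteq> [] \<and> hd (encode_tuple t @ v) = EltMark"
      by (rule next_elt_iff) (use d S tail_not_bit(1)[OF v, of t] in auto)
    with 0 show ?thesis unfolding tail_not_bit(2)[OF v] by (auto simp: elt_pos_def encode_tuple_def)
  next
    case (Suc j)
    then have j: "j < length t" using assms(2) by simp
    let ?v = "encode_tuple (drop (Suc j) t) @ v"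
    have "next_elt w (elt_pos S t (Suc j)) y \<longleftrightarrow>
        y = elt_pos S t (Suc j) + length (binary (t ! j)) + 1 \<and> ?v \<noteq> [] \<and> hd ?v = EltMark"
      by (rule next_elt_iff)
        (use drop_elt_pos[OF d S j] tail_not_bit(1)[OF v, of "drop (Suc j) t"] set_binary_bits in auto)
    moreover have "encode_tuple (take (Suc j) t) = encode_tuple (take j t) @ EltMark # binary (t ! j)"
      using j by (simp add: take_Suc_conv_app_nth encode_tuple_append encode_tuple_Cons) (simp add: encode_tuple_def)
    then have "elt_pos S t (Suc j) + length (binary (t ! j)) + 1 = elt_pos S t (Suc (Suc j))"
      by (simp add: elt_pos_def)
    ultimately show ?thesis unfolding tail_not_bit(2)[OF v] Suc by auto
  qed
  show "elt_pos S t k \<le> length w"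
    using drop_elt_pos(2)[OF d S, of "k - 1"] S assms(2) by (cases k) (auto simp: elt_pos_def)
qed

definition bits_from :: "letter list \<Rightarrow> nat \<Rightarrow> letter list" where
  "bits_from w x = takeWhile (\<lambda>a. a \<in> bits) (drop x w)"

lemma bits_from_elt_pos:
  assumes "tuple_at w S t" "k < length t"
  shows "bits_from w (elt_pos S t (Suc k)) = binary (t ! k)"
proof -
  from assms(1) obtain v where S: "S \<le> length w" and d: "drop S w = encode_tuple t @ v"
    and v: "v = [] \<or> hd v = TupleMark \<or> hd v = RelMark" by (auto simp: tuple_at_def)
  let ?v = "encode_tuple (drop (Suc k) t) @ v"
  have "takeWhile (\<lambda>a. a \<in> bits) ?v = []"
    using tail_not_bit(1)[OF v, of "drop (Suc k) t"] by (cases ?v) (auto simp del: append_is_Nil_conv)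
  moreover have "\<forall>a\<in>set (binary (t ! k)). a \<in> bits" using set_binary_bits by auto
  ultimately show ?thesis unfolding bits_from_def drop_elt_pos(1)[OF d S assms(2)]
    by (subst takeWhile_append2) auto
qed

lemma path_chain:
  assumes "\<And>m z. m \<le> M \<Longrightarrow> f m \<in> positions w \<times> positions w \<and> z \<in> positions w \<times> positions w \<and>
      (case f m of (x, y) \<Rightarrow> case z of (x', y') \<Rightarrow> R x y x' y') \<longleftrightarrow> m < M \<and> z = f (Suc m)"
  shows "path w R (f 0) z \<longleftrightarrow> (\<exists>m\<le>M. z = f m)"
  unfolding path_def star_on_def
proof (rule star_chain)
  fix m d assume "m \<le> M"
  from assms[OF this, of d]
  show "f m \<in> positions w \<times> positions w \<and> d \<in> positions w \<times> positions w \<and> (case f m of (x, y) \<Rightarrow> \<lambda>(x', y'). R x y x' y') d \<longleftrightarrow>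
      m < M \<and> d = f (Suc m)"
    by (cases "f m"; cases d) (simp only: prod.case)
qed

text \<open>The two numerals are read in step, and since both must be followed by a non-digit at the
  same moment, they have equal length. Equality of digit words is equality of numbers because
  numerals are unique.\<close>

definition same_value :: "letter list \<Rightarrow> nat \<Rightarrow> nat \<Rightarrow> bool" where
  "same_value w p q \<longleftrightarrow> (\<exists>x\<in>positions w. \<exists>y\<in>positions w.
     path w (\<lambda>x y x' y'. x' = Suc x \<and> y' = Suc y \<and>
       (scan w x' = Letter Zero \<and> scan w y' = Letter Zero \<or> scan w x' = Letter One \<and> scan w y' = Letter One))
       (p, q) (x, y) \<and>
     (\<exists>x'\<in>positions w. x' = Suc x \<and> \<not> bit_at w x') \<and> (\<exists>y'\<in>positions w. y' = Suc y \<and> \<not> bit_at w y'))"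

lemma same_value_iff:
  assumes "p \<le> length w" "q \<le> length w"
  shows "same_value w p q \<longleftrightarrow> bits_from w p = bits_from w q"
proof -
  let ?A = "drop p w" and ?B = "drop q w"
  let ?P = "\<lambda>a. a \<in> bits"
  let ?R = "\<lambda>x y x' y'. x' = Suc x \<and> y' = Suc y \<and>
    (scan w x' = Letter Zero \<and> scan w y' = Letter Zero \<or> scan w x' = Letter One \<and> scan w y' = Letter One)"
  have R: "?R (p + m) (q + m) x' y' \<longleftrightarrow> x' = p + Suc m \<and> y' = q + Suc m \<and>
      m < length ?A \<and> m < length ?B \<and> ?A ! m = ?B ! m \<and> ?A ! m \<in> bits" for m x' y'
  proof (cases "x' = Suc p + m \<and> y' = Suc q + m")
    case True
    have "(m < length ?A \<and> ?A ! m = Zero) \<and> (m < length ?B \<and> ?B ! m = Zero) \<or>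
        (m < length ?A \<and> ?A ! m = One) \<and> (m < length ?B \<and> ?B ! m = One) \<longleftrightarrow>
      m < length ?A \<and> m < length ?B \<and> ?A ! m = ?B ! m \<and> ?A ! m \<in> bits"
      unfolding bits_def by (auto simp del: length_drop nth_drop)
    then show ?thesis using True by (simp only: scan_drop) (simp del: length_drop nth_drop)
  qed auto
  have sound: "\<exists>m. z = (p + m, q + m) \<and> m \<le> length ?A \<and> m \<le> length ?B \<and> take m ?A = take m ?B \<and> set (take m ?A) \<subseteq> bits"
    if "path w ?R (p, q) z" for z
    using that unfolding path_def
  proof (induction rule: star_on_induct)
    case base
    then show ?case by (intro exI[of _ 0]) simp
  next
    case (step y z)
    then obtain m where m: "y = (p + m, q + m)" "take m ?A = take m ?B" "set (take m ?A) \<subseteq> bits" by auto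
    obtain x' y' where z: "z = (x', y')" by (cases z)
    have "?R (p + m) (q + m) x' y'" using step.hyps(4)[unfolded m(1) z prod.case] .
    note r = this[unfolded R]
    then have "take (Suc m) ?A = take m ?A @ [?A ! m]" "take (Suc m) ?B = take m ?B @ [?B ! m]"
      by (simp_all only: take_Suc_conv_app_nth)
    with r m z show ?case by (intro exI[of _ "Suc m"]) auto
  qed
  have complete: "path w ?R (p, q) (p + m, q + m)"
    if "m \<le> length ?A" "m \<le> length ?B" "take m ?A = take m ?B" "set (take m ?A) \<subseteq> bits" for m
    using that
  proof (induction m)
    case 0
    then show ?case by (simp add: path_def star_on_refl)
  next
    case (Suc m)
    have t: "take (Suc m) ?A = take m ?A @ [?A ! m]" "take (Suc m) ?B = take m ?B @ [?B ! m]"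
      using Suc.prems by (simp_all add: take_Suc_conv_app_nth del: nth_drop)
    with Suc.prems have e: "take m ?A = take m ?B" "set (take m ?A) \<subseteq> bits" "?A ! m = ?B ! m" "?A ! m \<in> bits"
      by (simp_all del: nth_drop)
    have "path w ?R (p, q) (p + m, q + m)" by (rule Suc.IH) (use Suc.prems e in auto)
    moreover have "?R (p + m) (q + m) (p + Suc m) (q + Suc m)" unfolding R using Suc.prems e by auto
    ultimately show ?case unfolding path_def
      by (rule_tac star_on_step) (use Suc.prems assms in auto)
  qed
  have stop: "(\<exists>x'\<in>positions w. x' = Suc (p + m) \<and> \<not> bit_at w x') \<longleftrightarrow> \<not> (m < length (drop p w) \<and> drop p w ! m \<in> bits)"
    if "m \<le> length (drop p w)" "p \<le> length w" for m p
    using bit_at_drop[of w p m] that by auto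
  have len: "length (takeWhile ?P xs) = m \<and> takeWhile ?P xs = take m xs"
    if "set (take m xs) \<subseteq> bits" "\<not> (m < length xs \<and> xs ! m \<in> bits)" "m \<le> length xs" for m and xs :: "letter list"
  proof -
    have "xs = take m xs @ drop m xs" by simp
    moreover have "takeWhile ?P (drop m xs) = []"
      using that(2,3) by (cases "drop m xs") (auto dest: nth_via_drop)
    moreover have "takeWhile ?P (take m xs @ drop m xs) = take m xs @ takeWhile ?P (drop m xs)"
      using that(1) by (intro takeWhile_append2) auto
    ultimately show ?thesis using that(3) by simp
  qed
  show ?thesis
  proof
    assume "same_value w p q"
    then obtain x y where xy: "path w ?R (p, q) (x, y)" "\<exists>x'\<in>positions w. x' = Suc x \<and> \<not> bit_at w x'"
      "\<exists>y'\<in>positions w. y' = Suc y \<and> \<not> bit_at w y'" unfolding same_value_def by blast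
    from sound[OF xy(1)] obtain m where m: "x = p + m" "y = q + m" "m \<le> length ?A" "m \<le> length ?B"
      "take m ?A = take m ?B" "set (take m ?A) \<subseteq> bits" by auto
    have "takeWhile ?P ?A = take m ?A" "takeWhile ?P ?B = take m ?B"
      using len[of m ?A] len[of m ?B] stop[OF m(3) assms(1)] stop[OF m(4) assms(2)] xy m by auto
    with m(5) show "bits_from w p = bits_from w q" by (simp add: bits_from_def)
  next
    assume eq: "bits_from w p = bits_from w q"
    define m where "m = length (bits_from w p)"
    have split: "take m ?A = bits_from w p" "take m ?B = bits_from w q" "m \<le> length ?A" "m \<le> length ?B"
      "\<not> (m < length ?A \<and> ?A ! m \<in> bits)" "\<not> (m < length ?B \<and> ?B ! m \<in> bits)"
      using takeWhile_eq_take[of ?P ?A] takeWhile_eq_take[of ?P ?B] nth_length_takeWhile[of ?P ?A]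
        nth_length_takeWhile[of ?P ?B] length_takeWhile_le[of ?P ?A] length_takeWhile_le[of ?P ?B] eq
      unfolding m_def bits_from_def by (auto simp del: nth_drop length_drop)
    have "set (bits_from w p) \<subseteq> bits" unfolding bits_from_def by (auto dest: set_takeWhileD)
    with split eq have "path w ?R (p, q) (p + m, q + m)" by (intro complete) simp_all
    moreover have "p + m \<in> positions w" "q + m \<in> positions w" using split(3,4) assms by auto
    ultimately show "same_value w p q"
      unfolding same_value_def using stop[OF split(3) assms(1)] stop[OF split(4) assms(2)] split(5,6) by blast
  qed
qed

text \<open>For a mark that lies deeper than the block mark \<open>a\<close>: its occurrence must
  fall into the body of some block. Applied level by level, this leads from a position in the word
  to relation, tuple and element.\<close>

lemma split_blocks:
  assumes "u0 @ concat (map (\<lambda>x. a # g x) xs) = u @ m # v" "m \<noteq> a" "m \<notin> set u0"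
  obtains xs1 x xs2 u1 v1 where "xs = xs1 @ x # xs2" "u = u0 @ concat (map (\<lambda>x. a # g x) xs1) @ a # u1"
    "g x = u1 @ m # v1" "v = v1 @ concat (map (\<lambda>x. a # g x) xs2)"
proof -
  have "\<exists>xs1 x xs2 u1 v1. xs = xs1 @ x # xs2 \<and> u = u0 @ concat (map (\<lambda>x. a # g x) xs1) @ a # u1 \<and>
    g x = u1 @ m # v1 \<and> v = v1 @ concat (map (\<lambda>x. a # g x) xs2)"
    using assms
  proof (induction xs arbitrary: u0 u)
    case Nil
    then show ?case by auto
  next
    case (Cons x xs)
    let ?B = "concat (map (\<lambda>x. a # g x) xs)"
    have eq: "(u0 @ a # g x) @ ?B = u @ m # v" using Cons.prems(1) by simp
    show ?case
    proof (cases "length u < length (u0 @ a # g x)")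
      case True
      from append_eq_append_conv2[THEN iffD1, OF eq] obtain us where
        "u0 @ a # g x = u @ us \<and> us @ ?B = m # v \<or> (u0 @ a # g x) @ us = u \<and> ?B = us @ m # v" by (elim exE)
      moreover have "(u0 @ a # g x) @ us \<noteq> u" using True by auto
      ultimately have us: "u0 @ a # g x = u @ us" "us @ ?B = m # v" by argo+
      have "us \<noteq> []" using True us(1) by auto
      with us(2) obtain b where "us = m # b" by (cases us) auto
      with us have b: "u0 @ a # g x = u @ m # b" "b @ ?B = v" by simp_all
      from append_eq_append_conv2[THEN iffD1, OF b(1)] obtain c where
        "u0 = u @ c \<and> c @ a # g x = m # b \<or> u0 @ c = u \<and> a # g x = c @ m # b" by (elim exE)
      moreover have "\<not> (u0 = u @ c \<and> c @ a # g x = m # b)" using Cons.prems(2,3) by (cases c) auto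
      ultimately have c: "u = u0 @ c" "a # g x = c @ m # b" by argo+
      then obtain u1 where "c = a # u1" "g x = u1 @ m # b" using Cons.prems(2) by (cases c) auto
      with b c show ?thesis by (intro exI[of _ "[]"] exI[of _ x] exI[of _ xs] exI[of _ u1] exI[of _ b]) simp
    next
      case False
      then have "length (u0 @ a # g x) \<le> length u" by simp
      from append_eq_append_conv_if[THEN iffD1, OF eq] this have
        u: "u0 @ a # g x = take (length (u0 @ a # g x)) u" and B: "?B = drop (length (u0 @ a # g x)) u @ m # v"
        by (simp_all only: if_True)
      define u2 where "u2 = drop (length (u0 @ a # g x)) u"
      have u2: "u = (u0 @ a # g x) @ u2" "?B = u2 @ m # v"
        unfolding u2_def by (subst u) (simp_all only: append_take_drop_id B)
      have "[] @ ?B = u2 @ m # v" using u2 by simp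
      from Cons.IH[OF this Cons.prems(2)] obtain xs1 y xs2 u1 v1 where
        "xs = xs1 @ y # xs2" "u2 = concat (map (\<lambda>x. a # g x) xs1) @ a # u1" "g y = u1 @ m # v1"
        "v = v1 @ concat (map (\<lambda>x. a # g x) xs2)" by auto
      with u2(1) show ?thesis
        by (intro exI[of _ "x # xs1"] exI[of _ y] exI[of _ xs2] exI[of _ u1] exI[of _ v1]) simp
    qed
  qed
  then show thesis using that by blast
qed

text \<open>The companion of \<open>split_blocks\<close> for an occurrence of the block mark
  itself.\<close>

lemma split_at_mark:
  assumes "u0 @ concat (map (\<lambda>x. m # g x) xs) = u @ m # v" "m \<notin> set u0" "\<And>x. m \<notin> set (g x)"
  obtains xs1 x xs2 where "xs = xs1 @ x # xs2" "u = u0 @ concat (map (\<lambda>x. m # g x) xs1)"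
    "v = g x @ concat (map (\<lambda>x. m # g x) xs2)"
proof -
  have "\<exists>xs1 x xs2. xs = xs1 @ x # xs2 \<and> u = u0 @ concat (map (\<lambda>x. m # g x) xs1) \<and>
    v = g x @ concat (map (\<lambda>x. m # g x) xs2)"
    using assms(1,2)
  proof (induction xs arbitrary: u0 u)
    case Nil
    then show ?case by auto
  next
    case (Cons x xs)
    let ?B = "concat (map (\<lambda>x. m # g x) xs)"
    have eq: "u0 @ m # (g x @ ?B) = u @ m # v" using Cons.prems(1) by simp
    show ?case
    proof (cases "m \<in> set u")
      case False
      then have "u0 = u" "g x @ ?B = v" using first_occurrence_unique[OF Cons.prems(2) _ eq] by auto
      then show ?thesis by (intro exI[of _ "[]"] exI[of _ x] exI[of _ xs]) simp
    next
      case True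
      then obtain p q where u: "u = p @ m # q" "m \<notin> set p" by (meson split_list_first)
      have "u0 @ m # (g x @ ?B) = p @ m # (q @ m # v)" using eq u by simp
      from first_occurrence_unique[OF Cons.prems(2) u(2) this]
      have p: "u0 = p" and "g x @ ?B = q @ m # v" by auto
      from Cons.IH[OF this(2) assms(3)] obtain xs1 y xs2 where
        "xs = xs1 @ y # xs2" "q = g x @ concat (map (\<lambda>x. m # g x) xs1)" "v = g y @ concat (map (\<lambda>x. m # g x) xs2)"
        by blast
      with u p show ?thesis
        by (intro exI[of _ "x # xs1"] exI[of _ y] exI[of _ xs2]) simp
    qed
  qed
  then show thesis using that by blast
qed

lemma encode_split: "encode (n, rs1 @ R # rs2) = encode (n, rs1) @ RelMark # encode_relation R @ concat (map (\<lambda>R. RelMark # encode_relation R) rs2)"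
  by (simp add: encode_def)

lemma encode_relation_split: "encode_relation (r, ts1 @ t # ts2) =
    encode_relation (r, ts1) @ TupleMark # encode_tuple t @ concat (map (\<lambda>t. TupleMark # encode_tuple t) ts2)"
  by (simp add: encode_relation_def)

lemma scan_mark: "scan w p = Letter m \<longleftrightarrow> (\<exists>u v. w = u @ m # v \<and> p = length u + 1)"
proof
  assume "scan w p = Letter m"
  then have p: "0 < p" "p - 1 < length w" "w ! (p - 1) = m" by (auto simp: scan_Letter_iff)
  from id_take_nth_drop[OF p(2)] have "w = take (p - 1) w @ m # drop (Suc (p - 1)) w" using p by simp
  moreover have "p = length (take (p - 1) w) + 1" using p by simp
  ultimately show "\<exists>u v. w = u @ m # v \<and> p = length u + 1" by blast
next
  assume "\<exists>u v. w = u @ m # v \<and> p = length u + 1"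
  then show "scan w p = Letter m" by (auto simp: scan_Letter_iff nth_append)
qed

lemma hd_blocks: "concat (map (\<lambda>x. m # g x) xs) @ v = [] \<or> hd (concat (map (\<lambda>x. m # g x) xs) @ v) = m \<or> xs = []"
  by (cases xs) auto

lemma RelMark_fresh: "RelMark \<notin> set (encode_relation R)"
  using set_encode_relation[of R] by auto

lemma TupleMark_fresh: "TupleMark \<notin> set (encode_tuple t)" "RelMark \<notin> set (encode_tuple t)"
  using set_encode_tuple[of t] by auto

definition rel_of :: "letter list \<Rightarrow> nat \<Rightarrow> nat \<Rightarrow> bool" where
  "rel_of w G S \<longleftrightarrow> scan w G = Letter RelMark \<and> scan w S = Letter TupleMark \<and> G < S \<and>
     (\<forall>z\<in>positions w. G < z \<and> z < S \<longrightarrow> scan w z \<noteq> Letter RelMark)"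

definition relation_at :: "presentation \<Rightarrow> nat \<Rightarrow> nat \<times> nat list list \<Rightarrow> bool" where
  "relation_at = (\<lambda>(n, rs) G R. \<exists>rs1 rs2. rs = rs1 @ R # rs2 \<and> G = length (encode (n, rs1)) + 1)"

text \<open>The position fixes the length of the encoded prefix, hence the prefix itself, and
  injectivity of \<open>encode\<close> recovers the relations that precede.\<close>

lemma relation_at_unique:
  assumes "relation_at P G R" "relation_at P G R'"
  shows "R = R'"
proof -
  obtain n rs where P: "P = (n, rs)" by (cases P)
  from assms obtain rs1 rs2 rs1' rs2' where *: "rs = rs1 @ R # rs2" "G = length (encode (n, rs1)) + 1"
    "rs = rs1' @ R' # rs2'" "G = length (encode (n, rs1')) + 1" unfolding relation_at_def P prod.case by blast
  then have "encode (n, rs1 @ R # rs2) = encode (n, rs1' @ R' # rs2')" by simp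
  then have "encode (n, rs1) = encode (n, rs1')" using *(2,4) unfolding encode_split by simp
  then have "rs1 = rs1'" using encode_inject by blast
  with * show ?thesis by simp
qed

lemma relation_at_iff: "R \<in> set rs \<longleftrightarrow> (\<exists>G. relation_at (n, rs) G R)"
  by (auto simp: relation_at_def in_set_conv_decomp)

lemma tuple_at_append:
  assumes "w = u @ TupleMark # encode_tuple t @ v" "v = [] \<or> hd v = TupleMark \<or> hd v = RelMark"
  shows "tuple_at w (length u + 1) t"
  using assms by (auto simp: tuple_at_def)

lemma tuple_at_encode_tuple:
  assumes "tuple_at w S t"
  shows "encode_tuple t = takeWhile (\<lambda>a. a \<noteq> TupleMark \<and> a \<noteq> RelMark) (drop S w)"
proof -
  from assms obtain v where d: "drop S w = encode_tuple t @ v" and v: "v = [] \<or> hd v = TupleMark \<or> hd v = RelMark"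
    by (auto simp: tuple_at_def)
  have "takeWhile (\<lambda>a. a \<noteq> TupleMark \<and> a \<noteq> RelMark) v = []" using v by (cases v) auto
  moreover have "takeWhile (\<lambda>a. a \<noteq> TupleMark \<and> a \<noteq> RelMark) (encode_tuple t @ v) =
      encode_tuple t @ takeWhile (\<lambda>a. a \<noteq> TupleMark \<and> a \<noteq> RelMark) v"
    using TupleMark_fresh[of t] by (intro takeWhile_append2) auto
  ultimately show ?thesis by (simp add: d)
qed

lemma tuple_at_unique: "tuple_at w S t \<Longrightarrow> tuple_at w S t' \<Longrightarrow> t = t'"
  by (rule encode_tuple_inject) (simp only: tuple_at_encode_tuple)

text \<open>The reference description of positions, computed from a decomposition of the
  presentation; predicates formulated on the word alone are compared with it. A relation may be
  listed repeatedly, and \<open>G\<close> tells the occurrences apart.\<close>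

definition tuple_in :: "presentation \<Rightarrow> nat \<Rightarrow> nat \<Rightarrow> nat \<times> nat list list \<Rightarrow> nat list \<Rightarrow> bool" where
  "tuple_in = (\<lambda>(n, rs) G S R t. \<exists>rs1 ts1 ts2 rs2. rs = rs1 @ R # rs2 \<and> snd R = ts1 @ t # ts2 \<and>
     G = length (encode (n, rs1)) + 1 \<and> S = G + length (encode_relation (fst R, ts1)) + 1)"

lemma tail_blocks: 
  fixes v :: "letter list"
  shows "(let v = concat (map (\<lambda>t. TupleMark # encode_tuple t) ts) @ concat (map (\<lambda>R. RelMark # encode_relation R) rs)
   in v = [] \<or> hd v = TupleMark \<or> hd v = RelMark)"
  by (cases ts; cases rs) (auto simp: Let_def)

lemma tuple_in_encode:
  assumes "tuple_in (n, rs) G S R t"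
  shows "relation_at (n, rs) G R" "t \<in> set (snd R)" "tuple_at (encode (n, rs)) S t" "rel_of (encode (n, rs)) G S"
    "scan (encode (n, rs)) S = Letter TupleMark"
proof -
  from assms obtain rs1 ts1 ts2 rs2 where rs: "rs = rs1 @ R # rs2" "snd R = ts1 @ t # ts2"
     and G: "G = length (encode (n, rs1)) + 1" and S: "S = G + length (encode_relation (fst R, ts1)) + 1"
    by (auto simp: tuple_in_def)
  show "relation_at (n, rs) G R" unfolding relation_at_def prod.case using rs(1) G by blast
  show "t \<in> set (snd R)" using rs by simp
  let ?u = "encode_relation (fst R, ts1)"
  let ?v = "concat (map (\<lambda>t. TupleMark # encode_tuple t) ts2) @ concat (map (\<lambda>R. RelMark # encode_relation R) rs2)"
  have R: "R = (fst R, ts1 @ t # ts2)" using rs by (cases R) simp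
  have "encode_relation R = ?u @ TupleMark # encode_tuple t @ concat (map (\<lambda>t. TupleMark # encode_tuple t) ts2)"
    by (subst R) (simp only: encode_relation_split)
  then have w: "encode (n, rs) = (encode (n, rs1) @ RelMark # ?u) @ TupleMark # encode_tuple t @ ?v"
    unfolding rs(1) encode_split by simp
  have "S = length (encode (n, rs1) @ RelMark # ?u) + 1" using G S by simp
  then show "tuple_at (encode (n, rs)) S t"
    using tuple_at_append[OF w] tail_blocks[of ts2 rs2] by (simp only: Let_def)
  show sS: "scan (encode (n, rs)) S = Letter TupleMark"
    unfolding scan_mark using w \<open>S = length (encode (n, rs1) @ RelMark # ?u) + 1\<close> by blast
  have sG: "scan (encode (n, rs)) G = Letter RelMark"
    unfolding scan_mark G using w by auto
  have "scan (encode (n, rs)) z \<noteq> Letter RelMark" if "G < z" "z < S" for z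
  proof -
    from that obtain i where z: "z = Suc G + i" by (metis add_Suc less_iff_Suc_add)
    then have i: "i < length ?u" using that S by simp
    have d: "drop G (encode (n, rs)) = ?u @ TupleMark # encode_tuple t @ ?v" unfolding w G by simp
    have "scan (encode (n, rs)) z = Letter RelMark \<Longrightarrow> ?u ! i = RelMark"
      unfolding z scan_drop d using i by (simp add: nth_append)
    with i RelMark_fresh[of "(fst R, ts1)"] nth_mem[OF i] show ?thesis by metis
  qed
  then show "rel_of (encode (n, rs)) G S" using sS sG S by (simp add: rel_of_def)
qed

lemma tuple_in_exists:
  assumes "relation_at (n, rs) G R" "t \<in> set (snd R)"
  shows "\<exists>S. tuple_in (n, rs) G S R t"
proof -
  from assms(1) obtain rs1 rs2 where rs: "rs = rs1 @ R # rs2" "G = length (encode (n, rs1)) + 1"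
    by (auto simp: relation_at_def)
  from assms(2) obtain ts1 ts2 where ts: "snd R = ts1 @ t # ts2" by (meson split_list)
  from rs ts show ?thesis unfolding tuple_in_def prod.case by blast
qed

lemma TupleMark_position:
  assumes "scan (encode (n, rs)) S = Letter TupleMark"
  shows "\<exists>G R t. tuple_in (n, rs) G S R t"
proof -
  from assms obtain u v where w: "encode (n, rs) = u @ TupleMark # v" and S: "S = length u + 1"
    by (auto simp: scan_mark)
  have "replicate n Stroke @ concat (map (\<lambda>R. RelMark # encode_relation R) rs) = u @ TupleMark # v"
    using w by (simp add: encode_def)
  then obtain rs1 R rs2 u1 v1 where rs: "rs = rs1 @ R # rs2"
    and u: "u = replicate n Stroke @ concat (map (\<lambda>R. RelMark # encode_relation R) rs1) @ RelMark # u1"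
    and R: "encode_relation R = u1 @ TupleMark # v1" by (rule split_blocks) simp_all
  obtain r ts where Rr: "R = (r, ts)" by (cases R)
  have "replicate r Stroke @ concat (map (\<lambda>t. TupleMark # encode_tuple t) ts) = u1 @ TupleMark # v1"
    using R by (simp add: encode_relation_def Rr)
  then obtain ts1 t ts2 where ts: "ts = ts1 @ t # ts2"
    and u1: "u1 = replicate r Stroke @ concat (map (\<lambda>t. TupleMark # encode_tuple t) ts1)"
    by (rule split_at_mark) (simp_all add: TupleMark_fresh)
  have "u = encode (n, rs1) @ RelMark # encode_relation (fst R, ts1)"
    using u u1 by (simp add: encode_def encode_relation_def Rr)
  then have "S = (length (encode (n, rs1)) + 1) + length (encode_relation (fst R, ts1)) + 1" using S by simp
  then show ?thesis using rs ts Rr unfolding tuple_in_def prod.case by fastforce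
qed

text \<open>There is just one nearest relation mark to the left of \<open>S\<close>, so
  \<open>G\<close> agrees with the mark found by decomposing the word around
  \<open>S\<close>.\<close>

lemma rel_of_encode:
  assumes "rel_of (encode (n, rs)) G S"
  shows "\<exists>R t. tuple_in (n, rs) G S R t"
proof -
  have "scan (encode (n, rs)) S = Letter TupleMark" using assms by (simp add: rel_of_def)
  from TupleMark_position[OF this] obtain G' R t where t: "tuple_in (n, rs) G' S R t" by blast
  have r: "rel_of (encode (n, rs)) G' S" by (rule tuple_in_encode(4)[OF t])
  have "G = G'"
  proof (rule ccontr)
    assume "G \<noteq> G'"
    moreover have "G \<in> positions (encode (n, rs))" "G' \<in> positions (encode (n, rs))"
      using assms r by (auto simp: rel_of_def scan_Letter_iff)
    ultimately show False using assms r unfolding rel_of_def by (meson nat_neq_iff)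
  qed
  with t show ?thesis by blast
qed

lemma elt_pos_mark:
  assumes "tuple_at w S t" "k < length t"
  shows "scan w (elt_pos S t (Suc k)) = Letter EltMark"
  using next_elt_pos(1)[of w S t k "elt_pos S t (Suc k)"] assms by (auto simp: next_elt_def)

lemma EltMark_position:
  assumes "scan (encode (n, rs)) p = Letter EltMark"
  shows "\<exists>G S R t k. tuple_in (n, rs) G S R t \<and> k < length t \<and> p = elt_pos S t (Suc k)"
proof -
  from assms obtain u v where w: "encode (n, rs) = u @ EltMark # v" and p: "p = length u + 1"
    by (auto simp: scan_mark)
  have "replicate n Stroke @ concat (map (\<lambda>R. RelMark # encode_relation R) rs) = u @ EltMark # v"
    using w by (simp add: encode_def)
  then obtain rs1 R rs2 u1 v1 where rs: "rs = rs1 @ R # rs2"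
    and u: "u = replicate n Stroke @ concat (map (\<lambda>R. RelMark # encode_relation R) rs1) @ RelMark # u1"
    and R: "encode_relation R = u1 @ EltMark # v1" by (rule split_blocks) simp_all
  obtain r ts where Rr: "R = (r, ts)" by (cases R)
  have "replicate r Stroke @ concat (map (\<lambda>t. TupleMark # encode_tuple t) ts) = u1 @ EltMark # v1"
    using R by (simp add: encode_relation_def Rr)
  then obtain ts1 t ts2 u2 v2 where ts: "ts = ts1 @ t # ts2"
    and u1: "u1 = replicate r Stroke @ concat (map (\<lambda>t. TupleMark # encode_tuple t) ts1) @ TupleMark # u2"
    and t: "encode_tuple t = u2 @ EltMark # v2" by (rule split_blocks) simp_all
  have fresh: "EltMark \<notin> set (binary x)" for x using set_binary[of x] by auto
  have "[] @ concat (map (\<lambda>x. EltMark # binary x) t) = u2 @ EltMark # v2"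
    using t by (simp add: encode_tuple_def)
  then obtain t1 a t2 where ta: "t = t1 @ a # t2"
    and u2: "u2 = [] @ concat (map (\<lambda>x. EltMark # binary x) t1)"
    by (rule split_at_mark) (simp_all add: fresh)
  define G where "G = length (encode (n, rs1)) + 1"
  define S where "S = G + length (encode_relation (fst R, ts1)) + 1"
  have "tuple_in (n, rs) G S R t" using rs ts Rr unfolding tuple_in_def prod.case G_def S_def by fastforce
  moreover have "p = elt_pos S t (Suc (length t1))"
    unfolding p u u1 u2 elt_pos_def S_def G_def ta
    by (simp add: encode_def encode_relation_def encode_tuple_def Rr)
  ultimately show ?thesis using ta by (intro exI[of _ G] exI[of _ S] exI[of _ R] exI[of _ t] exI[of _ "length t1"]) simp
qed

lemma path_refl: "path w R x x"
  by (simp add: path_def star_on_refl)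

lemma path_step:
  assumes "path w R z (x, y)" "x \<in> positions w" "y \<in> positions w" "x' \<in> positions w" "y' \<in> positions w" "R x y x' y'"
  shows "path w R z (x', y')"
  using assms(1) unfolding path_def by (rule star_on_step) (use assms in auto)

lemma path_induct:
  assumes "path w R (a, b) (x, y)" "Q a b"
    and step: "\<And>x y x' y'. x \<in> positions w \<Longrightarrow> y \<in> positions w \<Longrightarrow> x' \<in> positions w \<Longrightarrow> y' \<in> positions w \<Longrightarrow>
      R x y x' y' \<Longrightarrow> Q x y \<Longrightarrow> Q x' y'"
  shows "Q x y"
proof -
  have "case_prod Q (x, y)"
    using assms(1)[unfolded path_def]
  proof (induction rule: star_on_induct)
    case base
    then show ?case using assms(2) by simp
  next
    case (step y z)
    obtain y1 y2 z1 z2 where [simp]: "y = (y1, y2)" "z = (z1, z2)" by (cases y; cases z)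
    from step.hyps step.IH show ?case by (auto intro: assms(3))
  qed
  then show ?thesis by simp
qed

text \<open>Both tuples are walked in step from their marks. Requiring an element mark at
  \<open>p\<close> excludes the empty walk, which would still sit on the tuple marks.\<close>

definition corresponding :: "letter list \<Rightarrow> nat \<Rightarrow> nat \<Rightarrow> nat \<Rightarrow> nat \<Rightarrow> bool" where
  "corresponding w S T p q \<longleftrightarrow> scan w p = Letter EltMark \<and>
     path w (\<lambda>x y x' y'. next_elt w x x' \<and> next_elt w y y') (S, T) (p, q)"

lemma elt_pos_inject:
  assumes "elt_pos S t (Suc i) = elt_pos S t (Suc j)" "i < length t" "j < length t"
  shows "i = j"
proof -
  have "length (encode_tuple (take i t)) < length (encode_tuple (take j t))" if "i < j" "j < length t" for i j
  proof -
    have "take j t = take i t @ t ! i # take (j - Suc i) (drop (Suc i) t)"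
      using that id_take_nth_drop[of i "take j t"] by (simp add: min_def drop_take)
    then show ?thesis by (simp add: encode_tuple_append encode_tuple_Cons)
  qed
  from this[of i j] this[of j i] assms show ?thesis by (cases i j rule: linorder_cases) (auto simp: elt_pos_def)
qed

lemma next_elt_positions: "next_elt w x y \<Longrightarrow> x \<in> positions w \<and> y \<in> positions w"
  by (auto simp: next_elt_def scan_Letter_iff)

lemma elt_pos_0: "elt_pos S t 0 = S"
  by (simp add: elt_pos_def)

lemma corresponding_iff:
  assumes "tuple_at w S s" "tuple_at w T t" "scan w S = Letter TupleMark"
  shows "corresponding w S T p q \<longleftrightarrow> (\<exists>k. k < length s \<and> k < length t \<and> p = elt_pos S s (Suc k) \<and> q = elt_pos T t (Suc k))"
proof -
  define f where "f m = (elt_pos S s m, elt_pos T t m)" for m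
  have "path w (\<lambda>x y x' y'. next_elt w x x' \<and> next_elt w y y') (f 0) (p, q) \<longleftrightarrow>
      (\<exists>m\<le>min (length s) (length t). (p, q) = f m)"
  proof (rule path_chain)
    fix m and z :: "nat \<times> nat" assume m: "m \<le> min (length s) (length t)"
    obtain x' y' where z: "z = (x', y')" by (cases z)
    have "f m \<in> positions w \<times> positions w"
      using next_elt_pos(2)[OF assms(1), of m] next_elt_pos(2)[OF assms(2), of m] m by (simp add: f_def)
    moreover have "next_elt w (elt_pos S s m) x' \<longleftrightarrow> m < length s \<and> x' = elt_pos S s (Suc m)"
      by (rule next_elt_pos(1)[OF assms(1)]) (use m in simp)
    moreover have "next_elt w (elt_pos T t m) y' \<longleftrightarrow> m < length t \<and> y' = elt_pos T t (Suc m)"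
      by (rule next_elt_pos(1)[OF assms(2)]) (use m in simp)
    ultimately show "f m \<in> positions w \<times> positions w \<and> z \<in> positions w \<times> positions w \<and>
        (case f m of (x, y) \<Rightarrow> case z of (x', y') \<Rightarrow> next_elt w x x' \<and> next_elt w y y') \<longleftrightarrow>
        m < min (length s) (length t) \<and> z = f (Suc m)"
      unfolding z using next_elt_positions[of w "elt_pos S s m" x'] next_elt_positions[of w "elt_pos T t m" y']
      by (auto simp: f_def)
  qed
  then have "corresponding w S T p q \<longleftrightarrow> scan w p = Letter EltMark \<and>
      (\<exists>m\<le>min (length s) (length t). p = elt_pos S s m \<and> q = elt_pos T t m)"
    by (simp add: corresponding_def f_def elt_pos_0)
  also have "\<dots> \<longleftrightarrow> (\<exists>k. k < length s \<and> k < length t \<and> p = elt_pos S s (Suc k) \<and> q = elt_pos T t (Suc k))"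
  proof
    assume "scan w p = Letter EltMark \<and> (\<exists>m\<le>min (length s) (length t). p = elt_pos S s m \<and> q = elt_pos T t m)"
    then obtain m where m: "scan w p = Letter EltMark" "m \<le> min (length s) (length t)" "p = elt_pos S s m" "q = elt_pos T t m"
      by blast
    show "\<exists>k. k < length s \<and> k < length t \<and> p = elt_pos S s (Suc k) \<and> q = elt_pos T t (Suc k)"
    proof (cases m)
      case 0
      with m assms(3) show ?thesis by (simp add: elt_pos_0)
    next
      case (Suc k)
      with m show ?thesis by (intro exI[of _ k]) simp
    qed
  next
    assume "\<exists>k. k < length s \<and> k < length t \<and> p = elt_pos S s (Suc k) \<and> q = elt_pos T t (Suc k)"
    then obtain k where "k < length s" "k < length t" "p = elt_pos S s (Suc k)" "q = elt_pos T t (Suc k)" by blast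
    then show "scan w p = Letter EltMark \<and> (\<exists>m\<le>min (length s) (length t). p = elt_pos S s m \<and> q = elt_pos T t m)"
      using elt_pos_mark[OF assms(1), of k] by (intro conjI exI[of _ "Suc k"]) simp_all
  qed
  finally show ?thesis .
qed

section \<open>Validity of the encoded structure\<close>

definition arities_ok :: "letter list \<Rightarrow> bool" where
  "arities_ok w \<longleftrightarrow> (\<forall>G\<in>positions w. \<forall>S\<in>positions w. rel_of w G S \<longrightarrow>
     (\<exists>x\<in>positions w. \<exists>y\<in>positions w.
        path w (\<lambda>x y x' y'. x' = Suc x \<and> scan w x' = Letter Stroke \<and> next_elt w y y') (G, S) (x, y) \<and>
        (\<exists>z\<in>positions w. z = Suc x \<and> scan w z \<noteq> Letter Stroke) \<and> \<not> (\<exists>z\<in>positions w. next_elt w y z)))"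

lemma scan_after_strokes:
  assumes "drop G w = replicate r Stroke @ v" "v = [] \<or> hd v \<noteq> Stroke" "i \<le> r"
  shows "scan w (Suc G + i) = Letter Stroke \<longleftrightarrow> i < r"
  unfolding scan_drop assms(1) using assms(2,3) by (cases v) (auto simp: nth_append)

lemma relation_at_strokes:
  assumes "relation_at (n, rs) G (r, ts)"
  shows "G + r \<le> length (encode (n, rs))"
    "i \<le> r \<Longrightarrow> scan (encode (n, rs)) (Suc G + i) = Letter Stroke \<longleftrightarrow> i < r"
proof -
  from assms obtain rs1 rs2 where rs: "rs = rs1 @ (r, ts) # rs2" and G: "G = length (encode (n, rs1)) + 1"
    unfolding relation_at_def prod.case by blast
  let ?v = "concat (map (\<lambda>t. TupleMark # encode_tuple t) ts) @ concat (map (\<lambda>R. RelMark # encode_relation R) rs2)"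
  have w: "encode (n, rs) = encode (n, rs1) @ RelMark # replicate r Stroke @ ?v"
    unfolding rs encode_split by (simp add: encode_relation_def)
  then show "G + r \<le> length (encode (n, rs))" by (simp add: G)
  show "i \<le> r \<Longrightarrow> scan (encode (n, rs)) (Suc G + i) = Letter Stroke \<longleftrightarrow> i < r"
  proof (rule scan_after_strokes)
    show "drop G (encode (n, rs)) = replicate r Stroke @ ?v" unfolding w G by simp
    show "?v = [] \<or> hd ?v \<noteq> Stroke" using tail_blocks[of ts rs2] unfolding Let_def by (elim disjE) simp_all
  qed
qed

text \<open>The strokes after the relation mark and the elements of the tuple are consumed in step.
  The walk visits exactly the points with at most \<open>min r (length t)\<close> steps, and both
  sequences are exhausted at such a point only if they are equally long.\<close>

lemma arities_ok_iff: "arities_ok (encode (n, rs)) \<longleftrightarrow> (\<forall>(r, ts)\<in>set rs. \<forall>t\<in>set ts. length t = r)"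
proof -
  let ?w = "encode (n, rs)"
  let ?R = "\<lambda>x y x' y'. x' = Suc x \<and> scan ?w x' = Letter Stroke \<and> next_elt ?w y y'"
  have *: "(\<exists>x\<in>positions ?w. \<exists>y\<in>positions ?w. path ?w ?R (G, S) (x, y) \<and>
        (\<exists>z\<in>positions ?w. z = Suc x \<and> scan ?w z \<noteq> Letter Stroke) \<and> \<not> (\<exists>z\<in>positions ?w. next_elt ?w y z)) \<longleftrightarrow> length t = r"
    (is "?L \<longleftrightarrow> _") if t: "tuple_in (n, rs) G S (r, ts) t" for G S r ts t
  proof -
    note facts = tuple_in_encode[OF t]
    note strokes = relation_at_strokes[OF facts(1)]
    note elt = next_elt_pos[OF facts(3)]
    define f where "f m = (G + m, elt_pos S t m)" for m
    have "path ?w ?R (f 0) z \<longleftrightarrow> (\<exists>m\<le>min r (length t). z = f m)" for z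
    proof (rule path_chain)
      fix m and z :: "nat \<times> nat" assume m: "m \<le> min r (length t)"
      obtain x' y' where z: "z = (x', y')" by (cases z)
      have fm: "f m \<in> positions ?w \<times> positions ?w" using elt(2)[of m] strokes(1) m by (simp add: f_def)
      have e: "next_elt ?w (elt_pos S t m) y' \<longleftrightarrow> m < length t \<and> y' = elt_pos S t (Suc m)"
        using elt(1) m by simp
      have s: "scan ?w (Suc (G + m)) = Letter Stroke \<longleftrightarrow> m < r" using strokes(2)[of m] m by simp
      have "scan ?w (Suc (G + m)) = Letter Stroke \<Longrightarrow> Suc (G + m) \<in> positions ?w" by (simp add: scan_Letter_iff)
      with fm e s show "f m \<in> positions ?w \<times> positions ?w \<and> z \<in> positions ?w \<times> positions ?w \<and>
          (case f m of (x, y) \<Rightarrow> case z of (x', y') \<Rightarrow> ?R x y x' y') \<longleftrightarrow> m < min r (length t) \<and> z = f (Suc m)"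
        unfolding z using next_elt_positions[of ?w "elt_pos S t m" y'] by (auto simp: f_def)
    qed
    then have path: "path ?w ?R (G, S) z \<longleftrightarrow> (\<exists>m\<le>min r (length t). z = f m)" for z
      by (simp add: f_def elt_pos_0)
    have stop1: "(\<exists>z\<in>positions ?w. z = Suc (G + m) \<and> scan ?w z \<noteq> Letter Stroke) \<longleftrightarrow> m = r" if "m \<le> r" for m
      using strokes(1) strokes(2)[OF that] that by auto
    have stop2: "(\<exists>z\<in>positions ?w. next_elt ?w (elt_pos S t m) z) \<longleftrightarrow> m \<noteq> length t" if "m \<le> length t" for m
      using elt(1)[OF that] elt(2)[of "Suc m"] that by auto
    have "?L \<longleftrightarrow> (\<exists>m\<le>min r (length t). m = r \<and> m = length t)"
    proof
      assume ?L
      then obtain x y where xy: "path ?w ?R (G, S) (x, y)" "\<exists>z\<in>positions ?w. z = Suc x \<and> scan ?w z \<noteq> Letter Stroke"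
        "\<not> (\<exists>z\<in>positions ?w. next_elt ?w y z)" by blast
      then obtain m where m: "m \<le> min r (length t)" "x = G + m" "y = elt_pos S t m" unfolding path f_def by blast
      with xy(2,3) stop1[of m] stop2[of m] have "m = r" "m = length t" by simp_all
      with m(1) show "\<exists>m\<le>min r (length t). m = r \<and> m = length t" by blast
    next
      assume "\<exists>m\<le>min r (length t). m = r \<and> m = length t"
      then have r: "length t = r" by auto
      have "path ?w ?R (G, S) (G + r, elt_pos S t r)" unfolding path f_def using r by auto
      moreover have "G + r \<in> positions ?w" "elt_pos S t r \<in> positions ?w" using strokes(1) elt(2)[of r] r by simp_all
      ultimately show ?L using stop1[of r] stop2[of r] r by blast
    qed
    then show ?thesis by auto
  qed
  show ?thesis
  proof
    assume ok: "arities_ok ?w"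
    have "length t = r" if "(r, ts) \<in> set rs" "t \<in> set ts" for r ts t
    proof -
      from that(1) obtain G where "relation_at (n, rs) G (r, ts)" unfolding relation_at_iff[of _ _ n] by blast
      from tuple_in_exists[OF this] that(2) obtain S where S: "tuple_in (n, rs) G S (r, ts) t" by auto
      have "rel_of ?w G S" by (rule tuple_in_encode(4)[OF S])
      moreover from this have "G \<in> positions ?w" "S \<in> positions ?w" by (auto simp: rel_of_def scan_Letter_iff)
      ultimately show ?thesis using ok *[OF S] unfolding arities_ok_def by blast
    qed
    then show "\<forall>(r, ts)\<in>set rs. \<forall>t\<in>set ts. length t = r" by blast
  next
    assume len: "\<forall>(r, ts)\<in>set rs. \<forall>t\<in>set ts. length t = r"
    show "arities_ok ?w" unfolding arities_ok_def
    proof (intro ballI impI)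
      fix G S assume "rel_of ?w G S"
      from rel_of_encode[OF this] obtain r ts t where t: "tuple_in (n, rs) G S (r, ts) t" by (metis surj_pair)
      have "(r, ts) \<in> set rs" unfolding relation_at_iff[of _ _ n] using tuple_in_encode(1)[OF t] by blast
      moreover have "t \<in> set ts" using tuple_in_encode(2)[OF t] by simp
      ultimately have "length t = r" using len by blast
      then show "\<exists>x\<in>positions ?w. \<exists>y\<in>positions ?w. path ?w ?R (G, S) (x, y) \<and>
        (\<exists>z\<in>positions ?w. z = Suc x \<and> scan ?w z \<noteq> Letter Stroke) \<and> \<not> (\<exists>z\<in>positions ?w. next_elt ?w y z)"
        unfolding *[OF t] .
    qed
  qed
qed

text \<open>Positions serve as numbers. Successor is available only as a relation, hence the
  intermediate \<open>u\<close>; the constant 0 is bound to a variable so that all arguments of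
  \<open>path\<close> are registers.\<close>

definition doubles :: "letter list \<Rightarrow> nat \<Rightarrow> nat \<Rightarrow> bool" where
  "doubles w v d \<longleftrightarrow> (\<exists>z\<in>positions w. z = 0 \<and>
     path w (\<lambda>x y x' y'. x' = Suc x \<and> (\<exists>u\<in>positions w. u = Suc y \<and> y' = Suc u)) (z, z) (v, d))"

lemma doubles_iff:
  assumes "d \<in> positions w"
  shows "doubles w v d \<longleftrightarrow> d = 2 * v"
proof -
  let ?R = "\<lambda>x y x' y'. x' = Suc x \<and> (\<exists>u\<in>positions w. u = Suc y \<and> y' = Suc u)"
  have "path w ?R (0, 0) (v, d) \<Longrightarrow> d = 2 * v"
    by (erule path_induct) auto
  moreover have "2 * v \<in> positions w \<Longrightarrow> path w ?R (0, 0) (v, 2 * v)"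
  proof (induction v)
    case 0
    then show ?case using path_refl[of w ?R "(0, 0)"] by simp
  next
    case (Suc v)
    then have "path w ?R (0, 0) (v, 2 * v)" by simp
    then show ?case by (rule path_step) (use Suc.prems in auto)
  qed
  ultimately show ?thesis using assms unfolding doubles_def by auto
qed

definition bits_value :: "letter list \<Rightarrow> nat" where
  "bits_value = foldl (\<lambda>v a. 2 * v + (if a = One then 1 else 0)) 0"

lemma bits_value_simps: "bits_value [] = 0" "bits_value (ds @ [a]) = 2 * bits_value ds + (if a = One then 1 else 0)"
  by (simp_all add: bits_value_def)

lemma bits_value_append_ge: "bits_value ds \<le> bits_value (ds @ es)"
proof (induction es rule: rev_induct)
  case (snoc a es)
  then show ?case using bits_value_simps(2)[of "ds @ es" a] by simp
qed simp

lemma bits_value_binary: "bits_value (binary x) = x"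
proof (induction x rule: less_induct)
  case (less x)
  show ?case
  proof (cases "x < 2")
    case True
    then show ?thesis by (subst binary.simps) (use bits_value_simps(2)[of "[]"] in \<open>auto simp: bits_value_simps(1) less_2_cases_iff\<close>)
  next
    case False
    then have "bits_value (binary (x div 2)) = x div 2" by (intro less) simp
    with False show ?thesis by (subst binary.simps) (auto simp: bits_value_simps)
  qed
qed

text \<open>Horner's rule, applied to the next digit of a numeral. A value that is not a position
  blocks the walk, which is correct since an element must be below the universe size and that size
  is at most the input length.\<close>

definition value_step :: "letter list \<Rightarrow> nat \<Rightarrow> nat \<Rightarrow> nat \<Rightarrow> nat \<Rightarrow> bool" where
  "value_step w x v x' v' \<longleftrightarrow> x' = Suc x \<and> (\<exists>d\<in>positions w. doubles w v d \<and>
     (scan w x' = Letter Zero \<and> v' = d \<or> scan w x' = Letter One \<and> v' = Suc d))"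

text \<open>After the numeral has been evaluated to \<open>v\<close>, the inequality
  \<open>v < n\<close> is checked against the unary universe size: the positions from 1 to
  \<open>v + 1\<close> must all carry strokes.\<close>

definition element_ok :: "letter list \<Rightarrow> nat \<Rightarrow> bool" where
  "element_ok w p \<longleftrightarrow> (\<exists>z\<in>positions w. z = 0 \<and> (\<exists>x\<in>positions w. \<exists>v\<in>positions w.
     path w (value_step w) (p, z) (x, v) \<and> (\<exists>x'\<in>positions w. x' = Suc x \<and> \<not> bit_at w x') \<and>
     (\<exists>u\<in>positions w. u = Suc v \<and> (\<forall>y\<in>positions w. z < y \<and> \<not> u < y \<longrightarrow> scan w y = Letter Stroke))))"

lemma strokes_iff:
  "(\<exists>u\<in>positions (encode (n, rs)). u = Suc v \<and> (\<forall>y\<in>positions (encode (n, rs)). 0 < y \<and> \<not> u < y \<longrightarrow> scan (encode (n, rs)) y = Letter Stroke)) \<longleftrightarrow> v < n"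
  (is "?L \<longleftrightarrow> _")
proof -
  let ?w = "encode (n, rs)" and ?v = "concat (map (\<lambda>R. RelMark # encode_relation R) rs)"
  have d: "drop 0 ?w = replicate n Stroke @ ?v" by (simp add: encode_def)
  have v: "?v = [] \<or> hd ?v \<noteq> Stroke" by (cases rs) auto
  have s: "scan ?w (Suc i) = Letter Stroke \<longleftrightarrow> i < n" if "i \<le> n" for i
    using scan_after_strokes[OF d v that] by simp
  have n: "n \<le> length ?w" by (simp add: encode_def)
  show ?thesis
  proof
    assume ?L
    then have *: "Suc v \<in> positions ?w" "\<And>y. y \<in> positions ?w \<Longrightarrow> 0 < y \<Longrightarrow> y \<le> Suc v \<Longrightarrow> scan ?w y = Letter Stroke"
      by (auto simp: not_less)
    show "v < n"
    proof (rule ccontr)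
      assume "\<not> v < n"
      with *(2)[of "Suc n"] n s[of n] show False by simp
    qed
  next
    assume v: "v < n"
    have "scan ?w y = Letter Stroke" if "0 < y" "y \<le> Suc v" for y
      using s[of "y - 1"] that v by simp
    with v n show ?L by auto
  qed
qed

lemma element_ok_iff:
  assumes "tuple_at (encode (n, rs)) S t" "k < length t"
  shows "element_ok (encode (n, rs)) (elt_pos S t (Suc k)) \<longleftrightarrow> t ! k < n"
proof -
  let ?w = "encode (n, rs)"
  define p where "p = elt_pos S t (Suc k)"
  define bs where "bs = binary (t ! k)"
  have p: "p \<le> length ?w" using next_elt_pos(2)[OF assms(1), of "Suc k"] assms(2) by (simp add: p_def)
  have take: "takeWhile (\<lambda>a. a \<in> bits) (drop p ?w) = bs"
    using bits_from_elt_pos[OF assms] by (simp add: bits_from_def p_def bs_def)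
  have len: "length bs \<le> length (drop p ?w)" using length_takeWhile_le[of _ "drop p ?w"] take by metis
  have nth: "i < length bs \<Longrightarrow> drop p ?w ! i = bs ! i" for i using takeWhile_nth[of i _ "drop p ?w"] take by metis
  have bits: "set bs \<subseteq> bits" using set_binary_bits bs_def by simp
  have bit: "bit_at ?w (Suc (p + i)) \<longleftrightarrow> i < length bs" if "i \<le> length bs" for i
  proof -
    have "bit_at ?w (Suc p + i) \<longleftrightarrow> i < length (drop p ?w) \<and> drop p ?w ! i \<in> bits" by (rule bit_at_drop)
    also have "\<dots> \<longleftrightarrow> i < length bs"
    proof (cases "i < length bs")
      case True
      with nth bits len show ?thesis using nth_mem[OF True] by (auto simp del: nth_drop)
    next
      case False
      with that have i: "i = length bs" by simp
      show ?thesis using nth_length_takeWhile[of "\<lambda>a. a \<in> bits" "drop p ?w"] unfolding take i by blast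
    qed
    finally show ?thesis by simp
  qed
  have sc: "scan ?w (Suc (p + i)) = Letter a \<longleftrightarrow> bs ! i = a" if "i < length bs" for i a
    using scan_drop[of ?w p i a] nth[OF that] len that by (simp del: nth_drop)
  have sound: "\<exists>m\<le>length bs. x = p + m \<and> v = bits_value (take m bs)" if "path ?w (value_step ?w) (p, 0) (x, v)" for x v
    using that
  proof (rule path_induct)
    show "\<exists>m\<le>length bs. p = p + m \<and> 0 = bits_value (take m bs)" by (intro exI[of _ 0]) (simp add: bits_value_simps)
  next
    fix x y x' y' assume pos: "x \<in> positions ?w" "y \<in> positions ?w" and step: "value_step ?w x y x' y'"
      and "\<exists>m\<le>length bs. x = p + m \<and> y = bits_value (take m bs)"
    then obtain m where m: "m \<le> length bs" "x = p + m" "y = bits_value (take m bs)" by blast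
    from step obtain d where d: "x' = Suc x" "d = 2 * y"
      "scan ?w x' = Letter Zero \<and> y' = d \<or> scan ?w x' = Letter One \<and> y' = Suc d"
      unfolding value_step_def using doubles_iff by blast
    then have "bit_at ?w (Suc (p + m))" using m by (auto simp: bit_at_def)
    then have less: "m < length bs" using bit[OF m(1)] by simp
    from less have t: "take (Suc m) bs = take m bs @ [bs ! m]" by (rule take_Suc_conv_app_nth)
    have "y' = bits_value (take (Suc m) bs)"
      unfolding t bits_value_simps using d m sc[OF less] by auto
    with less d(1) m(2) show "\<exists>m\<le>length bs. x' = p + m \<and> y' = bits_value (take m bs)"
      by (intro exI[of _ "Suc m"]) simp
  qed
  \<comment> \<open>Prefixes of the numeral have values no larger than the numeral itself, so no
    intermediate result of the evaluation leaves the range of positions.\<close>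
  have small: "bits_value (take m bs) \<le> t ! k" for m
    using bits_value_append_ge[of "take m bs" "drop m bs"] bits_value_binary[of "t ! k"] by (simp add: bs_def)
  have complete: "path ?w (value_step ?w) (p, 0) (p + m, bits_value (take m bs))"
    if "m \<le> length bs" "t ! k \<le> length ?w" for m
    using that(1)
  proof (induction m)
    case 0
    then show ?case using path_refl by (simp add: bits_value_simps)
  next
    case (Suc m)
    then have less: "m < length bs" by simp
    then have t: "take (Suc m) bs = take m bs @ [bs ! m]" by (rule take_Suc_conv_app_nth)
    have "bits_value (take (Suc m) bs) \<le> length ?w" using small[of "Suc m"] that(2) by simp
    then have "2 * bits_value (take m bs) \<in> positions ?w" unfolding t bits_value_simps by simp
    then have "doubles ?w (bits_value (take m bs)) (2 * bits_value (take m bs))" by (simp add: doubles_iff)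
    moreover have "bs ! m = Zero \<or> bs ! m = One" using bits nth_mem[OF less] by (auto simp: bits_def)
    ultimately have st: "value_step ?w (p + m) (bits_value (take m bs)) (p + Suc m) (bits_value (take (Suc m) bs))"
      unfolding value_step_def t bits_value_simps using sc[OF less] \<open>2 * bits_value (take m bs) \<in> positions ?w\<close>
      by (intro conjI bexI[of _ "2 * bits_value (take m bs)"]) auto
    have pa: "path ?w (value_step ?w) (p, 0) (p + m, bits_value (take m bs))" using Suc by simp
    have "bits_value (take m bs) \<in> positions ?w" "bits_value (take (Suc m) bs) \<in> positions ?w"
      using small[of m] small[of "Suc m"] that(2) by simp_all
    moreover have "p + m \<in> positions ?w" "p + Suc m \<in> positions ?w" using len p less by simp_all
    ultimately show ?case using st by (intro path_step[OF pa])
  qed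
  show ?thesis unfolding p_def[symmetric]
  proof
    assume "element_ok ?w p"
    then obtain x v where xv: "path ?w (value_step ?w) (p, 0) (x, v)" "\<not> bit_at ?w (Suc x)" "v < n"
      unfolding element_ok_def using strokes_iff by blast
    from sound[OF xv(1)] obtain m where m: "m \<le> length bs" "x = p + m" "v = bits_value (take m bs)" by blast
    with xv(2) bit[of m] have "m = length bs" by simp
    with m(3) have "v = t ! k" by (simp add: bs_def bits_value_binary)
    with xv(3) show "t ! k < n" by simp
  next
    assume less: "t ! k < n"
    have "n \<le> length ?w" by (simp add: encode_def)
    with less have "path ?w (value_step ?w) (p, 0) (p + length bs, t ! k)"
      using complete[of "length bs"] by (simp add: bs_def bits_value_binary)
    moreover have "p + length bs \<in> positions ?w" "Suc (p + length bs) \<in> positions ?w" using len p by simp_all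
    moreover have "\<not> bit_at ?w (Suc (p + length bs))" using bit[of "length bs"] by simp
    moreover have "t ! k \<in> positions ?w" "0 \<in> positions ?w" using less \<open>n \<le> length ?w\<close> by simp_all
    ultimately show "element_ok ?w p"
      unfolding element_ok_def using strokes_iff[of n rs "t ! k"] less by blast
  qed
qed

definition nonempty_universe :: "letter list \<Rightarrow> bool" where
  "nonempty_universe w \<longleftrightarrow> (\<exists>z\<in>positions w. z = 0 \<and> (\<exists>y\<in>positions w. y = Suc z \<and> scan w y = Letter Stroke))"

definition elements_ok :: "letter list \<Rightarrow> bool" where
  "elements_ok w \<longleftrightarrow> (\<forall>p\<in>positions w. scan w p = Letter EltMark \<longrightarrow> element_ok w p)"

lemma tuple_in_set: "tuple_in (n, rs) G S R t \<Longrightarrow> R \<in> set rs \<and> t \<in> set (snd R)"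
  using tuple_in_encode(1,2)[of n rs G S R t] relation_at_iff[of R rs n] by blast

lemma set_tuple_in:
  assumes "(r, ts) \<in> set rs" "t \<in> set ts"
  obtains G S where "tuple_in (n, rs) G S (r, ts) t"
proof -
  from assms(1) obtain G where "relation_at (n, rs) G (r, ts)" unfolding relation_at_iff[of _ _ n] by blast
  from tuple_in_exists[OF this] assms(2) that show thesis by auto
qed

lemma elt_pos_positions: "tuple_at w S t \<Longrightarrow> k < length t \<Longrightarrow> elt_pos S t (Suc k) \<in> positions w"
  using next_elt_pos(2)[of w S t "Suc k"] by simp

lemma elements_ok_iff:
  "elements_ok (encode (n, rs)) \<longleftrightarrow> (\<forall>(r, ts)\<in>set rs. \<forall>t\<in>set ts. set t \<subseteq> {..<n})"
proof
  assume ok: "elements_ok (encode (n, rs))"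
  have "x < n" if R: "(r, ts) \<in> set rs" and t: "t \<in> set ts" and x: "x \<in> set t" for r ts t x
  proof -
    obtain G S where S: "tuple_in (n, rs) G S (r, ts) t" using set_tuple_in[OF R t] .
    from x obtain k where k: "k < length t" "t ! k = x" by (auto simp: in_set_conv_nth)
    note at = tuple_in_encode(3)[OF S]
    have "element_ok (encode (n, rs)) (elt_pos S t (Suc k))"
      using ok elt_pos_positions[OF at k(1)] elt_pos_mark[OF at k(1)] unfolding elements_ok_def by blast
    with element_ok_iff[OF at k(1)] k(2) show ?thesis by simp
  qed
  then show "\<forall>(r, ts)\<in>set rs. \<forall>t\<in>set ts. set t \<subseteq> {..<n}" by blast
next
  assume lt: "\<forall>(r, ts)\<in>set rs. \<forall>t\<in>set ts. set t \<subseteq> {..<n}"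
  show "elements_ok (encode (n, rs))" unfolding elements_ok_def
  proof (intro ballI impI)
    fix p assume "scan (encode (n, rs)) p = Letter EltMark"
    from EltMark_position[OF this] obtain G S R t k where t: "tuple_in (n, rs) G S R t" "k < length t"
      "p = elt_pos S t (Suc k)" by blast
    have "t ! k < n" using tuple_in_set[OF t(1)] lt nth_mem[OF t(2)] by (cases R) fastforce
    then show "element_ok (encode (n, rs)) p"
      unfolding t(3) element_ok_iff[OF tuple_in_encode(3)[OF t(1)] t(2)] .
  qed
qed

lemma nonempty_universe_iff: "nonempty_universe (encode (n, rs)) \<longleftrightarrow> 0 < n"
proof -
  have "scan (encode (n, rs)) (Suc 0) = Letter Stroke \<longleftrightarrow> 0 < n"
    by (cases n; cases rs) (auto simp: scan_Suc encode_def)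
  then show ?thesis unfolding nonempty_universe_def by auto
qed

lemma is_structure_iff:
  "is_structure (structure_of (n, rs)) \<longleftrightarrow>
     nonempty_universe (encode (n, rs)) \<and> arities_ok (encode (n, rs)) \<and> elements_ok (encode (n, rs))"
  unfolding nonempty_universe_iff arities_ok_iff elements_ok_iff
  by (fastforce simp: is_structure_def structure_of_def lessThan_empty_iff)

section \<open>The implication graph on positions of the input\<close>

definition blending :: "letter list \<Rightarrow> nat \<Rightarrow> nat \<Rightarrow> nat \<Rightarrow> nat \<Rightarrow> nat \<Rightarrow> bool" where
  "blending w S T U p q \<longleftrightarrow>
     (\<forall>x\<in>positions w. \<forall>y\<in>positions w. corresponding w S T x y \<longrightarrow>
        (\<exists>z\<in>positions w. corresponding w S U x z \<and> (same_value w z x \<or> same_value w z y))) \<and>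
     (\<exists>z\<in>positions w. corresponding w S U p z \<and> same_value w z p) \<and>
     (\<exists>z\<in>positions w. corresponding w T U q z \<and> same_value w z q)"

text \<open>The counterpart of \<open>forces\<close> on occurrences. In \<open>blending\<close> the
  first position is looked up in the tuple at \<open>S\<close> and the second in the tuple at
  \<open>T\<close>, so passing \<open>p\<close> and \<open>q'\<close> expresses agreement with
  \<open>s\<close> at one coordinate and with \<open>t\<close> at the other.\<close>

definition forcing_step :: "letter list \<Rightarrow> nat \<Rightarrow> nat \<Rightarrow> nat \<Rightarrow> nat \<Rightarrow> bool" where
  "forcing_step w p q p' q' \<longleftrightarrow>
     (\<exists>G\<in>positions w. \<exists>S\<in>positions w. \<exists>T\<in>positions w. rel_of w G S \<and> rel_of w G T \<and>
        corresponding w S T p q \<and> corresponding w S T p' q' \<and>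
        \<not> (\<exists>U\<in>positions w. rel_of w G U \<and> blending w S T U p q'))"

text \<open>Vertices are pairs of occurrences, and an element may occur in many places. The first
  alternative lets a walk change to other occurrences of the same two elements.\<close>

definition graph_step :: "letter list \<Rightarrow> nat \<Rightarrow> nat \<Rightarrow> nat \<Rightarrow> nat \<Rightarrow> bool" where
  "graph_step w p q p' q' \<longleftrightarrow> scan w p' = Letter EltMark \<and> scan w q' = Letter EltMark \<and>
     (same_value w p p' \<and> same_value w q q' \<or> forcing_step w p q p' q')"

definition cyclic :: "letter list \<Rightarrow> bool" where
  "cyclic w \<longleftrightarrow> (\<exists>p\<in>positions w. \<exists>q\<in>positions w. scan w p = Letter EltMark \<and> scan w q = Letter EltMark \<and>
     \<not> same_value w p q \<and> path w (graph_step w) (p, q) (q, p) \<and> path w (graph_step w) (q, p) (p, q))"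

definition element_at :: "letter list \<Rightarrow> nat \<Rightarrow> nat" where
  "element_at w p = (THE a. bits_from w p = binary a)"

lemma element_at_elt_pos:
  assumes "tuple_at w S t" "k < length t"
  shows "element_at w (elt_pos S t (Suc k)) = t ! k"
  unfolding element_at_def bits_from_elt_pos[OF assms] by (rule the_equality) (auto dest: binary_inject)

lemma same_value_elt_pos:
  assumes "tuple_at w S s" "i < length s" "tuple_at w T t" "j < length t"
  shows "same_value w (elt_pos S s (Suc i)) (elt_pos T t (Suc j)) \<longleftrightarrow> s ! i = t ! j"
proof -
  have "elt_pos S s (Suc i) \<le> length w" "elt_pos T t (Suc j) \<le> length w"
    using next_elt_pos(2)[OF assms(1), of "Suc i"] next_elt_pos(2)[OF assms(3), of "Suc j"] assms by simp_all
  then show ?thesis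
    using same_value_iff bits_from_elt_pos[OF assms(1,2)] bits_from_elt_pos[OF assms(3,4)]
    by (auto dest: binary_inject)
qed

lemma same_value_element_at:
  assumes "scan (encode (n, rs)) p = Letter EltMark" "scan (encode (n, rs)) q = Letter EltMark"
  shows "same_value (encode (n, rs)) p q \<longleftrightarrow> element_at (encode (n, rs)) p = element_at (encode (n, rs)) q"
proof -
  from EltMark_position[OF assms(1)] obtain G S R s i where s: "tuple_in (n, rs) G S R s" "i < length s" "p = elt_pos S s (Suc i)" by blast
  from EltMark_position[OF assms(2)] obtain G' T R' t j where t: "tuple_in (n, rs) G' T R' t" "j < length t" "q = elt_pos T t (Suc j)" by blast
  note at = tuple_in_encode(3)[OF s(1)] s(2) tuple_in_encode(3)[OF t(1)] t(2)
  show ?thesis unfolding s(3) t(3) same_value_elt_pos[OF at] element_at_elt_pos[OF at(1,2)] element_at_elt_pos[OF at(3,4)] ..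
qed

lemma blending_iff:
  assumes S: "tuple_at w S s" "scan w S = Letter TupleMark" and T: "tuple_at w T t" "scan w T = Letter TupleMark"
    and U: "tuple_at w U u" and len: "length s = r" "length t = r" "length u = r" and ij: "i < r" "j < r"
  shows "blending w S T U (elt_pos S s (Suc i)) (elt_pos T t (Suc j)) \<longleftrightarrow>
    (\<forall>k<r. u ! k = s ! k \<or> u ! k = t ! k) \<and> u ! i = s ! i \<and> u ! j = t ! j"
proof -
  note ST = corresponding_iff[OF S(1) T(1) S(2)]
  note SU = corresponding_iff[OF S(1) U S(2)]
  note TU = corresponding_iff[OF T(1) U T(2)]
  have image: "(\<exists>z\<in>positions w. corresponding w S U (elt_pos S s (Suc k)) z \<and> Q z) \<longleftrightarrow> Q (elt_pos U u (Suc k))"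
    if "k < r" for k Q
    unfolding SU using that len elt_pos_inject[of S s k] elt_pos_positions[OF U, of k] by auto
  have image': "(\<exists>z\<in>positions w. corresponding w T U (elt_pos T t (Suc k)) z \<and> Q z) \<longleftrightarrow> Q (elt_pos U u (Suc k))"
    if "k < r" for k Q
    unfolding TU using that len elt_pos_inject[of T t k] elt_pos_positions[OF U, of k] by auto
  have v: "same_value w (elt_pos U u (Suc k)) (elt_pos S s (Suc k)) \<longleftrightarrow> u ! k = s ! k"
    "same_value w (elt_pos U u (Suc k)) (elt_pos T t (Suc k)) \<longleftrightarrow> u ! k = t ! k" if "k < r" for k
    using same_value_elt_pos[OF U _ S(1)] same_value_elt_pos[OF U _ T(1)] that len by simp_all
  have all: "(\<forall>x\<in>positions w. \<forall>y\<in>positions w. corresponding w S T x y \<longrightarrow> Q x y) \<longleftrightarrow>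
      (\<forall>k<r. Q (elt_pos S s (Suc k)) (elt_pos T t (Suc k)))" (is "?L \<longleftrightarrow> ?R") for Q
  proof
    assume L: ?L
    show ?R
    proof (intro allI impI)
      fix k assume k: "k < r"
      have c: "corresponding w S T (elt_pos S s (Suc k)) (elt_pos T t (Suc k))"
        unfolding ST by (intro exI[of _ k] conjI refl) (use k len in simp_all)
      have "elt_pos S s (Suc k) \<in> positions w" "elt_pos T t (Suc k) \<in> positions w"
        by (rule elt_pos_positions[OF S(1)] elt_pos_positions[OF T(1)], use k len in simp)+
      from L[rule_format, OF this c] show "Q (elt_pos S s (Suc k)) (elt_pos T t (Suc k))" .
    qed
  next
    assume R: ?R
    show ?L
    proof (intro ballI impI)
      fix x y assume "corresponding w S T x y"
      then obtain k where "k < length s" "x = elt_pos S s (Suc k)" "y = elt_pos T t (Suc k)" unfolding ST by (elim exE conjE)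
      with R len show "Q x y" by simp
    qed
  qed
  show ?thesis unfolding blending_def all image[OF ij(1)] image'[OF ij(2)] v(1)[OF ij(1)] v(2)[OF ij(2)]
    using image v by auto
qed

context
  fixes n :: nat and rs :: "(nat \<times> nat list list) list"
  assumes H: "is_structure (structure_of (n, rs))"
begin

text \<open>Since \<open>G\<close> identifies the relation, tuple marks below \<open>G\<close> range
  over exactly its tuples.\<close>

lemma blending_exists_iff:
  assumes S: "tuple_in (n, rs) G S (r, ts) s" and T: "tuple_in (n, rs) G T (r, ts) t" and ij: "i < r" "j < r"
  shows "(\<exists>U\<in>positions (encode (n, rs)). rel_of (encode (n, rs)) G U \<and>
      blending (encode (n, rs)) S T U (elt_pos S s (Suc i)) (elt_pos T t (Suc j))) \<longleftrightarrow>
    (\<exists>u\<in>set ts. (\<forall>k<r. u ! k = s ! k \<or> u ! k = t ! k) \<and> u ! i = s ! i \<and> u ! j = t ! j)"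
proof -
  let ?w = "encode (n, rs)"
  have iff: "blending ?w S T U (elt_pos S s (Suc i)) (elt_pos T t (Suc j)) \<longleftrightarrow>
    (\<forall>k<r. u ! k = s ! k \<or> u ! k = t ! k) \<and> u ! i = s ! i \<and> u ! j = t ! j"
    if U: "tuple_in (n, rs) G U (r, ts) u" for U u
  proof (rule blending_iff[OF tuple_in_encode(3,5)[OF S] tuple_in_encode(3,5)[OF T] tuple_in_encode(3)[OF U] _ _ _ ij])
    show "length s = r" "length t = r" "length u = r"
      using tuple_in_set[OF S] tuple_in_set[OF T] tuple_in_set[OF U] structure_of_facts(1)[OF H] by auto
  qed
  show ?thesis
  proof
    assume "\<exists>U\<in>positions ?w. rel_of ?w G U \<and> blending ?w S T U (elt_pos S s (Suc i)) (elt_pos T t (Suc j))"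
    then obtain U where U: "rel_of ?w G U" "blending ?w S T U (elt_pos S s (Suc i)) (elt_pos T t (Suc j))" by blast
    from rel_of_encode[OF U(1)] obtain R u where u: "tuple_in (n, rs) G U R u" by blast
    have "R = (r, ts)" by (rule relation_at_unique[OF tuple_in_encode(1)[OF u] tuple_in_encode(1)[OF S]])
    with u U(2) iff tuple_in_set[OF u] show "\<exists>u\<in>set ts. (\<forall>k<r. u ! k = s ! k \<or> u ! k = t ! k) \<and> u ! i = s ! i \<and> u ! j = t ! j"
      by (intro bexI[of _ u]) auto
  next
    assume "\<exists>u\<in>set ts. (\<forall>k<r. u ! k = s ! k \<or> u ! k = t ! k) \<and> u ! i = s ! i \<and> u ! j = t ! j"
    then obtain u where u: "u \<in> set ts" "(\<forall>k<r. u ! k = s ! k \<or> u ! k = t ! k) \<and> u ! i = s ! i \<and> u ! j = t ! j" by blast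
    from tuple_in_exists[OF tuple_in_encode(1)[OF S]] u(1) obtain U where U: "tuple_in (n, rs) G U (r, ts) u" by auto
    have "U \<in> positions ?w" using tuple_in_encode(5)[OF U] by (simp add: scan_Letter_iff)
    with iff[OF U] u(2) tuple_in_encode(4)[OF U]
    show "\<exists>U\<in>positions ?w. rel_of ?w G U \<and> blending ?w S T U (elt_pos S s (Suc i)) (elt_pos T t (Suc j))" by blast
  qed
qed

lemma forcing_step_sound:
  assumes "forcing_step (encode (n, rs)) p q p' q'"
  shows "forces rs (element_at (encode (n, rs)) p, element_at (encode (n, rs)) q)
    (element_at (encode (n, rs)) p', element_at (encode (n, rs)) q')"
proof -
  let ?w = "encode (n, rs)"
  from assms obtain G S T where G: "rel_of ?w G S" "rel_of ?w G T" "corresponding ?w S T p q" "corresponding ?w S T p' q'"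
    "\<not> (\<exists>U\<in>positions ?w. rel_of ?w G U \<and> blending ?w S T U p q')" unfolding forcing_step_def by blast
  from rel_of_encode[OF G(1)] obtain r ts s where S: "tuple_in (n, rs) G S (r, ts) s" by auto
  from rel_of_encode[OF G(2)] obtain R t where T: "tuple_in (n, rs) G T R t" by auto
  have "R = (r, ts)" by (rule relation_at_unique[OF tuple_in_encode(1)[OF T] tuple_in_encode(1)[OF S]])
  note T = T[unfolded this]
  have sets: "(r, ts) \<in> set rs" "s \<in> set ts" "t \<in> set ts" using tuple_in_set[OF S] tuple_in_set[OF T] by simp_all
  have len: "length s = r" "length t = r" using structure_of_facts(1)[OF H sets(1)] sets by simp_all
  note at = tuple_in_encode(3)[OF S] tuple_in_encode(3)[OF T]
  note corr = corresponding_iff[OF at tuple_in_encode(5)[OF S]]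
  from G(3) corr obtain i where i: "i < r" "p = elt_pos S s (Suc i)" "q = elt_pos T t (Suc i)" using len by auto
  from G(4) corr obtain j where j: "j < r" "p' = elt_pos S s (Suc j)" "q' = elt_pos T t (Suc j)" using len by auto
  have no: "\<not> (\<exists>u\<in>set ts. (\<forall>k<r. u ! k = s ! k \<or> u ! k = t ! k) \<and> u ! i = s ! i \<and> u ! j = t ! j)"
    using G(5) blending_exists_iff[OF S T i(1) j(1)] i j by simp
  have el: "element_at ?w p = s ! i" "element_at ?w q = t ! i" "element_at ?w p' = s ! j" "element_at ?w q' = t ! j"
    unfolding i j using element_at_elt_pos[OF at(1)] element_at_elt_pos[OF at(2)] i(1) j(1) len by simp_all
  from no sets i(1) j(1) show ?thesis unfolding el forces_def by blast
qed

lemma forcing_step_complete: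
  assumes "forces rs (a, b) (a', b')"
  obtains p q p' q' where "forcing_step (encode (n, rs)) p q p' q'"
    "\<forall>x\<in>{p, q, p', q'}. scan (encode (n, rs)) x = Letter EltMark"
    "element_at (encode (n, rs)) p = a" "element_at (encode (n, rs)) q = b"
    "element_at (encode (n, rs)) p' = a'" "element_at (encode (n, rs)) q' = b'"
proof -
  let ?w = "encode (n, rs)"
  from assms obtain r ts s t i j where sets: "(r, ts) \<in> set rs" "s \<in> set ts" "t \<in> set ts" and ij: "i < r" "j < r"
    and ab: "a = s ! i" "b = t ! i" "a' = s ! j" "b' = t ! j" and no:
     "\<not> (\<exists>u\<in>set ts. (\<forall>k<r. u ! k = s ! k \<or> u ! k = t ! k) \<and> u ! i = s ! i \<and> u ! j = t ! j)"
    unfolding forces_def by auto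
  obtain G S where S: "tuple_in (n, rs) G S (r, ts) s" using set_tuple_in[OF sets(1,2)] .
  from tuple_in_exists[OF tuple_in_encode(1)[OF S]] sets(3) obtain T where T: "tuple_in (n, rs) G T (r, ts) t" by auto
  have len: "length s = r" "length t = r" using structure_of_facts(1)[OF H sets(1)] sets by simp_all
  note at = tuple_in_encode(3)[OF S] tuple_in_encode(3)[OF T]
  note corr = corresponding_iff[OF at tuple_in_encode(5)[OF S]]
  let ?p = "elt_pos S s (Suc i)" and ?q = "elt_pos T t (Suc i)" and ?p' = "elt_pos S s (Suc j)" and ?q' = "elt_pos T t (Suc j)"
  show thesis
  proof (rule that)
    have "corresponding ?w S T ?p ?q" "corresponding ?w S T ?p' ?q'" unfolding corr using ij len by auto
    moreover have "G \<in> positions ?w" "S \<in> positions ?w" "T \<in> positions ?w"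
      using tuple_in_encode(4)[OF S] tuple_in_encode(4)[OF T] by (auto simp: rel_of_def scan_Letter_iff)
    ultimately show "forcing_step ?w ?p ?q ?p' ?q'" unfolding forcing_step_def
      using no blending_exists_iff[OF S T ij] tuple_in_encode(4)[OF S] tuple_in_encode(4)[OF T] by blast
    show "\<forall>x\<in>{?p, ?q, ?p', ?q'}. scan ?w x = Letter EltMark"
      using elt_pos_mark[OF at(1)] elt_pos_mark[OF at(2)] ij len by simp
    show "element_at ?w ?p = a" "element_at ?w ?q = b" "element_at ?w ?p' = a'" "element_at ?w ?q' = b'"
      unfolding ab using element_at_elt_pos[OF at(1)] element_at_elt_pos[OF at(2)] ij len by simp_all
  qed
qed

text \<open>\<open>element_at\<close> projects walks on occurrences to walks in
  \<open>forces\<close>, where changes of occurrence disappear. Conversely each edge lifts to some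
  occurrences of its endpoints, and these are joined to the current ones by such changes.\<close>

lemma graph_path_iff:
  assumes "\<forall>x\<in>{p, q, p', q'}. scan (encode (n, rs)) x = Letter EltMark"
  shows "path (encode (n, rs)) (graph_step (encode (n, rs))) (p, q) (p', q') \<longleftrightarrow>
    (forces rs)\<^sup>*\<^sup>* (element_at (encode (n, rs)) p, element_at (encode (n, rs)) q)
      (element_at (encode (n, rs)) p', element_at (encode (n, rs)) q')"
proof
  let ?w = "encode (n, rs)"
  let ?e = "element_at ?w"
  let ?F = "(forces rs)\<^sup>*\<^sup>*"
  define F where "F = forces rs"
  assume "path ?w (graph_step ?w) (p, q) (p', q')"
  then have "scan ?w p' = Letter EltMark \<and> scan ?w q' = Letter EltMark \<and> F\<^sup>*\<^sup>* (?e p, ?e q) (?e p', ?e q')"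
  proof (rule path_induct)
    show "scan ?w p = Letter EltMark \<and> scan ?w q = Letter EltMark \<and> F\<^sup>*\<^sup>* (?e p, ?e q) (?e p, ?e q)"
      using assms by simp
  next
    fix x y x' y' assume g: "graph_step ?w x y x' y'"
      and IH: "scan ?w x = Letter EltMark \<and> scan ?w y = Letter EltMark \<and> F\<^sup>*\<^sup>* (?e p, ?e q) (?e x, ?e y)"
    then have m: "scan ?w x' = Letter EltMark" "scan ?w y' = Letter EltMark" by (simp_all add: graph_step_def)
    from g have "same_value ?w x x' \<and> same_value ?w y y' \<or> forcing_step ?w x y x' y'" by (simp add: graph_step_def)
    then have "F\<^sup>*\<^sup>* (?e p, ?e q) (?e x', ?e y')"
    proof
      assume "same_value ?w x x' \<and> same_value ?w y y'"
      then have "?e x = ?e x'" "?e y = ?e y'" using same_value_element_at[of n rs] IH m by simp_all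
      with IH show ?thesis by simp
    next
      assume "forcing_step ?w x y x' y'"
      then have "F (?e x, ?e y) (?e x', ?e y')" unfolding F_def by (rule forcing_step_sound)
      with IH show ?thesis by (blast intro: rtranclp.rtrancl_into_rtrancl[of F])
    qed
    with m show "scan ?w x' = Letter EltMark \<and> scan ?w y' = Letter EltMark \<and> F\<^sup>*\<^sup>* (?e p, ?e q) (?e x', ?e y')" by simp
  qed
  then show "(forces rs)\<^sup>*\<^sup>* (?e p, ?e q) (?e p', ?e q')" by (simp add: F_def)
next
  let ?w = "encode (n, rs)"
  let ?e = "element_at ?w"
  let ?P = "path ?w (graph_step ?w)"
  have pos: "x \<in> positions ?w" if "scan ?w x = Letter EltMark" for x using that by (simp add: scan_Letter_iff)
  \<comment> \<open>A change of occurrence at fixed elements.\<close>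
  have move: "?P z (x', y')" if "?P z (x, y)" "\<forall>x\<in>{x, y, x', y'}. scan ?w x = Letter EltMark" "?e x = ?e x'" "?e y = ?e y'" for z x y x' y'
    by (rule path_step[OF that(1)]) (use that(2-) pos same_value_element_at[of n rs] in \<open>auto simp: graph_step_def\<close>)
  assume "(forces rs)\<^sup>*\<^sup>* (?e p, ?e q) (?e p', ?e q')"
  moreover have "\<forall>p' q'. scan ?w p' = Letter EltMark \<longrightarrow> scan ?w q' = Letter EltMark \<longrightarrow> z = (?e p', ?e q') \<longrightarrow> ?P (p, q) (p', q')"
    if "(forces rs)\<^sup>*\<^sup>* (?e p, ?e q) z" for z
    using that
  proof (induction rule: rtranclp_induct)
    case base
    show ?case using move[OF path_refl[of ?w "graph_step ?w" "(p, q)"]] assms by simp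
  next
    case (step y z)
    show ?case
    proof (intro allI impI)
      fix p' q' assume m: "scan ?w p' = Letter EltMark" "scan ?w q' = Letter EltMark" and z: "z = (?e p', ?e q')"
      obtain a b where y: "y = (a, b)" by (cases y)
      have "forces rs (a, b) (?e p', ?e q')" using step.hyps(2) y z by simp
      then obtain p1 q1 p2 q2 where f: "forcing_step ?w p1 q1 p2 q2"
        and f': "\<forall>x\<in>{p1, q1, p2, q2}. scan ?w x = Letter EltMark" "?e p1 = a" "?e q1 = b" "?e p2 = ?e p'" "?e q2 = ?e q'"
        by (rule forcing_step_complete)
      have "?P (p, q) (p1, q1)" using step.IH y f' by simp
      then have "?P (p, q) (p2, q2)"
        by (rule path_step) (use f f' pos in \<open>auto simp: graph_step_def\<close>)
      then show "?P (p, q) (p', q')" by (rule move) (use f' m in auto)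
    qed
  qed
  ultimately show "?P (p, q) (p', q')" using assms by simp
qed

lemma cyclic_iff:
  "cyclic (encode (n, rs)) \<longleftrightarrow>
    (\<exists>a b. a \<noteq> b \<and> (forces rs)\<^sup>*\<^sup>* (a, b) (b, a) \<and> (forces rs)\<^sup>*\<^sup>* (b, a) (a, b))"
proof
  let ?w = "encode (n, rs)"
  assume "cyclic ?w"
  then obtain p q where "scan ?w p = Letter EltMark" "scan ?w q = Letter EltMark" "\<not> same_value ?w p q"
    "path ?w (graph_step ?w) (p, q) (q, p)" "path ?w (graph_step ?w) (q, p) (p, q)" unfolding cyclic_def by blast
  then show "\<exists>a b. a \<noteq> b \<and> (forces rs)\<^sup>*\<^sup>* (a, b) (b, a) \<and> (forces rs)\<^sup>*\<^sup>* (b, a) (a, b)"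
    using graph_path_iff[of p q q p] graph_path_iff[of q p p q] same_value_element_at[of n rs p q]
    by (intro exI[of _ "element_at ?w p"] exI[of _ "element_at ?w q"]) simp
next
  let ?w = "encode (n, rs)"
  assume "\<exists>a b. a \<noteq> b \<and> (forces rs)\<^sup>*\<^sup>* (a, b) (b, a) \<and> (forces rs)\<^sup>*\<^sup>* (b, a) (a, b)"
  then obtain a b where ab: "a \<noteq> b" "(forces rs)\<^sup>*\<^sup>* (a, b) (b, a)" "(forces rs)\<^sup>*\<^sup>* (b, a) (a, b)" by blast
  \<comment> \<open>As the endpoints differ, there is a first edge; it guarantees that both elements
    actually occur in the input.\<close>
  from ab(2) obtain z where "forces rs (a, b) z" using ab(1) by (cases rule: converse_rtranclpE) auto
  moreover obtain a' b' where "z = (a', b')" by (cases z)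
  ultimately have "forces rs (a, b) (a', b')" by simp
  then obtain p q p' q' where "\<forall>x\<in>{p, q, p', q'}. scan ?w x = Letter EltMark" "element_at ?w p = a" "element_at ?w q = b"
    by (rule forcing_step_complete)
  then have pq: "scan ?w p = Letter EltMark" "scan ?w q = Letter EltMark" "element_at ?w p = a" "element_at ?w q = b"
    by simp_all
  moreover have "p \<in> positions ?w" "q \<in> positions ?w" using pq by (simp_all add: scan_Letter_iff)
  moreover have "path ?w (graph_step ?w) (p, q) (q, p)" "path ?w (graph_step ?w) (q, p) (p, q)"
    using graph_path_iff[of p q q p] graph_path_iff[of q p p q] ab pq by simp_all
  moreover have "\<not> same_value ?w p q" using same_value_element_at[OF pq(1,2)] pq ab(1) by simp
  ultimately show "cyclic ?w" unfolding cyclic_def by blast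
qed

lemma admits_iff: "admits_conservative_commutative (structure_of (n, rs)) \<longleftrightarrow> \<not> cyclic (encode (n, rs))"
  unfolding cyclic_iff using admits_imp_no_cycle[OF H] no_cycle_imp_admits[OF H] by blast

end

lemma conservative_commutative_problem_iff:
  "w \<in> conservative_commutative_problem \<longleftrightarrow>
     w \<in> range encode \<and> nonempty_universe w \<and> arities_ok w \<and> elements_ok w \<and> \<not> cyclic w"
proof
  assume "w \<in> conservative_commutative_problem"
  then obtain n rs where "w = encode (n, rs)" "is_structure (structure_of (n, rs))"
    "admits_conservative_commutative (structure_of (n, rs))" unfolding conservative_commutative_problem_def by auto
  then show "w \<in> range encode \<and> nonempty_universe w \<and> arities_ok w \<and> elements_ok w \<and> \<not> cyclic w"
    using is_structure_iff[of n rs] admits_iff[of n rs] by simp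
next
  assume w: "w \<in> range encode \<and> nonempty_universe w \<and> arities_ok w \<and> elements_ok w \<and> \<not> cyclic w"
  then obtain n rs where "w = encode (n, rs)" by auto
  with w is_structure_iff[of n rs] admits_iff[of n rs]
  have "w = encode (n, rs) \<and> is_structure (structure_of (n, rs)) \<and> admits_conservative_commutative (structure_of (n, rs))"
    by simp
  then show "w \<in> conservative_commutative_problem"
    unfolding conservative_commutative_problem_def mem_Collect_eq by (rule exI[of _ "(n, rs)"])
qed

section \<open>Definability of the position predicates and the conclusion\<close>

lemma definable_path_closed:
  assumes "\<And>l x y x' y'. x < l \<Longrightarrow> y < l \<Longrightarrow> x' < l \<Longrightarrow> y' < l \<Longrightarrow>
      definable l (\<lambda>(w :: 's :: finite list) c. E w (c x) (c y) (c x') (c y'))"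
    and "a < k" "b < k" "a' < k" "b' < k"
  shows "definable k (\<lambda>w c. path w (E w) (c a, c b) (c a', c b'))"
  using definable_path[of k "\<lambda>w _. E w" a b a' b'] assms by blast

text \<open>The definability proofs that use these rules follow the shape of the formula. Below a
  quantifier, \<open>trunc_less\<close> reads an outer variable from its own register.\<close>

lemmas definable_intros = definable_ex definable_all definable_conj definable_disj definable_imp definable_not
  definable_eq definable_less definable_succ definable_zero definable_scan definable_path_closed

lemma definable_bit_at: "x < k \<Longrightarrow> definable k (\<lambda>w c. bit_at w (c x))"
  unfolding bit_at_def by (rule definable_intros | assumption)+

lemma definable_next_elt: "x < k \<Longrightarrow> y < k \<Longrightarrow> definable k (\<lambda>w c. next_elt w (c x) (c y))"
  unfolding next_elt_def
  by (rule definable_intros definable_bit_at | assumption | simp only: trunc_less less_SucI lessI)+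

lemma definable_same_value: "x < k \<Longrightarrow> y < k \<Longrightarrow> definable k (\<lambda>w c. same_value w (c x) (c y))"
  unfolding same_value_def
  by (rule definable_intros definable_bit_at | assumption | simp only: trunc_less less_SucI lessI)+

lemma definable_corresponding:
  "S < k \<Longrightarrow> T < k \<Longrightarrow> x < k \<Longrightarrow> y < k \<Longrightarrow> definable k (\<lambda>w c. corresponding w (c S) (c T) (c x) (c y))"
  unfolding corresponding_def
  by (rule definable_intros definable_next_elt | assumption | simp only: trunc_less less_SucI lessI)+

lemma definable_rel_of: "x < k \<Longrightarrow> y < k \<Longrightarrow> definable k (\<lambda>w c. rel_of w (c x) (c y))"
  unfolding rel_of_def
  by (rule definable_intros | assumption | simp only: trunc_less less_SucI lessI)+

lemma definable_blending:
  "S < k \<Longrightarrow> T < k \<Longrightarrow> U < k \<Longrightarrow> x < k \<Longrightarrow> y < k \<Longrightarrow> definable k (\<lambda>w c. blending w (c S) (c T) (c U) (c x) (c y))"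
  unfolding blending_def
  by (rule definable_intros definable_corresponding definable_same_value | assumption | simp only: trunc_less less_SucI lessI)+

lemma definable_forcing_step:
  "x < k \<Longrightarrow> y < k \<Longrightarrow> x' < k \<Longrightarrow> y' < k \<Longrightarrow> definable k (\<lambda>w c. forcing_step w (c x) (c y) (c x') (c y'))"
  unfolding forcing_step_def
  by (rule definable_intros definable_corresponding definable_rel_of definable_blending | assumption
      | simp only: trunc_less less_SucI lessI)+

lemma definable_graph_step:
  "x < k \<Longrightarrow> y < k \<Longrightarrow> x' < k \<Longrightarrow> y' < k \<Longrightarrow> definable k (\<lambda>w c. graph_step w (c x) (c y) (c x') (c y'))"
  unfolding graph_step_def
  by (rule definable_intros definable_same_value definable_forcing_step | assumption)+

lemma definable_cyclic: "definable k (\<lambda>w c. cyclic w)"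
  unfolding cyclic_def
  by (rule definable_intros definable_same_value definable_graph_step | assumption
      | simp only: trunc_less less_SucI lessI)+

lemma definable_arities_ok: "definable k (\<lambda>w c. arities_ok w)"
  unfolding arities_ok_def
  by (rule definable_intros definable_rel_of definable_next_elt | assumption
      | simp only: trunc_less less_SucI lessI)+

lemma definable_doubles: "x < k \<Longrightarrow> y < k \<Longrightarrow> definable k (\<lambda>w c. doubles w (c x) (c y))"
  unfolding doubles_def
  by (rule definable_intros | assumption | simp only: trunc_less less_SucI lessI)+

lemma definable_value_step:
  "x < k \<Longrightarrow> y < k \<Longrightarrow> x' < k \<Longrightarrow> y' < k \<Longrightarrow> definable k (\<lambda>w c. value_step w (c x) (c y) (c x') (c y'))"
  unfolding value_step_def
  by (rule definable_intros definable_doubles | assumption | simp only: trunc_less less_SucI lessI)+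

lemma definable_element_ok: "x < k \<Longrightarrow> definable k (\<lambda>w c. element_ok w (c x))"
  unfolding element_ok_def
  by (rule definable_intros definable_value_step definable_bit_at | assumption
      | simp only: trunc_less less_SucI lessI)+

lemma definable_elements_ok: "definable k (\<lambda>w c. elements_ok w)"
  unfolding elements_ok_def
  by (rule definable_intros definable_element_ok | assumption | simp only: trunc_less less_SucI lessI)+

lemma definable_nonempty_universe: "definable k (\<lambda>w c. nonempty_universe w)"
  unfolding nonempty_universe_def
  by (rule definable_intros | assumption | simp only: trunc_less less_SucI lessI)+

text \<open>Compiled programs start with the head at the right end, tests at the left end. A guessed
  number of left moves followed by a check for the left end marker bridges the gap.\<close>

lemma test_imp_NL:
  fixes L :: "('s :: finite) list set"
  assumes "test 0 (\<lambda>w c. w \<in> L)"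
  shows "L \<in> NL"
proof -
  from assms obtain p where p: "implements 0 p (\<lambda>w c c'. c' = c \<and> w \<in> L)" by (auto simp: test_def action_def)
  show ?thesis
  proof (rule program_in_NL[of _ "Seq (Star (Atom (Move MoveLeft))) (Seq (Atom (Scan LeftEnd)) p)"])
    fix w :: "'s list"
    define c :: env where "c = (\<lambda>_. 0)"
    have "ok w 0 c" by (simp add: ok_def c_def)
    let ?m = "Atom (Move MoveLeft) :: 's prog"
    have "run w (Seq (Star ?m) (Seq (Atom (Scan LeftEnd)) p)) (length w + 1, c) s \<longleftrightarrow> run w p (0, c) s" for s
    proof -
      have "run w (Seq (Star ?m) (Seq (Atom (Scan LeftEnd)) p)) (length w + 1, c) s \<longleftrightarrow>
          (\<exists>t. (run w ?m)\<^sup>*\<^sup>* (length w + 1, c) t \<and> (\<exists>u. exec w (Scan LeftEnd) t u \<and> run w p u s))"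
        by (simp only: run.simps relcompp_apply)
      also have "\<dots> \<longleftrightarrow> (\<exists>t. (\<exists>m\<le>length w + 1. t = (length w + 1 - m, c)) \<and> (\<exists>u. exec w (Scan LeftEnd) t u \<and> run w p u s))"
        unfolding rewind[OF order_refl] ..
      also have "\<dots> \<longleftrightarrow> (\<exists>u. exec w (Scan LeftEnd) (0, c) u \<and> run w p u s)"
      proof
        assume "\<exists>t. (\<exists>m\<le>length w + 1. t = (length w + 1 - m, c)) \<and> (\<exists>u. exec w (Scan LeftEnd) t u \<and> run w p u s)"
        then obtain m u where m: "exec w (Scan LeftEnd) (length w + 1 - m, c) u" "run w p u s" by (elim exE conjE) simp
        then have "length w + 1 - m = 0" by (simp add: scan_def split: if_splits)
        with m show "\<exists>u. exec w (Scan LeftEnd) (0, c) u \<and> run w p u s" by (intro exI[of _ u]) simp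
      next
        assume "\<exists>u. exec w (Scan LeftEnd) (0, c) u \<and> run w p u s"
        then show "\<exists>t. (\<exists>m\<le>length w + 1. t = (length w + 1 - m, c)) \<and> (\<exists>u. exec w (Scan LeftEnd) t u \<and> run w p u s)"
          by (intro exI[of _ "(0, c)"] conjI exI[of _ "length w + 1"]) simp_all
      qed
      also have "\<dots> \<longleftrightarrow> run w p (0, c) s" by (simp add: scan_def del: split_paired_Ex)
      finally show ?thesis .
    qed
    moreover have "(\<exists>s. run w p (0, c) s) \<longleftrightarrow> w \<in> L"
      using implementsD[OF p \<open>ok w 0 c\<close>] \<open>ok w 0 c\<close> by (simp del: split_paired_Ex)
    ultimately show "w \<in> L \<longleftrightarrow> (\<exists>s. run w (Seq (Star (Atom (Move MoveLeft))) (Seq (Atom (Scan LeftEnd)) p)) (length w + 1, \<lambda>_. 0) s)"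
      by (simp only: c_def)
  qed
qed

theorem theorem5p5: "conservative_commutative_problem \<in> NL"
proof (rule test_imp_NL)
  \<comment> \<open>Membership in the set of encodings is only tested positively, while the
    remaining conditions involve negations and are therefore shown to be definable; of these, the
    positive half enters the final conjunction.\<close>
  have "test 0 (\<lambda>w c. w \<in> range encode)" by (rule test_readable[OF readable_encodings])
  moreover have "definable 0 (\<lambda>w c. nonempty_universe w \<and> arities_ok w \<and> elements_ok w \<and> \<not> cyclic w)"
    by (intro definable_conj definable_not definable_nonempty_universe definable_arities_ok
        definable_elements_ok definable_cyclic)
  ultimately have "test 0 (\<lambda>w c. w \<in> range encode \<and> nonempty_universe w \<and> arities_ok w \<and> elements_ok w \<and> \<not> cyclic w)"
    unfolding definable_def by (rule test_conj[OF _ conjunct1])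
  then show "test 0 (\<lambda>w c. w \<in> conservative_commutative_problem)"
    unfolding conservative_commutative_problem_iff .
qed

end
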